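(* Let $(\mathcal G, \mathcal L)$ be a principal twisted étale groupoid. Then the map $\mathrm{Rad}_{\mathbb R}^{\mathcal G}(\mathcal G^0) \to T_{\mathbb R}(C^*_\lambda(\mathcal G, \mathcal L))$, $\mu\mapsto\tau_\mu$, where $\tau_\mu$ is the unique element of $T_{\mathbb R}(C^*_\lambda(\mathcal G,\mathcal L))$ satisfying $$\tau_\mu(f) = \int_{\mathcal G^0} f|_{\mathcal G^0}\, \mathrm d\mu \qquad \text{for all } f\in \Gamma_c(\mathcal G,\mathcal L),$$ is an isomorphism of ordered topological vector spaces.
   Context: Groupoids: An étale groupoid $\mathcal G$ is a topological groupoid whose range map $r$ (hence also source map $s$) is a local homeomorphism; its unit space $\mathcal G^0$ is assumed locally compact Hausdorff ($\mathcal G$ itself need not be Hausdorff). It is principal if $g\mapsto (r(g),s(g))$ is injective. An open bisection is an open $U\subseteq\mathcal G$ on which $r$ and $s$ are injective. A twisted étale groupoid $(\mathcal G,\mathcal L)$ is an étale groupoid with a Fell line bundle $\mathcal L\to\mathcal G$ (a Fell bundle with one-dimensional fibres). For an open bisection $U$, $\Gamma_c(U,\mathcal L)$ is the space of compactly supported continuous sections $U\to\mathcal L$, extended by $0$ to $\mathcal G$; $\Gamma_c(\mathcal G,\mathcal L)$ is the linear span of these over all open bisections. It is a $*$-algebra with $(f*h)(g)=\sum_{g=g_1g_2} f(g_1)h(g_2)$ and $f^*(g)=f(g^{-1})^*$. The restriction of $\mathcal L$ to $\mathcal G^0$ is the trivial bundle with fibres $\mathbb C$, so $\Gamma_c(\mathcal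 G^0,\mathcal L)=C_c(\mathcal G^0)$ and $f|_{\mathcal G^0}$ is a complex function. $C^*_\lambda(\mathcal G,\mathcal L)$ is the completion of $\Gamma_c(\mathcal G,\mathcal L)$ for the left regular representation $\lambda$ on $\bigoplus_{x\in\mathcal G^0}\ell^2(\mathcal G_x,\mathcal L)$, where $\mathcal G_x=s^{-1}(x)$, acting by the convolution formula; one has $\Gamma_c(\mathcal G,\mathcal L)\subseteq \mathrm{Ped}(C^*_\lambda(\mathcal G,\mathcal L))$. Measures: $\mathrm{Rad}_{\mathbb R}(X)$, for $X$ locally compact Hausdorff, is the space of real Radon measures on $X$, i.e. self-adjoint linear functionals on $C_c(X)$ continuous for the locally convex inductive limit topology (equivalently, differences of positive Radon measures as functionals on $C_c(X)$), with the weak$^*$-topology from $C_c(X)$ and the cone of positive measures. $\mu\in \mathrm{Rad}_{\mathbb R}(\mathcal G^0)$ is $\mathcal G$-invariant if for every open bisection $U$ and $f\in C_c(r(U))$, $\int_{r(U)} f\,\mathrm d\mu=\int_{s(U)} f\circ\alpha_U\,\mathrm d\mu$, where $\alpha_U\colon s(U)\to r(U)$ is the homeomorphism $s(g)\mapsto r(g)$, $g\in U$. $\mathrm{Rad}_{\mathbb R}^{\mathcal G}(\mathcal G^0)$ is the ordered topological vector space of $\mathcal G$-invariant real Radon measures, with the weak$^*$-topology from $C_c(\mathcal G^0)$. Traces: For a $C^*$-algebra $A$, $\mathrm{Ped}(A)$ is the Pedersen ideal (the unique minimal norm-dense two-sided ideal), with the locally convex direct limit topology of its $C^*$-subalgebras: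 a linear functional on $\mathrm{Ped}(A)$ is continuous iff it is bounded on every $C^*$-subalgebra $D$ of $A$ contained in $\mathrm{Ped}(A)$. $T_{\mathbb R}(A)$ is the real vector space of continuous self-adjoint tracial functionals on $\mathrm{Ped}(A)$ ($\tau(xy)=\tau(yx)$, $\tau(x^* )=\overline{\tau(x)}$), with the weak$^*$-topology (pointwise convergence on $\mathrm{Ped}(A)$), ordered by the cone of positive traces ($\tau(a)\ge0$ for $a\in\mathrm{Ped}(A)\cap A_+$). An isomorphism of ordered topological vector spaces is a linear homeomorphism mapping the positive cone onto the positive cone. *)

theory Defs
  imports "HOL-Analysis.Analysis" "HOL-Library.Function_Algebras"
begin

section \<open>Etale groupoids\<close>

record 'g groupoid =
  gtop :: "'g topology"
  rng :: "'g \<Rightarrow> 'g"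
  src :: "'g \<Rightarrow> 'g"
  gmul :: "'g \<Rightarrow> 'g \<Rightarrow> 'g"
  ginv :: "'g \<Rightarrow> 'g"

abbreviation arrows :: "'g groupoid \<Rightarrow> 'g set"
  where "arrows G \<equiv> topspace (gtop G)"

definition units :: "'g groupoid \<Rightarrow> 'g set"
  where "units G = rng G ` arrows G"

definition unit_top :: "'g groupoid \<Rightarrow> 'g topology"
  where "unit_top G = subtopology (gtop G) (units G)"

definition local_homeomorphism :: "'a topology \<Rightarrow> 'b topology \<Rightarrow> ('a \<Rightarrow> 'b) \<Rightarrow> bool"
  where "local_homeomorphism X Y f \<longleftrightarrow>
    (\<forall>x\<in>topspace X. \<exists>U. openin X U \<and> x \<in> U \<and> openin Y (f ` U) \<and>
       homeomorphic_map (subtopology X U) (subtopology Y (f ` U)) f)"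

locale etale_groupoid =
  fixes G :: "'g groupoid"
  assumes rng_closed: "g \<in> arrows G \<Longrightarrow> rng G g \<in> arrows G"
    and src_closed: "g \<in> arrows G \<Longrightarrow> src G g \<in> arrows G"
    and inv_closed: "g \<in> arrows G \<Longrightarrow> ginv G g \<in> arrows G"
    and mul_closed: "\<lbrakk>g \<in> arrows G; h \<in> arrows G; src G g = rng G h\<rbrakk> \<Longrightarrow> gmul G g h \<in> arrows G"
    and rng_rng: "g \<in> arrows G \<Longrightarrow> rng G (rng G g) = rng G g"
    and src_rng: "g \<in> arrows G \<Longrightarrow> src G (rng G g) = rng G g"
    and rng_src: "g \<in> arrows G \<Longrightarrow> rng G (src G g) = src G g"
    and src_src: "g \<in> arrows G \<Longrightarrow> src G (src G g) = src G g"
    and rng_mul: "\<lbrakk>g \<in> arrows G; h \<in> arrows G; src G g = rng G h\<rbrakk> \<Longrightarrow> rng G (gmul G g h) = rng G g"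
    and src_mul: "\<lbrakk>g \<in> arrows G; h \<in> arrows G; src G g = rng G h\<rbrakk> \<Longrightarrow> src G (gmul G g h) = src G h"
    and mul_assoc: "\<lbrakk>g \<in> arrows G; h \<in> arrows G; k \<in> arrows G; src G g = rng G h; src G h = rng G k\<rbrakk>
      \<Longrightarrow> gmul G (gmul G g h) k = gmul G g (gmul G h k)"
    and rng_mul_left: "g \<in> arrows G \<Longrightarrow> gmul G (rng G g) g = g"
    and mul_src_right: "g \<in> arrows G \<Longrightarrow> gmul G g (src G g) = g"
    and rng_inv: "g \<in> arrows G \<Longrightarrow> rng G (ginv G g) = src G g"
    and src_inv: "g \<in> arrows G \<Longrightarrow> src G (ginv G g) = rng G g"
    and inv_mul: "g \<in> arrows G \<Longrightarrow> gmul G (ginv G g) g = src G g"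
    and mul_inv: "g \<in> arrows G \<Longrightarrow> gmul G g (ginv G g) = rng G g"
    and continuous_mul: "continuous_map
      (subtopology (prod_topology (gtop G) (gtop G)) {(g, h). src G g = rng G h})
      (gtop G) (\<lambda>(g, h). gmul G g h)"
    and continuous_inv: "continuous_map (gtop G) (gtop G) (ginv G)"
    and units_locally_compact: "locally_compact_space (unit_top G)"
    and units_Hausdorff: "Hausdorff_space (unit_top G)"
    and rng_local_homeomorphism: "local_homeomorphism (gtop G) (unit_top G) (rng G)"

definition principal_groupoid :: "'g groupoid \<Rightarrow> bool"
  where "principal_groupoid G \<longleftrightarrow> inj_on (\<lambda>g. (rng G g, src G g)) (arrows G)"

definition open_bisection :: "'g groupoid \<Rightarrow> 'g set \<Rightarrow> bool"
  where "open_bisection G U \<longleftrightarrow> openin (gtop G) U \<and> inj_on (rng G) U \<and> inj_on (src G) U"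

definition bisection_map :: "'g groupoid \<Rightarrow> 'g set \<Rightarrow> 'g \<Rightarrow> 'g"
  where "bisection_map G U x = rng G (the_inv_into U (src G) x)"


section \<open>Fell line bundles\<close>

text \<open>
  The fibres are complex subspaces of one ambient vector space on the type \<open>'v\<close>; a point of the
  total space is a pair of a base point and a vector of the fibre over it, so fibres over distinct
  base points are disjoint in the total space even where they overlap in \<open>'v\<close>. For \<open>a\<close> in the fibre
  over \<open>g\<close> and \<open>b\<close> in the fibre over \<open>h\<close>, the product is \<open>lmul L g h a b\<close>, in the fibre over
  \<open>gmul G g h\<close>, and the adjoint of \<open>a\<close> is \<open>lstar L g a\<close>, in the fibre over \<open>ginv G g\<close>.
\<close>

record ('g, 'v) fell_bundle =
  fib :: "'g \<Rightarrow> 'v set"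
  ltop :: "('g \<times> 'v) topology"
  lscale :: "complex \<Rightarrow> 'v \<Rightarrow> 'v"
  lnorm :: "'g \<Rightarrow> 'v \<Rightarrow> real"
  lmul :: "'g \<Rightarrow> 'g \<Rightarrow> 'v \<Rightarrow> 'v \<Rightarrow> 'v"
  lstar :: "'g \<Rightarrow> 'v \<Rightarrow> 'v"

text \<open>
  A continuous Banach bundle in the sense of Fell with one-dimensional fibres (which are therefore
  complete), together with a Fell bundle multiplication and involution. Continuity, rather than
  upper semicontinuity, of the norm is what makes the restriction to the unit space the trivial
  line bundle.
\<close>

locale twisted_etale_groupoid = etale_groupoid G
  for G :: "'g groupoid" +
  fixes L :: "('g, 'v::ab_group_add) fell_bundle"
  assumes scale_vector_space: "vector_space (lscale L)"
    and fib_subspace: "g \<in> arrows G \<Longrightarrow> module.subspace (lscale L) (fib L g)"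
    and fib_one_dimensional: "g \<in> arrows G \<Longrightarrow> vector_space.dim (lscale L) (fib L g) = 1"
    and norm_nonneg: "\<lbrakk>g \<in> arrows G; a \<in> fib L g\<rbrakk> \<Longrightarrow> 0 \<le> lnorm L g a"
    and norm_eq_0: "\<lbrakk>g \<in> arrows G; a \<in> fib L g\<rbrakk> \<Longrightarrow> lnorm L g a = 0 \<longleftrightarrow> a = 0"
    and norm_scale: "\<lbrakk>g \<in> arrows G; a \<in> fib L g\<rbrakk> \<Longrightarrow> lnorm L g (lscale L z a) = cmod z * lnorm L g a"
    and norm_triangle: "\<lbrakk>g \<in> arrows G; a \<in> fib L g; b \<in> fib L g\<rbrakk>
      \<Longrightarrow> lnorm L g (a + b) \<le> lnorm L g a + lnorm L g b"
    and topspace_total: "topspace (ltop L) = (SIGMA g:arrows G. fib L g)"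
    and continuous_proj: "continuous_map (ltop L) (gtop G) fst"
    and open_proj: "open_map (ltop L) (gtop G) fst"
    and continuous_norm: "continuous_map (ltop L) euclideanreal (\<lambda>(g, a). lnorm L g a)"
    and continuous_add: "continuous_map
      (subtopology (prod_topology (ltop L) (ltop L)) {((g, a), (h, b)). g = h})
      (ltop L) (\<lambda>((g, a), (h, b)). (g, a + b))"
    and continuous_scale: "continuous_map (prod_topology euclidean (ltop L)) (ltop L)
      (\<lambda>(z, (g, a)). (g, lscale L z a))"
    and zero_nhds: "\<lbrakk>g \<in> arrows G; openin (ltop L) W; (g, 0) \<in> W\<rbrakk>
      \<Longrightarrow> \<exists>U \<epsilon>. openin (gtop G) U \<and> g \<in> U \<and> 0 < \<epsilon> \<and>
            {(h, a). h \<in> U \<and> a \<in> fib L h \<and> lnorm L h a < \<epsilon>} \<subseteq> W"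
    and lmul_closed: "\<lbrakk>g \<in> arrows G; h \<in> arrows G; src G g = rng G h; a \<in> fib L g; b \<in> fib L h\<rbrakk>
      \<Longrightarrow> lmul L g h a b \<in> fib L (gmul G g h)"
    and lmul_add_left: "\<lbrakk>g \<in> arrows G; h \<in> arrows G; src G g = rng G h;
        a \<in> fib L g; a' \<in> fib L g; b \<in> fib L h\<rbrakk>
      \<Longrightarrow> lmul L g h (a + a') b = lmul L g h a b + lmul L g h a' b"
    and lmul_add_right: "\<lbrakk>g \<in> arrows G; h \<in> arrows G; src G g = rng G h;
        a \<in> fib L g; b \<in> fib L h; b' \<in> fib L h\<rbrakk>
      \<Longrightarrow> lmul L g h a (b + b') = lmul L g h a b + lmul L g h a b'"
    and lmul_scale_left: "\<lbrakk>g \<in> arrows G; h \<in> arrows G; src G g = rng G h; a \<in> fib L g; b \<in> fib L h\<rbrakk>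
      \<Longrightarrow> lmul L g h (lscale L z a) b = lscale L z (lmul L g h a b)"
    and lmul_scale_right: "\<lbrakk>g \<in> arrows G; h \<in> arrows G; src G g = rng G h; a \<in> fib L g; b \<in> fib L h\<rbrakk>
      \<Longrightarrow> lmul L g h a (lscale L z b) = lscale L z (lmul L g h a b)"
    and lmul_assoc: "\<lbrakk>g \<in> arrows G; h \<in> arrows G; k \<in> arrows G; src G g = rng G h; src G h = rng G k;
        a \<in> fib L g; b \<in> fib L h; c \<in> fib L k\<rbrakk>
      \<Longrightarrow> lmul L (gmul G g h) k (lmul L g h a b) c = lmul L g (gmul G h k) a (lmul L h k b c)"
    and norm_lmul: "\<lbrakk>g \<in> arrows G; h \<in> arrows G; src G g = rng G h; a \<in> fib L g; b \<in> fib L h\<rbrakk>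
      \<Longrightarrow> lnorm L (gmul G g h) (lmul L g h a b) \<le> lnorm L g a * lnorm L h b"
    and continuous_lmul: "continuous_map
      (subtopology (prod_topology (ltop L) (ltop L)) {((g, a), (h, b)). src G g = rng G h})
      (ltop L) (\<lambda>((g, a), (h, b)). (gmul G g h, lmul L g h a b))"
    and lstar_closed: "\<lbrakk>g \<in> arrows G; a \<in> fib L g\<rbrakk> \<Longrightarrow> lstar L g a \<in> fib L (ginv G g)"
    and lstar_add: "\<lbrakk>g \<in> arrows G; a \<in> fib L g; b \<in> fib L g\<rbrakk>
      \<Longrightarrow> lstar L g (a + b) = lstar L g a + lstar L g b"
    and lstar_scale: "\<lbrakk>g \<in> arrows G; a \<in> fib L g\<rbrakk>
      \<Longrightarrow> lstar L g (lscale L z a) = lscale L (cnj z) (lstar L g a)"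
    and lstar_lstar: "\<lbrakk>g \<in> arrows G; a \<in> fib L g\<rbrakk> \<Longrightarrow> lstar L (ginv G g) (lstar L g a) = a"
    and lstar_lmul: "\<lbrakk>g \<in> arrows G; h \<in> arrows G; src G g = rng G h; a \<in> fib L g; b \<in> fib L h\<rbrakk>
      \<Longrightarrow> lstar L (gmul G g h) (lmul L g h a b)
            = lmul L (ginv G h) (ginv G g) (lstar L h b) (lstar L g a)"
    and continuous_lstar: "continuous_map (ltop L) (ltop L) (\<lambda>(g, a). (ginv G g, lstar L g a))"
    and norm_lstar_lmul: "\<lbrakk>g \<in> arrows G; a \<in> fib L g\<rbrakk>
      \<Longrightarrow> lnorm L (src G g) (lmul L (ginv G g) g (lstar L g a) a) = (lnorm L g a)\<^sup>2"
    and lstar_lmul_positive: "\<lbrakk>g \<in> arrows G; a \<in> fib L g\<rbrakk>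
      \<Longrightarrow> \<exists>b\<in>fib L (src G g). lmul L (ginv G g) g (lstar L g a) a
            = lmul L (src G g) (src G g) (lstar L (src G g) b) b"

text \<open>
  The fibre over a unit \<open>x\<close> is a one-dimensional C*-algebra; \<open>unit_coord\<close> is its canonical
  identification with the complex numbers, sending the unit element to 1.
\<close>

definition fib_one :: "('g, 'v) fell_bundle \<Rightarrow> 'g \<Rightarrow> 'v"
  where "fib_one L x =
    (THE u. u \<in> fib L x \<and> (\<forall>a\<in>fib L x. lmul L x x u a = a \<and> lmul L x x a u = a))"

definition unit_coord :: "('g, 'v) fell_bundle \<Rightarrow> 'g \<Rightarrow> 'v \<Rightarrow> complex"
  where "unit_coord L x a = (THE z. a = lscale L z (fib_one L x))"


section \<open>Compactly supported sections\<close>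

definition sections_c :: "'g groupoid \<Rightarrow> ('g, 'v::ab_group_add) fell_bundle \<Rightarrow> 'g set \<Rightarrow> ('g \<Rightarrow> 'v) set"
  where "sections_c G L U = {f. (\<forall>g\<in>U. f g \<in> fib L g) \<and>
    continuous_map (subtopology (gtop G) U) (ltop L) (\<lambda>g. (g, f g)) \<and>
    (\<exists>K. compactin (gtop G) K \<and> K \<subseteq> U \<and> (\<forall>g. g \<notin> K \<longrightarrow> f g = 0))}"

definition Gamma_c :: "'g groupoid \<Rightarrow> ('g, 'v::ab_group_add) fell_bundle \<Rightarrow> ('g \<Rightarrow> 'v) set"
  where "Gamma_c G L = module.span (\<lambda>z f g. lscale L z (f g))
    (\<Union>U\<in>{U. open_bisection G U}. sections_c G L U)"

text \<open>
  The convolution \<open>f * \<xi>\<close>. The sum is restricted to the factorisations on which \<open>f\<close> does not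
  vanish, so that it is a finite sum whenever \<open>f\<close> lies in \<open>Gamma_c G L\<close>.
\<close>

definition conv :: "'g groupoid \<Rightarrow> ('g, 'v::ab_group_add) fell_bundle \<Rightarrow> ('g \<Rightarrow> 'v) \<Rightarrow> ('g \<Rightarrow> 'v) \<Rightarrow> 'g \<Rightarrow> 'v"
  where "conv G L f \<xi> g =
    (\<Sum>(g1, g2) \<in> {(g1, g2). g1 \<in> arrows G \<and> g2 \<in> arrows G \<and> src G g1 = rng G g2 \<and>
                     gmul G g1 g2 = g \<and> f g1 \<noteq> 0}.
       lmul L g1 g2 (f g1) (\<xi> g2))"

definition restrict_units :: "'g groupoid \<Rightarrow> ('g, 'v) fell_bundle \<Rightarrow> ('g \<Rightarrow> 'v) \<Rightarrow> 'g \<Rightarrow> complex"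
  where "restrict_units G L f = (\<lambda>x. if x \<in> units G then unit_coord L x (f x) else 0)"


section \<open>C*-algebras, the Pedersen ideal and traces\<close>

text \<open>
  The data of a C*-algebra whose addition is that of the ambient type.
\<close>

record 'a cstar_structure =
  carr :: "'a set"
  cscale :: "complex \<Rightarrow> 'a \<Rightarrow> 'a"
  cmul :: "'a \<Rightarrow> 'a \<Rightarrow> 'a"
  cstar :: "'a \<Rightarrow> 'a"
  cnorm :: "'a \<Rightarrow> real"

definition positive_elements :: "'a cstar_structure \<Rightarrow> 'a set"
  where "positive_elements A = {cmul A (cstar A b) b | b. b \<in> carr A}"

definition two_sided_ideal :: "'a::ab_group_add cstar_structure \<Rightarrow> 'a set \<Rightarrow> bool"
  where "two_sided_ideal A I \<longleftrightarrow> I \<subseteq> carr A \<and> module.subspace (cscale A) I \<and>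
    (\<forall>a\<in>carr A. \<forall>b\<in>I. cmul A a b \<in> I \<and> cmul A b a \<in> I)"

definition norm_dense :: "'a::ab_group_add cstar_structure \<Rightarrow> 'a set \<Rightarrow> bool"
  where "norm_dense A I \<longleftrightarrow> (\<forall>a\<in>carr A. \<forall>\<epsilon>>0. \<exists>b\<in>I. cnorm A (a - b) < \<epsilon>)"

definition Ped :: "'a::ab_group_add cstar_structure \<Rightarrow> 'a set"
  where "Ped A = (THE I. two_sided_ideal A I \<and> norm_dense A I \<and>
    (\<forall>J. two_sided_ideal A J \<and> norm_dense A J \<and> J \<subseteq> I \<longrightarrow> J = I))"

definition cstar_subalgebra :: "'a::ab_group_add cstar_structure \<Rightarrow> 'a set \<Rightarrow> bool"
  where "cstar_subalgebra A D \<longleftrightarrow> D \<subseteq> carr A \<and> module.subspace (cscale A) D \<and>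
    (\<forall>a\<in>D. \<forall>b\<in>D. cmul A a b \<in> D) \<and> (\<forall>a\<in>D. cstar A a \<in> D) \<and>
    (\<forall>a\<in>carr A. (\<forall>\<epsilon>>0. \<exists>d\<in>D. cnorm A (a - d) < \<epsilon>) \<longrightarrow> a \<in> D)"

text \<open>
  A linear functional on a space \<open>V\<close> is represented by a function that is \<open>undefined\<close> off \<open>V\<close>.
\<close>

definition linear_functionals :: "(complex \<Rightarrow> 'a \<Rightarrow> 'a) \<Rightarrow> 'a::plus set \<Rightarrow> ('a \<Rightarrow> complex) set"
  where "linear_functionals sc V = {\<phi>\<in>extensional V.
    (\<forall>x\<in>V. \<forall>y\<in>V. \<phi> (x + y) = \<phi> x + \<phi> y) \<and> (\<forall>z. \<forall>x\<in>V. \<phi> (sc z x) = z * \<phi> x)}"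

definition traces :: "'a::ab_group_add cstar_structure \<Rightarrow> ('a \<Rightarrow> complex) set"
  where "traces A = {\<tau>\<in>linear_functionals (cscale A) (Ped A).
    (\<forall>D. cstar_subalgebra A D \<and> D \<subseteq> Ped A \<longrightarrow> (\<exists>C. \<forall>d\<in>D. cmod (\<tau> d) \<le> C * cnorm A d)) \<and>
    (\<forall>x\<in>Ped A. \<tau> (cstar A x) = cnj (\<tau> x)) \<and>
    (\<forall>x\<in>Ped A. \<forall>y\<in>Ped A. \<tau> (cmul A x y) = \<tau> (cmul A y x))}"

definition positive_traces :: "'a::ab_group_add cstar_structure \<Rightarrow> ('a \<Rightarrow> complex) set"
  where "positive_traces A = {\<tau>\<in>traces A. \<forall>a\<in>Ped A \<inter> positive_elements A. \<tau> a \<in> \<real>\<^sub>\<ge>\<^sub>0}"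


section \<open>The reduced C*-algebra\<close>

text \<open>
  As the arrow space is the disjoint union of the source fibres \<open>G\<^sub>x\<close>, the Hilbert space direct sum
  of the spaces \<open>\<ell>\<^sup>2(G\<^sub>x, L)\<close> is the space of square-summable sections over all arrows. The inner
  product of \<open>a\<close> and \<open>b\<close> in the fibre over \<open>g\<close> is \<open>a* b\<close>, read as a complex number in the fibre
  over \<open>src G g\<close>.
\<close>

definition l2 :: "'g groupoid \<Rightarrow> ('g, 'v::ab_group_add) fell_bundle \<Rightarrow> ('g \<Rightarrow> 'v) set"
  where "l2 G L = {\<xi>. (\<forall>g\<in>arrows G. \<xi> g \<in> fib L g) \<and> (\<forall>g. g \<notin> arrows G \<longrightarrow> \<xi> g = 0) \<and>
    (\<lambda>g. (lnorm L g (\<xi> g))\<^sup>2) summable_on arrows G}"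

definition l2_inner :: "'g groupoid \<Rightarrow> ('g, 'v) fell_bundle \<Rightarrow> ('g \<Rightarrow> 'v) \<Rightarrow> ('g \<Rightarrow> 'v) \<Rightarrow> complex"
  where "l2_inner G L \<xi> \<eta> = (\<Sum>\<^sub>\<infinity>g\<in>arrows G.
    unit_coord L (src G g) (lmul L (ginv G g) g (lstar L g (\<xi> g)) (\<eta> g)))"

definition l2_norm :: "'g groupoid \<Rightarrow> ('g, 'v) fell_bundle \<Rightarrow> ('g \<Rightarrow> 'v) \<Rightarrow> real"
  where "l2_norm G L \<xi> = sqrt (\<Sum>\<^sub>\<infinity>g\<in>arrows G. (lnorm L g (\<xi> g))\<^sup>2)"

text \<open>
  Operators on \<open>l2 G L\<close> are represented by functions that vanish off \<open>l2 G L\<close>, so that sums,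
  scalar multiples and compositions of operators are those of functions.
\<close>

type_synonym ('g, 'v) operator = "('g \<Rightarrow> 'v) \<Rightarrow> ('g \<Rightarrow> 'v)"

definition bounded_operators :: "'g groupoid \<Rightarrow> ('g, 'v::ab_group_add) fell_bundle \<Rightarrow> ('g, 'v) operator set"
  where "bounded_operators G L = {T.
    (\<forall>\<xi>\<in>l2 G L. T \<xi> \<in> l2 G L) \<and> (\<forall>\<xi>. \<xi> \<notin> l2 G L \<longrightarrow> T \<xi> = 0) \<and>
    (\<forall>\<xi>\<in>l2 G L. \<forall>\<eta>\<in>l2 G L. T (\<xi> + \<eta>) = T \<xi> + T \<eta>) \<and>
    (\<forall>z. \<forall>\<xi>\<in>l2 G L. T (\<lambda>g. lscale L z (\<xi> g)) = (\<lambda>g. lscale L z (T \<xi> g))) \<and>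
    (\<exists>C. \<forall>\<xi>\<in>l2 G L. l2_norm G L (T \<xi>) \<le> C * l2_norm G L \<xi>)}"

definition operator_norm :: "'g groupoid \<Rightarrow> ('g, 'v::ab_group_add) fell_bundle \<Rightarrow> ('g, 'v) operator \<Rightarrow> real"
  where "operator_norm G L T = Sup {l2_norm G L (T \<xi>) | \<xi>. \<xi> \<in> l2 G L \<and> l2_norm G L \<xi> \<le> 1}"

definition adjoint_operator ::
    "'g groupoid \<Rightarrow> ('g, 'v::ab_group_add) fell_bundle \<Rightarrow> ('g, 'v) operator \<Rightarrow> ('g, 'v) operator"
  where "adjoint_operator G L T = (THE S. S \<in> bounded_operators G L \<and>
    (\<forall>\<xi>\<in>l2 G L. \<forall>\<eta>\<in>l2 G L. l2_inner G L (T \<xi>) \<eta> = l2_inner G L \<xi> (S \<eta>)))"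

definition regular_rep ::
    "'g groupoid \<Rightarrow> ('g, 'v::ab_group_add) fell_bundle \<Rightarrow> ('g \<Rightarrow> 'v) \<Rightarrow> ('g, 'v) operator"
  where "regular_rep G L f = (\<lambda>\<xi>. if \<xi> \<in> l2 G L then conv G L f \<xi> else 0)"

definition reduced_cstar ::
    "'g groupoid \<Rightarrow> ('g, 'v::ab_group_add) fell_bundle \<Rightarrow> ('g, 'v) operator cstar_structure"
  where "reduced_cstar G L =
    \<lparr>carr = {T\<in>bounded_operators G L.
               \<forall>\<epsilon>>0. \<exists>f\<in>Gamma_c G L. operator_norm G L (T - regular_rep G L f) < \<epsilon>},
     cscale = (\<lambda>z T \<xi> g. lscale L z (T \<xi> g)),
     cmul = (\<lambda>S T. S \<circ> T),
     cstar = adjoint_operator G L,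
     cnorm = operator_norm G L\<rparr>"


section \<open>Real Radon measures\<close>

definition C_c :: "'x topology \<Rightarrow> ('x \<Rightarrow> complex) set"
  where "C_c X = {f. continuous_map X euclidean f \<and>
    (\<exists>K. compactin X K \<and> (\<forall>x. x \<notin> K \<longrightarrow> f x = 0))}"

text \<open>
  A real Radon measure \<open>\<mu>\<close> is the functional sending \<open>f\<close> in \<open>C_c X\<close> to its integral against \<open>\<mu>\<close>.
  A linear functional is continuous for the inductive limit topology iff its restriction to the
  functions supported in any fixed compact set is bounded for the supremum norm.
\<close>

definition Rad :: "'x topology \<Rightarrow> (('x \<Rightarrow> complex) \<Rightarrow> complex) set"
  where "Rad X = {\<mu>\<in>linear_functionals (\<lambda>z f x. z * f x) (C_c X).
    (\<forall>f\<in>C_c X. \<mu> (\<lambda>x. cnj (f x)) = cnj (\<mu> f)) \<and>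
    (\<forall>K. compactin X K \<longrightarrow> (\<exists>C. \<forall>f\<in>C_c X. \<forall>B.
       (\<forall>x. x \<notin> K \<longrightarrow> f x = 0) \<and> (\<forall>x. cmod (f x) \<le> B) \<longrightarrow> cmod (\<mu> f) \<le> C * B))}"

definition invariant_Rad :: "'g groupoid \<Rightarrow> (('g \<Rightarrow> complex) \<Rightarrow> complex) set"
  where "invariant_Rad G = {\<mu>\<in>Rad (unit_top G).
    \<forall>U. open_bisection G U \<longrightarrow> (\<forall>f\<in>C_c (subtopology (unit_top G) (rng G ` U)).
      \<mu> f = \<mu> (\<lambda>x. if x \<in> src G ` U then f (bisection_map G U x) else 0))}"

definition positive_invariant_Rad :: "'g groupoid \<Rightarrow> (('g \<Rightarrow> complex) \<Rightarrow> complex) set"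
  where "positive_invariant_Rad G =
    {\<mu>\<in>invariant_Rad G. \<forall>f\<in>C_c (unit_top G). (\<forall>x. f x \<in> \<real>\<^sub>\<ge>\<^sub>0) \<longrightarrow> \<mu> f \<in> \<real>\<^sub>\<ge>\<^sub>0}"


section \<open>Ordered topological vector spaces of functionals\<close>

text \<open>
  \<open>F\<close> is an isomorphism from the real vector space \<open>V\<close> of functionals on \<open>D\<close>, with positive cone
  \<open>P\<close>, onto the real vector space \<open>V'\<close> of functionals on \<open>D'\<close>, with positive cone \<open>P'\<close>, both
  carrying the topology of pointwise convergence.
\<close>

definition weak_star :: "'a set \<Rightarrow> ('a \<Rightarrow> complex) set \<Rightarrow> ('a \<Rightarrow> complex) topology"
  where "weak_star D V = subtopology (product_topology (\<lambda>_. euclidean) D) V"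

definition ordered_tvs_iso ::
    "'a set \<Rightarrow> ('a \<Rightarrow> complex) set \<Rightarrow> ('a \<Rightarrow> complex) set \<Rightarrow>
     'b set \<Rightarrow> ('b \<Rightarrow> complex) set \<Rightarrow> ('b \<Rightarrow> complex) set \<Rightarrow>
     (('a \<Rightarrow> complex) \<Rightarrow> ('b \<Rightarrow> complex)) \<Rightarrow> bool"
  where "ordered_tvs_iso D V P D' V' P' F \<longleftrightarrow>
    (\<forall>\<phi>\<in>V. \<forall>\<psi>\<in>V. F (\<lambda>x\<in>D. \<phi> x + \<psi> x) = (\<lambda>y\<in>D'. F \<phi> y + F \<psi> y)) \<and>
    (\<forall>c::real. \<forall>\<phi>\<in>V. F (\<lambda>x\<in>D. complex_of_real c * \<phi> x) = (\<lambda>y\<in>D'. complex_of_real c * F \<phi> y)) \<and>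
    homeomorphic_map (weak_star D V) (weak_star D' V') F \<and>
    F ` P = P'"


section \<open>The trace of an invariant measure\<close>

text \<open>
  A principal etale groupoid is Hausdorff, since \<open>(rng, src)\<close> is a continuous injection into a
  Hausdorff space. Its unit space is then clopen, so the restriction of \<open>f\<close> to the units lies
  in \<open>C_c (unit_top G)\<close>, and its integral against \<open>\<mu>\<close> is the value of the functional \<open>\<mu>\<close>.
\<close>

definition extends_measure :: "'g groupoid \<Rightarrow> ('g, 'v::ab_group_add) fell_bundle \<Rightarrow>
    (('g \<Rightarrow> complex) \<Rightarrow> complex) \<Rightarrow> (('g, 'v) operator \<Rightarrow> complex) \<Rightarrow> bool"
  where "extends_measure G L \<mu> \<tau> \<longleftrightarrow>
    (\<forall>f\<in>Gamma_c G L. \<tau> (regular_rep G L f) = \<mu> (restrict_units G L f))"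

definition trace_of :: "'g groupoid \<Rightarrow> ('g, 'v::ab_group_add) fell_bundle \<Rightarrow>
    (('g \<Rightarrow> complex) \<Rightarrow> complex) \<Rightarrow> (('g, 'v) operator \<Rightarrow> complex)"
  where "trace_of G L \<mu> = (THE \<tau>. \<tau> \<in> traces (reduced_cstar G L) \<and> extends_measure G L \<mu> \<tau>)"

end

(*
  Write A for the reduced C*-algebra, M f for the operator of f in C_c(G^0) and E : A -> C_b(G^0) for
  the expectation T |-> <T delta_x, delta_x>. A Neumann series shows that every dense ideal contains
  the operators M f, so the Pedersen ideal is the span of A (M C_c) A. For an invariant functional mu
  the trace is tau(d) = lim_e mu(e E(d)) along the cutoff functions e: invariance says that mu o E is
  tracial on the convolution algebra, and by continuity mu(e E(a (M f) b)) = mu(f E(b (M e) a)) on A,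
  which converges to mu(f E(b a)). As this also bounds mu(e E(d)) uniformly in e for each d, the
  uniform boundedness principle makes tau bounded on every C*-subalgebra inside the Pedersen ideal.
  A trace is determined by its values on sections, since tau(x (M f) y) = tau((M f) y x (M e)) when
  e = 1 on the support of f, and these elements lie in a corner on which tau is bounded. For principal
  G a trace vanishes on sections supported off the units, so that it factors through E. Finally,
  traciality of mu o E implies invariance of mu because line bundles have local unit sections.
*)
theory Submission
  imports Defs
begin

section \<open>Compactly supported functions\<close>

text \<open>The obstacle is that \<open>\<mu>\<close> cannot simply be composed with
  \<open>E\<close> on the Pedersen ideal: for \<open>d\<close> in it, \<open>E d\<close> is bounded
  and continuous but need not have compact support, while \<open>\<mu>\<close> is only a functional
  on functions of compact support, possibly a difference of two infinite positive measures. Monotone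
  convergence is therefore not at hand. What replaces it is that the cutoff can be moved into the
  middle of a product, where it acts as an approximate unit in norm. The limit at \<open>d\<close>
  is then \<open>\<mu> w\<close> for a function \<open>w\<close> that depends on \<open>d\<close>
  alone, and this gives weak* continuity without further work. The bundle axioms ask for an open
  projection and a continuous norm, not for local triviality. The local unit sections have to be
  constructed: a function on the circle over one arrow is extended to nearby circles by Tietze's
  theorem, and averaging over rotations restores equivariance. The locale \<open>trace_data\<close>
  separates the two halves. It keeps of the groupoid only \<open>M\<close>, \<open>E\<close>, a
  dense subalgebra \<open>\<Gamma>\<close> and the set \<open>N\<close> of tracial
  functionals.\<close>

lemma continuous_map_compose_on:
  assumes "continuous_map X euclidean f" "continuous_on UNIV h"
  shows "continuous_map X euclidean (\<lambda>x. h (f x))"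
  using continuous_map_compose[OF assms(1), of euclidean h] assms(2) by (simp add: o_def)

lemma continuous_map_compose_on2:
  assumes "continuous_map X euclidean f" "continuous_map X euclidean g"
    and "continuous_on UNIV (\<lambda>p. h (fst p) (snd p))"
  shows "continuous_map X euclidean (\<lambda>x. h (f x) (g x))"
proof -
  have "continuous_map X (prod_topology euclidean euclidean) (\<lambda>x. (f x, g x))"
    using assms by (intro continuous_map_pairedI)
  then have "continuous_map X euclidean (\<lambda>x. (f x, g x))"
    by simp
  from continuous_map_compose_on[OF this assms(3)] show ?thesis by simp
qed

lemma continuous_map_complex_mult:
  fixes f g :: "'x \<Rightarrow> complex"
  assumes "continuous_map X euclidean f" "continuous_map X euclidean g"
  shows "continuous_map X euclidean (\<lambda>x. f x * g x)"
  by (rule continuous_map_compose_on2[OF assms]) (intro continuous_intros)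

lemma continuous_map_locallyI:
  assumes "\<And>x. x \<in> topspace X \<Longrightarrow> \<exists>U. openin X U \<and> x \<in> U \<and> continuous_map (subtopology X U) Y f"
  shows "continuous_map X Y f"
proof -
  obtain U where U: "\<And>x. x \<in> topspace X \<Longrightarrow>
      openin X (U x) \<and> x \<in> U x \<and> continuous_map (subtopology X (U x)) Y f"
    using assms by metis
  show ?thesis
  proof (rule pasting_lemma[where I = "topspace X" and T = U and f = "\<lambda>_. f"])
    fix x assume "x \<in> topspace X"
    then show "\<exists>j. j \<in> topspace X \<and> x \<in> U j \<and> f x = f x" using U by blast
  qed (use U in auto)
qed

lemma continuous_map_open_glue:
  assumes "openin X U" "openin X V" "topspace X \<subseteq> U \<union> V"
    and "continuous_map (subtopology X U) Y f" "continuous_map (subtopology X V) Y f"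
  shows "continuous_map X Y f"
  by (rule continuous_map_locallyI) (use assms in blast)

text \<open>Extension by zero: \<open>U\<close> and the complement of \<open>K\<close> are open and
  cover the space, and \<open>f\<close> is continuous on each of them, being constant on the
  second.\<close>

lemma continuous_map_zero_off:
  fixes f :: "'x \<Rightarrow> 'b::real_normed_vector"
  assumes "openin X U" "closedin X K" "K \<subseteq> U" "continuous_map (subtopology X U) euclidean f"
    and "\<And>x. x \<notin> K \<Longrightarrow> f x = 0"
  shows "continuous_map X euclidean f"
proof (rule continuous_map_open_glue[of X U "topspace X - K"])
  show "continuous_map (subtopology X (topspace X - K)) euclidean f"
    by (rule continuous_map_eq[of _ _ "\<lambda>_. 0"]) (use assms(5) in auto)
qed (use assms in auto)

lemma C_cI:
  "continuous_map X euclidean f \<Longrightarrow> compactin X K \<Longrightarrow> (\<And>x. x \<notin> K \<Longrightarrow> f x = 0) \<Longrightarrow> f \<in> C_c X"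
  unfolding C_c_def by blast

lemma C_cD_continuous: "f \<in> C_c X \<Longrightarrow> continuous_map X euclidean f"
  unfolding C_c_def by blast

lemma C_cE:
  assumes "f \<in> C_c X"
  obtains K where "compactin X K" "\<And>x. x \<notin> K \<Longrightarrow> f x = 0"
  using assms unfolding C_c_def by blast

lemma C_c_zero: "(\<lambda>_. 0) \<in> C_c X"
  by (rule C_cI[of _ _ "{}"]) auto

lemma C_c_outside: "f \<in> C_c X \<Longrightarrow> x \<notin> topspace X \<Longrightarrow> f x = 0"
  by (erule C_cE) (use compactin_subset_topspace in blast)

lemma C_c_mult_left:
  assumes "continuous_map X euclidean f" "g \<in> C_c X"
  shows "(\<lambda>x. f x * g x) \<in> C_c X"
proof -
  obtain K where "compactin X K" "\<And>x. x \<notin> K \<Longrightarrow> g x = 0" by (rule C_cE[OF assms(2)]) blast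
  then show ?thesis
    by (intro C_cI[of _ _ K] continuous_map_complex_mult assms C_cD_continuous[OF assms(2)]) auto
qed

lemma C_c_scale: "g \<in> C_c X \<Longrightarrow> (\<lambda>x. z * g x) \<in> C_c X"
  by (rule C_c_mult_left) auto

lemma C_c_add:
  assumes "f \<in> C_c X" "g \<in> C_c X"
  shows "(\<lambda>x. f x + g x) \<in> C_c X"
proof -
  obtain K where K: "compactin X K" "\<And>x. x \<notin> K \<Longrightarrow> f x = 0" by (rule C_cE[OF assms(1)]) blast
  obtain K' where K': "compactin X K'" "\<And>x. x \<notin> K' \<Longrightarrow> g x = 0" by (rule C_cE[OF assms(2)]) blast
  show ?thesis
  proof (rule C_cI)
    show "compactin X (K \<union> K')" using K K' by (simp add: compactin_Un)
    show "continuous_map X euclidean (\<lambda>x. f x + g x)"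
      by (intro continuous_map_add C_cD_continuous assms)
  qed (use K K' in auto)
qed

lemma C_c_cnj:
  assumes "f \<in> C_c X"
  shows "(\<lambda>x. cnj (f x)) \<in> C_c X"
proof -
  obtain K where K: "compactin X K" "\<And>x. x \<notin> K \<Longrightarrow> f x = 0" by (rule C_cE[OF assms]) blast
  show ?thesis
    by (rule C_cI[OF _ K(1)], rule continuous_map_compose_on[OF C_cD_continuous[OF assms]])
      (use K(2) in \<open>auto intro!: continuous_intros\<close>)
qed


lemma C_c_bounded:
  assumes "f \<in> C_c X"
  obtains B where "0 \<le> B" "\<And>x. cmod (f x) \<le> B"
proof -
  obtain K where K: "compactin X K" "\<And>x. x \<notin> K \<Longrightarrow> f x = 0" by (rule C_cE[OF assms]) blast
  have "compactin euclidean (f ` K)"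
    using image_compactin K(1) C_cD_continuous[OF assms] by blast
  then have "bounded (f ` K)" by (simp add: compact_imp_bounded)
  then obtain B where B: "\<And>x. x \<in> K \<Longrightarrow> cmod (f x) \<le> B" unfolding bounded_iff by blast
  show ?thesis
  proof (rule that[of "max B 0"])
    show "cmod (f x) \<le> max B 0" for x
      using B[of x] K(2)[of x] by (cases "x \<in> K") auto
  qed auto
qed

text \<open>Urysohn's lemma with control of the support: a compact neighbourhood \<open>L\<close> of
  \<open>K\<close> is first found inside \<open>U\<close>, and the separating function is made to
  vanish off an open \<open>V\<close> between \<open>K\<close> and \<open>L\<close>.\<close>

lemma C_c_bump:
  assumes "locally_compact_space X" "Hausdorff_space X" "compactin X K" "openin X U" "K \<subseteq> U"
  obtains u L where "(\<lambda>x. complex_of_real (u x)) \<in> C_c X" "\<And>x. 0 \<le> u x" "\<And>x. u x \<le> 1"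
    "\<And>x. x \<in> K \<Longrightarrow> u x = 1" "compactin X L" "L \<subseteq> U" "\<And>x. x \<notin> L \<Longrightarrow> u x = 0"
proof -
  let ?Y = "subtopology X U"
  have reg: "completely_regular_space X"
    using assms(1,2) locally_compact_Hausdorff_imp_regular_space
      locally_compact_regular_imp_completely_regular_space by blast
  have "locally_compact_space ?Y"
    by (rule locally_compact_space_open_subset)
      (use assms locally_compact_Hausdorff_imp_regular_space in auto)
  moreover have "Hausdorff_space ?Y" using assms(2) by (simp add: Hausdorff_space_subtopology)
  moreover have "compactin ?Y K" using assms by (simp add: compactin_subtopology)
  ultimately obtain V L where VL: "openin ?Y V" "compactin ?Y L" "K \<subseteq> V" "V \<subseteq> L"
    using locally_compact_space_compact_closed_compact[of ?Y] by blast
  have V: "openin X V" using VL(1) assms(4) by (meson openin_trans_full)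
  have L: "compactin X L" "L \<subseteq> U" using VL(2) by (auto simp: compactin_subtopology)
  have "disjnt K (topspace X - V)" using VL(3) by (auto simp: disjnt_def)
  then obtain f where f: "continuous_map X (top_of_set {0..1::real}) f"
      "f ` (topspace X - V) \<subseteq> {0}" "f ` K \<subseteq> {1}"
    using Urysohn_completely_regular_compact_closed[OF _ reg assms(3), of 0 1 "topspace X - V"] V
    by auto
  \<comment> \<open>Members of \<open>C_c X\<close> vanish at every element of the type outside a
    compact set, so the values off the space are reset to 0.\<close>
  define u where "u x = (if x \<in> topspace X then f x else 0)" for x
  have KX: "K \<subseteq> topspace X" using assms(3) by (rule compactin_subset_topspace)
  have 01: "f x \<in> {0..1}" if "x \<in> topspace X" for x
    using continuous_map_image_subset_topspace[OF f(1)] that by auto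
  have 0: "u x = 0" if "x \<notin> L" for x
    using that f(2) VL(4) by (auto simp: u_def)
  have "continuous_map X euclideanreal f" using f(1) by (simp add: continuous_map_in_subtopology)
  then have "continuous_map X euclidean (\<lambda>x. complex_of_real (f x))"
    by (rule continuous_map_compose_on) (intro continuous_intros)
  then have "continuous_map X euclidean (\<lambda>x. complex_of_real (u x))"
    by (rule continuous_map_eq) (auto simp: u_def)
  then have "(\<lambda>x. complex_of_real (u x)) \<in> C_c X"
    by (rule C_cI[OF _ L(1)]) (simp add: 0)
  then show ?thesis
  proof (rule that[of u L])
    show "u x = 1" if "x \<in> K" for x using that f(3) KX by (auto simp: u_def)
    show "0 \<le> u x" "u x \<le> 1" for x using 01[of x] by (auto simp: u_def)
  qed (use L 0 in auto)
qed

text \<open>A partition of unity, in the form of an induction principle.\<close>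

lemma C_c_local_induct:
  assumes X: "locally_compact_space X" "Hausdorff_space X"
    and f: "f \<in> C_c X" and K: "compactin X K" "\<And>x. x \<notin> K \<Longrightarrow> f x = 0"
    and loc: "\<And>x. x \<in> K \<Longrightarrow> \<exists>W. openin X W \<and> x \<in> W \<and>
      (\<forall>h\<in>C_c X. \<forall>L. compactin X L \<and> L \<subseteq> W \<and> (\<forall>y. y \<notin> L \<longrightarrow> h y = 0) \<longrightarrow> Q h)"
    and zero: "Q (\<lambda>_. 0)"
    and add: "\<And>g h. g \<in> C_c X \<Longrightarrow> h \<in> C_c X \<Longrightarrow> Q g \<Longrightarrow> Q h \<Longrightarrow> Q (\<lambda>x. g x + h x)"
  shows "Q f"
proof -
  \<comment> \<open>Every continuous product with the bump at \<open>x\<close> is supported in the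
    neighbourhood on which \<open>Q\<close> is known.\<close>
  have "\<exists>u. (\<lambda>y. complex_of_real (u y)) \<in> C_c X \<and> (\<forall>y. 0 \<le> u y) \<and> u x = 1 \<and>
     (\<forall>h::'a \<Rightarrow> complex. continuous_map X euclidean (\<lambda>y. h y * u y) \<longrightarrow> Q (\<lambda>y. h y * u y))" if x: "x \<in> K" for x
  proof -
    obtain W where W: "openin X W" "x \<in> W"
      "\<And>h L. h \<in> C_c X \<Longrightarrow> compactin X L \<Longrightarrow> L \<subseteq> W \<Longrightarrow> (\<And>y. y \<notin> L \<Longrightarrow> h y = 0) \<Longrightarrow> Q h"
      using loc[OF x] by blast
    have "compactin X {x}" using x compactin_subset_topspace[OF K(1)] by auto
    then obtain u L where u: "(\<lambda>x. complex_of_real (u x)) \<in> C_c X" "\<And>x. 0 \<le> u x" "\<And>x. u x \<le> 1"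
      "u x = 1" "compactin X L" "L \<subseteq> W" "\<And>x. x \<notin> L \<Longrightarrow> u x = 0"
      by (rule C_c_bump[OF X _ W(1), of "{x}"]) (use W(2) in auto)
    have "Q (\<lambda>y. h y * u y)" if "continuous_map X euclidean (\<lambda>y. h y * u y)" for h :: "'a \<Rightarrow> complex"
      by (rule W(3)[OF _ u(5,6)]) (use that u(5,7) in \<open>auto intro: C_cI\<close>)
    then show ?thesis using u by blast
  qed
  then have "\<forall>x\<in>K. \<exists>u. (\<lambda>y. complex_of_real (u y)) \<in> C_c X \<and> (\<forall>y. 0 \<le> u y) \<and> u x = 1 \<and>
     (\<forall>h::'a \<Rightarrow> complex. continuous_map X euclidean (\<lambda>y. h y * u y) \<longrightarrow> Q (\<lambda>y. h y * u y))"
    by blast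
  from bchoice[OF this] obtain u where u0: "\<forall>x\<in>K. (\<lambda>y. complex_of_real (u x y)) \<in> C_c X \<and>
     (\<forall>y. 0 \<le> u x y) \<and> u x x = 1 \<and>
     (\<forall>h::'a \<Rightarrow> complex. continuous_map X euclidean (\<lambda>y. h y * u x y) \<longrightarrow> Q (\<lambda>y. h y * u x y))"
    by (elim exE)
  then have u: "\<And>x. x \<in> K \<Longrightarrow> (\<lambda>y. complex_of_real (u x y)) \<in> C_c X"
     "\<And>x y. x \<in> K \<Longrightarrow> 0 \<le> u x y" "\<And>x. x \<in> K \<Longrightarrow> u x x = 1"
     "\<And>x (h::'a \<Rightarrow> complex). x \<in> K \<Longrightarrow> continuous_map X euclidean (\<lambda>y. h y * u x y) \<Longrightarrow> Q (\<lambda>y. h y * u x y)"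
    by simp_all
  have cu: "continuous_map X euclideanreal (u x)" if "x \<in> K" for x
    using continuous_map_compose_on[OF C_cD_continuous[OF u(1)[OF that]], of Re]
    by (simp add: continuous_intros)
  define N where "N x = {y\<in>topspace X. 0 < u x y}" for x
  have N: "openin X (N x)" if "x \<in> K" for x
    using openin_continuous_map_preimage[OF cu[OF that], of "{0<..}"] by (simp add: N_def)
  have "K \<subseteq> \<Union> (N ` K)"
    using u(3) compactin_subset_topspace[OF K(1)] by (fastforce simp: N_def)
  then obtain F where "finite F" "F \<subseteq> N ` K" "K \<subseteq> \<Union> F"
    using compactinD[OF K(1), of "N ` K"] N by auto
  then obtain J where J: "finite J" "J \<subseteq> K" "K \<subseteq> \<Union> (N ` J)"
    using finite_subset_image[of F N K] by auto
  \<comment> \<open>On \<open>K\<close> at least one of the finitely many bumps is positive, so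
    \<open>H\<close> is positive there. As \<open>f\<close> vanishes off \<open>K\<close>, the
    quotient of \<open>f\<close> by \<open>H\<close> extends continuously by zero, and
    \<open>f\<close> is the sum of its products with the bumps.\<close>
  define H where "H y = (\<Sum>x\<in>J. u x y)" for y
  have H: "0 < H y" if "y \<in> K" for y
  proof -
    obtain x where "x \<in> J" "0 < u x y" using J(3) \<open>y \<in> K\<close> by (auto simp: N_def)
    then show ?thesis unfolding H_def using J u(2) by (intro sum_pos2[of J x]) auto
  qed
  have cH: "continuous_map X euclideanreal H"
    unfolding H_def by (rule continuous_map_sum) (use J cu in auto)
  define U where "U = {y\<in>topspace X. 0 < H y}"
  have U: "openin X U"
    using openin_continuous_map_preimage[OF cH, of "{0<..}"] by (simp add: U_def)
  have KU: "K \<subseteq> U" using H compactin_subset_topspace[OF K(1)] by (auto simp: U_def)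
  have "continuous_map (subtopology X U) euclideanreal (\<lambda>y. inverse (H y))"
    by (rule continuous_map_real_inverse[OF continuous_map_from_subtopology[OF cH]])
      (auto simp: U_def)
  then have "continuous_map (subtopology X U) euclidean (\<lambda>y. complex_of_real (inverse (H y)))"
    by (rule continuous_map_compose_on) (intro continuous_intros)
  then have "continuous_map (subtopology X U) euclidean (\<lambda>y. f y * complex_of_real (inverse (H y)))"
    by (rule continuous_map_complex_mult[OF continuous_map_from_subtopology[OF C_cD_continuous[OF f]]])
  then have "continuous_map X euclidean (\<lambda>y. f y * complex_of_real (inverse (H y)))"
    by (rule continuous_map_zero_off[OF U compactin_imp_closedin[OF X(2) K(1)] KU]) (simp add: K(2))
  then have c: "continuous_map X euclidean (\<lambda>y. f y * complex_of_real (inverse (H y)) * u x y)"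
    if "x \<in> K" for x
    by (rule continuous_map_complex_mult[OF _ C_cD_continuous[OF u(1)[OF that]]])
  have sumQ: "(\<lambda>y. \<Sum>x\<in>I. f y * complex_of_real (inverse (H y)) * u x y) \<in> C_c X \<and>
      Q (\<lambda>y. \<Sum>x\<in>I. f y * complex_of_real (inverse (H y)) * u x y)" if "finite I" "I \<subseteq> K" for I
    using that
  proof (induction I rule: finite_induct)
    case empty
    then show ?case using zero C_c_zero by auto
  next
    case (insert x I)
    have 1: "(\<lambda>y. f y * complex_of_real (inverse (H y)) * u x y) \<in> C_c X"
      by (rule C_cI[OF c K(1)]) (use insert K(2) in auto)
    have 2: "Q (\<lambda>y. f y * complex_of_real (inverse (H y)) * u x y)"
      by (rule u(4)[OF _ c]) (use insert in auto)
    show ?case using insert add[OF 1 _ 2] C_c_add[OF 1] by simp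
  qed
  have "(\<lambda>y. \<Sum>x\<in>J. f y * complex_of_real (inverse (H y)) * u x y) = f"
  proof
    fix y
    have "(\<Sum>x\<in>J. f y * complex_of_real (inverse (H y)) * u x y)
        = f y * complex_of_real (inverse (H y)) * complex_of_real (H y)"
      by (simp add: H_def sum_distrib_left)
    also have "\<dots> = f y"
      using H[of y] K(2)[of y] by (cases "y \<in> K") auto
    finally show "(\<Sum>x\<in>J. f y * complex_of_real (inverse (H y)) * u x y) = f y" .
  qed
  then show ?thesis using sumQ[of J] J by simp
qed

section \<open>Real Radon measures as functionals\<close>

lemma Rad_add:
  "\<mu> \<in> Rad X \<Longrightarrow> f \<in> C_c X \<Longrightarrow> g \<in> C_c X \<Longrightarrow> \<mu> (\<lambda>x. f x + g x) = \<mu> f + \<mu> g"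
  unfolding Rad_def linear_functionals_def by (auto simp: plus_fun_def)

lemma Rad_scale: "\<mu> \<in> Rad X \<Longrightarrow> f \<in> C_c X \<Longrightarrow> \<mu> (\<lambda>x. z * f x) = z * \<mu> f"
  unfolding Rad_def linear_functionals_def by auto

lemma Rad_cnj: "\<mu> \<in> Rad X \<Longrightarrow> f \<in> C_c X \<Longrightarrow> \<mu> (\<lambda>x. cnj (f x)) = cnj (\<mu> f)"
  unfolding Rad_def by auto



text \<open>The constant in \<open>Rad\<close> may have any sign. Since \<open>B\<close> bounds a
  modulus it is nonnegative, so the constant may be enlarged to a nonnegative one, as monotonicity
  arguments require.\<close>

lemma Rad_bound:
  assumes "\<mu> \<in> Rad X" "compactin X K"
  obtains C where "0 \<le> C" "\<And>f B. f \<in> C_c X \<Longrightarrow> (\<And>x. x \<notin> K \<Longrightarrow> f x = 0) \<Longrightarrow> (\<And>x. cmod (f x) \<le> B)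
      \<Longrightarrow> cmod (\<mu> f) \<le> C * B"
proof -
  obtain C where C: "\<And>f B. f \<in> C_c X \<Longrightarrow> (\<And>x. x \<notin> K \<Longrightarrow> f x = 0) \<Longrightarrow> (\<And>x. cmod (f x) \<le> B)
      \<Longrightarrow> cmod (\<mu> f) \<le> C * B"
    using assms unfolding Rad_def by blast
  show ?thesis
  proof (rule that[of "max C 0"])
    fix f :: "'a \<Rightarrow> complex" and B
    assume f: "f \<in> C_c X" "\<And>x. x \<notin> K \<Longrightarrow> f x = 0" "\<And>x. cmod (f x) \<le> B"
    have "0 \<le> B" using f(3) norm_ge_zero order_trans by blast
    then have "C * B \<le> max C 0 * B" by (intro mult_right_mono) auto
    with C[OF f] show "cmod (\<mu> f) \<le> max C 0 * B" by linarith
  qed auto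
qed


section \<open>Complete normed *-algebras on a carrier\<close>

text \<open>The laws of a C*-algebra on which the construction of the traces draws, restricted to
  the carrier because the operations of a \<open>cstar_structure\<close> mean nothing
  elsewhere.\<close>

locale banach_star_algebra =
  fixes A :: "'a::ab_group_add cstar_structure"
  assumes cscale_vector_space: "vector_space (cscale A)"
    and carr_subspace: "module.subspace (cscale A) (carr A)"
    and cmul_closed: "\<lbrakk>a \<in> carr A; b \<in> carr A\<rbrakk> \<Longrightarrow> cmul A a b \<in> carr A"
    and cmul_assoc: "\<lbrakk>a \<in> carr A; b \<in> carr A; c \<in> carr A\<rbrakk>
      \<Longrightarrow> cmul A (cmul A a b) c = cmul A a (cmul A b c)"
    and cmul_add_left: "\<lbrakk>a \<in> carr A; b \<in> carr A; c \<in> carr A\<rbrakk>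
      \<Longrightarrow> cmul A (a + b) c = cmul A a c + cmul A b c"
    and cmul_add_right: "\<lbrakk>a \<in> carr A; b \<in> carr A; c \<in> carr A\<rbrakk>
      \<Longrightarrow> cmul A a (b + c) = cmul A a b + cmul A a c"
    and cmul_scale_left: "\<lbrakk>a \<in> carr A; b \<in> carr A\<rbrakk> \<Longrightarrow> cmul A (cscale A z a) b = cscale A z (cmul A a b)"
    and cmul_scale_right: "\<lbrakk>a \<in> carr A; b \<in> carr A\<rbrakk> \<Longrightarrow> cmul A a (cscale A z b) = cscale A z (cmul A a b)"
    and cstar_closed: "a \<in> carr A \<Longrightarrow> cstar A a \<in> carr A"
    and cstar_add: "\<lbrakk>a \<in> carr A; b \<in> carr A\<rbrakk> \<Longrightarrow> cstar A (a + b) = cstar A a + cstar A b"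
    and cstar_scale: "a \<in> carr A \<Longrightarrow> cstar A (cscale A z a) = cscale A (cnj z) (cstar A a)"
    and cstar_cmul: "\<lbrakk>a \<in> carr A; b \<in> carr A\<rbrakk> \<Longrightarrow> cstar A (cmul A a b) = cmul A (cstar A b) (cstar A a)"
    and cnorm_triangle: "\<lbrakk>a \<in> carr A; b \<in> carr A\<rbrakk> \<Longrightarrow> cnorm A (a + b) \<le> cnorm A a + cnorm A b"
    and cnorm_scale: "a \<in> carr A \<Longrightarrow> cnorm A (cscale A z a) = cmod z * cnorm A a"
    and cnorm_cmul: "\<lbrakk>a \<in> carr A; b \<in> carr A\<rbrakk> \<Longrightarrow> cnorm A (cmul A a b) \<le> cnorm A a * cnorm A b"
    and cnorm_eq_0D: "\<lbrakk>a \<in> carr A; cnorm A a = 0\<rbrakk> \<Longrightarrow> a = 0"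
    and cauchy_convergent: "\<lbrakk>\<And>n. s n \<in> carr A; \<And>\<epsilon>. 0 < \<epsilon> \<Longrightarrow> \<exists>N. \<forall>m\<ge>N. \<forall>n\<ge>N. cnorm A (s m - s n) < \<epsilon>\<rbrakk>
      \<Longrightarrow> \<exists>l\<in>carr A. (\<lambda>n. cnorm A (s n - l)) \<longlonglongrightarrow> 0"
begin

sublocale V: vector_space "cscale A"
  by (rule cscale_vector_space)

lemma carr_0: "0 \<in> carr A"
  using V.subspace_0[OF carr_subspace] .

lemma carr_add: "a \<in> carr A \<Longrightarrow> b \<in> carr A \<Longrightarrow> a + b \<in> carr A"
  by (rule V.subspace_add[OF carr_subspace])

lemma carr_diff: "a \<in> carr A \<Longrightarrow> b \<in> carr A \<Longrightarrow> a - b \<in> carr A"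
  by (rule V.subspace_diff[OF carr_subspace])

lemma carr_scale: "a \<in> carr A \<Longrightarrow> cscale A z a \<in> carr A"
  by (rule V.subspace_scale[OF carr_subspace])

lemmas closed = carr_0 carr_add carr_diff carr_scale cmul_closed cstar_closed

lemma cmul_diff_left: "\<lbrakk>a \<in> carr A; b \<in> carr A; c \<in> carr A\<rbrakk>
    \<Longrightarrow> cmul A (a - b) c = cmul A a c - cmul A b c"
  using cmul_add_left[of "a - b" b c] by (simp add: closed algebra_simps)

lemma cmul_diff_right: "\<lbrakk>a \<in> carr A; b \<in> carr A; c \<in> carr A\<rbrakk>
    \<Longrightarrow> cmul A a (b - c) = cmul A a b - cmul A a c"
  using cmul_add_right[of a "b - c" c] by (simp add: closed algebra_simps)

lemma cnorm_0: "cnorm A 0 = 0"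
  using cnorm_scale[OF carr_0, of 0] by simp

lemma cnorm_minus_commute: "\<lbrakk>a \<in> carr A; b \<in> carr A\<rbrakk> \<Longrightarrow> cnorm A (a - b) = cnorm A (b - a)"
  using cnorm_scale[of "b - a" "-1"] by (simp add: closed)

text \<open>The triangle inequality for \<open>a\<close> and \<open>- a\<close> bounds 0 by twice
  the norm of \<open>a\<close>.\<close>

lemma cnorm_nonneg: "a \<in> carr A \<Longrightarrow> 0 \<le> cnorm A a"
  using cnorm_triangle[of a "0 - a"] cnorm_minus_commute[of a 0] carr_diff[of 0 a]
  by (simp add: carr_0 cnorm_0)

lemma cnorm_triangle_diff: "\<lbrakk>a \<in> carr A; b \<in> carr A; c \<in> carr A\<rbrakk>
    \<Longrightarrow> cnorm A (a - c) \<le> cnorm A (a - b) + cnorm A (b - c)"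
  using cnorm_triangle[of "a - b" "b - c"] by (simp add: closed)

text \<open>The equation says \<open>(1 - u) (1 + v) = 1\<close> without mentioning a unit, and
  \<open>v\<close> is the sum of the powers of \<open>u\<close>.\<close>

lemma neumann_inverse:
  assumes u: "u \<in> carr A" "cnorm A u \<le> 1/2"
  obtains v where "v \<in> carr A" "v = u + cmul A u v"
proof -
  \<comment> \<open>The partial sums \<open>u + u^2 + ... + u^n\<close>, written by Horner's
    rule.\<close>
  define s where "s = rec_nat 0 (\<lambda>_ x. u + cmul A u x)"
  have s0: "s 0 = 0" and s1: "s (Suc n) = u + cmul A u (s n)" for n
    by (simp_all add: s_def)
  have sc: "s n \<in> carr A" for n
    by (induction n) (simp_all add: s0 s1 closed u)
  have st: "cnorm A (s (Suc n) - s n) \<le> (1/2) ^ Suc n" for n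
  proof (induction n)
    case 0
    have "cmul A u 0 = 0"
      using cmul_scale_right[OF u(1) carr_0, of 0] by simp
    then show ?case using u by (simp add: s0 s1)
  next
    case (Suc n)
    have "s (Suc (Suc n)) - s (Suc n) = cmul A u (s (Suc n) - s n)"
      by (subst s1, subst (2) s1) (simp add: cmul_diff_right u sc)
    then have "cnorm A (s (Suc (Suc n)) - s (Suc n)) \<le> cnorm A u * cnorm A (s (Suc n) - s n)"
      by (simp add: cnorm_cmul u sc closed)
    also have "\<dots> \<le> 1/2 * (1/2) ^ Suc n"
      using u Suc by (intro mult_mono) (simp_all add: cnorm_nonneg sc closed)
    finally show ?case by simp
  qed
  \<comment> \<open>A difference of powers, instead of a single power, makes the induction on
    \<open>k\<close> telescope.\<close>
  have le: "cnorm A (s (n + k) - s n) \<le> (1/2) ^ n - (1/2) ^ (n + k)" for n k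
  proof (induction k)
    case 0
    then show ?case by (simp add: cnorm_0)
  next
    case (Suc k)
    have "cnorm A (s (n + Suc k) - s n) \<le> cnorm A (s (Suc (n + k)) - s (n + k)) + cnorm A (s (n + k) - s n)"
      using cnorm_triangle_diff[of "s (Suc (n + k))" "s (n + k)" "s n"] by (simp add: sc)
    then show ?case using Suc st[of "n + k"] by simp
  qed
  have "\<exists>N. \<forall>m\<ge>N. \<forall>n\<ge>N. cnorm A (s m - s n) < \<epsilon>" if "0 < \<epsilon>" for \<epsilon>
  proof -
    obtain N where N: "(1/2::real) ^ N < \<epsilon>"
      using real_arch_pow_inv[of \<epsilon> "1/2"] \<open>0 < \<epsilon>\<close> by auto
    have *: "cnorm A (s m - s n) < \<epsilon>" if "N \<le> n" "n \<le> m" for m n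
    proof -
      have "(1/2::real) ^ n \<le> (1/2) ^ N" using that by (intro power_decreasing) auto
      moreover have "0 < (1/2::real) ^ m" by simp
      moreover have "cnorm A (s m - s n) \<le> (1/2) ^ n - (1/2) ^ m" using le[of n "m - n"] that by simp
      ultimately show ?thesis using N by linarith
    qed
    have "cnorm A (s m - s n) < \<epsilon>" if "N \<le> m" "N \<le> n" for m n
      using *[of n m] *[of m n] cnorm_minus_commute[of "s n" "s m"] that sc by (cases "n \<le> m") auto
    then show ?thesis by blast
  qed
  then obtain v where v: "v \<in> carr A" "(\<lambda>n. cnorm A (s n - v)) \<longlonglongrightarrow> 0"
    using cauchy_convergent[of s] sc by blast
  have "cnorm A (v - (u + cmul A u v)) \<le> cnorm A (s (Suc n) - v) + 1/2 * cnorm A (s n - v)" for n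
  proof -
    have "cnorm A (v - (u + cmul A u v)) \<le> cnorm A (v - s (Suc n)) + cnorm A (s (Suc n) - (u + cmul A u v))"
      by (rule cnorm_triangle_diff) (simp_all add: closed v u sc)
    also have "s (Suc n) - (u + cmul A u v) = cmul A u (s n - v)"
      by (simp add: s1 cmul_diff_right closed v u sc)
    also have "cnorm A (cmul A u (s n - v)) \<le> cnorm A u * cnorm A (s n - v)"
      by (simp add: cnorm_cmul closed v u sc)
    also have "\<dots> \<le> 1/2 * cnorm A (s n - v)"
      using u by (intro mult_right_mono) (simp_all add: cnorm_nonneg closed v sc)
    finally show ?thesis using cnorm_minus_commute[of v "s (Suc n)"] sc v by simp
  qed
  moreover have "(\<lambda>n. cnorm A (s (Suc n) - v) + 1/2 * cnorm A (s n - v)) \<longlonglongrightarrow> 0 + 1/2 * 0"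
    by (intro tendsto_intros LIMSEQ_Suc v(2))
  ultimately have "cnorm A (v - (u + cmul A u v)) \<le> 0"
    by (intro LIMSEQ_le_const) auto
  then have "cnorm A (v - (u + cmul A u v)) = 0"
    using cnorm_nonneg[of "v - (u + cmul A u v)"] v u by (simp add: closed)
  then have "v - (u + cmul A u v) = 0"
    by (intro cnorm_eq_0D) (simp_all add: closed v u)
  then show ?thesis using that[OF v(1)] by simp
qed

text \<open>
  Were the conclusion false, one could choose nested closed balls on the n-th of which some member
  of the family exceeds n.
\<close>

lemma uniform_boundedness:
  assumes D: "D \<subseteq> carr A" "V.subspace D"
    and closed_D: "\<And>a. a \<in> carr A \<Longrightarrow> (\<And>\<epsilon>. 0 < \<epsilon> \<Longrightarrow> \<exists>d\<in>D. cnorm A (a - d) < \<epsilon>) \<Longrightarrow> a \<in> D"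
    and add: "\<And>\<phi> x y. \<phi> \<in> \<Phi> \<Longrightarrow> x \<in> D \<Longrightarrow> y \<in> D \<Longrightarrow> \<phi> (x + y) = \<phi> x + \<phi> y"
    and scale: "\<And>\<phi> x z. \<phi> \<in> \<Phi> \<Longrightarrow> x \<in> D \<Longrightarrow> \<phi> (cscale A z x) = z * \<phi> x"
    and bdd: "\<And>\<phi>. \<phi> \<in> \<Phi> \<Longrightarrow> \<exists>C. \<forall>x\<in>D. cmod (\<phi> x) \<le> C * cnorm A x"
    and ptw: "\<And>x. x \<in> D \<Longrightarrow> \<exists>C. \<forall>\<phi>\<in>\<Phi>. cmod (\<phi> x) \<le> C"
  shows "\<exists>C. \<forall>\<phi>\<in>\<Phi>. \<forall>x\<in>D. cmod (\<phi> x) \<le> C * cnorm A x"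
proof (rule ccontr)
  assume not: "\<nexists>C. \<forall>\<phi>\<in>\<Phi>. \<forall>x\<in>D. cmod (\<phi> x) \<le> C * cnorm A x"
  note Dsub = V.subspace_add[OF D(2)] V.subspace_diff[OF D(2)] V.subspace_scale[OF D(2)]
  have Dc: "x \<in> D \<Longrightarrow> x \<in> carr A" for x using D by blast
  have diff: "\<phi> (x - y) = \<phi> x - \<phi> y" if "\<phi> \<in> \<Phi>" "x \<in> D" "y \<in> D" for \<phi> x y
    using add[OF that(1), of "x - y" y] that Dsub by simp
  have large: "\<exists>\<phi>\<in>\<Phi>. \<exists>y'\<in>D. cnorm A (y' - y) \<le> r \<and> B < cmod (\<phi> y')"
    if y: "y \<in> D" "0 < r" for y r B
  proof (rule ccontr)
    assume "\<not> ?thesis"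
    then have B: "cmod (\<phi> y') \<le> B" if "\<phi> \<in> \<Phi>" "y' \<in> D" "cnorm A (y' - y) \<le> r" for \<phi> y'
      using that not_less by blast
    \<comment> \<open>Rescaling \<open>x\<close> to norm \<open>r\<close> keeps
      \<open>y + c x\<close> in the ball, so that \<open>c * \<phi> x\<close> is a difference of two
      values bounded by \<open>B\<close>. A bound on one ball would thus be a bound on
      \<open>D\<close>, which was excluded.\<close>
    have "cmod (\<phi> x) \<le> 2 * B / r * cnorm A x" if \<phi>: "\<phi> \<in> \<Phi>" "x \<in> D" for \<phi> x
    proof (cases "cnorm A x = 0")
      case True
      then have "x = 0" using cnorm_eq_0D Dc that by blast
      then have "\<phi> x = 0" using scale[OF \<phi>, of 0] by simp
      then show ?thesis using True by simp
    next
      case False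
      then have p: "0 < cnorm A x" using cnorm_nonneg[OF Dc[OF \<phi>(2)]] by simp
      define c where "c = complex_of_real (r / cnorm A x)"
      have c: "cmod c * cnorm A x = r" "0 < cmod c" using p y(2) by (auto simp: c_def norm_divide)
      have "cnorm A (y + cscale A c x - y) \<le> r"
        using c by (simp add: cnorm_scale Dc \<phi>)
      then have "cmod (\<phi> (y + cscale A c x)) \<le> B"
        using B[OF \<phi>(1) Dsub(1)[OF y(1) Dsub(3)[OF \<phi>(2)]]] by blast
      moreover have "cmod (\<phi> y) \<le> B"
        using B[OF \<phi>(1) y(1)] y(2) by (simp add: cnorm_0)
      moreover have "c * \<phi> x = \<phi> (y + cscale A c x) - \<phi> y"
        using add[OF \<phi>(1) y(1), of "cscale A c x"] scale[OF \<phi>, of c] Dsub(3) \<phi>(2) by simp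
      ultimately have "cmod c * cmod (\<phi> x) \<le> 2 * B"
        using norm_triangle_ineq4[of "\<phi> (y + cscale A c x)" "\<phi> y"] by (simp add: norm_mult[symmetric])
      moreover have "cmod c = r / cnorm A x" using p c(1) by (simp only: eq_divide_eq) simp
      ultimately show ?thesis using p y(2) by (simp add: field_simps)
    qed
    with not show False by blast
  qed
  \<comment> \<open>A pair is the centre and the radius of a closed ball. \<open>?P\<close> forces
    the radii to 0, and the first part of \<open>?Q\<close> nests the ball of \<open>q\<close> in
    that of \<open>p\<close>.\<close>
  let ?P = "\<lambda>n::nat. \<lambda>p. fst p \<in> D \<and> 0 < snd p \<and> snd p \<le> (1/2::real) ^ n"
  let ?Q = "\<lambda>n p q. cnorm A (fst q - fst p) + snd q \<le> snd p \<and>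
      (\<exists>\<phi>\<in>\<Phi>. \<forall>z\<in>D. cnorm A (z - fst q) \<le> snd q \<longrightarrow> real n < cmod (\<phi> z))"
  have "\<exists>p. ?P 0 p"
    by (rule exI[of _ "(0, 1)"]) (use V.subspace_0[OF D(2)] in auto)
  moreover have "\<exists>q. ?P (Suc n) q \<and> ?Q n p q" if p: "?P n p" for n p
  proof -
    obtain \<phi> y where \<phi>: "\<phi> \<in> \<Phi>" "y \<in> D" "cnorm A (y - fst p) \<le> snd p / 2" "real n + 1 < cmod (\<phi> y)"
      using large[of "fst p" "snd p / 2" "real n + 1"] p by auto
    obtain C where C: "\<And>x. x \<in> D \<Longrightarrow> cmod (\<phi> x) \<le> C * cnorm A x" using bdd[OF \<phi>(1)] by blast
    \<comment> \<open>The second bound lets \<open>\<phi>\<close> vary by at most 1 on the new ball,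
      which the surplus 1 in the choice of \<open>y\<close> absorbs.\<close>
    define r where "r = min (snd p / 2) (1 / (\<bar>C\<bar> + 1))"
    have r: "0 < r" "r \<le> snd p / 2" "\<bar>C\<bar> * r \<le> 1"
    proof -
      show "0 < r" "r \<le> snd p / 2" using p by (auto simp: r_def)
      have "\<bar>C\<bar> * r \<le> \<bar>C\<bar> * (1 / (\<bar>C\<bar> + 1))" by (intro mult_left_mono) (auto simp: r_def)
      also have "\<dots> \<le> 1" by (simp add: field_simps)
      finally show "\<bar>C\<bar> * r \<le> 1" .
    qed
    have "real n < cmod (\<phi> z)" if z: "z \<in> D" "cnorm A (z - y) \<le> r" for z
    proof -
      have "cmod (\<phi> (z - y)) \<le> C * cnorm A (z - y)" using C z \<phi> Dsub by blast
      also have "\<dots> \<le> \<bar>C\<bar> * r"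
        using z(2) cnorm_nonneg[of "z - y"] z \<phi> Dc closed by (intro mult_mono) auto
      finally have "cmod (\<phi> z - \<phi> y) \<le> 1" using r(3) diff[OF \<phi>(1) z(1) \<phi>(2)] by simp
      then show ?thesis using \<phi>(4) norm_triangle_ineq2[of "\<phi> y" "\<phi> z"] by (simp add: norm_minus_commute)
    qed
    then show ?thesis using p \<phi> r by (intro exI[of _ "(y, r)"]) auto
  qed
  ultimately have "\<exists>f. \<forall>n. ?P n (f n) \<and> ?Q n (f n) (f (Suc n))"
    by (rule dependent_nat_choice)
  then obtain f where f': "\<forall>n. ?P n (f n) \<and> ?Q n (f n) (f (Suc n))"
    by (rule exE)
  have f: "?P n (f n)" "?Q n (f n) (f (Suc n))" for n
    using spec[OF f', of n] by (rule conjunct1, rule conjunct2)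
  have fc: "fst (f n) \<in> carr A" for n using f(1)[of n] Dc by blast
  \<comment> \<open>Keeping the smaller radius on the left is the exact form of nesting, and it lets
    the induction add up the steps.\<close>
  have ball: "cnorm A (fst (f (n + k)) - fst (f n)) + snd (f (n + k)) \<le> snd (f n)" for n k
  proof (induction k)
    case 0
    then show ?case by (simp add: cnorm_0)
  next
    case (Suc k)
    then show ?case
      using f(2)[of "n + k"] cnorm_triangle_diff[OF fc[of "Suc (n + k)"] fc[of "n + k"] fc[of n]] by simp
  qed
  have ball': "cnorm A (fst (f m) - fst (f n)) \<le> snd (f n)" if "n \<le> m" for m n
    using ball[of n "m - n"] f(1)[of m] that by simp
  have "\<exists>N. \<forall>m\<ge>N. \<forall>n\<ge>N. cnorm A (fst (f m) - fst (f n)) < \<epsilon>" if "0 < \<epsilon>" for \<epsilon>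
  proof -
    obtain N where N: "(1/2::real) ^ N < \<epsilon> / 2"
      using real_arch_pow_inv[of "\<epsilon> / 2" "1/2"] \<open>0 < \<epsilon>\<close> by auto
    have "cnorm A (fst (f m) - fst (f n)) < \<epsilon>" if "N \<le> m" "N \<le> n" for m n
    proof -
      have "cnorm A (fst (f m) - fst (f N)) < \<epsilon> / 2" "cnorm A (fst (f n) - fst (f N)) < \<epsilon> / 2"
        using ball'[OF that(1)] ball'[OF that(2)] f(1)[of N] N by linarith+
      then show ?thesis
        using cnorm_triangle_diff[OF fc[of m] fc[of N] fc[of n]] cnorm_minus_commute[OF fc fc, of n N] by linarith
    qed
    then show ?thesis by blast
  qed
  then obtain y where y: "y \<in> carr A" "(\<lambda>n. cnorm A (fst (f n) - y)) \<longlonglongrightarrow> 0"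
    using cauchy_convergent[of "\<lambda>n. fst (f n)"] fc by blast
  have yn: "cnorm A (y - fst (f n)) \<le> snd (f n)" for n
  proof -
    have "cnorm A (y - fst (f n)) \<le> cnorm A (fst (f m) - y) + snd (f n)" if "n \<le> m" for m
      using cnorm_triangle_diff[OF y(1) fc[of m] fc[of n]] ball'[OF that] cnorm_minus_commute[OF y(1) fc, of m]
      by linarith
    moreover have "(\<lambda>m. cnorm A (fst (f m) - y) + snd (f n)) \<longlonglongrightarrow> 0 + snd (f n)"
      by (intro tendsto_intros y(2))
    ultimately show ?thesis using LIMSEQ_le_const[of _ "0 + snd (f n)"] by auto
  qed
  have "y \<in> D"
  proof (rule closed_D[OF y(1)])
    fix \<epsilon> :: real assume "0 < \<epsilon>"
    then obtain N where N: "(1/2::real) ^ N < \<epsilon>"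
      using real_arch_pow_inv[of \<epsilon> "1/2"] by auto
    then show "\<exists>d\<in>D. cnorm A (y - d) < \<epsilon>"
      using yn[of N] f(1)[of N] by (intro bexI[of _ "fst (f N)"]) auto
  qed
  then obtain C where C: "\<And>\<phi>. \<phi> \<in> \<Phi> \<Longrightarrow> cmod (\<phi> y) \<le> C" using ptw by blast
  obtain n where "C < real n" using reals_Archimedean2 by blast
  moreover obtain \<phi> where "\<phi> \<in> \<Phi>" "real n < cmod (\<phi> y)"
    using f(2)[of n] yn[of "Suc n"] \<open>y \<in> D\<close> by (elim conjE bexE) simp
  ultimately show False using C[of \<phi>] by linarith
qed

end


section \<open>Traces from invariant functionals\<close>

lemma continuous_map_dist_iff:
  fixes f :: "'x \<Rightarrow> 'b::metric_space"
  shows "continuous_map X euclidean f \<longleftrightarrow>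
    (\<forall>x\<in>topspace X. \<forall>\<epsilon>>0. \<exists>U. openin X U \<and> x \<in> U \<and> (\<forall>y\<in>U. dist (f y) (f x) < \<epsilon>))"
  using Met_TC.continuous_map_to_metric[of X f]
  by (simp add: Met_TC.mball_def dist_commute mtopology_is_euclidean)

text \<open>The three-epsilon argument for uniform limits, over a topology given as a value instead
  of a type class.\<close>

lemma continuous_map_uniform_approx:
  fixes f :: "'x \<Rightarrow> 'b::real_normed_vector"
  assumes "\<And>\<epsilon>. 0 < \<epsilon> \<Longrightarrow> \<exists>g. continuous_map X euclidean g \<and> (\<forall>x\<in>topspace X. norm (f x - g x) < \<epsilon>)"
  shows "continuous_map X euclidean f"
  unfolding continuous_map_dist_iff
proof (intro ballI allI impI)
  fix x \<epsilon> assume x: "x \<in> topspace X" and "0 < (\<epsilon>::real)"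
  then obtain g where g: "continuous_map X euclidean g" "\<And>x. x \<in> topspace X \<Longrightarrow> norm (f x - g x) < \<epsilon>/3"
    using assms[of "\<epsilon>/3"] by auto
  obtain U where U: "openin X U" "x \<in> U" "\<And>y. y \<in> U \<Longrightarrow> dist (g y) (g x) < \<epsilon>/3"
    using g(1)[unfolded continuous_map_dist_iff, rule_format, OF x, of "\<epsilon>/3"] \<open>0 < \<epsilon>\<close> by auto
  have "dist (f y) (f x) < \<epsilon>" if y: "y \<in> U" for y
  proof -
    have "y \<in> topspace X" using openin_subset[OF U(1)] y by blast
    then have "dist (f y) (g y) < \<epsilon>/3" using g(2) by (simp add: dist_norm)
    moreover have "dist (f x) (g x) < \<epsilon>/3" using g(2)[OF x] by (simp add: dist_norm)
    ultimately show ?thesis using U(3)[OF y] dist_triangle[of "f y" "f x" "g y"]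
        dist_triangle[of "g y" "f x" "g x"] by (simp add: dist_commute)
  qed
  then show "\<exists>U. openin X U \<and> x \<in> U \<and> (\<forall>y\<in>U. dist (f y) (f x) < \<epsilon>)" using U by blast
qed



text \<open>
  \<open>M\<close> is the multiplication action of \<open>C_c X\<close>, \<open>E\<close> the conditional expectation onto functions on
  \<open>X\<close>, \<open>\<Gamma>\<close> a dense subalgebra and \<open>N\<close> the set of invariant functionals.
\<close>

locale trace_data = banach_star_algebra A
  for A :: "'a::ab_group_add cstar_structure" +
  fixes X :: "'x topology" and M :: "('x \<Rightarrow> complex) \<Rightarrow> 'a" and E :: "'a \<Rightarrow> 'x \<Rightarrow> complex"
    and \<Gamma> :: "'a set" and N :: "(('x \<Rightarrow> complex) \<Rightarrow> complex) set"
  assumes X: "locally_compact_space X" "Hausdorff_space X"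
    and M_add: "\<lbrakk>f \<in> C_c X; g \<in> C_c X\<rbrakk> \<Longrightarrow> M (\<lambda>x. f x + g x) = M f + M g"
    and M_scale: "f \<in> C_c X \<Longrightarrow> M (\<lambda>x. z * f x) = cscale A z (M f)"
    and M_mult: "\<lbrakk>f \<in> C_c X; g \<in> C_c X\<rbrakk> \<Longrightarrow> M (\<lambda>x. f x * g x) = cmul A (M f) (M g)"
    and M_cnj: "f \<in> C_c X \<Longrightarrow> M (\<lambda>x. cnj (f x)) = cstar A (M f)"
    and M_norm: "\<lbrakk>f \<in> C_c X; \<And>x. cmod (f x) \<le> B\<rbrakk> \<Longrightarrow> cnorm A (M f) \<le> B"
    and \<Gamma>_subspace: "module.subspace (cscale A) \<Gamma>"
    and \<Gamma>_carr: "\<Gamma> \<subseteq> carr A"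
    and M_\<Gamma>: "f \<in> C_c X \<Longrightarrow> M f \<in> \<Gamma>"
    and \<Gamma>_mult: "\<lbrakk>p \<in> \<Gamma>; q \<in> \<Gamma>\<rbrakk> \<Longrightarrow> cmul A p q \<in> \<Gamma>"
    and \<Gamma>_dense: "\<lbrakk>a \<in> carr A; 0 < \<epsilon>\<rbrakk> \<Longrightarrow> \<exists>p\<in>\<Gamma>. cnorm A (a - p) < \<epsilon>"
    and \<Gamma>_unit: "p \<in> \<Gamma> \<Longrightarrow> \<exists>e\<in>C_c X. cmul A p (M e) = p"
    and E_add: "\<lbrakk>a \<in> carr A; b \<in> carr A\<rbrakk> \<Longrightarrow> E (a + b) x = E a x + E b x"
    and E_scale: "a \<in> carr A \<Longrightarrow> E (cscale A z a) x = z * E a x"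
    and E_bound: "a \<in> carr A \<Longrightarrow> cmod (E a x) \<le> cnorm A a"
    and E_M_left: "\<lbrakk>f \<in> C_c X; a \<in> carr A\<rbrakk> \<Longrightarrow> E (cmul A (M f) a) x = f x * E a x"
    and E_M_right: "\<lbrakk>f \<in> C_c X; a \<in> carr A\<rbrakk> \<Longrightarrow> E (cmul A a (M f)) x = f x * E a x"
    and E_M: "f \<in> C_c X \<Longrightarrow> E (M f) = f"
    and E_\<Gamma>: "p \<in> \<Gamma> \<Longrightarrow> E p \<in> C_c X"
    and E_star: "a \<in> carr A \<Longrightarrow> E (cstar A a) x = cnj (E a x)"
    and E_positive: "a \<in> carr A \<Longrightarrow> E (cmul A (cstar A a) a) x \<in> \<real>\<^sub>\<ge>\<^sub>0"
    and N_iff: "\<mu> \<in> N \<longleftrightarrow> \<mu> \<in> Rad X \<and> (\<forall>p\<in>\<Gamma>. \<forall>q\<in>\<Gamma>. \<mu> (E (cmul A p q)) = \<mu> (E (cmul A q p)))"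
    and trace_E: "\<lbrakk>\<And>p q. p \<in> \<Gamma> \<Longrightarrow> q \<in> \<Gamma> \<Longrightarrow> \<tau> (p + q) = \<tau> p + \<tau> q;
        \<And>f p. f \<in> C_c X \<Longrightarrow> p \<in> \<Gamma> \<Longrightarrow> \<tau> (cmul A (M f) p) = \<tau> (cmul A p (M f)); p \<in> \<Gamma>\<rbrakk>
      \<Longrightarrow> \<tau> p = (\<tau> (M (E p)) :: complex)"
begin

lemma \<Gamma>_in: "g \<in> \<Gamma> \<Longrightarrow> g \<in> carr A"
  using \<Gamma>_carr by blast

lemma M_carr: "f \<in> C_c X \<Longrightarrow> M f \<in> carr A"
  by (intro \<Gamma>_in M_\<Gamma>)

lemma E_diff: "\<lbrakk>a \<in> carr A; b \<in> carr A\<rbrakk> \<Longrightarrow> E (a - b) x = E a x - E b x"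
  using E_add[of "a - b" b] by (simp add: closed)

text \<open>As \<open>E\<close> is contractive, \<open>E a\<close> is a uniform limit of functions
  \<open>E g\<close> with \<open>g\<close> in \<open>\<Gamma>\<close>, which lie in
  \<open>C_c X\<close>.\<close>

lemma E_continuous: "a \<in> carr A \<Longrightarrow> continuous_map X euclidean (E a)"
proof (rule continuous_map_uniform_approx)
  fix \<epsilon> :: real assume a: "a \<in> carr A" and "0 < \<epsilon>"
  then obtain g where g: "g \<in> \<Gamma>" "cnorm A (a - g) < \<epsilon>" using \<Gamma>_dense by blast
  have "cmod (E a x - E g x) < \<epsilon>" for x
    using E_bound[of "a - g" x] g a by (simp add: E_diff \<Gamma>_in closed)
  then show "\<exists>h. continuous_map X euclidean h \<and> (\<forall>x\<in>topspace X. cmod (E a x - h x) < \<epsilon>)"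
    using C_cD_continuous[OF E_\<Gamma>[OF g(1)]] by blast
qed

lemma E_C_c: "\<lbrakk>f \<in> C_c X; a \<in> carr A\<rbrakk> \<Longrightarrow> (\<lambda>x. f x * E a x) \<in> C_c X"
  using C_c_mult_left[OF E_continuous, of a f] by (simp add: mult.commute)

text \<open>Serves in place of extension by continuity: an identity between bounded expressions that
  holds on \<open>\<Gamma>\<close> is carried to the whole algebra by applying this to their
  difference.\<close>

lemma dense_zero:
  assumes diff: "\<And>a b. a \<in> carr A \<Longrightarrow> b \<in> carr A \<Longrightarrow> \<phi> (a - b) = \<phi> a - (\<phi> b :: complex)"
    and bound: "\<And>a. a \<in> carr A \<Longrightarrow> cmod (\<phi> a) \<le> C * cnorm A a"
    and zero: "\<And>g. g \<in> \<Gamma> \<Longrightarrow> \<phi> g = 0"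
    and a: "a \<in> carr A"
  shows "\<phi> a = 0"
proof -
  have "cmod (\<phi> a) \<le> \<epsilon>" if "0 < \<epsilon>" for \<epsilon>
  proof -
    have "0 < \<epsilon> / (\<bar>C\<bar> + 1)" using that by simp
    then obtain g where g: "g \<in> \<Gamma>" "cnorm A (a - g) < \<epsilon> / (\<bar>C\<bar> + 1)" using \<Gamma>_dense[OF a] by blast
    have "cmod (\<phi> a) = cmod (\<phi> (a - g))" using diff[OF a \<Gamma>_in[OF g(1)]] zero[OF g(1)] by simp
    also have "\<dots> \<le> C * cnorm A (a - g)" by (intro bound closed a \<Gamma>_in g)
    also have "\<dots> \<le> (\<bar>C\<bar> + 1) * (\<epsilon> / (\<bar>C\<bar> + 1))"
      using g cnorm_nonneg[OF carr_diff[OF a \<Gamma>_in[OF g(1)]]] by (intro mult_mono) auto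
    also have "\<dots> = \<epsilon>" by (simp add: add_nonneg_eq_0_iff)
    finally show ?thesis .
  qed
  then have "cmod (\<phi> a) \<le> 0" by (rule field_le_epsilon[of _ 0, simplified])
  then show ?thesis by simp
qed

section \<open>Cutoff functions and the Pedersen ideal\<close>

definition cutoff :: "'x set \<Rightarrow> ('x \<Rightarrow> real) \<Rightarrow> bool"
  where "cutoff K e \<longleftrightarrow> (\<lambda>x. complex_of_real (e x)) \<in> C_c X \<and> (\<forall>x. 0 \<le> e x \<and> e x \<le> 1) \<and> (\<forall>x\<in>K. e x = 1)"

abbreviation "MR e \<equiv> M (\<lambda>x. complex_of_real (e x))"

lemma cutoff_exists:
  assumes "compactin X K"
  shows "\<exists>e. cutoff K e"
  by (rule C_c_bump[OF X assms openin_topspace compactin_subset_topspace[OF assms]])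
    (unfold cutoff_def, blast)

text \<open>Limits along cutoffs are indexed by compact sets ordered by inclusion; this is what
  permits passing to a union of two of them. At the other extreme, \<open>cutoff {} e\<close> says
  only that \<open>e\<close> has compact support and values between 0 and 1.\<close>

lemma cutoff_mono: "cutoff K e \<Longrightarrow> L \<subseteq> K \<Longrightarrow> cutoff L e"
  unfolding cutoff_def by blast

lemma cutoff_C_c: "cutoff K e \<Longrightarrow> (\<lambda>x. complex_of_real (e x)) \<in> C_c X"
  unfolding cutoff_def by blast

lemma cutoff_norm: "cutoff K e \<Longrightarrow> cmod (complex_of_real (e x)) \<le> 1"
  unfolding cutoff_def by simp

lemma cutoff_times:
  assumes "cutoff K e" "\<And>x. x \<notin> K \<Longrightarrow> f x = 0"
  shows "complex_of_real (e x) * f x = f x"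
  using assms unfolding cutoff_def by (cases "x \<in> K") auto

lemma M_cutoff:
  assumes "cutoff K e" "f \<in> C_c X" "\<And>x. x \<notin> K \<Longrightarrow> f x = 0"
  shows "cmul A (MR e) (M f) = M f" "cmul A (M f) (MR e) = M f"
proof -
  have *: "complex_of_real (e x) * f x = f x" for x
    by (rule cutoff_times[OF assms(1,3)])
  have "(\<lambda>x. complex_of_real (e x) * f x) = f" "(\<lambda>x. f x * complex_of_real (e x)) = f"
    by (rule ext, rule *) (rule ext, subst mult.commute, rule *)
  then show "cmul A (MR e) (M f) = M f" "cmul A (M f) (MR e) = M f"
    using M_mult[OF cutoff_C_c[OF assms(1)] assms(2)] M_mult[OF assms(2) cutoff_C_c[OF assms(1)]]
    by simp_all
qed

lemma MR_norm: "cutoff K e \<Longrightarrow> cnorm A (MR e) \<le> 1"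
  by (intro M_norm cutoff_C_c cutoff_norm)

text \<open>A concrete candidate for \<open>Ped A\<close>, which is a definite description and can
  be used only after \<open>Ped_eq\<close>.\<close>

definition pedersen :: "'a set"
  where "pedersen = V.span {cmul A (cmul A x (M f)) y | x f y. x \<in> carr A \<and> y \<in> carr A \<and> f \<in> C_c X}"

lemma pedersen_subspace: "V.subspace pedersen"
  unfolding pedersen_def by (rule V.subspace_span)

lemma pedersen_gen:
  "x \<in> carr A \<Longrightarrow> y \<in> carr A \<Longrightarrow> f \<in> C_c X \<Longrightarrow> cmul A (cmul A x (M f)) y \<in> pedersen"
  unfolding pedersen_def by (intro V.span_base) blast

lemma pedersen_carr: "pedersen \<subseteq> carr A"
  unfolding pedersen_def by (intro V.span_minimal carr_subspace) (auto intro!: closed M_carr)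

lemma pedersen_in: "d \<in> pedersen \<Longrightarrow> d \<in> carr A"
  using pedersen_carr by blast

text \<open>Zero needs no case of its own, since it is the multiple by 0 of a generator.\<close>

lemma pedersen_induct [consumes 1, case_names gen add scale]:
  assumes "d \<in> pedersen"
    and gen: "\<And>x f y. x \<in> carr A \<Longrightarrow> f \<in> C_c X \<Longrightarrow> y \<in> carr A \<Longrightarrow> Q (cmul A (cmul A x (M f)) y)"
    and add: "\<And>c d. c \<in> carr A \<Longrightarrow> d \<in> carr A \<Longrightarrow> Q c \<Longrightarrow> Q d \<Longrightarrow> Q (c + d)"
    and scale: "\<And>z d. d \<in> carr A \<Longrightarrow> Q d \<Longrightarrow> Q (cscale A z d)"
  shows "Q d"
proof -
  let ?w = "cmul A (cmul A 0 (M (\<lambda>_. 0))) 0"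
  have w: "?w \<in> carr A" by (intro closed M_carr C_c_zero)
  have "Q 0" using scale[OF w gen[OF carr_0 C_c_zero carr_0], of 0] by simp
  then have "V.subspace {d. d \<in> carr A \<and> Q d}"
    by (intro V.subspaceI) (auto intro: closed add scale)
  with assms(1) have "d \<in> carr A \<and> Q d"
    unfolding pedersen_def
    by (rule V.span_induct) (auto intro!: closed M_carr gen)
  then show ?thesis by simp
qed

lemma cmul_pedersen:
  assumes "a \<in> carr A" "d \<in> pedersen"
  shows "cmul A a d \<in> pedersen" "cmul A d a \<in> pedersen"
proof -
  from assms(2) have "cmul A a d \<in> pedersen \<and> cmul A d a \<in> pedersen"
  proof (induction rule: pedersen_induct)
    case (gen x f y)
    have "cmul A a (cmul A (cmul A x (M f)) y) = cmul A (cmul A (cmul A a x) (M f)) y"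
         "cmul A (cmul A (cmul A x (M f)) y) a = cmul A (cmul A x (M f)) (cmul A y a)"
      using gen assms by (simp_all add: cmul_assoc M_carr closed)
    then show ?case using gen assms by (simp add: pedersen_gen closed)
  qed (use assms pedersen_subspace in \<open>auto simp: cmul_add_left cmul_add_right cmul_scale_left
      cmul_scale_right intro!: V.subspace_add V.subspace_scale\<close>)
  then show "cmul A a d \<in> pedersen" "cmul A d a \<in> pedersen" by auto
qed

lemma cstar_pedersen: "d \<in> pedersen \<Longrightarrow> cstar A d \<in> pedersen"
proof (induction rule: pedersen_induct)
  case (gen x f y)
  have "cstar A (cmul A (cmul A x (M f)) y) = cmul A (cmul A (cstar A y) (M (\<lambda>x. cnj (f x)))) (cstar A x)"
    using gen by (simp add: cstar_cmul M_carr closed M_cnj cmul_assoc)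
  then show ?case using gen by (simp add: pedersen_gen closed C_c_cnj)
qed (use pedersen_subspace in \<open>auto simp: cstar_add cstar_scale intro!: V.subspace_add V.subspace_scale\<close>)

text \<open>Applying the hypothesis twice writes \<open>a\<close> as \<open>a (M f) (M f)\<close>, a
  generator with left factor \<open>a\<close> and right factor \<open>M f\<close>.\<close>

lemma M_fixed_pedersen:
  assumes "a \<in> carr A" "f \<in> C_c X" "cmul A a (M f) = a"
  shows "a \<in> pedersen"
  using pedersen_gen[OF assms(1) M_carr[OF assms(2)] assms(2)] assms by simp

lemma \<Gamma>_pedersen: "\<Gamma> \<subseteq> pedersen"
  using \<Gamma>_unit M_fixed_pedersen \<Gamma>_in by blast

text \<open>Let \<open>e\<close> be 1 on the support of \<open>f\<close>, let \<open>b\<close> in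
  \<open>J\<close> be close to \<open>M e\<close>, and put \<open>u = M e - b\<close>. Then
  \<open>(M f) b = (M f) (1 - u)\<close>. Multiplying by the inverse \<open>1 + v\<close> of
  \<open>1 - u\<close> recovers \<open>M f\<close>, and after expansion every term contains
  \<open>b\<close> and so stays in \<open>J\<close>.\<close>

lemma pedersen_minimal:
  assumes J: "two_sided_ideal A J" "norm_dense A J"
  shows "pedersen \<subseteq> J"
proof -
  have Jc: "J \<subseteq> carr A" "V.subspace J"
    and Jm: "\<And>a b. a \<in> carr A \<Longrightarrow> b \<in> J \<Longrightarrow> cmul A a b \<in> J" "\<And>a b. a \<in> carr A \<Longrightarrow> b \<in> J \<Longrightarrow> cmul A b a \<in> J"
    using J(1) unfolding two_sided_ideal_def by blast+
  have MJ: "M f \<in> J" if f: "f \<in> C_c X" for f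
  proof -
    obtain K where K: "compactin X K" "\<And>x. x \<notin> K \<Longrightarrow> f x = 0" by (rule C_cE[OF f]) blast
    obtain e where e: "cutoff K e" using cutoff_exists[OF K(1)] by blast
    have ec: "MR e \<in> carr A" by (intro M_carr cutoff_C_c[OF e])
    have "(0::real) < 1/2" by simp
    with J(2) ec obtain b where b: "b \<in> J" "cnorm A (MR e - b) < 1/2"
      unfolding norm_dense_def by meson
    have bc: "b \<in> carr A" using b Jc by blast
    define u where "u = MR e - b"
    have u: "u \<in> carr A" "cnorm A u \<le> 1/2" using b bc ec by (auto simp: u_def closed)
    obtain v where v: "v \<in> carr A" "v = u + cmul A u v" by (rule neumann_inverse[OF u]) blast
    have Mf: "M f \<in> carr A" by (rule M_carr[OF f])
    have "cmul A (M f) b = cmul A (M f) (MR e) - cmul A (M f) u"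
      using bc ec Mf by (simp add: u_def cmul_diff_right closed)
    then have 1: "cmul A (M f) b = M f - cmul A (M f) u"
      using M_cutoff[OF e f K(2)] by simp
    have "cmul A (cmul A (M f) b) v = cmul A (M f) v - cmul A (M f) (cmul A u v)"
      unfolding 1 using Mf u v(1) by (simp add: cmul_diff_left cmul_assoc closed)
    also have "\<dots> = cmul A (M f) (v - cmul A u v)"
      using Mf u v(1) by (simp add: cmul_diff_right closed)
    also have "v - cmul A u v = u" using v(2) by (simp add: algebra_simps)
    finally have "M f = cmul A (M f) b + cmul A (cmul A (M f) b) v" using 1 by simp
    moreover have "cmul A (M f) b \<in> J" using Jm(1)[OF Mf b(1)] .
    ultimately show ?thesis using Jm(2)[OF v(1)] V.subspace_add[OF Jc(2)] by metis
  qed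
  show ?thesis
    unfolding pedersen_def by (intro V.span_minimal Jc) (auto intro: Jm(2)[OF _ Jm(1)[OF _ MJ]])
qed

text \<open>\<open>pedersen\<close> is not only minimal but least among the dense ideals, hence any
  minimal one coincides with it.\<close>

lemma Ped_eq: "Ped A = pedersen"
proof -
  have 1: "two_sided_ideal A pedersen"
    unfolding two_sided_ideal_def using pedersen_carr pedersen_subspace cmul_pedersen by blast
  have 2: "norm_dense A pedersen"
    unfolding norm_dense_def using \<Gamma>_dense \<Gamma>_pedersen by blast
  show ?thesis
    unfolding Ped_def
  proof (rule the_equality)
    show "two_sided_ideal A pedersen \<and> norm_dense A pedersen \<and>
      (\<forall>J. two_sided_ideal A J \<and> norm_dense A J \<and> J \<subseteq> pedersen \<longrightarrow> J = pedersen)"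
      using 1 2 pedersen_minimal by blast
  next
    fix I assume I: "two_sided_ideal A I \<and> norm_dense A I \<and>
      (\<forall>J. two_sided_ideal A J \<and> norm_dense A J \<and> J \<subseteq> I \<longrightarrow> J = I)"
    then have "pedersen \<subseteq> I" using pedersen_minimal by blast
    then show "I = pedersen" using I 1 2 by blast
  qed
qed

text \<open>An element \<open>g\<close> of \<open>\<Gamma>\<close> is fixed on the right by some
  \<open>M f\<close>, hence by \<open>M e\<close> for every cutoff \<open>e\<close> of the support
  of \<open>f\<close>. The error of approximating \<open>y\<close> by \<open>g\<close> does not
  grow, as \<open>M e\<close> has norm at most 1.\<close>

lemma approximate_unit:
  assumes y: "y \<in> carr A" and "0 < \<epsilon>"
  obtains K where "compactin X K" "\<And>e. cutoff K e \<Longrightarrow> cnorm A (cmul A y (MR e) - y) < \<epsilon>"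
proof -
  obtain g where g: "g \<in> \<Gamma>" "cnorm A (y - g) < \<epsilon> / 2" using \<Gamma>_dense[OF y, of "\<epsilon> / 2"] \<open>0 < \<epsilon>\<close> by auto
  obtain f where f: "f \<in> C_c X" "cmul A g (M f) = g" using \<Gamma>_unit[OF g(1)] by blast
  obtain K where K: "compactin X K" "\<And>x. x \<notin> K \<Longrightarrow> f x = 0" by (rule C_cE[OF f(1)]) blast
  have gc: "g \<in> carr A" using g \<Gamma>_in by blast
  have "cnorm A (cmul A y (MR e) - y) < \<epsilon>" if e: "cutoff K e" for e
  proof -
    have ec: "MR e \<in> carr A" by (intro M_carr cutoff_C_c[OF e])
    have "cmul A g (MR e) = cmul A (cmul A g (M f)) (MR e)" using f by simp
    also have "\<dots> = cmul A g (cmul A (M f) (MR e))" by (rule cmul_assoc[OF gc M_carr[OF f(1)] ec])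
    also have "\<dots> = g" using M_cutoff(2)[OF e f(1) K(2)] f(2) by simp
    finally have ge: "cmul A g (MR e) = g" .
    have "cnorm A (cmul A y (MR e) - y) \<le> cnorm A (cmul A y (MR e) - cmul A g (MR e)) + cnorm A (g - y)"
      using cnorm_triangle_diff[of "cmul A y (MR e)" g y] y gc ec ge by (simp add: closed)
    also have "cmul A y (MR e) - cmul A g (MR e) = cmul A (y - g) (MR e)"
      using y gc ec by (simp add: cmul_diff_left)
    also have "cnorm A (cmul A (y - g) (MR e)) \<le> cnorm A (y - g) * cnorm A (MR e)"
      by (intro cnorm_cmul closed y gc ec)
    also have "\<dots> \<le> cnorm A (y - g)"
      using mult_left_mono[OF MR_norm[OF e] cnorm_nonneg[OF carr_diff[OF y gc]]] by simp
    finally show ?thesis using g(2) cnorm_minus_commute[OF y gc] by simp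
  qed
  with K(1) show ?thesis using that by blast
qed

end


section \<open>The trace of an invariant functional as a limit along cutoff functions\<close>

context trace_data
begin

text \<open>The weight \<open>f\<close> gives the integrand compact support. This makes the
  expression meaningful for every \<open>a\<close> in the algebra, and bounded in the norm of
  \<open>a\<close> as long as \<open>f\<close> is fixed.\<close>

definition pair :: "(('x \<Rightarrow> complex) \<Rightarrow> complex) \<Rightarrow> ('x \<Rightarrow> complex) \<Rightarrow> 'a \<Rightarrow> complex"
  where "pair \<mu> f a = \<mu> (\<lambda>x. f x * E a x)"

lemma N_Rad: "\<mu> \<in> N \<Longrightarrow> \<mu> \<in> Rad X"
  using N_iff by blast

lemma pair_add: "\<lbrakk>\<mu> \<in> Rad X; f \<in> C_c X; a \<in> carr A; b \<in> carr A\<rbrakk>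
    \<Longrightarrow> pair \<mu> f (a + b) = pair \<mu> f a + pair \<mu> f b"
  unfolding pair_def using Rad_add[OF _ E_C_c E_C_c, of \<mu> f a f b]
  by (simp add: E_add distrib_left)

lemma pair_scale: "\<lbrakk>\<mu> \<in> Rad X; f \<in> C_c X; a \<in> carr A\<rbrakk> \<Longrightarrow> pair \<mu> f (cscale A z a) = z * pair \<mu> f a"
  unfolding pair_def using Rad_scale[OF _ E_C_c, of \<mu> f a z]
  by (simp add: E_scale mult.left_commute)

lemma pair_diff: "\<lbrakk>\<mu> \<in> Rad X; f \<in> C_c X; a \<in> carr A; b \<in> carr A\<rbrakk>
    \<Longrightarrow> pair \<mu> f (a - b) = pair \<mu> f a - pair \<mu> f b"
  using pair_add[of \<mu> f "a - b" b] by (simp add: closed)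

lemma pair_bound:
  assumes "\<mu> \<in> Rad X" "f \<in> C_c X"
  obtains C where "0 \<le> C" "\<And>a. a \<in> carr A \<Longrightarrow> cmod (pair \<mu> f a) \<le> C * cnorm A a"
proof -
  obtain K where K: "compactin X K" "\<And>x. x \<notin> K \<Longrightarrow> f x = 0" by (rule C_cE[OF assms(2)]) blast
  obtain B where B: "0 \<le> B" "\<And>x. cmod (f x) \<le> B" by (rule C_c_bounded[OF assms(2)]) blast
  obtain C where C: "0 \<le> C" "\<And>f B. f \<in> C_c X \<Longrightarrow> (\<And>x. x \<notin> K \<Longrightarrow> f x = 0) \<Longrightarrow> (\<And>x. cmod (f x) \<le> B)
      \<Longrightarrow> cmod (\<mu> f) \<le> C * B"
    by (rule Rad_bound[OF assms(1) K(1)]) blast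
  show ?thesis
  proof (rule that[of "C * B"])
    fix a assume a: "a \<in> carr A"
    have "cmod (f x * E a x) \<le> B * cnorm A a" for x
      unfolding norm_mult using B(2)[of x] E_bound[OF a, of x] B(1) by (intro mult_mono) auto
    then have "cmod (pair \<mu> f a) \<le> C * (B * cnorm A a)"
      unfolding pair_def by (intro C(2) E_C_c assms a) (simp_all add: K(2))
    then show "cmod (pair \<mu> f a) \<le> C * B * cnorm A a" by (simp add: mult.assoc)
  qed (use B C in simp)
qed

text \<open>The trace property extends from \<open>\<Gamma>\<close> to the completion, in each variable separately.\<close>

lemma pair_swap:
  assumes \<mu>: "\<mu> \<in> N" and e: "e \<in> C_c X" and f: "f \<in> C_c X" and a: "a \<in> carr A" and b: "b \<in> carr A"
  shows "pair \<mu> e (cmul A (cmul A a (M f)) b) = pair \<mu> f (cmul A (cmul A b (M e)) a)"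
proof -
  note R = N_Rad[OF \<mu>] and ec = M_carr[OF e] and fc = M_carr[OF f]
  let ?\<phi> = "\<lambda>a b. pair \<mu> e (cmul A (cmul A a (M f)) b) - pair \<mu> f (cmul A (cmul A b (M e)) a)"
  obtain C where C: "0 \<le> C" "\<And>a. a \<in> carr A \<Longrightarrow> cmod (pair \<mu> e a) \<le> C * cnorm A a"
    by (rule pair_bound[OF R e]) blast
  obtain C' where C': "0 \<le> C'" "\<And>a. a \<in> carr A \<Longrightarrow> cmod (pair \<mu> f a) \<le> C' * cnorm A a"
    by (rule pair_bound[OF R f]) blast
  have tri: "cnorm A (cmul A (cmul A x y) z) \<le> cnorm A x * cnorm A y * cnorm A z"
    if "x \<in> carr A" "y \<in> carr A" "z \<in> carr A" for x y z
  proof -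
    have "cnorm A (cmul A (cmul A x y) z) \<le> cnorm A (cmul A x y) * cnorm A z"
      by (intro cnorm_cmul closed that)
    also have "\<dots> \<le> cnorm A x * cnorm A y * cnorm A z"
      by (intro mult_right_mono cnorm_cmul cnorm_nonneg that)
    finally show ?thesis .
  qed
  have bnd: "cmod (?\<phi> a b) \<le> (C * cnorm A (M f) + C' * cnorm A (M e)) * cnorm A a * cnorm A b"
    if ab: "a \<in> carr A" "b \<in> carr A" for a b
  proof -
    have "cmod (?\<phi> a b) \<le> C * cnorm A (cmul A (cmul A a (M f)) b) + C' * cnorm A (cmul A (cmul A b (M e)) a)"
      by (rule order_trans[OF norm_triangle_ineq4]) (intro add_mono C C' closed ab ec fc)
    also have "\<dots> \<le> C * (cnorm A a * cnorm A (M f) * cnorm A b) + C' * (cnorm A b * cnorm A (M e) * cnorm A a)"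
      by (intro add_mono mult_left_mono tri C(1) C'(1) ab ec fc)
    finally show ?thesis by (simp add: algebra_simps)
  qed
  have d1: "?\<phi> (a - a') b = ?\<phi> a b - ?\<phi> a' b" if "a \<in> carr A" "a' \<in> carr A" "b \<in> carr A" for a a' b
    using that ec fc by (simp add: cmul_diff_left cmul_diff_right closed pair_diff R e f)
  have d2: "?\<phi> a (b - b') = ?\<phi> a b - ?\<phi> a b'" if "a \<in> carr A" "b \<in> carr A" "b' \<in> carr A" for a b b'
    using that ec fc by (simp add: cmul_diff_left cmul_diff_right closed pair_diff R e f)
  have \<Gamma>\<Gamma>: "?\<phi> g h = 0" if g: "g \<in> \<Gamma>" and h: "h \<in> \<Gamma>" for g h
  proof -
    note gc = \<Gamma>_in[OF g] and hc = \<Gamma>_in[OF h]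
    have "pair \<mu> e (cmul A (cmul A g (M f)) h) = \<mu> (E (cmul A (M e) (cmul A (cmul A g (M f)) h)))"
      unfolding pair_def by (rule arg_cong[of _ _ \<mu>], rule ext) (simp add: E_M_left e closed gc hc fc)
    \<comment> \<open>Bracketing the product as \<open>(e g) (f h)\<close> gives two factors in
      \<open>\<Gamma>\<close>, which a functional in \<open>N\<close> allows to be
      exchanged.\<close>
    also have "cmul A (M e) (cmul A (cmul A g (M f)) h) = cmul A (cmul A (M e) g) (cmul A (M f) h)"
      using gc hc ec fc by (simp add: cmul_assoc closed)
    also have "\<mu> (E \<dots>) = \<mu> (E (cmul A (cmul A (M f) h) (cmul A (M e) g)))"
      using \<mu> unfolding N_iff by (meson \<Gamma>_mult M_\<Gamma> e f g h)
    also have "cmul A (cmul A (M f) h) (cmul A (M e) g) = cmul A (M f) (cmul A (cmul A h (M e)) g)"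
      using gc hc ec fc by (simp add: cmul_assoc closed)
    also have "\<mu> (E \<dots>) = pair \<mu> f (cmul A (cmul A h (M e)) g)"
      unfolding pair_def by (rule arg_cong[of _ _ \<mu>], rule ext) (simp add: E_M_left f closed gc hc ec)
    finally show ?thesis by simp
  qed
  have 1: "?\<phi> a h = 0" if h: "h \<in> \<Gamma>" and a: "a \<in> carr A" for a h
  proof (rule dense_zero[of "\<lambda>a. ?\<phi> a h", OF _ _ _ a])
    show "cmod (?\<phi> a h) \<le> ((C * cnorm A (M f) + C' * cnorm A (M e)) * cnorm A h) * cnorm A a" if "a \<in> carr A" for a
      using bnd[OF that \<Gamma>_in[OF h]] by (simp add: algebra_simps)
  qed (use d1 \<Gamma>_in h \<Gamma>\<Gamma> in auto)
  have "?\<phi> a b = 0"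
  proof (rule dense_zero[of "\<lambda>b. ?\<phi> a b", OF _ _ _ b])
    show "cmod (?\<phi> a b) \<le> ((C * cnorm A (M f) + C' * cnorm A (M e)) * cnorm A a) * cnorm A b" if "b \<in> carr A" for b
      using bnd[OF a that] by (simp add: algebra_simps)
  qed (use d2 a 1 in auto)
  then show ?thesis by simp
qed

text \<open>\<open>plim \<mu> d t\<close> says that \<open>\<mu>(e E(d))\<close> tends to \<open>t\<close> along the cutoff functions \<open>e\<close>.\<close>

definition plim :: "(('x \<Rightarrow> complex) \<Rightarrow> complex) \<Rightarrow> 'a \<Rightarrow> complex \<Rightarrow> bool"
  where "plim \<mu> d t \<longleftrightarrow> (\<forall>\<epsilon>>0. \<exists>K. compactin X K \<and>
    (\<forall>e. cutoff K e \<longrightarrow> cmod (pair \<mu> (\<lambda>x. complex_of_real (e x)) d - t) < \<epsilon>))"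

lemma plimE:
  assumes "plim \<mu> d t" "0 < \<epsilon>"
  obtains K where "compactin X K"
    "\<And>e. cutoff K e \<Longrightarrow> cmod (pair \<mu> (\<lambda>x. complex_of_real (e x)) d - t) < \<epsilon>"
  using assms unfolding plim_def by blast

text \<open>Both limits can be tested on one cutoff of the union of the two compact sets.\<close>

lemma plim_unique:
  assumes "plim \<mu> d t" "plim \<mu> d t'"
  shows "t = t'"
proof (rule ccontr)
  assume "t \<noteq> t'"
  then have p: "0 < cmod (t - t') / 2" by simp
  obtain K where K: "compactin X K"
    "\<And>e. cutoff K e \<Longrightarrow> cmod (pair \<mu> (\<lambda>x. complex_of_real (e x)) d - t) < cmod (t - t') / 2"
    by (rule plimE[OF assms(1) p]) blast
  obtain K' where K': "compactin X K'"
    "\<And>e. cutoff K' e \<Longrightarrow> cmod (pair \<mu> (\<lambda>x. complex_of_real (e x)) d - t') < cmod (t - t') / 2"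
    by (rule plimE[OF assms(2) p]) blast
  have "compactin X (K \<union> K')" using K K' by (simp add: compactin_Un)
  then obtain e where "cutoff (K \<union> K') e" using cutoff_exists by blast
  then have "cutoff K e" "cutoff K' e" using cutoff_mono by auto
  from K(2)[OF this(1)] K'(2)[OF this(2)]
  show False
    using norm_triangle_ineq4[of "pair \<mu> (\<lambda>x. complex_of_real (e x)) d - t'" "pair \<mu> (\<lambda>x. complex_of_real (e x)) d - t"]
    by simp
qed

lemma plim_add:
  assumes "\<mu> \<in> Rad X" "d \<in> carr A" "d' \<in> carr A" "plim \<mu> d t" "plim \<mu> d' t'"
  shows "plim \<mu> (d + d') (t + t')"
  unfolding plim_def
proof (intro allI impI)
  fix \<epsilon> :: real assume "0 < \<epsilon>"
  then have p: "0 < \<epsilon> / 2" by simp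
  obtain K where K: "compactin X K"
    "\<And>e. cutoff K e \<Longrightarrow> cmod (pair \<mu> (\<lambda>x. complex_of_real (e x)) d - t) < \<epsilon> / 2"
    by (rule plimE[OF assms(4) p]) blast
  obtain K' where K': "compactin X K'"
    "\<And>e. cutoff K' e \<Longrightarrow> cmod (pair \<mu> (\<lambda>x. complex_of_real (e x)) d' - t') < \<epsilon> / 2"
    by (rule plimE[OF assms(5) p]) blast
  have "cmod (pair \<mu> (\<lambda>x. complex_of_real (e x)) (d + d') - (t + t')) < \<epsilon>" if e: "cutoff (K \<union> K') e" for e
  proof -
    have "cutoff K e" "cutoff K' e" using e cutoff_mono by auto
    from K(2)[OF this(1)] K'(2)[OF this(2)] show ?thesis
      using norm_triangle_ineq[of "pair \<mu> (\<lambda>x. complex_of_real (e x)) d - t" "pair \<mu> (\<lambda>x. complex_of_real (e x)) d' - t'"]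
      by (simp add: pair_add assms cutoff_C_c[OF e] algebra_simps)
  qed
  then show "\<exists>K. compactin X K \<and>
      (\<forall>e. cutoff K e \<longrightarrow> cmod (pair \<mu> (\<lambda>x. complex_of_real (e x)) (d + d') - (t + t')) < \<epsilon>)"
    using K(1) K'(1) by (intro exI[of _ "K \<union> K'"]) (simp add: compactin_Un)
qed

lemma plim_scale:
  assumes "\<mu> \<in> Rad X" "d \<in> carr A" "plim \<mu> d t"
  shows "plim \<mu> (cscale A z d) (z * t)"
  unfolding plim_def
proof (intro allI impI)
  fix \<epsilon> :: real assume "0 < \<epsilon>"
  then have p: "0 < \<epsilon> / (cmod z + 1)" by (simp add: add_nonneg_pos)
  obtain K where K: "compactin X K"
    "\<And>e. cutoff K e \<Longrightarrow> cmod (pair \<mu> (\<lambda>x. complex_of_real (e x)) d - t) < \<epsilon> / (cmod z + 1)"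
    by (rule plimE[OF assms(3) p]) blast
  have "cmod (pair \<mu> (\<lambda>x. complex_of_real (e x)) (cscale A z d) - z * t) < \<epsilon>" if e: "cutoff K e" for e
  proof -
    let ?p = "pair \<mu> (\<lambda>x. complex_of_real (e x)) d - t"
    have "cmod (pair \<mu> (\<lambda>x. complex_of_real (e x)) (cscale A z d) - z * t) = cmod z * cmod ?p"
      by (simp add: pair_scale assms cutoff_C_c[OF e] norm_mult[symmetric] algebra_simps)
    also have "\<dots> \<le> (cmod z + 1) * cmod ?p" by (intro mult_right_mono) auto
    also have "\<dots> < (cmod z + 1) * (\<epsilon> / (cmod z + 1))"
      using K(2)[OF e] by (intro mult_strict_left_mono) (auto simp: add_nonneg_pos)
    also have "\<dots> = \<epsilon>" using norm_ge_zero[of z] by (simp add: add_nonneg_eq_0_iff)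
    finally show ?thesis .
  qed
  then show "\<exists>K. compactin X K \<and>
      (\<forall>e. cutoff K e \<longrightarrow> cmod (pair \<mu> (\<lambda>x. complex_of_real (e x)) (cscale A z d) - z * t) < \<epsilon>)"
    using K(1) by blast
qed

lemma plim_star:
  assumes "\<mu> \<in> Rad X" "d \<in> carr A" "plim \<mu> d t"
  shows "plim \<mu> (cstar A d) (cnj t)"
proof -
  have "cmod (pair \<mu> (\<lambda>x. complex_of_real (e x)) (cstar A d) - cnj t)
      = cmod (pair \<mu> (\<lambda>x. complex_of_real (e x)) d - t)" if e: "cutoff K e" for e K
  proof -
    have "pair \<mu> (\<lambda>x. complex_of_real (e x)) (cstar A d) = cnj (pair \<mu> (\<lambda>x. complex_of_real (e x)) d)"
      using Rad_cnj[OF assms(1) E_C_c[OF cutoff_C_c[OF e] assms(2)]]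
      by (simp add: pair_def E_star assms)
    then show ?thesis by (metis complex_cnj_diff complex_mod_cnj)
  qed
  then show ?thesis using assms(3) unfolding plim_def by simp
qed

text \<open>Along the cutoffs the values are eventually constant, because \<open>E g\<close> has
  compact support.\<close>

lemma plim_\<Gamma>:
  assumes "g \<in> \<Gamma>"
  shows "plim \<mu> g (\<mu> (E g))"
proof -
  obtain K where K: "compactin X K" "\<And>x. x \<notin> K \<Longrightarrow> E g x = 0" by (rule C_cE[OF E_\<Gamma>[OF assms]]) blast
  have "pair \<mu> (\<lambda>x. complex_of_real (e x)) g = \<mu> (E g)" if e: "cutoff K e" for e
    unfolding pair_def by (rule arg_cong[of _ _ \<mu>], rule ext, rule cutoff_times[OF e K(2)])
  then show ?thesis unfolding plim_def using K(1) by force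
qed

text \<open>\<open>pair_swap\<close> turns the cutoff into a factor between \<open>y\<close> and
  \<open>x\<close>. There it is an approximate unit for \<open>y\<close> in norm, and the outer
  functional \<open>pair \<mu> f\<close> no longer depends on the cutoff.\<close>

lemma plim_gen:
  assumes \<mu>: "\<mu> \<in> N" and x: "x \<in> carr A" and y: "y \<in> carr A" and f: "f \<in> C_c X"
  shows "plim \<mu> (cmul A (cmul A x (M f)) y) (pair \<mu> f (cmul A y x))"
  unfolding plim_def
proof (intro allI impI)
  fix \<epsilon> :: real assume "0 < \<epsilon>"
  note R = N_Rad[OF \<mu>]
  obtain C where C: "0 \<le> C" "\<And>a. a \<in> carr A \<Longrightarrow> cmod (pair \<mu> f a) \<le> C * cnorm A a"
    by (rule pair_bound[OF R f]) blast
  have nx: "0 \<le> cnorm A x" using cnorm_nonneg[OF x] .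
  \<comment> \<open>The summand 1 keeps \<open>q\<close> positive even if \<open>C\<close> or the
    norm of \<open>x\<close> is 0.\<close>
  define q where "q = C * cnorm A x + 1"
  have q: "0 < q" using C nx by (simp add: q_def add_nonneg_pos)
  obtain K where K: "compactin X K" "\<And>e. cutoff K e \<Longrightarrow> cnorm A (cmul A y (MR e) - y) < \<epsilon> / q"
    by (rule approximate_unit[OF y, of "\<epsilon> / q"]) (use \<open>0 < \<epsilon>\<close> q in auto)
  have "cmod (pair \<mu> (\<lambda>x. complex_of_real (e x)) (cmul A (cmul A x (M f)) y) - pair \<mu> f (cmul A y x)) < \<epsilon>"
    if e: "cutoff K e" for e
  proof -
    note ec = M_carr[OF cutoff_C_c[OF e]]
    have "pair \<mu> (\<lambda>x. complex_of_real (e x)) (cmul A (cmul A x (M f)) y) - pair \<mu> f (cmul A y x)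
        = pair \<mu> f (cmul A (cmul A y (MR e) - y) x)"
      using pair_swap[OF \<mu> cutoff_C_c[OF e] f x y] x y ec
      by (simp add: cmul_diff_left pair_diff closed R f)
    also have "cmod \<dots> \<le> C * (cnorm A (cmul A y (MR e) - y) * cnorm A x)"
      by (rule order_trans[OF C(2) mult_left_mono]) (intro closed cnorm_cmul C x y ec)+
    also have "\<dots> = (C * cnorm A x) * cnorm A (cmul A y (MR e) - y)" by simp
    also have "\<dots> \<le> q * cnorm A (cmul A y (MR e) - y)"
      by (intro mult_right_mono cnorm_nonneg closed x y ec) (simp add: q_def)
    also have "\<dots> < q * (\<epsilon> / q)" using K(2)[OF e] q by (intro mult_strict_left_mono)
    also have "\<dots> = \<epsilon>" using q by simp
    finally show ?thesis .
  qed
  then show "\<exists>K. compactin X K \<and> (\<forall>e. cutoff K e \<longrightarrow>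
      cmod (pair \<mu> (\<lambda>x. complex_of_real (e x)) (cmul A (cmul A x (M f)) y) - pair \<mu> f (cmul A y x)) < \<epsilon>)"
    using K(1) by blast
qed

text \<open>One \<open>w\<close> serves all \<open>\<mu>\<close> in \<open>N\<close> at once, so
  evaluating the traces at \<open>d\<close> is evaluating the measures at \<open>w\<close>. The
  weak* continuity of the correspondence rests on this uniformity.\<close>

lemma plim_representing:
  assumes "d \<in> pedersen"
  shows "\<exists>w\<in>C_c X. \<forall>\<mu>\<in>N. plim \<mu> d (\<mu> w)"
  using assms
proof (induction rule: pedersen_induct)
  case (gen x f y)
  then show ?case
    using plim_gen E_C_c[OF gen(2) cmul_closed[OF gen(3,1)]] unfolding pair_def by blast
next
  case (add c d)
  then obtain v w where vw: "v \<in> C_c X" "w \<in> C_c X"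
    "\<And>\<mu>. \<mu> \<in> N \<Longrightarrow> plim \<mu> c (\<mu> v)" "\<And>\<mu>. \<mu> \<in> N \<Longrightarrow> plim \<mu> d (\<mu> w)" by blast
  have "plim \<mu> (c + d) (\<mu> (\<lambda>x. v x + w x))" if \<mu>: "\<mu> \<in> N" for \<mu>
    unfolding Rad_add[OF N_Rad[OF \<mu>] vw(1,2)]
    by (intro plim_add N_Rad \<mu> add vw)
  then show ?case using C_c_add[OF vw(1,2)] by blast
next
  case (scale z d)
  then obtain v where v: "v \<in> C_c X" "\<And>\<mu>. \<mu> \<in> N \<Longrightarrow> plim \<mu> d (\<mu> v)" by blast
  have "plim \<mu> (cscale A z d) (\<mu> (\<lambda>x. z * v x))" if \<mu>: "\<mu> \<in> N" for \<mu>
    unfolding Rad_scale[OF N_Rad[OF \<mu>] v(1)]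
    by (intro plim_scale N_Rad \<mu> scale v)
  then show ?case using C_c_scale[OF v(1)] by blast
qed

definition tr :: "(('x \<Rightarrow> complex) \<Rightarrow> complex) \<Rightarrow> 'a \<Rightarrow> complex"
  where "tr \<mu> = (\<lambda>d\<in>pedersen. THE t. plim \<mu> d t)"

lemma tr_eq: "d \<in> pedersen \<Longrightarrow> plim \<mu> d t \<Longrightarrow> tr \<mu> d = t"
  unfolding tr_def using plim_unique by auto

lemma plim_tr:
  assumes "\<mu> \<in> N" "d \<in> pedersen"
  shows "plim \<mu> d (tr \<mu> d)"
proof -
  obtain w where "plim \<mu> d (\<mu> w)" using plim_representing[OF assms(2)] assms(1) by blast
  then show ?thesis using tr_eq[OF assms(2)] by simp
qed

text \<open>The pointwise hypothesis of the uniform boundedness principle. On a generator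
  \<open>x (M f) y\<close> the cutoff is moved between \<open>y\<close> and \<open>x\<close>, where
  its norm is at most 1 whatever its support.\<close>

lemma pair_cutoff_bounded:
  assumes \<mu>: "\<mu> \<in> N" and d: "d \<in> pedersen"
  shows "\<exists>C. \<forall>e. cutoff {} e \<longrightarrow> cmod (pair \<mu> (\<lambda>x. complex_of_real (e x)) d) \<le> C"
  using d
proof (induction rule: pedersen_induct)
  case (gen x f y)
  obtain C where C: "0 \<le> C" "\<And>a. a \<in> carr A \<Longrightarrow> cmod (pair \<mu> f a) \<le> C * cnorm A a"
    by (rule pair_bound[OF N_Rad[OF \<mu>] gen(2)]) blast
  have "cmod (pair \<mu> (\<lambda>x. complex_of_real (e x)) (cmul A (cmul A x (M f)) y)) \<le> C * (cnorm A y * cnorm A x)"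
    if e: "cutoff {} e" for e
  proof -
    note ec = M_carr[OF cutoff_C_c[OF e]] and x = gen(1) and y = gen(3)
    have "cnorm A (cmul A (cmul A y (MR e)) x) \<le> cnorm A (cmul A y (MR e)) * cnorm A x"
      by (intro cnorm_cmul closed x y ec)
    also have "\<dots> \<le> (cnorm A y * cnorm A (MR e)) * cnorm A x"
      by (intro mult_right_mono cnorm_cmul cnorm_nonneg x y ec)
    also have "\<dots> \<le> (cnorm A y * 1) * cnorm A x"
      by (intro mult_right_mono mult_left_mono MR_norm[OF e] cnorm_nonneg x y)
    finally have "cnorm A (cmul A (cmul A y (MR e)) x) \<le> cnorm A y * cnorm A x" by simp
    moreover have "cmod (pair \<mu> f (cmul A (cmul A y (MR e)) x)) \<le> C * cnorm A (cmul A (cmul A y (MR e)) x)"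
      by (intro C closed x y ec)
    ultimately show ?thesis
      using pair_swap[OF \<mu> cutoff_C_c[OF e] gen(2) x y] mult_left_mono[OF _ C(1)] by fastforce
  qed
  then show ?case by blast
next
  case (add c d)
  then obtain C C' where "\<And>e. cutoff {} e \<Longrightarrow> cmod (pair \<mu> (\<lambda>x. complex_of_real (e x)) c) \<le> C"
     "\<And>e. cutoff {} e \<Longrightarrow> cmod (pair \<mu> (\<lambda>x. complex_of_real (e x)) d) \<le> C'" by blast
  then have "cmod (pair \<mu> (\<lambda>x. complex_of_real (e x)) (c + d)) \<le> C + C'" if "cutoff {} e" for e
    unfolding pair_add[OF N_Rad[OF \<mu>] cutoff_C_c[OF that] add(1,2)]
    using that by (intro norm_triangle_mono)
  then show ?case by blast
next
  case (scale z d)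
  then obtain C where "\<And>e. cutoff {} e \<Longrightarrow> cmod (pair \<mu> (\<lambda>x. complex_of_real (e x)) d) \<le> C" by blast
  then have "cmod (pair \<mu> (\<lambda>x. complex_of_real (e x)) (cscale A z d)) \<le> cmod z * C" if "cutoff {} e" for e
    unfolding pair_scale[OF N_Rad[OF \<mu>] cutoff_C_c[OF that] scale(1)] norm_mult
    using that by (intro mult_left_mono) auto
  then show ?case by blast
qed

text \<open>A C*-subalgebra is norm closed, which is what the nested balls need. The constant is
  common to all cutoffs and therefore survives the limit.\<close>

lemma tr_bounded:
  assumes \<mu>: "\<mu> \<in> N" and D: "cstar_subalgebra A D" "D \<subseteq> pedersen"
  shows "\<exists>C. \<forall>d\<in>D. cmod (tr \<mu> d) \<le> C * cnorm A d"
proof -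
  note R = N_Rad[OF \<mu>]
  have Dc: "D \<subseteq> carr A" "V.subspace D"
    and Dl: "\<And>a. a \<in> carr A \<Longrightarrow> (\<And>\<epsilon>. 0 < \<epsilon> \<Longrightarrow> \<exists>d\<in>D. cnorm A (a - d) < \<epsilon>) \<Longrightarrow> a \<in> D"
    using D(1) unfolding cstar_subalgebra_def by auto
  let ?\<Phi> = "{pair \<mu> (\<lambda>x. complex_of_real (e x)) | e. cutoff {} e}"
  have "\<exists>C. \<forall>\<phi>\<in>?\<Phi>. \<forall>x\<in>D. cmod (\<phi> x) \<le> C * cnorm A x"
  proof (rule uniform_boundedness[OF Dc Dl])
    fix x assume "x \<in> D"
    then show "\<exists>C. \<forall>\<phi>\<in>?\<Phi>. cmod (\<phi> x) \<le> C" using pair_cutoff_bounded[OF \<mu>] D(2) by blast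
  next
    fix \<phi> assume "\<phi> \<in> ?\<Phi>"
    then obtain e where e: "\<phi> = pair \<mu> (\<lambda>x. complex_of_real (e x))" "cutoff {} e" by blast
    note ec = cutoff_C_c[OF e(2)]
    show "\<exists>C. \<forall>x\<in>D. cmod (\<phi> x) \<le> C * cnorm A x"
      unfolding e(1) by (rule pair_bound[OF R ec]) (use Dc(1) in blast)
    show "\<phi> (x + y) = \<phi> x + \<phi> y" if "x \<in> D" "y \<in> D" for x y
      unfolding e(1) using that Dc(1) by (intro pair_add R ec) auto
    show "\<phi> (cscale A z x) = z * \<phi> x" if "x \<in> D" for x z
      unfolding e(1) using that Dc(1) by (intro pair_scale R ec) auto
  qed
  then obtain C where C: "\<And>e x. cutoff {} e \<Longrightarrow> x \<in> D \<Longrightarrow>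
      cmod (pair \<mu> (\<lambda>x. complex_of_real (e x)) x) \<le> C * cnorm A x" by blast
  have "cmod (tr \<mu> d) \<le> C * cnorm A d" if d: "d \<in> D" for d
  proof (rule field_le_epsilon)
    fix \<epsilon> :: real assume \<epsilon>: "0 < \<epsilon>"
    have dp: "d \<in> pedersen" using d D by blast
    obtain K where K: "compactin X K"
      "\<And>e. cutoff K e \<Longrightarrow> cmod (pair \<mu> (\<lambda>x. complex_of_real (e x)) d - tr \<mu> d) < \<epsilon>"
      by (rule plimE[OF plim_tr[OF \<mu> dp] \<epsilon>]) blast
    obtain e where e: "cutoff K e" using cutoff_exists[OF K(1)] by blast
    have "cutoff {} e" using cutoff_mono[OF e] by simp
    from C[OF this d] K(2)[OF e] show "cmod (tr \<mu> d) \<le> C * cnorm A d + \<epsilon>"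
      using norm_triangle_ineq2[of "tr \<mu> d" "pair \<mu> (\<lambda>x. complex_of_real (e x)) d"]
      by (simp add: norm_minus_commute)
  qed
  then show ?thesis by blast
qed

text \<open>For \<open>x = a (M f) b\<close> both products are again of the generating form,
  \<open>a (M f) (b y)\<close> and \<open>(y a) (M f) b\<close>, and both limits equal
  \<open>pair \<mu> f (b y a)\<close>. Claiming a common limit keeps the statement additive in
  \<open>x\<close>.\<close>

lemma tr_commute:
  assumes \<mu>: "\<mu> \<in> N" and "x \<in> pedersen" and y: "y \<in> carr A"
  shows "\<exists>t. plim \<mu> (cmul A x y) t \<and> plim \<mu> (cmul A y x) t"
  using assms(2)
proof (induction rule: pedersen_induct)
  case (gen a f b)
  have eq: "cmul A (cmul A (cmul A a (M f)) b) y = cmul A (cmul A a (M f)) (cmul A b y)"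
       "cmul A y (cmul A (cmul A a (M f)) b) = cmul A (cmul A (cmul A y a) (M f)) b"
       "cmul A b (cmul A y a) = cmul A (cmul A b y) a"
    using gen y by (simp_all add: cmul_assoc M_carr closed)
  then show ?case
    using plim_gen[OF \<mu> gen(1) cmul_closed[OF gen(3) y] gen(2)]
      plim_gen[OF \<mu> cmul_closed[OF y gen(1)] gen(3) gen(2)] by auto
next
  case (add c d)
  then show ?case using y plim_add[OF N_Rad[OF \<mu>]]
    by (simp add: cmul_add_left cmul_add_right) (meson cmul_closed)
next
  case (scale z d)
  then show ?case using y plim_scale[OF N_Rad[OF \<mu>]]
    by (simp add: cmul_scale_left cmul_scale_right) (meson cmul_closed)
qed

lemma tr_traces:
  assumes \<mu>: "\<mu> \<in> N"
  shows "tr \<mu> \<in> traces A"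
  unfolding traces_def linear_functionals_def Ped_eq
proof (intro CollectI conjI ballI allI impI)
  note R = N_Rad[OF \<mu>] and P = plim_tr[OF \<mu>] and c = pedersen_in
  show "tr \<mu> \<in> extensional pedersen" unfolding tr_def by simp
  show "tr \<mu> (x + y) = tr \<mu> x + tr \<mu> y" if "x \<in> pedersen" "y \<in> pedersen" for x y
    by (intro tr_eq plim_add R c P that V.subspace_add[OF pedersen_subspace])
  show "tr \<mu> (cscale A z x) = z * tr \<mu> x" if "x \<in> pedersen" for x z
    by (intro tr_eq plim_scale R c P that V.subspace_scale[OF pedersen_subspace])
  show "tr \<mu> (cstar A x) = cnj (tr \<mu> x)" if "x \<in> pedersen" for x
    by (intro tr_eq plim_star R c P that cstar_pedersen)
  show "tr \<mu> (cmul A x y) = tr \<mu> (cmul A y x)" if x: "x \<in> pedersen" and y: "y \<in> pedersen" for x y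
  proof -
    obtain t where "plim \<mu> (cmul A x y) t" "plim \<mu> (cmul A y x) t" using tr_commute[OF \<mu> x c[OF y]] by blast
    then show ?thesis using tr_eq cmul_pedersen[OF c[OF x] y] by simp
  qed
  show "\<exists>C. \<forall>d\<in>D. cmod (tr \<mu> d) \<le> C * cnorm A d" if "cstar_subalgebra A D \<and> D \<subseteq> pedersen" for D
    using tr_bounded[OF \<mu>] that by blast
qed

lemma tr_\<Gamma>: "g \<in> \<Gamma> \<Longrightarrow> tr \<mu> g = \<mu> (E g)"
  using \<Gamma>_pedersen by (intro tr_eq plim_\<Gamma>) auto

end


section \<open>Recovering the functional from the trace; the isomorphism\<close>

context trace_data
begin

lemma traces_facts:
  assumes "\<tau> \<in> traces A"
  shows "\<tau> \<in> extensional pedersen"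
    and "\<And>x y. x \<in> pedersen \<Longrightarrow> y \<in> pedersen \<Longrightarrow> \<tau> (x + y) = \<tau> x + \<tau> y"
    and "\<And>z x. x \<in> pedersen \<Longrightarrow> \<tau> (cscale A z x) = z * \<tau> x"
    and "\<And>D. cstar_subalgebra A D \<Longrightarrow> D \<subseteq> pedersen \<Longrightarrow> \<exists>C. \<forall>d\<in>D. cmod (\<tau> d) \<le> C * cnorm A d"
    and "\<And>x. x \<in> pedersen \<Longrightarrow> \<tau> (cstar A x) = cnj (\<tau> x)"
    and "\<And>x y. x \<in> pedersen \<Longrightarrow> y \<in> pedersen \<Longrightarrow> \<tau> (cmul A x y) = \<tau> (cmul A y x)"
  using assms unfolding traces_def linear_functionals_def Ped_eq by blast+

lemma M_pedersen: "f \<in> C_c X \<Longrightarrow> M f \<in> pedersen"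
  using M_\<Gamma> \<Gamma>_pedersen by blast

text \<open>Given by equations instead of as a closure, so that membership is checked by computing
  with cutoffs. It is a C*-subalgebra inside the Pedersen ideal, and the continuity of a trace is
  only ever used on such sets.\<close>

definition corner :: "('x \<Rightarrow> real) \<Rightarrow> 'a set"
  where "corner e = {a \<in> carr A. cmul A (MR e) a = a \<and> cmul A a (MR e) = a}"

lemma corner_cstar_subalgebra:
  assumes e: "cutoff K e"
  shows "cstar_subalgebra A (corner e)"
proof -
  note ec = M_carr[OF cutoff_C_c[OF e]]
  have zero: "cmul A (MR e) 0 = 0" "cmul A 0 (MR e) = 0"
    using cmul_scale_left[OF carr_0 ec, of 0] cmul_scale_right[OF ec carr_0, of 0] by simp_all
  have star: "cstar A (MR e) = MR e"
    using M_cnj[OF cutoff_C_c[OF e]] by simp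
  \<comment> \<open>Multiplication by \<open>M e\<close> is contractive, so a point at distance less
    than \<open>\<epsilon> / 2\<close> from a fixed point is moved by at most
    \<open>\<epsilon>\<close>.\<close>
  have lim: "a \<in> corner e"
    if a: "a \<in> carr A" and approx: "\<And>\<epsilon>. 0 < \<epsilon> \<Longrightarrow> \<exists>d\<in>corner e. cnorm A (a - d) < \<epsilon>" for a
  proof -
    have "cnorm A (cmul A (MR e) a - a) \<le> \<epsilon> \<and> cnorm A (cmul A a (MR e) - a) \<le> \<epsilon>" if "0 < \<epsilon>" for \<epsilon>
    proof -
      obtain d where d: "d \<in> carr A" "cmul A (MR e) d = d" "cmul A d (MR e) = d" "cnorm A (a - d) < \<epsilon> / 2"
        using approx[of "\<epsilon> / 2"] \<open>0 < \<epsilon>\<close> unfolding corner_def by auto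
      have n: "0 \<le> cnorm A (a - d)" by (intro cnorm_nonneg closed a d)
      have "cnorm A (cmul A (MR e) (a - d)) \<le> cnorm A (MR e) * cnorm A (a - d)"
        by (intro cnorm_cmul closed a d ec)
      also have "\<dots> \<le> 1 * cnorm A (a - d)" by (intro mult_right_mono MR_norm[OF e] n)
      finally have 1: "cnorm A (cmul A (MR e) a - d) < \<epsilon> / 2"
        using d a ec by (simp add: cmul_diff_right)
      have "cnorm A (cmul A (a - d) (MR e)) \<le> cnorm A (a - d) * cnorm A (MR e)"
        by (intro cnorm_cmul closed a d ec)
      also have "\<dots> \<le> cnorm A (a - d) * 1" by (intro mult_left_mono MR_norm[OF e] n)
      finally have 2: "cnorm A (cmul A a (MR e) - d) < \<epsilon> / 2"
        using d a ec by (simp add: cmul_diff_left)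
      show ?thesis
        using 1 2 d(4) cnorm_minus_commute[OF a d(1)]
          cnorm_triangle_diff[OF cmul_closed[OF ec a] d(1) a] cnorm_triangle_diff[OF cmul_closed[OF a ec] d(1) a]
        by simp
    qed
    then have "cnorm A (cmul A (MR e) a - a) \<le> 0" "cnorm A (cmul A a (MR e) - a) \<le> 0"
      using field_le_epsilon[of _ "0::real"] by (metis add_0)+
    then have "cnorm A (cmul A (MR e) a - a) = 0" "cnorm A (cmul A a (MR e) - a) = 0"
      by (intro antisym cnorm_nonneg closed a ec; simp)+
    then have "cmul A (MR e) a - a = 0" "cmul A a (MR e) - a = 0"
      by (intro cnorm_eq_0D closed a ec; simp)+
    then show ?thesis using a by (simp add: corner_def)
  qed
  have "V.subspace (corner e)"
    by (rule V.subspaceI)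
      (use ec in \<open>auto simp: corner_def zero closed cmul_add_left cmul_add_right cmul_scale_left cmul_scale_right\<close>)
  moreover have "cmul A a b \<in> corner e" if "a \<in> corner e" "b \<in> corner e" for a b
  proof -
    have ab: "a \<in> carr A" "b \<in> carr A" "cmul A (MR e) a = a" "cmul A b (MR e) = b"
      using that by (auto simp: corner_def)
    show ?thesis
      using cmul_assoc[OF ec ab(1,2)] cmul_assoc[OF ab(1,2) ec] ab by (simp add: corner_def closed)
  qed
  moreover have "cstar A a \<in> corner e" if "a \<in> corner e" for a
  proof -
    have a: "a \<in> carr A" "cmul A (MR e) a = a" "cmul A a (MR e) = a" using that by (auto simp: corner_def)
    show ?thesis
      using cstar_cmul[OF ec a(1)] cstar_cmul[OF a(1) ec] a by (simp add: corner_def closed star)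
  qed
  ultimately show ?thesis
    unfolding cstar_subalgebra_def using lim by (auto simp: corner_def)
qed

lemma corner_pedersen: "cutoff K e \<Longrightarrow> corner e \<subseteq> pedersen"
  using M_fixed_pedersen cutoff_C_c unfolding corner_def by blast

lemma corner_bounded:
  assumes "\<tau> \<in> traces A" "cutoff K e"
  obtains C where "0 \<le> C" "\<And>d. d \<in> corner e \<Longrightarrow> cmod (\<tau> d) \<le> C * cnorm A d"
proof -
  obtain C where C: "\<And>d. d \<in> corner e \<Longrightarrow> cmod (\<tau> d) \<le> C * cnorm A d"
    using traces_facts(4)[OF assms(1) corner_cstar_subalgebra corner_pedersen] assms(2) by blast
  show ?thesis
  proof (rule that[of "max C 0"])
    fix d assume d: "d \<in> corner e"
    then have "0 \<le> cnorm A d" by (intro cnorm_nonneg) (simp add: corner_def)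
    then have "C * cnorm A d \<le> max C 0 * cnorm A d" by (intro mult_right_mono) auto
    then show "cmod (\<tau> d) \<le> max C 0 * cnorm A d" using C[OF d] by linarith
  qed simp
qed

text \<open>
  By the trace property a trace is determined on \<open>x (M f) y\<close> by its values on a corner, where it
  is bounded and hence determined by the dense subspace \<open>\<Gamma>\<close>.
\<close>

lemma traces_eqI:
  assumes \<tau>: "\<tau> \<in> traces A" and \<tau>': "\<tau>' \<in> traces A" and eq: "\<And>g. g \<in> \<Gamma> \<Longrightarrow> \<tau> g = \<tau>' g"
  shows "\<tau> = \<tau>'"
proof -
  have "d \<in> pedersen \<and> \<tau> d = \<tau>' d" if "d \<in> pedersen" for d
    using that
  proof (induction d rule: pedersen_induct)
    case (gen x f y)
    obtain K where K: "compactin X K" "\<And>x. x \<notin> K \<Longrightarrow> f x = 0" by (rule C_cE[OF gen(2)]) blast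
    obtain e where e: "cutoff K e" using cutoff_exists[OF K(1)] by blast
    obtain L where L: "compactin X L" "\<And>x. x \<notin> L \<Longrightarrow> complex_of_real (e x) = 0"
      by (rule C_cE[OF cutoff_C_c[OF e]]) blast
    \<comment> \<open>A second cutoff, equal to 1 on the supports of both \<open>f\<close> and
      \<open>e\<close>, fixes every \<open>(M f) z (M e)\<close> from either side and puts all of
      them into one corner.\<close>
    have "compactin X (K \<union> L)" using K L by (simp add: compactin_Un)
    then obtain h where h: "cutoff (K \<union> L) h" using cutoff_exists by blast
    note x = gen(1) and y = gen(3) and fc = M_carr[OF gen(2)] and ec = M_carr[OF cutoff_C_c[OF e]]
      and hc = M_carr[OF cutoff_C_c[OF h]]
    have hf: "cmul A (MR h) (M f) = M f"
      by (rule M_cutoff(1)[OF h gen(2)]) (use K(2) in blast)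
    have eh: "cmul A (MR e) (MR h) = MR e"
      by (rule M_cutoff(2)[OF h cutoff_C_c[OF e]]) (use L(2) in blast)
    define w where "w z = cmul A (cmul A (M f) z) (MR e)" for z
    have w: "w z \<in> corner h" if z: "z \<in> carr A" for z
    proof -
      have "cmul A (MR h) (w z) = cmul A (cmul A (cmul A (MR h) (M f)) z) (MR e)"
           "cmul A (w z) (MR h) = cmul A (cmul A (M f) z) (cmul A (MR e) (MR h))"
        unfolding w_def using z fc ec hc by (simp_all add: cmul_assoc closed)
      then show ?thesis unfolding corner_def using hf eh z fc ec by (simp add: w_def closed)
    qed
    have wd: "w (z - z') = w z - w z'" if "z \<in> carr A" "z' \<in> carr A" for z z'
      using that fc ec by (simp add: w_def cmul_diff_left cmul_diff_right closed)
    have wn: "cnorm A (w z) \<le> cnorm A (M f) * cnorm A z" if z: "z \<in> carr A" for z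
    proof -
      have "cnorm A (w z) \<le> cnorm A (cmul A (M f) z) * cnorm A (MR e)"
        unfolding w_def by (intro cnorm_cmul closed fc ec z)
      also have "\<dots> \<le> cnorm A (cmul A (M f) z) * 1"
        by (intro mult_left_mono MR_norm[OF e] cnorm_nonneg closed fc z)
      also have "\<dots> \<le> cnorm A (M f) * cnorm A z" using cnorm_cmul[OF fc z] by simp
      finally show ?thesis .
    qed
    \<comment> \<open>A trace may exchange only factors that lie in the Pedersen ideal, while
      \<open>x\<close> and \<open>y\<close> are arbitrary. Writing \<open>M f\<close> as
      \<open>(M e) (M f)\<close> supplies one factor from the ideal to each side.\<close>
    have sw: "\<sigma> (cmul A (cmul A x (M f)) y) = \<sigma> (w (cmul A y x))" if \<sigma>: "\<sigma> \<in> traces A" for \<sigma>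
    proof -
      have "cmul A (cmul A x (M f)) y = cmul A (cmul A x (cmul A (MR e) (M f))) y"
        using M_cutoff(1)[OF e gen(2) K(2)] by simp
      also have "\<dots> = cmul A (cmul A x (MR e)) (cmul A (M f) y)"
        using x y fc ec by (simp add: cmul_assoc closed)
      also have "\<sigma> \<dots> = \<sigma> (cmul A (cmul A (M f) y) (cmul A x (MR e)))"
        by (intro traces_facts(6)[OF \<sigma>] cmul_pedersen(1)[OF x] cmul_pedersen(2)[OF y] M_pedersen
            cutoff_C_c[OF e] gen(2))
      also have "cmul A (cmul A (M f) y) (cmul A x (MR e)) = w (cmul A y x)"
        unfolding w_def using x y fc ec by (simp add: cmul_assoc closed)
      finally show ?thesis .
    qed
    obtain C where C: "0 \<le> C" "\<And>d. d \<in> corner h \<Longrightarrow> cmod (\<tau> d) \<le> C * cnorm A d"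
      by (rule corner_bounded[OF \<tau> h]) blast
    obtain C' where C': "0 \<le> C'" "\<And>d. d \<in> corner h \<Longrightarrow> cmod (\<tau>' d) \<le> C' * cnorm A d"
      by (rule corner_bounded[OF \<tau>' h]) blast
    have wp: "w z \<in> pedersen" if "z \<in> carr A" for z using w[OF that] corner_pedersen[OF h] by blast
    have diff: "\<sigma> (w (z - z')) = \<sigma> (w z) - \<sigma> (w z')"
      if "\<sigma> \<in> traces A" "z \<in> carr A" "z' \<in> carr A" for \<sigma> z z'
      using traces_facts(2)[OF that(1) wp[OF carr_diff[OF that(2,3)]] wp[OF that(3)]] that wd by simp
    have "\<tau> (w (cmul A y x)) - \<tau>' (w (cmul A y x)) = 0"
    proof (rule dense_zero[where \<phi> = "\<lambda>z. \<tau> (w z) - \<tau>' (w z)"])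
      show "cmod (\<tau> (w z) - \<tau>' (w z)) \<le> ((C + C') * cnorm A (M f)) * cnorm A z" if z: "z \<in> carr A" for z
      proof -
        have "cmod (\<tau> (w z) - \<tau>' (w z)) \<le> C * cnorm A (w z) + C' * cnorm A (w z)"
          by (rule order_trans[OF norm_triangle_ineq4]) (intro add_mono C C' w z)
        also have "\<dots> \<le> (C + C') * (cnorm A (M f) * cnorm A z)"
          using mult_left_mono[OF wn[OF z], of "C + C'"] C C' by (simp add: distrib_right)
        finally show ?thesis by (simp add: mult.assoc)
      qed
      show "\<tau> (w g) - \<tau>' (w g) = 0" if "g \<in> \<Gamma>" for g
        using eq[of "w g"] that unfolding w_def by (simp add: \<Gamma>_mult M_\<Gamma> gen(2) cutoff_C_c[OF e])
    qed (use diff[OF \<tau>] diff[OF \<tau>'] x y in \<open>auto intro: closed\<close>)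
    then show ?case using sw[OF \<tau>] sw[OF \<tau>'] pedersen_gen[OF x y gen(2)] by simp
  next
    case (add c d)
    then show ?case
      using traces_facts(2)[OF \<tau>] traces_facts(2)[OF \<tau>'] V.subspace_add[OF pedersen_subspace] by simp
  next
    case (scale z d)
    then show ?case
      using traces_facts(3)[OF \<tau>] traces_facts(3)[OF \<tau>'] V.subspace_scale[OF pedersen_subspace] by simp
  qed
  then have "\<tau> d = \<tau>' d" if "d \<in> pedersen" for d using that by blast
  then show ?thesis
    using traces_facts(1)[OF \<tau>] traces_facts(1)[OF \<tau>'] by (intro extensionalityI)
qed

definition measure_of_trace :: "('a \<Rightarrow> complex) \<Rightarrow> ('x \<Rightarrow> complex) \<Rightarrow> complex"
  where "measure_of_trace \<tau> = (\<lambda>f\<in>C_c X. \<tau> (M f))"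

lemma trace_eq_measure:
  assumes \<tau>: "\<tau> \<in> traces A" and g: "g \<in> \<Gamma>"
  shows "\<tau> g = measure_of_trace \<tau> (E g)"
proof -
  have "\<tau> g = \<tau> (M (E g))"
    by (rule trace_E[OF _ _ g])
      (use \<Gamma>_pedersen in \<open>auto intro!: traces_facts(2,6)[OF \<tau>] M_pedersen\<close>)
  then show ?thesis using E_\<Gamma>[OF g] by (simp add: measure_of_trace_def)
qed

text \<open>All \<open>f\<close> supported in a fixed compact set yield operators in a single
  corner, on which the trace is bounded; this is continuity for the inductive limit topology. The
  tracial condition defining \<open>N\<close> is inherited through
  \<open>trace_eq_measure\<close>.\<close>

lemma measure_of_trace_N:
  assumes \<tau>: "\<tau> \<in> traces A"
  shows "measure_of_trace \<tau> \<in> N"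
proof -
  let ?\<mu> = "measure_of_trace \<tau>"
  have app: "?\<mu> f = \<tau> (M f)" if "f \<in> C_c X" for f using that by (simp add: measure_of_trace_def)
  have "?\<mu> \<in> Rad X"
    unfolding Rad_def linear_functionals_def
  proof (intro CollectI conjI ballI allI impI)
    show "?\<mu> \<in> extensional (C_c X)" by (simp add: measure_of_trace_def)
    show "?\<mu> (f + g) = ?\<mu> f + ?\<mu> g" if "f \<in> C_c X" "g \<in> C_c X" for f g
      using app[OF C_c_add[OF that]] app that traces_facts(2)[OF \<tau> M_pedersen M_pedersen]
      by (simp add: plus_fun_def M_add)
    show "?\<mu> (\<lambda>x. z * f x) = z * ?\<mu> f" if "f \<in> C_c X" for f z
      using that app[OF C_c_scale[OF that]] app traces_facts(3)[OF \<tau> M_pedersen] by (simp add: M_scale)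
    show "?\<mu> (\<lambda>x. cnj (f x)) = cnj (?\<mu> f)" if "f \<in> C_c X" for f
      using that app[OF C_c_cnj[OF that]] app traces_facts(5)[OF \<tau> M_pedersen] by (simp add: M_cnj)
    fix K assume K: "compactin X K"
    obtain e where e: "cutoff K e" using cutoff_exists[OF K(1)] by blast
    obtain C where C: "0 \<le> C" "\<And>d. d \<in> corner e \<Longrightarrow> cmod (\<tau> d) \<le> C * cnorm A d"
      by (rule corner_bounded[OF \<tau> e]) blast
    have "cmod (?\<mu> f) \<le> C * B"
      if f: "f \<in> C_c X" "\<And>x. x \<notin> K \<Longrightarrow> f x = 0" "\<And>x. cmod (f x) \<le> B" for f B
    proof -
      have "M f \<in> corner e" using M_cutoff[OF e f(1,2)] M_carr[OF f(1)] by (simp add: corner_def)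
      then have "cmod (\<tau> (M f)) \<le> C * cnorm A (M f)" by (rule C)
      also have "\<dots> \<le> C * B" by (intro mult_left_mono M_norm f C)
      finally show ?thesis using app f by simp
    qed
    then show "\<exists>C. \<forall>f\<in>C_c X. \<forall>B. (\<forall>x. x \<notin> K \<longrightarrow> f x = 0) \<and> (\<forall>x. cmod (f x) \<le> B) \<longrightarrow> cmod (?\<mu> f) \<le> C * B"
      by blast
  qed
  moreover have "?\<mu> (E (cmul A g h)) = ?\<mu> (E (cmul A h g))" if "g \<in> \<Gamma>" "h \<in> \<Gamma>" for g h
    using that traces_facts(6)[OF \<tau>] \<Gamma>_pedersen
    by (simp add: trace_eq_measure[OF \<tau> \<Gamma>_mult, symmetric] subset_iff)
  ultimately show ?thesis unfolding N_iff by blast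
qed

lemma tr_measure_of_trace: "\<tau> \<in> traces A \<Longrightarrow> tr (measure_of_trace \<tau>) = \<tau>"
  by (intro traces_eqI tr_traces measure_of_trace_N) (simp_all add: tr_\<Gamma> trace_eq_measure)

lemma measure_of_tr:
  assumes "\<mu> \<in> N"
  shows "measure_of_trace (tr \<mu>) = \<mu>"
proof (rule extensionalityI)
  show "measure_of_trace (tr \<mu>) \<in> extensional (C_c X)" by (simp add: measure_of_trace_def)
  show "\<mu> \<in> extensional (C_c X)"
    using N_Rad[OF assms] unfolding Rad_def linear_functionals_def by blast
  show "measure_of_trace (tr \<mu>) f = \<mu> f" if "f \<in> C_c X" for f
    using that by (simp add: measure_of_trace_def tr_\<Gamma> M_\<Gamma> E_M)
qed

text \<open>A positive element has a pointwise nonnegative expectation, so its trace is a limit of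
  nonnegative numbers.\<close>

lemma tr_positive:
  assumes \<mu>: "\<mu> \<in> N" and pos: "\<And>f. f \<in> C_c X \<Longrightarrow> (\<And>x. f x \<in> \<real>\<^sub>\<ge>\<^sub>0) \<Longrightarrow> \<mu> f \<in> \<real>\<^sub>\<ge>\<^sub>0"
  shows "tr \<mu> \<in> positive_traces A"
proof -
  have "tr \<mu> a \<in> \<real>\<^sub>\<ge>\<^sub>0" if a: "a \<in> pedersen" and "a \<in> positive_elements A" for a
  proof -
    obtain b where b: "b \<in> carr A" "a = cmul A (cstar A b) b"
      using \<open>a \<in> positive_elements A\<close> unfolding positive_elements_def by blast
    have pp: "pair \<mu> (\<lambda>x. complex_of_real (e x)) a \<in> \<real>\<^sub>\<ge>\<^sub>0" if e: "cutoff K e" for e K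
      unfolding pair_def
    proof (rule pos[OF E_C_c[OF cutoff_C_c[OF e] pedersen_in[OF a]]])
      have "complex_of_real (e x) \<in> \<real>\<^sub>\<ge>\<^sub>0" for x using e unfolding cutoff_def by auto
      then show "complex_of_real (e x) * E a x \<in> \<real>\<^sub>\<ge>\<^sub>0" for x
        using E_positive[OF b(1)] b(2) by (intro nonneg_Reals_mult_I) auto
    qed
    have "\<exists>p\<in>\<real>\<^sub>\<ge>\<^sub>0. dist p (tr \<mu> a) < \<epsilon>" if \<epsilon>: "0 < \<epsilon>" for \<epsilon>
    proof -
      obtain K where K: "compactin X K"
        "\<And>e. cutoff K e \<Longrightarrow> cmod (pair \<mu> (\<lambda>x. complex_of_real (e x)) a - tr \<mu> a) < \<epsilon>"
        by (rule plimE[OF plim_tr[OF \<mu> a] \<epsilon>]) blast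
      obtain e where e: "cutoff K e" using cutoff_exists[OF K(1)] by blast
      show ?thesis using pp[OF e] K(2)[OF e] by (auto simp: dist_norm)
    qed
    then have "tr \<mu> a \<in> closure (\<real>\<^sub>\<ge>\<^sub>0 :: complex set)" unfolding closure_approachable by blast
    then show ?thesis by (simp add: closure_closed)
  qed
  then show ?thesis using tr_traces[OF \<mu>] unfolding positive_traces_def Ped_eq by blast
qed

text \<open>The square root of \<open>f\<close> has compact support as well, and exhibits
  \<open>M f\<close> as a positive element of the algebra.\<close>

lemma measure_positive:
  assumes \<tau>: "\<tau> \<in> positive_traces A" and f: "f \<in> C_c X" "\<And>x. f x \<in> \<real>\<^sub>\<ge>\<^sub>0"
  shows "measure_of_trace \<tau> f \<in> \<real>\<^sub>\<ge>\<^sub>0"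
proof -
  define r where "r = (\<lambda>x. complex_of_real (sqrt (Re (f x))))"
  obtain K where K: "compactin X K" "\<And>x. x \<notin> K \<Longrightarrow> f x = 0" by (rule C_cE[OF f(1)]) blast
  have r: "r \<in> C_c X"
  proof (rule C_cI[OF _ K(1)])
    show "continuous_map X euclidean r"
      unfolding r_def by (rule continuous_map_compose_on[OF C_cD_continuous[OF f(1)]]) (intro continuous_intros)
  qed (simp add: r_def K(2))
  have "f = (\<lambda>x. cnj (r x) * r x)"
  proof
    fix x
    have "f x = complex_of_real (Re (f x))" "0 \<le> Re (f x)"
      using f(2)[of x] by (auto simp: complex_nonneg_Reals_iff complex_eq_iff)
    then show "f x = cnj (r x) * r x" by (simp add: r_def of_real_mult[symmetric])
  qed
  then have "M f = cmul A (cstar A (M r)) (M r)"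
    using M_mult[OF C_c_cnj[OF r] r] M_cnj[OF r] by simp
  then have "M f \<in> positive_elements A"
    unfolding positive_elements_def using M_carr[OF r] by blast
  then show ?thesis
    using \<tau> M_pedersen[OF f(1)] f(1) unfolding positive_traces_def Ped_eq by (simp add: measure_of_trace_def)
qed

lemma trace_unique:
  assumes "\<mu> \<in> N"
  shows "\<tau> \<in> traces A \<and> (\<forall>g\<in>\<Gamma>. \<tau> g = \<mu> (E g)) \<longleftrightarrow> \<tau> = tr \<mu>"
  using tr_traces[OF assms] tr_\<Gamma> traces_eqI[of \<tau> "tr \<mu>"] by auto

lemma N_extensional: "\<mu> \<in> N \<Longrightarrow> \<mu> \<in> extensional (C_c X)"
  using N_Rad unfolding Rad_def linear_functionals_def by blast

text \<open>Evaluations correspond to evaluations in both directions: at \<open>d\<close> to one at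
  the representing function of \<open>d\<close>, and at \<open>f\<close> to one at
  \<open>M f\<close>.\<close>

lemma homeomorphic_map_tr: "homeomorphic_map (weak_star (C_c X) N) (weak_star pedersen (traces A)) tr"
proof -
  have t1: "topspace (weak_star (C_c X) N) = N"
    unfolding weak_star_def using N_extensional by (auto simp: PiE_def)
  have t2: "topspace (weak_star pedersen (traces A)) = traces A"
    unfolding weak_star_def using traces_facts(1) by (auto simp: PiE_def)
  have "continuous_map (weak_star (C_c X) N) (weak_star pedersen (traces A)) tr"
    unfolding weak_star_def[of pedersen] continuous_map_in_subtopology continuous_map_componentwise
  proof (intro conjI ballI)
    show "tr \<in> topspace (weak_star (C_c X) N) \<rightarrow> traces A" using t1 tr_traces by auto
    show "tr ` topspace (weak_star (C_c X) N) \<subseteq> extensional pedersen"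
      unfolding t1 using tr_traces traces_facts(1) by blast
    fix d assume d: "d \<in> pedersen"
    then obtain w where w: "w \<in> C_c X" "\<And>\<mu>. \<mu> \<in> N \<Longrightarrow> plim \<mu> d (\<mu> w)" using plim_representing by blast
    have "continuous_map (weak_star (C_c X) N) euclidean (\<lambda>\<mu>. \<mu> w)"
      unfolding weak_star_def
      by (intro continuous_map_from_subtopology continuous_map_product_projection w)
    then show "continuous_map (weak_star (C_c X) N) euclidean (\<lambda>\<mu>. tr \<mu> d)"
      by (rule continuous_map_eq) (use t1 tr_eq[OF d w(2)] in auto)
  qed
  moreover have "continuous_map (weak_star pedersen (traces A)) (weak_star (C_c X) N) measure_of_trace"
    unfolding weak_star_def[of "C_c X"] continuous_map_in_subtopology continuous_map_componentwise
  proof (intro conjI ballI)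
    show "measure_of_trace \<in> topspace (weak_star pedersen (traces A)) \<rightarrow> N"
      using t2 measure_of_trace_N by auto
    show "measure_of_trace ` topspace (weak_star pedersen (traces A)) \<subseteq> extensional (C_c X)"
      by (auto simp: measure_of_trace_def)
    fix f assume f: "f \<in> C_c X"
    show "continuous_map (weak_star pedersen (traces A)) euclidean (\<lambda>\<tau>. measure_of_trace \<tau> f)"
      unfolding weak_star_def measure_of_trace_def restrict_apply'[OF f]
      by (rule continuous_map_from_subtopology[OF continuous_map_product_projection[OF M_pedersen[OF f]]])
  qed
  ultimately have "homeomorphic_maps (weak_star (C_c X) N) (weak_star pedersen (traces A)) tr measure_of_trace"
    unfolding homeomorphic_maps_def using t1 t2 measure_of_tr tr_measure_of_trace by simp
  then show ?thesis using homeomorphic_maps_map by blast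
qed

text \<open>Linearity is read off from the inverse map, which is composition with \<open>M\<close>:
  the combination of traces is a trace, and its functional is the combination of the functionals.
  The coefficients are real because traces are self-adjoint.\<close>

lemma tr_linear:
  assumes "\<phi> \<in> N" "\<psi> \<in> N"
  shows "tr (\<lambda>f\<in>C_c X. complex_of_real a * \<phi> f + complex_of_real b * \<psi> f)
    = (\<lambda>d\<in>pedersen. complex_of_real a * tr \<phi> d + complex_of_real b * tr \<psi> d)"
proof -
  let ?\<sigma> = "\<lambda>d\<in>pedersen. complex_of_real a * tr \<phi> d + complex_of_real b * tr \<psi> d"
  note T = traces_facts[OF tr_traces[OF assms(1)]] and T' = traces_facts[OF tr_traces[OF assms(2)]]
  have "?\<sigma> \<in> traces A"
    unfolding traces_def linear_functionals_def Ped_eq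
  proof (intro CollectI conjI ballI allI impI)
    fix D assume D: "cstar_subalgebra A D \<and> D \<subseteq> pedersen"
    obtain C where C: "\<And>d. d \<in> D \<Longrightarrow> cmod (tr \<phi> d) \<le> C * cnorm A d" using T(4) D by blast
    obtain C' where C': "\<And>d. d \<in> D \<Longrightarrow> cmod (tr \<psi> d) \<le> C' * cnorm A d" using T'(4) D by blast
    have "cmod (?\<sigma> d) \<le> (\<bar>a\<bar> * C + \<bar>b\<bar> * C') * cnorm A d" if d: "d \<in> D" for d
    proof -
      have "cmod (?\<sigma> d) \<le> \<bar>a\<bar> * cmod (tr \<phi> d) + \<bar>b\<bar> * cmod (tr \<psi> d)"
        using d D norm_triangle_ineq[of "complex_of_real a * tr \<phi> d" "complex_of_real b * tr \<psi> d"]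
        by (simp add: subset_iff norm_mult)
      also have "\<dots> \<le> \<bar>a\<bar> * (C * cnorm A d) + \<bar>b\<bar> * (C' * cnorm A d)"
        by (intro add_mono mult_left_mono C C' d) auto
      finally show ?thesis by (simp add: algebra_simps)
    qed
    then show "\<exists>C. \<forall>d\<in>D. cmod (?\<sigma> d) \<le> C * cnorm A d" by blast
  next
    fix x y assume xy: "x \<in> pedersen" "y \<in> pedersen"
    then have p: "x + y \<in> pedersen" "cmul A x y \<in> pedersen" "cmul A y x \<in> pedersen"
      by (auto intro: V.subspace_add[OF pedersen_subspace] cmul_pedersen(1) pedersen_in)
    show "?\<sigma> (x + y) = ?\<sigma> x + ?\<sigma> y" using xy p T(2) T'(2) by (simp add: algebra_simps)
    show "?\<sigma> (cmul A x y) = ?\<sigma> (cmul A y x)" using xy p T(6)[OF xy] T'(6)[OF xy] by simp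
  next
    fix z x assume x: "x \<in> pedersen"
    then have p: "cscale A z x \<in> pedersen" "cstar A x \<in> pedersen"
      by (auto intro: V.subspace_scale[OF pedersen_subspace] cstar_pedersen)
    show "?\<sigma> (cscale A z x) = z * ?\<sigma> x" using x p T(3) T'(3) by (simp add: algebra_simps)
  next
    fix x assume x: "x \<in> pedersen"
    then have p: "cstar A x \<in> pedersen" by (rule cstar_pedersen)
    show "?\<sigma> (cstar A x) = cnj (?\<sigma> x)" using x p T(5) T'(5) by simp
  qed simp
  then have "?\<sigma> = tr (measure_of_trace ?\<sigma>)" by (simp add: tr_measure_of_trace)
  moreover have "measure_of_trace ?\<sigma> = (\<lambda>f\<in>C_c X. complex_of_real a * \<phi> f + complex_of_real b * \<psi> f)"
    unfolding measure_of_trace_def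
    by (rule restrict_ext) (simp add: M_pedersen tr_\<Gamma> M_\<Gamma> E_M)
  ultimately show ?thesis by simp
qed

theorem ordered_tvs_iso_trace:
  "(\<forall>\<mu>\<in>N. \<exists>!\<tau>. \<tau> \<in> traces A \<and> (\<forall>g\<in>\<Gamma>. \<tau> g = \<mu> (E g))) \<and>
   ordered_tvs_iso (C_c X) N {\<mu>\<in>N. \<forall>f\<in>C_c X. (\<forall>x. f x \<in> \<real>\<^sub>\<ge>\<^sub>0) \<longrightarrow> \<mu> f \<in> \<real>\<^sub>\<ge>\<^sub>0}
     (Ped A) (traces A) (positive_traces A) (\<lambda>\<mu>. THE \<tau>. \<tau> \<in> traces A \<and> (\<forall>g\<in>\<Gamma>. \<tau> g = \<mu> (E g)))"
proof -
  let ?F = "\<lambda>\<mu>. THE \<tau>. \<tau> \<in> traces A \<and> (\<forall>g\<in>\<Gamma>. \<tau> g = \<mu> (E g))"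
  have F: "?F \<mu> = tr \<mu>" if "\<mu> \<in> N" for \<mu> using trace_unique[OF that] by simp
  \<comment> \<open>Coefficients \<open>1, 1\<close> will give additivity and \<open>c, 0\<close>
    homogeneity, so that only one combination has to be shown to lie in \<open>N\<close>.\<close>
  have comb: "?F (\<lambda>f\<in>C_c X. complex_of_real a * \<phi> f + complex_of_real b * \<psi> f)
      = (\<lambda>d\<in>pedersen. complex_of_real a * tr \<phi> d + complex_of_real b * tr \<psi> d)"
    if N: "\<phi> \<in> N" "\<psi> \<in> N" for \<phi> \<psi> a b
  proof -
    let ?c = "\<lambda>f\<in>C_c X. complex_of_real a * \<phi> f + complex_of_real b * \<psi> f"
    have lin: "tr ?c = (\<lambda>d\<in>pedersen. complex_of_real a * tr \<phi> d + complex_of_real b * tr \<psi> d)"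
      by (rule tr_linear[OF N])
    have "?c \<in> N"
    proof -
      have R: "?c \<in> Rad X"
        unfolding Rad_def linear_functionals_def
      proof (intro CollectI conjI ballI allI impI)
        fix f g assume fg: "f \<in> C_c X" "g \<in> C_c X"
        then show "?c (f + g) = ?c f + ?c g"
          using C_c_add[OF fg] Rad_add[OF N_Rad[OF N(1)] fg] Rad_add[OF N_Rad[OF N(2)] fg]
          by (simp add: plus_fun_def algebra_simps)
      next
        fix z f assume f: "f \<in> C_c X"
        then show "?c (\<lambda>x. z * f x) = z * ?c f"
          using C_c_scale[OF f] Rad_scale[OF N_Rad[OF N(1)] f] Rad_scale[OF N_Rad[OF N(2)] f]
          by (simp add: algebra_simps)
      next
        fix f assume f: "f \<in> C_c X"
        then show "?c (\<lambda>x. cnj (f x)) = cnj (?c f)"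
          using C_c_cnj[OF f] Rad_cnj[OF N_Rad[OF N(1)] f] Rad_cnj[OF N_Rad[OF N(2)] f]
          by simp
      next
        fix K assume K: "compactin X K"
        obtain C where C: "0 \<le> C" "\<And>f B. f \<in> C_c X \<Longrightarrow> (\<And>x. x \<notin> K \<Longrightarrow> f x = 0) \<Longrightarrow> (\<And>x. cmod (f x) \<le> B)
          \<Longrightarrow> cmod (\<phi> f) \<le> C * B" by (rule Rad_bound[OF N_Rad[OF N(1)] K]) blast
        obtain C' where C': "0 \<le> C'" "\<And>f B. f \<in> C_c X \<Longrightarrow> (\<And>x. x \<notin> K \<Longrightarrow> f x = 0) \<Longrightarrow> (\<And>x. cmod (f x) \<le> B)
          \<Longrightarrow> cmod (\<psi> f) \<le> C' * B" by (rule Rad_bound[OF N_Rad[OF N(2)] K]) blast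
        have "cmod (?c f) \<le> (\<bar>a\<bar> * C + \<bar>b\<bar> * C') * B"
          if f: "f \<in> C_c X" "\<And>x. x \<notin> K \<Longrightarrow> f x = 0" "\<And>x. cmod (f x) \<le> B" for f B
        proof -
          have "cmod (?c f) \<le> \<bar>a\<bar> * cmod (\<phi> f) + \<bar>b\<bar> * cmod (\<psi> f)"
            using f(1) norm_triangle_ineq[of "complex_of_real a * \<phi> f" "complex_of_real b * \<psi> f"]
            by (simp add: norm_mult)
          also have "\<dots> \<le> \<bar>a\<bar> * (C * B) + \<bar>b\<bar> * (C' * B)"
            by (intro add_mono mult_left_mono C(2) C'(2) f) auto
          finally show ?thesis by (simp add: algebra_simps)
        qed
        then show "\<exists>C. \<forall>f\<in>C_c X. \<forall>B. (\<forall>x. x \<notin> K \<longrightarrow> f x = 0) \<and> (\<forall>x. cmod (f x) \<le> B) \<longrightarrow> cmod (?c f) \<le> C * B"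
          by blast
      qed simp
      show ?thesis
        unfolding N_iff using R N unfolding N_iff by (simp add: E_\<Gamma> \<Gamma>_mult)
    qed
    from F[OF this] lin show ?thesis by (rule trans)
  qed
  show ?thesis
    unfolding ordered_tvs_iso_def Ped_eq
  proof (intro conjI ballI allI)
    show "\<exists>!\<tau>. \<tau> \<in> traces A \<and> (\<forall>g\<in>\<Gamma>. \<tau> g = \<mu> (E g))" if "\<mu> \<in> N" for \<mu>
      using trace_unique[OF that] by simp
    show "?F (\<lambda>f\<in>C_c X. \<phi> f + \<psi> f) = (\<lambda>y\<in>pedersen. ?F \<phi> y + ?F \<psi> y)" if "\<phi> \<in> N" "\<psi> \<in> N" for \<phi> \<psi>
      using comb[OF that, of 1 1] F that by simp
    show "?F (\<lambda>f\<in>C_c X. complex_of_real c * \<phi> f) = (\<lambda>y\<in>pedersen. complex_of_real c * ?F \<phi> y)"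
      if "\<phi> \<in> N" for \<phi> c
      using comb[OF that that, of c 0] F that by simp
    have "topspace (weak_star (C_c X) N) \<subseteq> N" unfolding weak_star_def by auto
    then show "homeomorphic_map (weak_star (C_c X) N) (weak_star pedersen (traces A)) ?F"
      by (intro homeomorphic_map_eq[OF homeomorphic_map_tr]) (use F in auto)
    show "?F ` {\<mu>\<in>N. \<forall>f\<in>C_c X. (\<forall>x. f x \<in> \<real>\<^sub>\<ge>\<^sub>0) \<longrightarrow> \<mu> f \<in> \<real>\<^sub>\<ge>\<^sub>0} = positive_traces A"
    proof (intro equalityI subsetI)
      fix \<tau> assume "\<tau> \<in> ?F ` {\<mu>\<in>N. \<forall>f\<in>C_c X. (\<forall>x. f x \<in> \<real>\<^sub>\<ge>\<^sub>0) \<longrightarrow> \<mu> f \<in> \<real>\<^sub>\<ge>\<^sub>0}"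
      then show "\<tau> \<in> positive_traces A" using F tr_positive by auto
    next
      fix \<tau> assume \<tau>: "\<tau> \<in> positive_traces A"
      then have t: "\<tau> \<in> traces A" unfolding positive_traces_def by blast
      then have "\<tau> = ?F (measure_of_trace \<tau>)" using F measure_of_trace_N tr_measure_of_trace by simp
      moreover have "measure_of_trace \<tau> \<in> {\<mu>\<in>N. \<forall>f\<in>C_c X. (\<forall>x. f x \<in> \<real>\<^sub>\<ge>\<^sub>0) \<longrightarrow> \<mu> f \<in> \<real>\<^sub>\<ge>\<^sub>0}"
        using measure_of_trace_N[OF t] measure_positive[OF \<tau>] by blast
      ultimately show "\<tau> \<in> ?F ` {\<mu>\<in>N. \<forall>f\<in>C_c X. (\<forall>x. f x \<in> \<real>\<^sub>\<ge>\<^sub>0) \<longrightarrow> \<mu> f \<in> \<real>\<^sub>\<ge>\<^sub>0}" by blast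
    qed
  qed
qed

end


section \<open>Topology of etale groupoids\<close>

text \<open>The preimage of \<open>W\<close> under the inverse is the image of
  \<open>U \<inter> W\<close>, which is open by \<open>op\<close>.\<close>

lemma continuous_map_the_inv_into:
  assumes U: "openin X U" and inj: "inj_on f U"
    and op: "\<And>V. openin X V \<Longrightarrow> V \<subseteq> U \<Longrightarrow> openin Y (f ` V)"
  shows "continuous_map (subtopology Y (f ` U)) X (the_inv_into U f)"
  unfolding continuous_map_def
proof (intro conjI allI impI)
  have fU: "f ` U \<subseteq> topspace Y" using openin_subset[OF op[OF U]] by simp
  show "the_inv_into U f \<in> topspace (subtopology Y (f ` U)) \<rightarrow> topspace X"
    using openin_subset[OF U] by (auto simp: the_inv_into_f_f[OF inj])
  fix W assume W: "openin X W"
  have "{y \<in> topspace (subtopology Y (f ` U)). the_inv_into U f y \<in> W} = f ` (U \<inter> W)"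
    using fU by (auto simp: the_inv_into_f_f[OF inj])
  moreover have "openin Y (f ` (U \<inter> W))" by (intro op) (use U W in auto)
  ultimately show "openin (subtopology Y (f ` U)) {y \<in> topspace (subtopology Y (f ` U)). the_inv_into U f y \<in> W}"
    using openin_subtopology_Int2[of Y "f ` (U \<inter> W)" "f ` U"] by (simp add: Int_absorb1 image_mono)
qed

context etale_groupoid
begin

lemma units_arrows: "units G \<subseteq> arrows G"
  unfolding units_def using rng_closed by blast

lemma rng_unit: "x \<in> units G \<Longrightarrow> rng G x = x"
  unfolding units_def using rng_rng by auto

lemma src_unit: "x \<in> units G \<Longrightarrow> src G x = x"
  unfolding units_def using src_rng by auto

lemma rng_in_units: "g \<in> arrows G \<Longrightarrow> rng G g \<in> units G"
  unfolding units_def by blast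

lemma src_in_units: "g \<in> arrows G \<Longrightarrow> src G g \<in> units G"
  using rng_src src_closed unfolding units_def by force

lemma unit_arrow: "x \<in> units G \<Longrightarrow> x \<in> arrows G"
  using units_arrows by blast

lemma units_eq: "units G = {g \<in> arrows G. rng G g = g}"
  using rng_unit unit_arrow rng_in_units by force

lemma topspace_unit_top: "topspace (unit_top G) = units G"
  unfolding unit_top_def using units_arrows by auto

lemma inv_inv: "g \<in> arrows G \<Longrightarrow> ginv G (ginv G g) = g"
  using mul_assoc[of "ginv G (ginv G g)" "ginv G g" g] inv_mul[of "ginv G g"] inv_mul[of g]
    mul_src_right[of "ginv G (ginv G g)"] rng_mul_left[of g]
  by (simp add: inv_closed src_inv rng_inv)

lemma inv_unit: "x \<in> units G \<Longrightarrow> ginv G x = x"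
  using inv_mul[of x] mul_src_right[of "ginv G x"]
  by (simp add: unit_arrow inv_closed src_inv rng_unit src_unit)

lemma mul_left_inv: "\<lbrakk>g \<in> arrows G; h \<in> arrows G; src G g = rng G h\<rbrakk>
    \<Longrightarrow> gmul G (ginv G g) (gmul G g h) = h"
  using mul_assoc[of "ginv G g" g h] by (simp add: inv_closed src_inv inv_mul rng_mul_left)

lemma mul_inv_left: "\<lbrakk>g \<in> arrows G; h \<in> arrows G; rng G g = rng G h\<rbrakk>
    \<Longrightarrow> gmul G g (gmul G (ginv G g) h) = h"
  using mul_assoc[of g "ginv G g" h] by (simp add: inv_closed rng_inv src_inv mul_inv rng_mul_left)

lemma mul_eq_iff: "\<lbrakk>g \<in> arrows G; h \<in> arrows G; k \<in> arrows G; src G g = rng G h\<rbrakk>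
    \<Longrightarrow> gmul G g h = k \<longleftrightarrow> rng G k = rng G g \<and> h = gmul G (ginv G g) k"
  using mul_left_inv mul_inv_left rng_mul by metis

lemma inv_mul_arrow: "\<lbrakk>g \<in> arrows G; h \<in> arrows G; rng G g = rng G h\<rbrakk> \<Longrightarrow> gmul G (ginv G g) h \<in> arrows G"
  by (simp add: mul_closed inv_closed src_inv)

lemma rng_inv_mul: "\<lbrakk>g \<in> arrows G; h \<in> arrows G; rng G g = rng G h\<rbrakk> \<Longrightarrow> rng G (gmul G (ginv G g) h) = src G g"
  by (simp add: rng_mul inv_closed src_inv rng_inv)

lemma src_inv_mul: "\<lbrakk>g \<in> arrows G; h \<in> arrows G; rng G g = rng G h\<rbrakk> \<Longrightarrow> src G (gmul G (ginv G g) h) = src G h"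
  by (simp add: src_mul inv_closed src_inv)

lemma inv_gmul:
  assumes "g \<in> arrows G" "h \<in> arrows G" "src G g = rng G h"
  shows "ginv G (gmul G g h) = gmul G (ginv G h) (ginv G g)"
proof -
  have gh: "gmul G g h \<in> arrows G" "rng G (gmul G g h) = rng G g" "src G (gmul G g h) = src G h"
    using assms by (simp_all add: mul_closed rng_mul src_mul)
  let ?k = "gmul G (ginv G h) (ginv G g)"
  have k: "?k \<in> arrows G" "rng G ?k = src G h"
    using assms by (simp_all add: mul_closed inv_closed src_inv rng_inv rng_mul)
  have "gmul G (gmul G g h) ?k = gmul G g (gmul G h ?k)"
    by (rule mul_assoc) (use assms k in auto)
  also have "gmul G h ?k = ginv G g"
    by (rule mul_inv_left) (use assms in \<open>auto simp: inv_closed rng_inv\<close>)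
  finally have "gmul G (gmul G g h) ?k = rng G g" using assms by (simp add: mul_inv)
  then have "?k = gmul G (ginv G (gmul G g h)) (rng G g)"
    using mul_left_inv[OF gh(1) k(1)] gh k by simp
  also have "\<dots> = ginv G (gmul G g h)"
    using mul_src_right[OF inv_closed[OF gh(1)]] gh by (simp add: src_inv)
  finally show ?thesis by simp
qed

lemma continuous_rng: "continuous_map (gtop G) (unit_top G) (rng G)"
proof (rule continuous_map_locallyI)
  fix g assume "g \<in> arrows G"
  then obtain U where U: "openin (gtop G) U" "g \<in> U"
      "homeomorphic_map (subtopology (gtop G) U) (subtopology (unit_top G) (rng G ` U)) (rng G)"
    using rng_local_homeomorphism unfolding local_homeomorphism_def by blast
  then have "continuous_map (subtopology (gtop G) U) (unit_top G) (rng G)"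
    using homeomorphic_imp_continuous_map continuous_map_into_fulltopology by blast
  then show "\<exists>U. openin (gtop G) U \<and> g \<in> U \<and> continuous_map (subtopology (gtop G) U) (unit_top G) (rng G)"
    using U by blast
qed

lemma continuous_src: "continuous_map (gtop G) (unit_top G) (src G)"
  using continuous_map_compose[OF continuous_inv continuous_rng]
  by (rule continuous_map_eq) (simp add: rng_inv)

lemma open_rng:
  assumes V: "openin (gtop G) V"
  shows "openin (unit_top G) (rng G ` V)"
proof -
  have "\<exists>W. openin (unit_top G) W \<and> rng G g \<in> W \<and> W \<subseteq> rng G ` V" if g: "g \<in> V" for g
  proof -
    have "g \<in> arrows G" using g openin_subset[OF V] by blast
    then obtain U where U: "openin (gtop G) U" "g \<in> U" "openin (unit_top G) (rng G ` U)"
        "homeomorphic_map (subtopology (gtop G) U) (subtopology (unit_top G) (rng G ` U)) (rng G)"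
      using rng_local_homeomorphism unfolding local_homeomorphism_def by blast
    have "openin (subtopology (gtop G) U) (U \<inter> V)" using V openin_subtopology_Int2 by blast
    then have "openin (subtopology (unit_top G) (rng G ` U)) (rng G ` (U \<inter> V))"
      using homeomorphic_imp_open_map[OF U(4)] unfolding open_map_def by blast
    then have "openin (unit_top G) (rng G ` (U \<inter> V))" using U(3) openin_trans_full by blast
    then show ?thesis using U(2) g by blast
  qed
  then show ?thesis by (subst openin_subopen) blast
qed

lemma locally_rng_injective:
  assumes "g \<in> arrows G"
  obtains U where "openin (gtop G) U" "g \<in> U" "inj_on (rng G) U"
proof -
  obtain U where U: "openin (gtop G) U" "g \<in> U"
        "homeomorphic_map (subtopology (gtop G) U) (subtopology (unit_top G) (rng G ` U)) (rng G)"
    using rng_local_homeomorphism assms unfolding local_homeomorphism_def by blast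
  have "inj_on (rng G) U"
    using homeomorphic_imp_injective_map[OF U(3)] openin_subset[OF U(1)] by (simp add: Int_absorb1)
  then show ?thesis using that U by blast
qed

lemma openin_inv_image:
  assumes "openin (gtop G) V"
  shows "openin (gtop G) (ginv G ` V)"
proof -
  have "ginv G ` V = {g \<in> arrows G. ginv G g \<in> V}"
    using openin_subset[OF assms] inv_closed inv_inv by force
  then show ?thesis using openin_continuous_map_preimage[OF continuous_inv assms] by simp
qed


text \<open>Near a unit the range map is injective on some open \<open>U\<close>. If both
  \<open>g\<close> and \<open>rng G g\<close> lie in \<open>U\<close>, they have the same range and
  are therefore equal.\<close>

lemma openin_units: "openin (gtop G) (units G)"
proof (subst openin_subopen, intro ballI)
  fix x assume x: "x \<in> units G"
  obtain U where U: "openin (gtop G) U" "x \<in> U" "inj_on (rng G) U"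
    using locally_rng_injective[OF unit_arrow[OF x]] .
  let ?V = "U \<inter> {g \<in> arrows G. rng G g \<in> U}"
  have "continuous_map (gtop G) (gtop G) (rng G)"
    using continuous_rng unfolding unit_top_def by (rule continuous_map_into_fulltopology)
  then have "openin (gtop G) ?V"
    using U(1) openin_continuous_map_preimage by blast
  moreover have "g \<in> units G" if g: "g \<in> U" "g \<in> arrows G" "rng G g \<in> U" for g
  proof -
    have "rng G g = g" by (rule inj_onD[OF U(3) rng_rng[OF g(2)] g(3,1)])
    then show ?thesis using rng_in_units[OF g(2)] by simp
  qed
  then have "?V \<subseteq> units G" by blast
  ultimately show "\<exists>T. openin (gtop G) T \<and> x \<in> T \<and> T \<subseteq> units G"
    using x U(2) rng_unit[OF x] unit_arrow[OF x] by (intro exI[of _ ?V]) auto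
qed


lemma bisection_openin: "open_bisection G U \<Longrightarrow> openin (gtop G) U"
  unfolding open_bisection_def by blast

lemma bisection_arrow: "open_bisection G U \<Longrightarrow> g \<in> U \<Longrightarrow> g \<in> arrows G"
  using bisection_openin openin_subset by blast

lemma bisection_rng_inj: "open_bisection G U \<Longrightarrow> inj_on (rng G) U"
  unfolding open_bisection_def by blast

lemma bisection_src_inj: "open_bisection G U \<Longrightarrow> inj_on (src G) U"
  unfolding open_bisection_def by blast

lemma bisection_subset: "open_bisection G U \<Longrightarrow> openin (gtop G) V \<Longrightarrow> V \<subseteq> U \<Longrightarrow> open_bisection G V"
  unfolding open_bisection_def using inj_on_subset by blast

text \<open>The source is the range of the inverse, so a neighbourhood on which it is injective
  comes from inverting one of \<open>ginv G g\<close> on which the range is.\<close>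

lemma bisection_exists:
  assumes W: "openin (gtop G) W" and g: "g \<in> W"
  obtains U where "open_bisection G U" "g \<in> U" "U \<subseteq> W"
proof -
  have gA: "g \<in> arrows G" using W g openin_subset by blast
  obtain U1 where U1: "openin (gtop G) U1" "g \<in> U1" "inj_on (rng G) U1"
    using locally_rng_injective[OF gA] .
  obtain U2 where U2: "openin (gtop G) U2" "ginv G g \<in> U2" "inj_on (rng G) U2"
    using locally_rng_injective[OF inv_closed[OF gA]] .
  let ?U = "U1 \<inter> W \<inter> ginv G ` U2"
  have U2A: "h \<in> arrows G" if "h \<in> U2" for h using that openin_subset[OF U2(1)] by blast
  have "inj_on (src G) (ginv G ` U2)"
    by (rule inj_onI) (use U2A in \<open>auto simp: src_inv dest: inj_onD[OF U2(3)]\<close>)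
  then have "open_bisection G ?U"
    unfolding open_bisection_def
    using U1 W openin_inv_image[OF U2(1)] inj_on_subset[of "rng G" U1 ?U] inj_on_subset[of "src G" "ginv G ` U2" ?U]
    by auto
  moreover have "g \<in> ?U" using U1(2) g imageI[OF U2(2), of "ginv G"] inv_inv[OF gA] by simp
  ultimately show ?thesis using that[of ?U] by blast
qed

lemma bisection_units: "open_bisection G (units G)"
  unfolding open_bisection_def using openin_units by (auto intro!: inj_onI simp: rng_unit src_unit)

lemma bisection_inv: assumes U: "open_bisection G U" shows "open_bisection G (ginv G ` U)"
  unfolding open_bisection_def
proof (intro conjI)
  show "openin (gtop G) (ginv G ` U)" by (rule openin_inv_image[OF bisection_openin[OF U]])
  note A = bisection_arrow[OF U]
  show "inj_on (rng G) (ginv G ` U)"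
    by (rule inj_onI) (use A in \<open>auto simp: rng_inv dest: inj_onD[OF bisection_src_inj[OF U]]\<close>)
  show "inj_on (src G) (ginv G ` U)"
    by (rule inj_onI) (use A in \<open>auto simp: src_inv dest: inj_onD[OF bisection_rng_inj[OF U]]\<close>)
qed

section \<open>Factorisation through a bisection, and products of bisections\<close>

definition lpart :: "'g set \<Rightarrow> 'g \<Rightarrow> 'g"
  where "lpart U g = the_inv_into U (rng G) (rng G g)"

definition ldom :: "'g set \<Rightarrow> 'g set"
  where "ldom U = {g \<in> arrows G. rng G g \<in> rng G ` U}"

lemma lpart_eq: "open_bisection G U \<Longrightarrow> a \<in> U \<Longrightarrow> rng G g = rng G a \<Longrightarrow> lpart U g = a"
  unfolding lpart_def by (simp add: the_inv_into_f_f bisection_rng_inj)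

lemma lpart_in:
  assumes "open_bisection G U" "g \<in> ldom U"
  shows "lpart U g \<in> U" "rng G (lpart U g) = rng G g" "lpart U g \<in> arrows G"
proof -
  obtain a where "a \<in> U" "rng G g = rng G a" using assms(2) unfolding ldom_def by blast
  then show "lpart U g \<in> U" "rng G (lpart U g) = rng G g" using lpart_eq[OF assms(1)] by auto
  then show "lpart U g \<in> arrows G" using bisection_arrow[OF assms(1)] by blast
qed

lemma openin_ldom:
  assumes "open_bisection G U"
  shows "openin (gtop G) (ldom U)"
  unfolding ldom_def
  by (rule openin_continuous_map_preimage[OF continuous_rng open_rng[OF bisection_openin[OF assms]]])

lemma continuous_lpart:
  assumes U: "open_bisection G U"
  shows "continuous_map (subtopology (gtop G) (ldom U)) (gtop G) (lpart U)"
proof -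
  have "continuous_map (subtopology (gtop G) (ldom U)) (subtopology (unit_top G) (rng G ` U)) (rng G)"
    by (intro continuous_map_into_subtopology continuous_map_from_subtopology continuous_rng)
      (auto simp: ldom_def)
  moreover have "continuous_map (subtopology (unit_top G) (rng G ` U)) (gtop G) (the_inv_into U (rng G))"
    by (rule continuous_map_the_inv_into[OF bisection_openin[OF U] bisection_rng_inj[OF U] open_rng])
  ultimately have "continuous_map (subtopology (gtop G) (ldom U)) (gtop G) (the_inv_into U (rng G) \<circ> rng G)"
    by (rule continuous_map_compose)
  then show ?thesis by (simp add: lpart_def[abs_def] o_def)
qed


text \<open>For \<open>g\<close> in \<open>ldom U\<close> the pair of \<open>lpart U g\<close> and
  \<open>rpart U g\<close> is the only factorisation of \<open>g\<close> whose first factor lies in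
  \<open>U\<close>. Sums over factorisations collapse to this one when a section lives on
  \<open>U\<close>.\<close>

definition rpart :: "'g set \<Rightarrow> 'g \<Rightarrow> 'g"
  where "rpart U g = gmul G (ginv G (lpart U g)) g"

lemma rpart_props:
  assumes "open_bisection G U" "g \<in> ldom U"
  shows "rpart U g \<in> arrows G" "rng G (rpart U g) = src G (lpart U g)" "src G (rpart U g) = src G g"
    "gmul G (lpart U g) (rpart U g) = g"
  using lpart_in[OF assms] assms(2) inv_mul_arrow rng_inv_mul src_inv_mul mul_inv_left
  unfolding rpart_def ldom_def by auto

lemma rpart_mul:
  assumes "open_bisection G U" "a \<in> U" "h \<in> arrows G" "src G a = rng G h"
  shows "gmul G a h \<in> ldom U" "lpart U (gmul G a h) = a" "rpart U (gmul G a h) = h"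
proof -
  note a = bisection_arrow[OF assms(1,2)]
  have r: "rng G (gmul G a h) = rng G a" using rng_mul[OF a assms(3,4)] .
  show "gmul G a h \<in> ldom U" unfolding ldom_def using r assms a mul_closed by auto
  show l: "lpart U (gmul G a h) = a" by (rule lpart_eq[OF assms(1,2) r])
  show "rpart U (gmul G a h) = h" unfolding rpart_def l by (rule mul_left_inv[OF a assms(3,4)])
qed

lemma continuous_mul_maps:
  assumes "continuous_map Y (gtop G) f" "continuous_map Y (gtop G) h"
    "\<And>y. y \<in> topspace Y \<Longrightarrow> src G (f y) = rng G (h y)"
  shows "continuous_map Y (gtop G) (\<lambda>y. gmul G (f y) (h y))"
proof -
  have "continuous_map Y (subtopology (prod_topology (gtop G) (gtop G)) {(g, h). src G g = rng G h})
      (\<lambda>y. (f y, h y))"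
    by (intro continuous_map_into_subtopology continuous_map_pairedI assms) (use assms(3) in auto)
  from continuous_map_compose[OF this continuous_mul] show ?thesis by (simp add: o_def)
qed

lemma continuous_rpart:
  assumes U: "open_bisection G U"
  shows "continuous_map (subtopology (gtop G) (ldom U)) (gtop G) (rpart U)"
  unfolding rpart_def
proof (rule continuous_mul_maps)
  show "continuous_map (subtopology (gtop G) (ldom U)) (gtop G) (\<lambda>y. ginv G (lpart U y))"
    using continuous_map_compose[OF continuous_lpart[OF U] continuous_inv] by (simp add: o_def)
qed (use lpart_in[OF U] in \<open>auto simp: src_inv\<close>)

text \<open>
  The product of two bisections: \<open>g\<close> lies in \<open>U V\<close> iff the second factor of its only
  factorisation with first factor in \<open>U\<close> lies in \<open>V\<close>. In this form openness is immediate.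
\<close>

definition bmul :: "'g set \<Rightarrow> 'g set \<Rightarrow> 'g set"
  where "bmul U V = {g \<in> ldom U. rpart U g \<in> V}"

lemma bisection_bmul:
  assumes U: "open_bisection G U" and V: "open_bisection G V"
  shows "open_bisection G (bmul U V)"
proof -
  have top: "topspace (subtopology (gtop G) (ldom U)) = ldom U"
    using openin_subset[OF openin_ldom[OF U]] by auto
  have "openin (subtopology (gtop G) (ldom U)) (bmul U V)"
    using openin_continuous_map_preimage[OF continuous_rpart[OF U] bisection_openin[OF V]]
    unfolding bmul_def top .
  then have op: "openin (gtop G) (bmul U V)" using openin_ldom[OF U] openin_trans_full by blast
  \<comment> \<open>The first factor determines the range of the second, and the range map is
    injective on \<open>V\<close>.\<close>
  have key: "g = g'" if g: "g \<in> bmul U V" "g' \<in> bmul U V" and l: "lpart U g = lpart U g'" for g g'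
  proof -
    have d: "g \<in> ldom U" "rpart U g \<in> V" "g' \<in> ldom U" "rpart U g' \<in> V" using g unfolding bmul_def by auto
    have "rng G (rpart U g) = rng G (rpart U g')"
      using rpart_props(2)[OF U d(1)] rpart_props(2)[OF U d(3)] l by simp
    then have "rpart U g = rpart U g'" by (rule inj_onD[OF bisection_rng_inj[OF V] _ d(2,4)])
    with l have "gmul G (lpart U g) (rpart U g) = gmul G (lpart U g') (rpart U g')" by (rule arg_cong2)
    then show ?thesis unfolding rpart_props(4)[OF U d(1)] rpart_props(4)[OF U d(3)] .
  qed
  have "inj_on (rng G) (bmul U V)"
    by (rule inj_onI, rule key) (auto simp: lpart_def)
  \<comment> \<open>The factors are recovered from right to left: the source of \<open>g\<close>
    fixes the second factor, whose range is the source of the first.\<close>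
  moreover have "inj_on (src G) (bmul U V)"
  proof (rule inj_onI, rule key)
    fix g g' assume g: "g \<in> bmul U V" "g' \<in> bmul U V" "src G g = src G g'"
    have d: "g \<in> ldom U" "rpart U g \<in> V" "g' \<in> ldom U" "rpart U g' \<in> V" using g unfolding bmul_def by auto
    have "src G (rpart U g) = src G (rpart U g')"
      using rpart_props(3)[OF U d(1)] rpart_props(3)[OF U d(3)] g(3) by simp
    then have "rpart U g = rpart U g'" by (rule inj_onD[OF bisection_src_inj[OF V] _ d(2,4)])
    then have "src G (lpart U g) = src G (lpart U g')"
      using rpart_props(2)[OF U d(1)] rpart_props(2)[OF U d(3)] by simp
    then show "lpart U g = lpart U g'"
      by (rule inj_onD[OF bisection_src_inj[OF U]]) (intro lpart_in(1)[OF U] d(1,3))+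
  qed
  ultimately show ?thesis unfolding open_bisection_def using op by blast
qed

lemma bmul_iff:
  assumes "open_bisection G U" "a \<in> U" "h \<in> arrows G" "src G a = rng G h"
  shows "gmul G a h \<in> bmul U V \<longleftrightarrow> h \<in> V"
  unfolding bmul_def using rpart_mul[OF assms] by simp

text \<open>Local compactness and the Hausdorff property are assumed for the unit space only;
  neighbourhoods are lifted from there by the inverse of the range map on a bisection.\<close>

lemma compact_neighbourhood:
  assumes U: "openin (gtop G) U" and g: "g \<in> U"
  obtains W K where "openin (gtop G) W" "compactin (gtop G) K" "g \<in> W" "W \<subseteq> K" "K \<subseteq> U"
proof -
  obtain B where B: "open_bisection G B" "g \<in> B" "B \<subseteq> U" by (rule bisection_exists[OF U g]) blast
  have base: "neighbourhood_base_of (compactin (unit_top G)) (unit_top G)"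
    using locally_compact_space_neighbourhood_base units_locally_compact units_Hausdorff by blast
  have rB: "openin (unit_top G) (rng G ` B)" by (rule open_rng[OF bisection_openin[OF B(1)]])
  obtain V L where V: "openin (unit_top G) V" "compactin (unit_top G) L" "rng G g \<in> V" "V \<subseteq> L" "L \<subseteq> rng G ` B"
    using base[unfolded neighbourhood_base_of, rule_format, OF conjI[OF rB imageI[OF B(2)]]] by (elim exE conjE)
  have cont: "continuous_map (subtopology (unit_top G) (rng G ` B)) (gtop G) (the_inv_into B (rng G))"
    by (rule continuous_map_the_inv_into[OF bisection_openin[OF B(1)] bisection_rng_inj[OF B(1)] open_rng])
  have inv: "the_inv_into B (rng G) (rng G b) = b" if "b \<in> B" for b
    using that by (simp add: the_inv_into_f_f bisection_rng_inj[OF B(1)])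
  let ?W = "B \<inter> {h \<in> arrows G. rng G h \<in> V}"
  show ?thesis
  proof (rule that)
    show "openin (gtop G) ?W"
      using bisection_openin[OF B(1)] openin_continuous_map_preimage[OF continuous_rng V(1)] by blast
    show "compactin (gtop G) (the_inv_into B (rng G) ` L)"
      by (rule image_compactin[OF _ cont]) (use V in \<open>simp add: compactin_subtopology\<close>)
    show "g \<in> ?W" using B V bisection_arrow[OF B(1,2)] by blast
    show "?W \<subseteq> the_inv_into B (rng G) ` L"
    proof
      fix h assume h: "h \<in> ?W"
      then have "h = the_inv_into B (rng G) (rng G h)" using inv by simp
      then show "h \<in> the_inv_into B (rng G) ` L" using h V(4) by blast
    qed
    show "the_inv_into B (rng G) ` L \<subseteq> U" using V(5) inv B(3) by fastforce
  qed
qed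

lemma principal_Hausdorff:
  assumes "principal_groupoid G"
  shows "Hausdorff_space (gtop G)"
proof (rule Hausdorff_space_injective_preimage)
  show "continuous_map (gtop G) (prod_topology (unit_top G) (unit_top G)) (\<lambda>g. (rng G g, src G g))"
    by (intro continuous_map_pairedI continuous_rng continuous_src)
  show "inj_on (\<lambda>g. (rng G g, src G g)) (topspace (gtop G))"
    using assms unfolding principal_groupoid_def .
  show "Hausdorff_space (prod_topology (unit_top G) (unit_top G))"
    using units_Hausdorff by (simp add: Hausdorff_space_prod_topology)
qed

end

section \<open>Consequences of a Hausdorff arrow space\<close>

locale hausdorff_etale_groupoid = etale_groupoid +
  assumes Hausdorff: "Hausdorff_space (gtop G)"
begin

text \<open>The units are where the range map agrees with the identity, and such a set is closed
  when the target is Hausdorff.\<close>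

lemma closedin_units: "closedin (gtop G) (units G)"
proof -
  have "continuous_map (gtop G) (gtop G) (rng G)"
    using continuous_rng unfolding unit_top_def by (rule continuous_map_into_fulltopology)
  moreover have "continuous_map (gtop G) (gtop G) (\<lambda>g. g)" by simp
  ultimately show ?thesis
    unfolding units_eq by (rule closedin_continuous_maps_eq[OF Hausdorff])
qed

text \<open>Composable pairs form a closed set, being the coincidence set of two continuous maps
  into the Hausdorff unit space. They cut a compact set out of the product of \<open>K\<close> and
  \<open>L\<close>, and multiplication is continuous on it.\<close>

lemma compact_mul:
  assumes K: "compactin (gtop G) K" and L: "compactin (gtop G) L"
  shows "compactin (gtop G) {gmul G g h | g h. g \<in> K \<and> h \<in> L \<and> src G g = rng G h}"
proof -
  let ?P = "prod_topology (gtop G) (gtop G)"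
  have c: "continuous_map ?P (unit_top G) (src G \<circ> fst)" "continuous_map ?P (unit_top G) (rng G \<circ> snd)"
    by (rule continuous_map_compose[OF continuous_map_fst continuous_src],
        rule continuous_map_compose[OF continuous_map_snd continuous_rng])
  have "closedin ?P {p \<in> topspace ?P. (src G \<circ> fst) p = (rng G \<circ> snd) p}"
    by (rule closedin_continuous_maps_eq[OF units_Hausdorff c])
  moreover have "compactin ?P (K \<times> L)" using K L by (simp add: compactin_Times)
  ultimately have "compactin ?P ({p \<in> topspace ?P. (src G \<circ> fst) p = (rng G \<circ> snd) p} \<inter> (K \<times> L))"
    by (rule closed_Int_compactin)
  moreover have "({p \<in> topspace ?P. (src G \<circ> fst) p = (rng G \<circ> snd) p} \<inter> (K \<times> L))
      = {(g, h). g \<in> K \<and> h \<in> L \<and> src G g = rng G h}"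
    using compactin_subset_topspace[OF K] compactin_subset_topspace[OF L] by auto
  ultimately have "compactin (subtopology ?P {(g, h). src G g = rng G h})
      {(g, h). g \<in> K \<and> h \<in> L \<and> src G g = rng G h}"
    by (auto simp: compactin_subtopology)
  from image_compactin[OF this continuous_mul]
  have "compactin (gtop G) ((\<lambda>(g, h). gmul G g h) ` {(g, h). g \<in> K \<and> h \<in> L \<and> src G g = rng G h})" .
  moreover have "(\<lambda>(g, h). gmul G g h) ` {(g, h). g \<in> K \<and> h \<in> L \<and> src G g = rng G h}
      = {gmul G g h | g h. g \<in> K \<and> h \<in> L \<and> src G g = rng G h}" by auto
  ultimately show ?thesis by simp
qed

end


section \<open>Fell line bundles\<close>

context twisted_etale_groupoid
begin

sublocale VL: vector_space "lscale L"
  by (rule scale_vector_space)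

lemma fib_0: "g \<in> arrows G \<Longrightarrow> 0 \<in> fib L g"
  by (rule VL.subspace_0[OF fib_subspace])

lemma fib_add: "g \<in> arrows G \<Longrightarrow> a \<in> fib L g \<Longrightarrow> b \<in> fib L g \<Longrightarrow> a + b \<in> fib L g"
  by (rule VL.subspace_add[OF fib_subspace])

lemma fib_diff: "g \<in> arrows G \<Longrightarrow> a \<in> fib L g \<Longrightarrow> b \<in> fib L g \<Longrightarrow> a - b \<in> fib L g"
  by (rule VL.subspace_diff[OF fib_subspace])

lemma fib_scale: "g \<in> arrows G \<Longrightarrow> a \<in> fib L g \<Longrightarrow> lscale L z a \<in> fib L g"
  by (rule VL.subspace_scale[OF fib_subspace])

lemma norm_0: "g \<in> arrows G \<Longrightarrow> lnorm L g 0 = 0"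
  using norm_eq_0 fib_0 by blast

lemma norm_pos: "g \<in> arrows G \<Longrightarrow> a \<in> fib L g \<Longrightarrow> a \<noteq> 0 \<Longrightarrow> 0 < lnorm L g a"
  using norm_eq_0 norm_nonneg by (metis less_eq_real_def)

lemma lmul_0_left: "\<lbrakk>g \<in> arrows G; h \<in> arrows G; src G g = rng G h; b \<in> fib L h\<rbrakk> \<Longrightarrow> lmul L g h 0 b = 0"
  using lmul_scale_left[of g h 0 b 0] by (simp add: fib_0)

lemma lmul_0_right: "\<lbrakk>g \<in> arrows G; h \<in> arrows G; src G g = rng G h; a \<in> fib L g\<rbrakk> \<Longrightarrow> lmul L g h a 0 = 0"
  using lmul_scale_right[of g h a 0 0] by (simp add: fib_0)

lemma lstar_0: "g \<in> arrows G \<Longrightarrow> lstar L g 0 = 0"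
  using lstar_scale[of g 0 0] by (simp add: fib_0)

lemma fib_spanned:
  assumes g: "g \<in> arrows G"
  obtains b where "b \<in> fib L g" "b \<noteq> 0" "\<And>a. a \<in> fib L g \<Longrightarrow> \<exists>z. a = lscale L z b"
proof -
  obtain B where B: "B \<subseteq> fib L g" "VL.independent B" "fib L g \<subseteq> VL.span B" "card B = VL.dim (fib L g)"
    using VL.basis_exists by blast
  then have "card B = 1" using fib_one_dimensional[OF g] by simp
  then obtain b where b: "B = {b}" by (rule card_1_singletonE)
  have "b \<noteq> 0" using B(2) VL.dependent_zero unfolding b by blast
  moreover have "\<exists>z. a = lscale L z b" if "a \<in> fib L g" for a
    using B(3) that unfolding b VL.span_singleton by blast
  ultimately show ?thesis using that[of b] B(1) b by blast
qed

lemma fib_multiple: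
  assumes "g \<in> arrows G" "a \<in> fib L g" "b \<in> fib L g" "b \<noteq> 0"
  obtains z where "a = lscale L z b"
proof -
  obtain c where c: "c \<in> fib L g" "c \<noteq> 0" "\<And>a. a \<in> fib L g \<Longrightarrow> \<exists>z. a = lscale L z c"
    by (rule fib_spanned[OF assms(1)]) blast
  obtain z w where zw: "a = lscale L z c" "b = lscale L w c" using c(3) assms(2,3) by blast
  then have "w \<noteq> 0" using assms(4) by auto
  then have "a = lscale L (z / w) b" using zw by simp
  then show ?thesis by (rule that)
qed

lemma gmul_units: "x \<in> units G \<Longrightarrow> gmul G x x = x"
  using rng_mul_left[OF unit_arrow] rng_unit by force

lemma lmul_unit_closed: "x \<in> units G \<Longrightarrow> a \<in> fib L x \<Longrightarrow> b \<in> fib L x \<Longrightarrow> lmul L x x a b \<in> fib L x"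
  using lmul_closed[of x x a b] by (simp add: unit_arrow rng_unit src_unit gmul_units)


lemma lstar_unit_closed: "x \<in> units G \<Longrightarrow> a \<in> fib L x \<Longrightarrow> lstar L x a \<in> fib L x"
  using lstar_closed[of x a] by (simp add: unit_arrow inv_unit)

lemma lstar_unit_lmul: "x \<in> units G \<Longrightarrow> a \<in> fib L x \<Longrightarrow> b \<in> fib L x \<Longrightarrow>
    lstar L x (lmul L x x a b) = lmul L x x (lstar L x b) (lstar L x a)"
  using lstar_lmul[of x x a b] by (simp add: unit_arrow inv_unit rng_unit src_unit gmul_units)

lemma lstar_unit_lstar: "x \<in> units G \<Longrightarrow> a \<in> fib L x \<Longrightarrow> lstar L x (lstar L x a) = a"
  using lstar_lstar[of x a] by (simp add: unit_arrow inv_unit)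

lemma norm_lstar_lmul_unit: "x \<in> units G \<Longrightarrow> a \<in> fib L x \<Longrightarrow> lnorm L x (lmul L x x (lstar L x a) a) = (lnorm L x a)\<^sup>2"
  using norm_lstar_lmul[of x a] by (simp add: unit_arrow inv_unit src_unit)

text \<open>For nonzero \<open>a\<close> the element \<open>p = a* a\<close> is self-adjoint and
  nonzero by the C*-identity. Then \<open>p p\<close> is nonzero for the same reason, hence equals
  \<open>z p\<close> with \<open>z\<close> nonzero, and dividing \<open>p\<close> by
  \<open>z\<close> gives an idempotent that acts as the identity on the line it spans.\<close>

lemma fib_one_exists:
  assumes x: "x \<in> units G"
  shows "\<exists>u. u \<in> fib L x \<and> (\<forall>a\<in>fib L x. lmul L x x u a = a \<and> lmul L x x a u = a)"
proof -
  note xA = unit_arrow[OF x]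
  obtain a where a: "a \<in> fib L x" "a \<noteq> 0" by (rule fib_spanned[OF xA]) blast
  define p where "p = lmul L x x (lstar L x a) a"
  have p: "p \<in> fib L x" unfolding p_def by (intro lmul_unit_closed lstar_unit_closed x a)
  have "lnorm L x p = (lnorm L x a)\<^sup>2" unfolding p_def by (rule norm_lstar_lmul_unit[OF x a(1)])
  then have p0: "p \<noteq> 0" using norm_pos[OF xA a] norm_0[OF xA] by auto
  have "lstar L x p = p"
    unfolding p_def using a x by (simp add: lstar_unit_lmul lstar_unit_closed lstar_unit_lstar)
  then have "lnorm L x (lmul L x x p p) = (lnorm L x p)\<^sup>2" using norm_lstar_lmul_unit[OF x p] by simp
  then have pp0: "lmul L x x p p \<noteq> 0" using norm_pos[OF xA p p0] norm_0[OF xA] by auto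
  obtain z where z: "lmul L x x p p = lscale L z p"
    by (rule fib_multiple[OF xA lmul_unit_closed[OF x p p] p p0]) blast
  have z0: "z \<noteq> 0" using z pp0 by auto
  define u where "u = lscale L (inverse z) p"
  have u: "u \<in> fib L x" unfolding u_def by (rule fib_scale[OF xA p])
  have "lmul L x x u b = b \<and> lmul L x x b u = b" if b: "b \<in> fib L x" for b
  proof -
    obtain w where w: "b = lscale L w p" by (rule fib_multiple[OF xA b p p0]) blast
    show ?thesis
      unfolding w u_def using p xA x z z0
      by (simp add: lmul_scale_left lmul_scale_right rng_unit src_unit fib_scale)
  qed
  then show ?thesis using u by blast
qed

lemma fib_one_unique:
  assumes x: "x \<in> units G" and u: "u \<in> fib L x" "\<And>a. a \<in> fib L x \<Longrightarrow> lmul L x x u a = a"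
    and v: "v \<in> fib L x" "\<And>a. a \<in> fib L x \<Longrightarrow> lmul L x x a v = a"
  shows "u = v"
  using u(2)[OF v(1)] v(2)[OF u(1)] by simp

lemma fib_one:
  assumes x: "x \<in> units G"
  shows "fib_one L x \<in> fib L x" "\<And>a. a \<in> fib L x \<Longrightarrow> lmul L x x (fib_one L x) a = a"
    "\<And>a. a \<in> fib L x \<Longrightarrow> lmul L x x a (fib_one L x) = a"
proof -
  have "\<exists>!u. u \<in> fib L x \<and> (\<forall>a\<in>fib L x. lmul L x x u a = a \<and> lmul L x x a u = a)"
    using fib_one_exists[OF x] fib_one_unique[OF x] by blast
  from theI'[OF this]
  show "fib_one L x \<in> fib L x" "\<And>a. a \<in> fib L x \<Longrightarrow> lmul L x x (fib_one L x) a = a"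
    "\<And>a. a \<in> fib L x \<Longrightarrow> lmul L x x a (fib_one L x) = a"
    unfolding fib_one_def[symmetric] by auto
qed

text \<open>With \<open>u\<close> the unit, \<open>u* a\<close> is the adjoint of
  \<open>a* u = a*\<close>, hence \<open>a\<close>. So \<open>u*\<close> is a left unit, and a left
  unit coincides with a right one.\<close>

lemma lstar_fib_one: assumes x: "x \<in> units G" shows "lstar L x (fib_one L x) = fib_one L x"
proof (rule fib_one_unique[OF x])
  note o = fib_one[OF x]
  show "lstar L x (fib_one L x) \<in> fib L x" by (intro lstar_unit_closed x o)
  show "lmul L x x (lstar L x (fib_one L x)) a = a" if a: "a \<in> fib L x" for a
    using lstar_unit_lmul[OF x lstar_unit_closed[OF x a] o(1)] o(3)[OF lstar_unit_closed[OF x a]]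
      lstar_unit_lstar[OF x a] by simp
qed (use fib_one[OF x] in auto)

lemma fib_one_nonzero: assumes x: "x \<in> units G" shows "fib_one L x \<noteq> 0"
proof
  assume 0: "fib_one L x = 0"
  note xA = unit_arrow[OF x]
  obtain a where a: "a \<in> fib L x" "a \<noteq> 0" by (rule fib_spanned[OF xA]) blast
  then show False using fib_one(2)[OF x a(1)] lmul_0_left[OF xA xA _ a(1)] 0 by (simp add: rng_unit src_unit x)
qed

lemma norm_fib_one: assumes x: "x \<in> units G" shows "lnorm L x (fib_one L x) = 1"
  using norm_lstar_lmul_unit[OF x fib_one(1)[OF x]] lstar_fib_one[OF x] fib_one(2)[OF x fib_one(1)[OF x]]
    norm_pos[OF unit_arrow[OF x] fib_one(1)[OF x] fib_one_nonzero[OF x]]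
  by (simp add: power2_eq_square)

lemma unit_coord_eqI: "x \<in> units G \<Longrightarrow> a = lscale L z (fib_one L x) \<Longrightarrow> unit_coord L x a = z"
  unfolding unit_coord_def by (rule the_equality) (auto simp: fib_one_nonzero)

lemma unit_coord:
  assumes x: "x \<in> units G" and a: "a \<in> fib L x"
  shows "a = lscale L (unit_coord L x a) (fib_one L x)"
proof -
  obtain z where "a = lscale L z (fib_one L x)"
    by (rule fib_multiple[OF unit_arrow[OF x] a fib_one(1)[OF x] fib_one_nonzero[OF x]]) blast
  then show ?thesis using unit_coord_eqI[OF x] by simp
qed

lemma unit_coord_one: "x \<in> units G \<Longrightarrow> unit_coord L x (fib_one L x) = 1"
  by (rule unit_coord_eqI) auto

lemma unit_coord_0: "x \<in> units G \<Longrightarrow> unit_coord L x 0 = 0"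
  by (rule unit_coord_eqI) auto

lemma unit_coord_scale: "x \<in> units G \<Longrightarrow> a \<in> fib L x \<Longrightarrow> unit_coord L x (lscale L z a) = z * unit_coord L x a"
  using unit_coord[of x a] by (intro unit_coord_eqI) (auto simp flip: VL.scale_scale)

lemma unit_coord_add: "x \<in> units G \<Longrightarrow> a \<in> fib L x \<Longrightarrow> b \<in> fib L x \<Longrightarrow>
    unit_coord L x (a + b) = unit_coord L x a + unit_coord L x b"
  using unit_coord[of x a] unit_coord[of x b]
  by (intro unit_coord_eqI) (auto simp: VL.scale_left_distrib)

lemma unit_coord_diff: "x \<in> units G \<Longrightarrow> a \<in> fib L x \<Longrightarrow> b \<in> fib L x \<Longrightarrow>
    unit_coord L x (a - b) = unit_coord L x a - unit_coord L x b"
  using unit_coord_add[of x "a - b" b] by (simp add: fib_diff unit_arrow)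

lemma cmod_unit_coord: "x \<in> units G \<Longrightarrow> a \<in> fib L x \<Longrightarrow> cmod (unit_coord L x a) = lnorm L x a"
  using norm_scale[of x "fib_one L x" "unit_coord L x a"] unit_coord[of x a]
  by (simp add: unit_arrow fib_one norm_fib_one)

lemma unit_coord_lmul:
  assumes "x \<in> units G" "a \<in> fib L x" "b \<in> fib L x"
  shows "unit_coord L x (lmul L x x a b) = unit_coord L x a * unit_coord L x b"
proof (rule unit_coord_eqI[OF assms(1)])
  note o = fib_one[OF assms(1)] and xA = unit_arrow[OF assms(1)]
  let ?z = "unit_coord L x a" and ?w = "unit_coord L x b"
  have "lmul L x x (lscale L ?z (fib_one L x)) (lscale L ?w (fib_one L x)) = lscale L (?z * ?w) (fib_one L x)"
    using o xA assms(1) by (simp add: lmul_scale_left lmul_scale_right fib_scale rng_unit src_unit)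
  then show "lmul L x x a b = lscale L (?z * ?w) (fib_one L x)"
    using unit_coord[OF assms(1,2)] unit_coord[OF assms(1,3)] by simp
qed

lemma unit_coord_lstar:
  assumes "x \<in> units G" "a \<in> fib L x"
  shows "unit_coord L x (lstar L x a) = cnj (unit_coord L x a)"
proof (rule unit_coord_eqI[OF assms(1)])
  have "lstar L x (lscale L (unit_coord L x a) (fib_one L x)) = lscale L (cnj (unit_coord L x a)) (fib_one L x)"
    using fib_one[OF assms(1)] unit_arrow[OF assms(1)] lstar_fib_one[OF assms(1)] by (simp add: lstar_scale)
  then show "lstar L x a = lscale L (cnj (unit_coord L x a)) (fib_one L x)"
    using unit_coord[OF assms] by simp
qed

lemma lmul_closed': "\<lbrakk>g \<in> arrows G; h \<in> arrows G; src G g = rng G h; k = gmul G g h; a \<in> fib L g; b \<in> fib L h\<rbrakk>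
    \<Longrightarrow> lmul L g h a b \<in> fib L k"
  using lmul_closed by simp

lemma lstar_lmul_fib: "g \<in> arrows G \<Longrightarrow> a \<in> fib L g \<Longrightarrow> b \<in> fib L g \<Longrightarrow>
    lmul L (ginv G g) g (lstar L g a) b \<in> fib L (src G g)"
  by (rule lmul_closed') (auto simp: inv_closed src_inv inv_mul lstar_closed)

lemma lmul_inv_fib: "g \<in> arrows G \<Longrightarrow> a \<in> fib L g \<Longrightarrow> b \<in> fib L (ginv G g) \<Longrightarrow>
    lmul L g (ginv G g) a b \<in> fib L (rng G g)"
  by (rule lmul_closed') (auto simp: inv_closed rng_inv mul_inv)

lemma inv_lmul_fib: "g \<in> arrows G \<Longrightarrow> a \<in> fib L g \<Longrightarrow> b \<in> fib L (ginv G g) \<Longrightarrow>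
    lmul L (ginv G g) g b a \<in> fib L (src G g)"
  by (rule lmul_closed') (auto simp: inv_closed src_inv inv_mul)

lemma lmul_triple:
  assumes g: "g \<in> arrows G" and a: "a \<in> fib L g" and b: "b \<in> fib L (ginv G g)" and c: "c \<in> fib L g"
  shows "lmul L (rng G g) g (lmul L g (ginv G g) a b) c = lmul L g (src G g) a (lmul L (ginv G g) g b c)"
  using lmul_assoc[of g "ginv G g" g a b c] assms
  by (simp add: inv_closed rng_inv src_inv mul_inv inv_mul)

text \<open>
  A nonzero \<open>a\<close> in a fibre is a multiple of \<open>a a* a\<close>, on which the units of the fibres over its
  range and source act trivially by associativity.
\<close>

lemma fib_one_lmul:
  assumes g: "g \<in> arrows G" and a: "a \<in> fib L g"
  shows "lmul L (rng G g) g (fib_one L (rng G g)) a = a" "lmul L g (src G g) a (fib_one L (src G g)) = a"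
proof -
  have "lmul L (rng G g) g (fib_one L (rng G g)) a = a \<and> lmul L g (src G g) a (fib_one L (src G g)) = a"
  proof (cases "a = 0")
    case True
    then show ?thesis using g fib_one rng_in_units src_in_units
      by (simp add: lmul_0_left lmul_0_right rng_closed src_closed src_rng rng_src)
  next
    case False
    note r = rng_in_units[OF g] and s = src_in_units[OF g] and rA = rng_closed[OF g] and sA = src_closed[OF g]
    define c where "c = lmul L g (ginv G g) a (lstar L g a)"
    define d where "d = lmul L (ginv G g) g (lstar L g a) a"
    define b where "b = lmul L (rng G g) g c a"
    have st: "lstar L g a \<in> fib L (ginv G g)" by (rule lstar_closed[OF g a])
    have c: "c \<in> fib L (rng G g)" unfolding c_def by (rule lmul_inv_fib[OF g a st])
    have d: "d \<in> fib L (src G g)" unfolding d_def by (rule inv_lmul_fib[OF g a st])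
    have b: "b \<in> fib L g" unfolding b_def
      by (rule lmul_closed'[OF rA g _ _ c a]) (simp_all add: g src_rng rng_mul_left)
    have b': "b = lmul L g (src G g) a d" unfolding b_def c_def d_def by (rule lmul_triple[OF g a st a])
    have "lmul L (ginv G g) g (lstar L g a) b = lmul L (src G g) (src G g) d d"
      unfolding b' using lmul_assoc[of "ginv G g" g "src G g" "lstar L g a" a d] g a st d
      by (simp add: inv_closed src_inv inv_mul mul_src_right rng_src src_closed d_def)
    moreover have "lmul L (src G g) (src G g) d d \<noteq> 0"
    proof
      assume "lmul L (src G g) (src G g) d d = 0"
      then have "unit_coord L (src G g) d = 0"
        using unit_coord_lmul[OF s d d] unit_coord_0[OF s] by simp
      then have "lnorm L (src G g) d = 0" using cmod_unit_coord[OF s d] by simp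
      then show False using norm_lstar_lmul[OF g a] norm_pos[OF g a False] by (simp add: d_def)
    qed
    ultimately have b0: "b \<noteq> 0" using lmul_0_right[OF inv_closed[OF g] g _ st] g by (auto simp: src_inv)
    obtain z where z: "a = lscale L z b" by (rule fib_multiple[OF g a b b0]) blast
    have "lmul L (rng G g) g (fib_one L (rng G g)) b = b"
      unfolding b_def
      using lmul_assoc[of "rng G g" "rng G g" g "fib_one L (rng G g)" c a] g a c fib_one[OF r] r
      by (simp add: rA rng_rng src_rng gmul_units rng_mul_left)
    moreover have "lmul L g (src G g) b (fib_one L (src G g)) = b"
      unfolding b'
      using lmul_assoc[of g "src G g" "src G g" a d "fib_one L (src G g)"] g a d fib_one[OF s] s
      by (simp add: sA rng_src src_src gmul_units mul_src_right)
    moreover have "lmul L (rng G g) g (fib_one L (rng G g)) (lscale L z b)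
        = lscale L z (lmul L (rng G g) g (fib_one L (rng G g)) b)"
      by (rule lmul_scale_right) (use g b fib_one[OF r] rA src_rng in auto)
    moreover have "lmul L g (src G g) (lscale L z b) (fib_one L (src G g))
        = lscale L z (lmul L g (src G g) b (fib_one L (src G g)))"
      by (rule lmul_scale_left) (use g b fib_one[OF s] sA rng_src in auto)
    ultimately show ?thesis using z by simp
  qed
  then show "lmul L (rng G g) g (fib_one L (rng G g)) a = a" "lmul L g (src G g) a (fib_one L (src G g)) = a"
    by auto
qed

text \<open>The tracial property at the level of one arrow. The two coordinates are the scalars by
  which \<open>(a b) a\<close> and \<open>a (b a)\<close> differ from \<open>a\<close>, and these
  products are equal.\<close>

lemma unit_coord_commute:
  assumes g: "g \<in> arrows G" and a: "a \<in> fib L g" and b: "b \<in> fib L (ginv G g)"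
  shows "unit_coord L (rng G g) (lmul L g (ginv G g) a b) = unit_coord L (src G g) (lmul L (ginv G g) g b a)"
proof (cases "a = 0")
  case True
  then show ?thesis using g b
    by (simp add: lmul_0_left lmul_0_right inv_closed rng_inv src_inv unit_coord_0 rng_in_units src_in_units)
next
  case False
  note r = rng_in_units[OF g] and s = src_in_units[OF g]
  note c = unit_coord[OF r lmul_inv_fib[OF g a b]] and d = unit_coord[OF s inv_lmul_fib[OF g a b]]
  let ?z = "unit_coord L (rng G g) (lmul L g (ginv G g) a b)"
  let ?w = "unit_coord L (src G g) (lmul L (ginv G g) g b a)"
  have "lmul L (rng G g) g (lmul L g (ginv G g) a b) a = lscale L ?z a"
    by (subst c) (use g a r fib_one[OF r] fib_one_lmul[OF g a] in \<open>simp add: lmul_scale_left rng_closed src_rng\<close>)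
  moreover have "lmul L g (src G g) a (lmul L (ginv G g) g b a) = lscale L ?w a"
    by (subst d) (use g a s fib_one[OF s] fib_one_lmul[OF g a] in \<open>simp add: lmul_scale_right src_closed rng_src\<close>)
  ultimately have "lscale L ?z a = lscale L ?w a" unfolding lmul_triple[OF g a b a] by (rule trans[OF sym])
  with False show ?thesis by (simp only: VL.scale_cancel_right) blast
qed

section \<open>The inner product of a fibre\<close>

definition ip :: "'g \<Rightarrow> 'v \<Rightarrow> 'v \<Rightarrow> complex"
  where "ip g a b = unit_coord L (src G g) (lmul L (ginv G g) g (lstar L g a) b)"

text \<open>Positivity in the bundle makes the coordinate a nonnegative real number, and the
  C*-identity gives its modulus.\<close>

lemma ip_self:
  assumes g: "g \<in> arrows G" and a: "a \<in> fib L g"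
  shows "ip g a a = complex_of_real ((lnorm L g a)\<^sup>2)"
proof -
  note s = src_in_units[OF g]
  obtain b where b: "b \<in> fib L (src G g)"
    "lmul L (ginv G g) g (lstar L g a) a = lmul L (src G g) (src G g) (lstar L (src G g) b) b"
    using lstar_lmul_positive[OF g a] by blast
  have "ip g a a = cnj (unit_coord L (src G g) b) * unit_coord L (src G g) b"
    unfolding ip_def b(2) using b(1) s
    by (simp add: unit_coord_lmul lstar_unit_closed unit_coord_lstar)
  also have "\<dots> = complex_of_real ((cmod (unit_coord L (src G g) b))\<^sup>2)"
    unfolding complex_norm_square by (rule mult.commute)
  finally have "ip g a a = complex_of_real ((cmod (unit_coord L (src G g) b))\<^sup>2)" .
  moreover have "cmod (ip g a a) = (lnorm L g a)\<^sup>2"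
    unfolding ip_def using cmod_unit_coord[OF s lstar_lmul_fib[OF g a a]] norm_lstar_lmul[OF g a] by simp
  ultimately show ?thesis by (metis abs_of_nonneg norm_of_real zero_le_power2)
qed

text \<open>The C*-identity and submultiplicativity give one inequality; the other is the same
  inequality for the adjoint vector.\<close>

lemma norm_lstar:
  assumes g: "g \<in> arrows G" and a: "a \<in> fib L g"
  shows "lnorm L (ginv G g) (lstar L g a) = lnorm L g a"
proof -
  have le: "lnorm L h b \<le> lnorm L (ginv G h) (lstar L h b)" if h: "h \<in> arrows G" and b: "b \<in> fib L h" for h b
  proof (cases "b = 0")
    case True
    then show ?thesis using h by (simp add: lstar_0 norm_0 inv_closed)
  next
    case False
    have "lnorm L (gmul G (ginv G h) h) (lmul L (ginv G h) h (lstar L h b) b) \<le> lnorm L (ginv G h) (lstar L h b) * lnorm L h b"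
      by (rule norm_lmul) (use h b in \<open>auto simp: inv_closed src_inv lstar_closed\<close>)
    then have "lnorm L h b * lnorm L h b \<le> lnorm L (ginv G h) (lstar L h b) * lnorm L h b"
      using norm_lstar_lmul[OF h b] h by (simp add: inv_mul power2_eq_square)
    then show ?thesis using norm_pos[OF h b False] by simp
  qed
  show ?thesis
    using le[OF g a] le[OF inv_closed[OF g] lstar_closed[OF g a]] lstar_lstar[OF g a] inv_inv[OF g] by simp
qed

lemma ip_add_right: "\<lbrakk>g \<in> arrows G; a \<in> fib L g; b \<in> fib L g; c \<in> fib L g\<rbrakk> \<Longrightarrow> ip g a (b + c) = ip g a b + ip g a c"
  unfolding ip_def
  by (simp add: lmul_add_right inv_closed src_inv lstar_closed unit_coord_add src_in_units lstar_lmul_fib)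

lemma ip_scale_right: "\<lbrakk>g \<in> arrows G; a \<in> fib L g; b \<in> fib L g\<rbrakk> \<Longrightarrow> ip g a (lscale L z b) = z * ip g a b"
  unfolding ip_def
  by (simp add: lmul_scale_right inv_closed src_inv lstar_closed unit_coord_scale src_in_units lstar_lmul_fib)

lemma ip_cnj:
  assumes g: "g \<in> arrows G" and a: "a \<in> fib L g" and b: "b \<in> fib L g"
  shows "ip g b a = cnj (ip g a b)"
proof -
  have "lstar L (src G g) (lmul L (ginv G g) g (lstar L g a) b) = lmul L (ginv G g) g (lstar L g b) a"
    using lstar_lmul[of "ginv G g" g "lstar L g a" b] assms
    by (simp add: inv_closed src_inv inv_mul lstar_closed lstar_lstar inv_inv)
  then show ?thesis
    unfolding ip_def using unit_coord_lstar[OF src_in_units[OF g] lstar_lmul_fib[OF g a b]] by simp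
qed

lemma cmod_ip:
  assumes g: "g \<in> arrows G" and a: "a \<in> fib L g" and b: "b \<in> fib L g"
  shows "cmod (ip g a b) \<le> lnorm L g a * lnorm L g b"
proof -
  have "lnorm L (gmul G (ginv G g) g) (lmul L (ginv G g) g (lstar L g a) b) \<le> lnorm L (ginv G g) (lstar L g a) * lnorm L g b"
    by (rule norm_lmul) (use g a b in \<open>auto simp: inv_closed src_inv lstar_closed\<close>)
  then show ?thesis
    unfolding ip_def using cmod_unit_coord[OF src_in_units[OF g] lstar_lmul_fib[OF g a b]] norm_lstar[OF g a] g
    by (simp add: inv_mul)
qed

text \<open>The summand by summand form of the adjoint relation for convolution operators.\<close>

lemma ip_adjoint:
  assumes g: "g \<in> arrows G" and h: "h \<in> arrows G" and gh: "src G g = rng G h"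
    and a: "a \<in> fib L g" and x: "x \<in> fib L h" and y: "y \<in> fib L (gmul G g h)"
  shows "ip (gmul G g h) (lmul L g h a x) y = ip h x (lmul L (ginv G g) (gmul G g h) (lstar L g a) y)"
proof -
  have m: "gmul G g h \<in> arrows G" "rng G (gmul G g h) = rng G g" "src G (gmul G g h) = src G h"
    using g h gh by (simp_all add: mul_closed rng_mul src_mul)
  show ?thesis
    unfolding ip_def
    using lmul_assoc[of "ginv G h" "ginv G g" "gmul G g h" "lstar L h x" "lstar L g a" y] g h gh a x y m
    by (simp add: inv_gmul lstar_lmul inv_closed src_inv rng_inv lstar_closed mul_left_inv)
qed

section \<open>Continuous maps into the total space\<close>

lemma Lcont_base: "continuous_map Y (ltop L) (\<lambda>y. (g y, a y)) \<Longrightarrow> continuous_map Y (gtop G) g"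
  using continuous_map_compose[OF _ continuous_proj, of Y "\<lambda>y. (g y, a y)"] by (simp add: o_def)

lemma Lcont_fib:
  assumes "continuous_map Y (ltop L) (\<lambda>y. (g y, a y))" "y \<in> topspace Y"
  shows "g y \<in> arrows G" "a y \<in> fib L (g y)"
  using continuous_map_image_subset_topspace[OF assms(1)] assms(2) unfolding topspace_total by auto

lemma Lcont_norm: "continuous_map Y (ltop L) (\<lambda>y. (g y, a y)) \<Longrightarrow> continuous_map Y euclidean (\<lambda>y. lnorm L (g y) (a y))"
  using continuous_map_compose[OF _ continuous_norm, of Y "\<lambda>y. (g y, a y)"] by (simp add: o_def)

lemma Lcont_mul:
  assumes "continuous_map Y (ltop L) (\<lambda>y. (g y, a y))" "continuous_map Y (ltop L) (\<lambda>y. (h y, b y))"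
    "\<And>y. y \<in> topspace Y \<Longrightarrow> src G (g y) = rng G (h y)"
  shows "continuous_map Y (ltop L) (\<lambda>y. (gmul G (g y) (h y), lmul L (g y) (h y) (a y) (b y)))"
proof -
  have "continuous_map Y (subtopology (prod_topology (ltop L) (ltop L)) {((g, a), (h, b)). src G g = rng G h})
      (\<lambda>y. ((g y, a y), (h y, b y)))"
    by (intro continuous_map_into_subtopology continuous_map_pairedI assms) (use assms(3) in auto)
  from continuous_map_compose[OF this continuous_lmul] show ?thesis by (simp add: o_def)
qed

lemma Lcont_add:
  assumes "continuous_map Y (ltop L) (\<lambda>y. (g y, a y))" "continuous_map Y (ltop L) (\<lambda>y. (g y, b y))"
  shows "continuous_map Y (ltop L) (\<lambda>y. (g y, a y + b y))"
proof -
  have "continuous_map Y (subtopology (prod_topology (ltop L) (ltop L)) {((g, a), (h, b)). g = h})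
      (\<lambda>y. ((g y, a y), (g y, b y)))"
    by (intro continuous_map_into_subtopology continuous_map_pairedI assms) auto
  from continuous_map_compose[OF this continuous_add] show ?thesis by (simp add: o_def)
qed

lemma Lcont_scale:
  assumes "continuous_map Y euclidean z" "continuous_map Y (ltop L) (\<lambda>y. (g y, a y))"
  shows "continuous_map Y (ltop L) (\<lambda>y. (g y, lscale L (z y) (a y)))"
proof -
  have "continuous_map Y (prod_topology euclidean (ltop L)) (\<lambda>y. (z y, (g y, a y)))"
    by (intro continuous_map_pairedI assms)
  from continuous_map_compose[OF this continuous_scale] show ?thesis by (simp add: o_def)
qed

lemma Lcont_star:
  assumes "continuous_map Y (ltop L) (\<lambda>y. (g y, a y))"
  shows "continuous_map Y (ltop L) (\<lambda>y. (ginv G (g y), lstar L (g y) (a y)))"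
  using continuous_map_compose[OF assms continuous_lstar] by (simp add: o_def)

lemma openin_nonzero:
  assumes "openin (gtop G) U"
  shows "openin (ltop L) {p \<in> topspace (ltop L). snd p \<noteq> 0 \<and> fst p \<in> U}"
proof -
  have "openin (ltop L) {p \<in> topspace (ltop L). (\<lambda>(g, a). lnorm L g a) p \<in> {0<..}}"
    by (rule openin_continuous_map_preimage[OF continuous_norm]) simp
  moreover have "openin (ltop L) {p \<in> topspace (ltop L). fst p \<in> U}"
    by (rule openin_continuous_map_preimage[OF continuous_proj assms])
  ultimately have "openin (ltop L) ({p \<in> topspace (ltop L). (\<lambda>(g, a). lnorm L g a) p \<in> {0<..}}
      \<inter> {p \<in> topspace (ltop L). fst p \<in> U})" by blast
  also have "({p \<in> topspace (ltop L). (\<lambda>(g, a). lnorm L g a) p \<in> {0<..}} \<inter> {p \<in> topspace (ltop L). fst p \<in> U})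
      = {p \<in> topspace (ltop L). snd p \<noteq> 0 \<and> fst p \<in> U}"
    unfolding topspace_total using norm_pos norm_0 by fastforce
  finally show ?thesis .
qed

text \<open>Continuity over the base can be tested on the nonzero vectors, as the projection is open.\<close>

lemma continuous_map_from_nonzero:
  assumes U: "openin (gtop G) U"
    and c: "continuous_map (subtopology (ltop L) {p \<in> topspace (ltop L). snd p \<noteq> 0 \<and> fst p \<in> U}) Y (\<lambda>p. F (fst p))"
  shows "continuous_map (subtopology (gtop G) U) Y F"
proof -
  let ?S = "{p \<in> topspace (ltop L). snd p \<noteq> 0 \<and> fst p \<in> U}"
  have UA: "U \<subseteq> arrows G" by (rule openin_subset[OF U])
  have "quotient_map (subtopology (ltop L) ?S) (subtopology (gtop G) U) fst"
  proof (rule continuous_open_imp_quotient_map)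
    show "continuous_map (subtopology (ltop L) ?S) (subtopology (gtop G) U) fst"
      by (intro continuous_map_into_subtopology continuous_map_from_subtopology continuous_proj) auto
    show "open_map (subtopology (ltop L) ?S) (subtopology (gtop G) U) fst"
      unfolding open_map_def openin_open_subtopology[OF openin_nonzero[OF U]] openin_open_subtopology[OF U]
      using open_proj unfolding open_map_def by blast
    show "fst ` topspace (subtopology (ltop L) ?S) = topspace (subtopology (gtop G) U)"
    proof -
      have "g \<in> fst ` ?S" if g: "g \<in> U" for g
      proof -
        have gA: "g \<in> arrows G" using g UA by blast
        obtain a where "a \<in> fib L g" "a \<noteq> 0" by (rule fib_spanned[OF gA]) blast
        then have "(g, a) \<in> ?S" using gA g by (simp add: topspace_total)
        then show ?thesis by force
      qed
      then show ?thesis using UA by auto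
    qed
  qed
  then show ?thesis by (rule continuous_compose_quotient_map) (use c in \<open>simp add: o_def\<close>)
qed

lemma Lcont_id: "continuous_map (subtopology (ltop L) S) (ltop L) (\<lambda>p. (fst p, snd p))"
  by (simp add: continuous_map_from_subtopology)

text \<open>Seen from the nonzero vectors, the section sends \<open>(g, a)\<close> to
  \<open>(g, 0 a)\<close>, and scalar multiplication is continuous.\<close>

lemma continuous_zero_section: "continuous_map (gtop G) (ltop L) (\<lambda>g. (g, 0))"
proof -
  have "continuous_map (subtopology (gtop G) (arrows G)) (ltop L) (\<lambda>g. (g, 0))"
  proof (rule continuous_map_from_nonzero)
    show "continuous_map (subtopology (ltop L) {p \<in> topspace (ltop L). snd p \<noteq> 0 \<and> fst p \<in> arrows G}) (ltop L) (\<lambda>p. (fst p, 0))"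
      using Lcont_scale[where z = "\<lambda>_. 0", OF _ Lcont_id] by simp
  qed simp
  then show ?thesis by simp
qed

text \<open>Seen from the nonzero vectors, the unit over \<open>x\<close> is \<open>a* a\<close>
  divided by the squared norm of \<open>a\<close>, an expression continuous in
  \<open>a\<close>.\<close>

lemma continuous_unit_section: "continuous_map (unit_top G) (ltop L) (\<lambda>x. (x, fib_one L x))"
  unfolding unit_top_def
proof (rule continuous_map_from_nonzero[OF openin_units])
  let ?T = "subtopology (ltop L) {p \<in> topspace (ltop L). snd p \<noteq> 0 \<and> fst p \<in> units G}"
  have 1: "continuous_map ?T (ltop L) (\<lambda>p. (gmul G (ginv G (fst p)) (fst p), lmul L (ginv G (fst p)) (fst p) (lstar L (fst p) (snd p)) (snd p)))"
    by (intro Lcont_mul Lcont_star Lcont_id) (auto simp: src_inv unit_arrow)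
  have "continuous_map ?T euclideanreal (\<lambda>p. inverse ((lnorm L (fst p) (snd p))\<^sup>2))"
    by (intro continuous_map_real_inverse continuous_map_real_pow Lcont_norm Lcont_id)
      (auto simp: topspace_total norm_eq_0)
  then have 2: "continuous_map ?T euclidean (\<lambda>p. complex_of_real (inverse ((lnorm L (fst p) (snd p))\<^sup>2)))"
    by (rule continuous_map_compose_on) (intro continuous_intros)
  from Lcont_scale[OF 2 1] show "continuous_map ?T (ltop L) (\<lambda>p. (fst p, fib_one L (fst p)))"
  proof (rule continuous_map_eq)
    fix p assume "p \<in> topspace ?T"
    then obtain x a where p: "p = (x, a)" "x \<in> units G" "a \<in> fib L x" "a \<noteq> 0"
      by (cases p) (auto simp: topspace_total)
    note xA = unit_arrow[OF p(2)]
    have "lmul L (ginv G x) x (lstar L x a) a = lscale L (complex_of_real ((lnorm L x a)\<^sup>2)) (fib_one L x)"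
      using unit_coord[OF p(2) lmul_unit_closed[OF p(2) lstar_unit_closed[OF p(2,3)] p(3)]] ip_self[OF xA p(3)] p(2)
      by (simp add: ip_def src_unit inv_unit)
    then show "(gmul G (ginv G (fst p)) (fst p), lscale L (complex_of_real (inverse ((lnorm L (fst p) (snd p))\<^sup>2)))
         (lmul L (ginv G (fst p)) (fst p) (lstar L (fst p) (snd p)) (snd p))) = (fst p, fib_one L (fst p))"
      using p norm_pos[OF xA p(3,4)] by (simp add: inv_unit gmul_units)
  qed
qed

text \<open>The coordinate differs from its value \<open>z\<close> at \<open>y0\<close> by the norm
  of \<open>a y - z 1\<close>, which depends continuously on \<open>y\<close>. Continuity of the
  norm is thus turned into continuity of a complex-valued function.\<close>

lemma continuous_unit_coord:
  assumes c: "continuous_map Y (ltop L) (\<lambda>y. (x y, a y))" and u: "\<And>y. y \<in> topspace Y \<Longrightarrow> x y \<in> units G"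
  shows "continuous_map Y euclidean (\<lambda>y. unit_coord L (x y) (a y))"
  unfolding continuous_map_dist_iff
proof (intro ballI allI impI)
  fix y0 \<epsilon> assume y0: "y0 \<in> topspace Y" and \<epsilon>: "0 < (\<epsilon>::real)"
  define z where "z = unit_coord L (x y0) (a y0)"
  have "continuous_map Y (unit_top G) x"
    unfolding unit_top_def using Lcont_base[OF c] u by (intro continuous_map_into_subtopology) auto
  then have "continuous_map Y (ltop L) (\<lambda>y. (x y, fib_one L (x y)))"
    using continuous_map_compose[OF _ continuous_unit_section] by (simp add: o_def)
  then have "continuous_map Y (ltop L) (\<lambda>y. (x y, a y + lscale L (- z) (fib_one L (x y))))"
    by (intro Lcont_add c Lcont_scale) simp_all
  then have "continuous_map Y euclideanreal (\<lambda>y. lnorm L (x y) (a y + lscale L (- z) (fib_one L (x y))))"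
    by (rule Lcont_norm)
  then have n: "continuous_map Y euclideanreal (\<lambda>y. cmod (unit_coord L (x y) (a y) - z))"
  proof (rule continuous_map_eq)
    fix y assume y: "y \<in> topspace Y"
    note f = Lcont_fib[OF c y] and uy = u[OF y]
    have "unit_coord L (x y) (a y + lscale L (- z) (fib_one L (x y))) = unit_coord L (x y) (a y) - z"
      using f uy fib_one[OF uy] by (simp add: unit_coord_add unit_coord_scale unit_coord_one fib_scale fib_diff unit_coord_diff)
    then show "lnorm L (x y) (a y + lscale L (- z) (fib_one L (x y))) = cmod (unit_coord L (x y) (a y) - z)"
      using cmod_unit_coord[OF uy fib_add[OF f fib_scale[OF f(1) fib_one(1)[OF uy], of "- z"]]] by simp
  qed
  then obtain U where U: "openin Y U" "y0 \<in> U"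
    "\<And>y. y \<in> U \<Longrightarrow> dist (cmod (unit_coord L (x y) (a y) - z)) (cmod (unit_coord L (x y0) (a y0) - z)) < \<epsilon>"
    using n[unfolded continuous_map_dist_iff, rule_format, OF y0 \<epsilon>] by (elim exE conjE) blast
  have "dist (unit_coord L (x y) (a y)) (unit_coord L (x y0) (a y0)) < \<epsilon>" if "y \<in> U" for y
    using U(3)[OF that] by (simp add: z_def dist_norm)
  then show "\<exists>U. openin Y U \<and> y0 \<in> U \<and> (\<forall>y\<in>U. dist (unit_coord L (x y) (a y)) (unit_coord L (x y0) (a y0)) < \<epsilon>)"
    using U(1,2) by blast
qed

end


section \<open>Local sections\<close>

text \<open>Rotation invariance of the mean over the circle, written on one period; it makes the
  averaged function below equivariant.\<close>

lemma integral_periodic_shift: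
  fixes h :: "real \<Rightarrow> 'a::euclidean_space"
  assumes cont: "continuous_on UNIV h" and per: "\<And>t. h (b + t) = h t" and s: "0 \<le> s" "s \<le> b"
  shows "integral {0..b} (\<lambda>t. h (s + t)) = integral {0..b} h"
proof -
  have int: "h integrable_on {x..y}" for x y
    by (intro integrable_continuous_real continuous_on_subset[OF cont]) simp
  have "integral {0..b} (\<lambda>t. h (s + t)) = integral {0 + s..b + s} h"
    using integral_shift_Icc_real[of 0 b h s] by (simp add: o_def)
  also have "\<dots> = integral {s..b} h + integral {b..b + s} h"
    using Henstock_Kurzweil_Integration.integral_combine[OF s(2) _ int, of "b + s"] s by simp
  also have "integral {b..b + s} h = integral {0..s} h"
    using integral_shift_Icc_real[of 0 s h b] per by (simp add: o_def add.commute)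
  also have "integral {s..b} h + integral {0..s} h = integral {0..b} h"
    using Henstock_Kurzweil_Integration.integral_combine[OF s int] by (simp add: add.commute)
  finally show ?thesis .
qed

text \<open>The interval is compact, so the tube lemma makes the integrands for \<open>y\<close>
  near \<open>y0\<close> uniformly close. The denominator \<open>b + 1\<close> avoids dividing by 0
  when the interval is a point.\<close>

lemma continuous_map_parametric_integral:
  fixes H :: "real \<Rightarrow> 'y \<Rightarrow> complex"
  assumes c: "continuous_map (prod_topology (top_of_set {0..b}) Y) euclidean (\<lambda>(t, y). H t y)"
    and b: "0 \<le> b"
  shows "continuous_map Y euclidean (\<lambda>y. integral {0..b} (\<lambda>t. H t y))"
  unfolding continuous_map_dist_iff
proof (intro ballI allI impI)
  fix y0 \<epsilon> assume y0: "y0 \<in> topspace Y" and \<epsilon>: "0 < (\<epsilon>::real)"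
  let ?P = "prod_topology (top_of_set {0..b}) Y"
  have slice: "continuous_map (top_of_set {0..b}) euclidean (\<lambda>t. H t y)" if "y \<in> topspace Y" for y
  proof -
    have "continuous_map (top_of_set {0..b}) ?P (\<lambda>t. (t, y))"
      using that by (intro continuous_map_pairedI) auto
    from continuous_map_compose[OF this c] show ?thesis by (simp add: o_def)
  qed
  have co: "continuous_on {0..b} (\<lambda>t. H t y)" if "y \<in> topspace Y" for y
    using slice[OF that] by simp
  have "continuous_map ?P euclidean (\<lambda>p. H (fst p) y0)"
    using continuous_map_compose[OF continuous_map_fst slice[OF y0], of Y] by (simp add: o_def)
  moreover have "continuous_map ?P euclidean (\<lambda>p. H (fst p) (snd p))"
    using c by (simp add: case_prod_unfold)
  ultimately have "continuous_map ?P euclideanreal (\<lambda>p. norm (H (fst p) (snd p) - H (fst p) y0))"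
    by (intro continuous_map_norm continuous_map_diff)
  then have "openin ?P {p \<in> topspace ?P. norm (H (fst p) (snd p) - H (fst p) y0) \<in> {..< \<epsilon> / (b + 1)}}"
    by (rule openin_continuous_map_preimage) simp
  moreover have "compactin (top_of_set {0..b}) {0..b}" by (simp add: compactin_subtopology)
  moreover have "{0..b} \<times> {y0} \<subseteq> {p \<in> topspace ?P. norm (H (fst p) (snd p) - H (fst p) y0) \<in> {..< \<epsilon> / (b + 1)}}"
    using y0 \<epsilon> b by auto
  ultimately have "\<exists>U V. openin (top_of_set {0..b}) U \<and> openin Y V \<and> {0..b} \<subseteq> U \<and> y0 \<in> V \<and>
      U \<times> V \<subseteq> {p \<in> topspace ?P. norm (H (fst p) (snd p) - H (fst p) y0) \<in> {..< \<epsilon> / (b + 1)}}"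
    by (intro tube_lemma_left y0)
  then obtain U V where UV: "openin Y V" "{0..b} \<subseteq> U" "y0 \<in> V"
    "U \<times> V \<subseteq> {p \<in> topspace ?P. norm (H (fst p) (snd p) - H (fst p) y0) \<in> {..< \<epsilon> / (b + 1)}}"
    by (elim exE conjE)
  have "dist (integral {0..b} (\<lambda>t. H t y)) (integral {0..b} (\<lambda>t. H t y0)) < \<epsilon>" if y: "y \<in> V" for y
  proof -
    have yY: "y \<in> topspace Y" using openin_subset[OF UV(1)] y by blast
    have "norm (H t y - H t y0) \<le> \<epsilon> / (b + 1)" if "t \<in> {0..b}" for t
      using UV(2,4) y that by force
    then have "norm (integral {0..b} (\<lambda>t. H t y - H t y0)) \<le> \<epsilon> / (b + 1) * (b - 0)"
      by (intro integral_bound b continuous_on_diff co yY y0)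
    also have "\<dots> < \<epsilon>" using \<epsilon> b by (simp add: field_simps)
    also have "integral {0..b} (\<lambda>t. H t y - H t y0) = integral {0..b} (\<lambda>t. H t y) - integral {0..b} (\<lambda>t. H t y0)"
      by (intro Henstock_Kurzweil_Integration.integral_diff integrable_continuous_real co yY y0)
    finally show ?thesis by (simp add: dist_norm)
  qed
  then show "\<exists>U. openin Y U \<and> y0 \<in> U \<and>
      (\<forall>y\<in>U. dist (integral {0..b} (\<lambda>t. H t y)) (integral {0..b} (\<lambda>t. H t y0)) < \<epsilon>)"
    using UV by blast
qed

lemma unit_complex_cis:
  assumes "cmod w = 1"
  obtains s where "0 \<le> s" "s \<le> 2 * pi" "w = cis s"
  using that[of "Arg2pi w"] Arg2pi[of w] assms by (simp add: cis_conv_exp is_Arg_def)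

section \<open>The circle bundle and local unit sections\<close>

locale hausdorff_twist = twisted_etale_groupoid G L + hausdorff_etale_groupoid G
  for G :: "'g groupoid" and L :: "('g, 'v::ab_group_add) fell_bundle"
begin

text \<open>Over distinct arrows the base separates the points. Over the same arrow the norm of the
  difference is continuous on pairs with a common base point; it is positive near
  \<open>(p, q)\<close> and 0 on the diagonal, so the two neighbourhoods cannot share a
  point.\<close>

lemma ltop_Hausdorff: "Hausdorff_space (ltop L)"
  unfolding Hausdorff_space_def
proof (intro allI impI)
  fix p q assume pq: "p \<in> topspace (ltop L) \<and> q \<in> topspace (ltop L) \<and> p \<noteq> q"
  show "\<exists>U V. openin (ltop L) U \<and> openin (ltop L) V \<and> p \<in> U \<and> q \<in> V \<and> disjnt U V"
  proof (cases "fst p = fst q")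
    case False
    have "fst p \<in> arrows G \<and> fst q \<in> arrows G \<and> fst p \<noteq> fst q" using pq False by (auto simp: topspace_total)
    then have "\<exists>U V. openin (gtop G) U \<and> openin (gtop G) V \<and> fst p \<in> U \<and> fst q \<in> V \<and> disjnt U V"
      by (rule Hausdorff[unfolded Hausdorff_space_def, rule_format])
    then obtain U V where UV: "openin (gtop G) U" "openin (gtop G) V" "fst p \<in> U" "fst q \<in> V" "disjnt U V"
      by (elim exE conjE)
    have "openin (ltop L) {p \<in> topspace (ltop L). fst p \<in> U}" "openin (ltop L) {p \<in> topspace (ltop L). fst p \<in> V}"
      using openin_continuous_map_preimage[OF continuous_proj] UV by auto
    then show ?thesis using UV pq
      by (intro exI[of _ "{p \<in> topspace (ltop L). fst p \<in> U}"] exI[of _ "{p \<in> topspace (ltop L). fst p \<in> V}"])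
        (auto simp: disjnt_def)
  next
    case True
    let ?PP = "prod_topology (ltop L) (ltop L)"
    let ?D = "{x. fst (fst x) = fst (snd x)}"
    let ?P = "subtopology ?PP ?D"
    have 1: "continuous_map ?P (ltop L) (\<lambda>x. (fst (fst x), snd (fst x)))"
      by (simp add: continuous_map_from_subtopology continuous_map_fst)
    have "continuous_map ?P (ltop L) (\<lambda>x. (fst (snd x), snd (snd x)))"
      by (simp add: continuous_map_from_subtopology continuous_map_snd)
    then have "continuous_map ?P (ltop L) (\<lambda>x. (fst (fst x), snd (snd x)))"
      by (rule continuous_map_eq) auto
    then have "continuous_map ?P (ltop L) (\<lambda>x. (fst (fst x), snd (fst x) + lscale L (-1) (snd (snd x))))"
      by (intro Lcont_add 1 Lcont_scale) simp_all
    then have "continuous_map ?P euclideanreal (\<lambda>x. lnorm L (fst (fst x)) (snd (fst x) - snd (snd x)))"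
      using Lcont_norm by fastforce
    then have "openin ?P {x \<in> topspace ?P. lnorm L (fst (fst x)) (snd (fst x) - snd (snd x)) \<in> {0<..}}"
      by (rule openin_continuous_map_preimage) simp
    then obtain \<Omega> where \<Omega>: "openin ?PP \<Omega>"
      "{x \<in> topspace ?P. lnorm L (fst (fst x)) (snd (fst x) - snd (snd x)) \<in> {0<..}} = \<Omega> \<inter> ?D"
      unfolding openin_subtopology by blast
    obtain g a b where gab: "p = (g, a)" "q = (g, b)" using True by (cases p; cases q) auto
    then have gA: "g \<in> arrows G" "a \<in> fib L g" "b \<in> fib L g" "a - b \<noteq> 0" using pq by (auto simp: topspace_total)
    then have "0 < lnorm L g (a - b)" by (intro norm_pos fib_diff)
    then have "(p, q) \<in> {x \<in> topspace ?P. lnorm L (fst (fst x)) (snd (fst x) - snd (snd x)) \<in> {0<..}}"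
      using pq gab by simp
    then have "(p, q) \<in> \<Omega>" unfolding \<Omega>(2) by (rule IntD1)
    then have "\<exists>U V. openin (ltop L) U \<and> openin (ltop L) V \<and> p \<in> U \<and> q \<in> V \<and> U \<times> V \<subseteq> \<Omega>"
      by (rule \<Omega>(1)[unfolded openin_prod_topology_alt, rule_format])
    then obtain U V where UV: "openin (ltop L) U" "openin (ltop L) V" "p \<in> U" "q \<in> V" "U \<times> V \<subseteq> \<Omega>"
      by (elim exE conjE)
    have "disjnt U V"
    proof (rule ccontr)
      assume "\<not> disjnt U V"
      then obtain x where x: "x \<in> U" "x \<in> V" by (auto simp: disjnt_def)
      then have "(x, x) \<in> \<Omega> \<inter> ?D" using UV(5) by auto
      then have "(x, x) \<in> topspace ?P" "0 < lnorm L (fst x) (snd x - snd x)" unfolding \<Omega>(2)[symmetric] by simp_all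
      then show False using norm_0[of "fst x"] by (auto simp: topspace_total)
    qed
    then show ?thesis using UV by blast
  qed
qed

text \<open>The circle bundle of \<open>L\<close>: over each arrow the unit vectors form a single
  orbit of the complex numbers of modulus 1.\<close>

definition unit_sphere :: "('g \<times> 'v) set"
  where "unit_sphere = {p \<in> topspace (ltop L). lnorm L (fst p) (snd p) = 1}"

lemma unit_sphere_iff: "(g, a) \<in> unit_sphere \<longleftrightarrow> g \<in> arrows G \<and> a \<in> fib L g \<and> lnorm L g a = 1"
  unfolding unit_sphere_def topspace_total by auto

lemma unit_sphere_exists:
  assumes g: "g \<in> arrows G"
  obtains a where "(g, a) \<in> unit_sphere"
proof -
  obtain b where b: "b \<in> fib L g" "b \<noteq> 0" by (rule fib_spanned[OF g]) blast
  let ?a = "lscale L (complex_of_real (inverse (lnorm L g b))) b"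
  have "lnorm L g ?a = 1" using norm_pos[OF g b] by (simp add: norm_scale g b norm_inverse)
  then show ?thesis using that[of ?a] fib_scale[OF g b(1)] g by (simp add: unit_sphere_iff)
qed

lemma unit_sphere_scale: "(g, a) \<in> unit_sphere \<Longrightarrow> cmod z = 1 \<Longrightarrow> (g, lscale L z a) \<in> unit_sphere"
  by (simp add: unit_sphere_iff fib_scale norm_scale)

lemma unit_sphere_multiple:
  assumes "(g, a) \<in> unit_sphere" "(g, b) \<in> unit_sphere"
  obtains z where "cmod z = 1" "b = lscale L z a"
proof -
  have ab: "g \<in> arrows G" "a \<in> fib L g" "b \<in> fib L g" "lnorm L g a = 1" "lnorm L g b = 1"
    using assms by (auto simp: unit_sphere_iff)
  then have "a \<noteq> 0" using norm_0 by force
  then obtain z where z: "b = lscale L z a" using fib_multiple[OF ab(1,3,2)] by blast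
  then have "cmod z = 1" using ab norm_scale[OF ab(1,2), of z] by simp
  then show ?thesis using that z by blast
qed

text \<open>
  Since the projection is open, the unit vectors of nearby fibres are rotations of vectors close to
  a given one; the tube lemma over the circle then gives properness.
\<close>

lemma proper_map_unit_sphere: "proper_map (subtopology (ltop L) unit_sphere) (gtop G) fst"
  unfolding proper_map_def closed_map_fibre_neighbourhood
proof (intro conjI allI impI ballI)
  let ?Q = "subtopology (ltop L) unit_sphere"
  have top: "topspace ?Q = unit_sphere" unfolding unit_sphere_def by auto
  show "fst \<in> topspace ?Q \<rightarrow> arrows G" unfolding top by (auto simp: unit_sphere_iff)
  fix g assume g: "g \<in> arrows G"
  obtain a where a: "(g, a) \<in> unit_sphere" by (rule unit_sphere_exists[OF g]) blast
  have aL: "a \<in> fib L g" "lnorm L g a = 1" using a by (auto simp: unit_sphere_iff)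
  have "continuous_map (top_of_set (sphere 0 1)) (ltop L) (\<lambda>z. (g, lscale L z a))"
    by (rule Lcont_scale) (use g aL in \<open>auto simp: topspace_total\<close>)
  then have "continuous_map (top_of_set (sphere 0 1)) ?Q (\<lambda>z. (g, lscale L z a))"
    by (rule continuous_map_into_subtopology) (auto intro: unit_sphere_scale[OF a])
  moreover have "compactin (top_of_set (sphere 0 1 :: complex set)) (sphere 0 1)" by (simp add: compactin_subtopology)
  ultimately have "compactin ?Q ((\<lambda>z. (g, lscale L z a)) ` sphere 0 1)" by (rule image_compactin[rotated])
  also have "(\<lambda>z. (g, lscale L z a)) ` sphere 0 1 = {p \<in> topspace ?Q. fst p = g}"
  proof -
    have "p \<in> (\<lambda>z. (g, lscale L z a)) ` sphere 0 1" if "p \<in> unit_sphere" "fst p = g" for p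
    proof -
      have "(g, snd p) \<in> unit_sphere" using that by (cases p) auto
      then obtain z where "cmod z = 1" "snd p = lscale L z a" by (rule unit_sphere_multiple[OF a]) blast
      then show ?thesis using that(2) by (cases p) (auto simp: image_iff)
    qed
    then show ?thesis unfolding top by (auto intro: unit_sphere_scale[OF a])
  qed
  finally show "compactin ?Q {p \<in> topspace ?Q. fst p = g}" .
next
  let ?Q = "subtopology (ltop L) unit_sphere"
  let ?N = "{p \<in> topspace (ltop L). snd p \<noteq> 0 \<and> fst p \<in> arrows G}"
  let ?Y = "subtopology (ltop L) ?N"
  let ?C = "sphere 0 1 :: complex set"
  let ?P = "prod_topology (top_of_set ?C) ?Y"
  have top: "topspace ?Q = unit_sphere" unfolding unit_sphere_def by auto
  fix U g assume Ug: "openin ?Q U \<and> g \<in> arrows G \<and> {p \<in> topspace ?Q. fst p = g} \<subseteq> U"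
  then obtain U' where U': "openin (ltop L) U'" "U = U' \<inter> unit_sphere" unfolding openin_subtopology by blast
  obtain a where a: "(g, a) \<in> unit_sphere" by (rule unit_sphere_exists[of g]) (use Ug in auto)
  have aL: "g \<in> arrows G" "a \<in> fib L g" "lnorm L g a = 1" using a by (auto simp: unit_sphere_iff)
  have a0: "a \<noteq> 0" using aL norm_0 by force
  have oN: "openin (ltop L) ?N" by (rule openin_nonzero) simp
  \<comment> \<open>\<open>m\<close> sends \<open>(z, (h, b))\<close> to the unit vector in the
    direction of \<open>b\<close>, rotated by \<open>z\<close>. For \<open>b\<close> near
    \<open>a\<close> and all \<open>z\<close> at once the result stays in \<open>U'\<close>.\<close>
  define m where "m = (\<lambda>q::complex \<times> ('g \<times> 'v). (fst (snd q),
      lscale L (fst q * complex_of_real (inverse (lnorm L (fst (snd q)) (snd (snd q))))) (snd (snd q))))"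
  have 1: "continuous_map ?P (ltop L) (\<lambda>q. (fst (snd q), snd (snd q)))"
    unfolding prod.collapse by (rule continuous_map_into_fulltopology[OF continuous_map_snd])
  have "continuous_map ?P euclideanreal (\<lambda>q. inverse (lnorm L (fst (snd q)) (snd (snd q))))"
    by (intro continuous_map_real_inverse Lcont_norm 1) (auto simp: topspace_total norm_eq_0)
  then have 2: "continuous_map ?P euclidean (\<lambda>q. complex_of_real (inverse (lnorm L (fst (snd q)) (snd (snd q)))))"
    by (rule continuous_map_compose_on) (intro continuous_intros)
  have 3: "continuous_map ?P euclidean (\<lambda>q. fst q)"
    by (rule continuous_map_into_fulltopology[OF continuous_map_fst])
  have cm: "continuous_map ?P (ltop L) m"
    unfolding m_def by (intro Lcont_scale continuous_map_complex_mult 1 2 3)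
  have "openin ?P {q \<in> topspace ?P. m q \<in> U'}" by (rule openin_continuous_map_preimage[OF cm U'(1)])
  moreover have "compactin (top_of_set ?C) ?C" by (simp add: compactin_subtopology)
  moreover have ga: "(g, a) \<in> topspace ?Y" using aL a0 by (simp add: topspace_total)
  moreover have "?C \<times> {(g, a)} \<subseteq> {q \<in> topspace ?P. m q \<in> U'}"
  proof -
    have "m (z, (g, a)) \<in> U'" if "z \<in> ?C" for z
      using Ug U'(2) unit_sphere_scale[OF a, of z] that aL unfolding top by (auto simp: m_def)
    then show ?thesis using ga by auto
  qed
  ultimately have "\<exists>V N. openin (top_of_set ?C) V \<and> openin ?Y N \<and> ?C \<subseteq> V \<and> (g, a) \<in> N \<and>
      V \<times> N \<subseteq> {q \<in> topspace ?P. m q \<in> U'}"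
    by (intro tube_lemma_left)
  then obtain V N where N: "openin ?Y N" "?C \<subseteq> V" "(g, a) \<in> N" "V \<times> N \<subseteq> {q \<in> topspace ?P. m q \<in> U'}"
    by (elim exE conjE)
  have oN': "openin (ltop L) N" using N(1) oN openin_trans_full by blast
  have NN: "N \<subseteq> ?N" using openin_subset[OF N(1)] by auto
  have "openin (gtop G) (fst ` N)" using open_proj oN' unfolding open_map_def by blast
  moreover have "g \<in> fst ` N" using N(3) by force
  moreover have "{p \<in> topspace ?Q. fst p \<in> fst ` N} \<subseteq> U"
  proof
    fix p assume "p \<in> {p \<in> topspace ?Q. fst p \<in> fst ` N}"
    then obtain h c b where p: "p = (h, c)" "(h, c) \<in> unit_sphere" "(h, b) \<in> N" unfolding top by (cases p) auto
    have b: "h \<in> arrows G" "b \<in> fib L h" "b \<noteq> 0" using NN p(3) by (auto simp: topspace_total)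
    have c: "c \<in> fib L h" "lnorm L h c = 1" using p(2) by (auto simp: unit_sphere_iff)
    obtain w where w: "c = lscale L w b" by (rule fib_multiple[OF b(1) c(1) b(2,3)]) blast
    have nb: "0 < lnorm L h b" by (rule norm_pos[OF b])
    \<comment> \<open>The rotation that carries the normalised \<open>b\<close> to the given unit
      vector \<open>c\<close>.\<close>
    let ?z = "w * complex_of_real (lnorm L h b)"
    have "cmod ?z = 1" using norm_scale[OF b(1,2), of w] w c(2) nb by (simp add: norm_mult)
    then have "(?z, (h, b)) \<in> V \<times> N" using N(2) p(3) by (intro SigmaI subsetD[OF N(2)]) simp_all
    from subsetD[OF N(4) this] have "m (?z, (h, b)) \<in> U'" by simp
    moreover have "m (?z, (h, b)) = p" unfolding m_def p w using nb by simp
    ultimately show "p \<in> U" using U'(2) p by simp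
  qed
  ultimately show "\<exists>V. openin (gtop G) V \<and> g \<in> V \<and> {p \<in> topspace ?Q. fst p \<in> V} \<subseteq> U" by blast
qed

text \<open>
  A function on the circle over \<open>g0\<close> is extended to the sphere bundle over a compact neighbourhood
  by Tietze's theorem and made equivariant under the circle by averaging.
\<close>

lemma local_equivariant_function:
  assumes g0: "g0 \<in> arrows G"
  obtains W c where "openin (gtop G) W" "g0 \<in> W"
    "continuous_map (subtopology (ltop L) {p \<in> unit_sphere. fst p \<in> W}) euclidean (c :: 'g \<times> 'v \<Rightarrow> complex)"
    "\<And>g a z. g \<in> W \<Longrightarrow> (g, a) \<in> unit_sphere \<Longrightarrow> cmod z = 1 \<Longrightarrow> c (g, lscale L z a) = z * c (g, a)"
    "\<And>a. (g0, a) \<in> unit_sphere \<Longrightarrow> c (g0, a) \<noteq> 0"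
proof -
  obtain W K where WK: "openin (gtop G) W" "compactin (gtop G) K" "g0 \<in> W" "W \<subseteq> K" "K \<subseteq> arrows G"
    by (rule compact_neighbourhood[OF openin_topspace g0]) blast
  define S where "S = {p \<in> unit_sphere. fst p \<in> K}"
  let ?Q = "subtopology (ltop L) S"
  have S: "(g, a) \<in> S \<longleftrightarrow> (g, a) \<in> unit_sphere \<and> g \<in> K" for g a unfolding S_def by auto
  have SL: "unit_sphere \<subseteq> topspace (ltop L)" unfolding unit_sphere_def by auto
  have top: "topspace ?Q = S" using SL unfolding S_def by auto
  \<comment> \<open>Properness makes the circle bundle over the compact \<open>K\<close> compact;
    being Hausdorff it is then normal, as Tietze's theorem demands.\<close>
  have "compactin (subtopology (ltop L) unit_sphere) {p \<in> topspace (subtopology (ltop L) unit_sphere). fst p \<in> K}"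
    by (rule compactin_proper_map_preimage[OF proper_map_unit_sphere WK(2)])
  then have "compactin (ltop L) S"
    using SL by (auto simp: S_def compactin_subtopology Int_absorb1 intro: back_subst[of "compactin (ltop L)"])
  then have "compact_space ?Q" by (simp add: compact_space_subtopology)
  moreover have HQ: "Hausdorff_space ?Q" by (simp add: Hausdorff_space_subtopology ltop_Hausdorff)
  ultimately have normal: "normal_space ?Q" using compact_Hausdorff_or_regular_imp_normal_space by blast
  obtain a0 where a0: "(g0, a0) \<in> unit_sphere" by (rule unit_sphere_exists[OF g0]) blast
  have a0L: "a0 \<in> fib L g0" "lnorm L g0 a0 = 1" using a0 by (auto simp: unit_sphere_iff)
  define C where "C = {p \<in> S. fst p = g0}"
  have cfst: "continuous_map ?Q (gtop G) fst" by (rule continuous_map_from_subtopology[OF continuous_proj])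
  have "closedin (gtop G) {g0}" using Hausdorff g0 by (simp add: closedin_Hausdorff_singleton)
  then have "closedin ?Q {p \<in> topspace ?Q. fst p \<in> {g0}}"
    by (rule closedin_continuous_map_preimage[OF cfst])
  then have clC: "closedin ?Q C" unfolding top by (simp add: C_def)
  have CS: "C \<subseteq> S" unfolding C_def by blast
  let ?T = "subtopology ?Q C"
  have T: "?T = subtopology (ltop L) C" using CS by (simp add: subtopology_subtopology Int_absorb1)
  have topT: "topspace ?T = C" using top CS by auto
  \<comment> \<open>On the circle over \<open>g0\<close> this is the coordinate with respect to
    \<open>a0\<close>: the inner product of \<open>a0\<close> with the vector.\<close>
  let ?f = "\<lambda>p. unit_coord L (gmul G (ginv G g0) (fst p)) (lmul L (ginv G g0) (fst p) (lstar L g0 a0) (snd p))"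
  have cf: "continuous_map ?T euclidean ?f"
  proof (rule continuous_unit_coord)
    have "continuous_map ?T (ltop L) (\<lambda>p. (fst p, snd p))" unfolding T by (rule Lcont_id)
    then show "continuous_map ?T (ltop L) (\<lambda>p. (gmul G (ginv G g0) (fst p), lmul L (ginv G g0) (fst p) (lstar L g0 a0) (snd p)))"
    proof (intro Lcont_mul)
      show "continuous_map ?T (ltop L) (\<lambda>p. (ginv G g0, lstar L g0 a0))"
        using g0 a0L by (simp add: topspace_total inv_closed lstar_closed)
    qed (use topT g0 in \<open>auto simp: C_def src_inv\<close>)
    show "gmul G (ginv G g0) (fst p) \<in> units G" if "p \<in> topspace ?T" for p
      using that g0 unfolding topT C_def by (auto simp: inv_mul src_in_units)
  qed
  have fval: "?f (g0, lscale L z a0) = z" for z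
  proof -
    have "?f (g0, lscale L z a0) = ip g0 a0 (lscale L z a0)" using g0 by (simp add: ip_def inv_mul)
    then show ?thesis using ip_scale_right[OF g0 a0L(1) a0L(1), of z] ip_self[OF g0 a0L(1)] a0L(2) by simp
  qed
  obtain c1 where c1: "continuous_map ?Q euclideanreal c1" "\<And>p. p \<in> C \<Longrightarrow> c1 p = Re (?f p)"
    using Tietze_extension_realinterval[OF normal clC, of UNIV "\<lambda>p. Re (?f p)"]
      continuous_map_compose_on[OF cf, of Re] by (auto simp: continuous_on_Re continuous_on_id)
  obtain c2 where c2: "continuous_map ?Q euclideanreal c2" "\<And>p. p \<in> C \<Longrightarrow> c2 p = Im (?f p)"
    using Tietze_extension_realinterval[OF normal clC, of UNIV "\<lambda>p. Im (?f p)"]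
      continuous_map_compose_on[OF cf, of Im] by (auto simp: continuous_on_Im continuous_on_id)
  define d where "d p = Complex (c1 p) (c2 p)" for p
  have cd: "continuous_map ?Q euclidean d"
    unfolding d_def Complex_eq
    by (intro continuous_map_add continuous_map_complex_mult continuous_map_compose_on[OF c1(1)]
        continuous_map_compose_on[OF c2(1)]) (auto intro!: continuous_intros)
  have dC: "d p = ?f p" if "p \<in> C" for p
    using that c1(2) c2(2) by (simp add: d_def)
  \<comment> \<open>The integral over \<open>t\<close> is an unnormalised average of the rotated
    functions: rotating the argument translates the parameter and leaves the rotation behind as a
    factor.\<close>
  define H where "H t p = cis (- t) * d (fst p, lscale L (cis t) (snd p))" for t p
  define c where "c p = integral {0..2 * pi} (\<lambda>t. H t p)" for p
  have rot: "continuous_map (prod_topology (top_of_set B) ?Q) ?Q (\<lambda>q. (fst (snd q), lscale L (cis (fst q)) (snd (snd q))))" for B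
  proof (rule continuous_map_into_subtopology)
    have "continuous_map (prod_topology (top_of_set B) ?Q) euclideanreal fst"
      by (rule continuous_map_into_fulltopology[OF continuous_map_fst])
    then have "continuous_map (prod_topology (top_of_set B) ?Q) euclidean (\<lambda>q. cis (fst q))"
      by (rule continuous_map_compose_on) (intro continuous_intros)
    moreover have "continuous_map (prod_topology (top_of_set B) ?Q) (ltop L) (\<lambda>q. (fst (snd q), snd (snd q)))"
      unfolding prod.collapse by (rule continuous_map_into_fulltopology[OF continuous_map_snd])
    ultimately show "continuous_map (prod_topology (top_of_set B) ?Q) (ltop L) (\<lambda>q. (fst (snd q), lscale L (cis (fst q)) (snd (snd q))))"
      by (rule Lcont_scale)
    show "(\<lambda>q. (fst (snd q), lscale L (cis (fst q)) (snd (snd q)))) \<in> topspace (prod_topology (top_of_set B) ?Q) \<rightarrow> S"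
      unfolding topspace_prod_topology top by (auto simp: S unit_sphere_scale)
  qed
  have cH: "continuous_map (prod_topology (top_of_set B) ?Q) euclidean (\<lambda>(t, p). H t p)" for B
  proof -
    have "continuous_map (prod_topology (top_of_set B) ?Q) euclideanreal fst"
      by (rule continuous_map_into_fulltopology[OF continuous_map_fst])
    then have "continuous_map (prod_topology (top_of_set B) ?Q) euclidean (\<lambda>q. cis (- fst q))"
      by (rule continuous_map_compose_on) (intro continuous_intros)
    from continuous_map_complex_mult[OF this continuous_map_compose[OF rot cd, unfolded o_def]]
    show ?thesis by (simp add: H_def case_prod_unfold)
  qed
  have cc: "continuous_map ?Q euclidean c"
    unfolding c_def by (rule continuous_map_parametric_integral[OF cH]) simp
  have equiv: "c (g, lscale L z a) = z * c (g, a)" if ga: "(g, a) \<in> S" and z: "cmod z = 1" for g a z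
  proof -
    obtain s where s: "0 \<le> s" "s \<le> 2 * pi" "z = cis s" by (rule unit_complex_cis[OF z]) blast
    have "continuous_map (top_of_set UNIV) (prod_topology (top_of_set UNIV) ?Q) (\<lambda>t::real. (t, (g, a)))"
      using ga top by (intro continuous_map_pairedI) auto
    from continuous_map_compose[OF this cH] have co: "continuous_on UNIV (\<lambda>t. H t (g, a))" by (simp add: o_def)
    have cis2: "cis (2 * pi + t) = cis t" for t by (simp flip: cis_mult)
    have per: "H (2 * pi + t) (g, a) = H t (g, a)" for t
      unfolding H_def cis_cnj[symmetric] cis2 ..
    have "H t (g, lscale L z a) = z * H (s + t) (g, a)" for t
      by (simp add: H_def s(3) cis_mult add.commute flip: mult.assoc)
    then have "c (g, lscale L z a) = z * integral {0..2 * pi} (\<lambda>t. H (s + t) (g, a))"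
      unfolding c_def by simp
    also have "integral {0..2 * pi} (\<lambda>t. H (s + t) (g, a)) = c (g, a)"
      unfolding c_def by (rule integral_periodic_shift[OF co per s(1,2)])
    finally show ?thesis .
  qed
  have "(g0, lscale L (cis t) a0) \<in> C" for t
    unfolding C_def using unit_sphere_scale[OF a0] WK by (auto simp: S)
  \<comment> \<open>Over \<open>g0\<close> the function was equivariant from the start, so the
    integrand is constant. This keeps the average from vanishing there.\<close>
  then have "H t (g0, a0) = 1" for t
    using dC fval by (simp add: H_def cis_mult)
  then have c0: "c (g0, a0) = complex_of_real (2 * pi)"
    unfolding c_def by (simp add: scaleR_conv_of_real)
  show ?thesis
  proof (rule that[OF WK(1,3)])
    show "continuous_map (subtopology (ltop L) {p \<in> unit_sphere. fst p \<in> W}) euclidean c"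
      by (rule continuous_map_from_subtopology_mono[OF cc]) (use WK(4) in \<open>auto simp: S_def\<close>)
    show "c (g, lscale L z a) = z * c (g, a)" if "g \<in> W" "(g, a) \<in> unit_sphere" "cmod z = 1" for g a z
      using equiv that WK(4) S by blast
    show "c (g0, a) \<noteq> 0" if a: "(g0, a) \<in> unit_sphere" for a
    proof -
      obtain z where z: "cmod z = 1" "a = lscale L z a0" by (rule unit_sphere_multiple[OF a0 a]) blast
      have "(g0, a0) \<in> S" using a0 WK S by blast
      then have "c (g0, a) = z * complex_of_real (2 * pi)" using equiv z c0 by simp
      then show ?thesis using z(1) by auto
    qed
  qed
qed

text \<open>By equivariance the vector \<open>cnj (c (g, a))\<close> times \<open>a\<close> is the
  same for every unit vector \<open>a\<close> over \<open>g\<close>: a rotation of \<open>a\<close>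
  is cancelled by the conjugate. It is nonzero at \<open>g0\<close>, hence nearby, and is then
  normalised.\<close>

lemma local_unit_section:
  assumes g0: "g0 \<in> arrows G"
  obtains W u where "openin (gtop G) W" "g0 \<in> W" "\<And>g. g \<in> W \<Longrightarrow> u g \<in> fib L g" "\<And>g. g \<in> W \<Longrightarrow> lnorm L g (u g) = 1"
    "continuous_map (subtopology (gtop G) W) (ltop L) (\<lambda>g. (g, u g))"
proof -
  obtain W c where Wc: "openin (gtop G) W" "g0 \<in> W"
    "continuous_map (subtopology (ltop L) {p \<in> unit_sphere. fst p \<in> W}) euclidean (c :: 'g \<times> 'v \<Rightarrow> complex)"
    "\<And>g a z. g \<in> W \<Longrightarrow> (g, a) \<in> unit_sphere \<Longrightarrow> cmod z = 1 \<Longrightarrow> c (g, lscale L z a) = z * c (g, a)"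
    "\<And>a. (g0, a) \<in> unit_sphere \<Longrightarrow> c (g0, a) \<noteq> 0"
    by (rule local_equivariant_function[OF g0]) blast
  have WA: "g \<in> arrows G" if "g \<in> W" for g using that openin_subset[OF Wc(1)] by blast
  define b where "b g = (SOME a. (g, a) \<in> unit_sphere)" for g
  have b: "(g, b g) \<in> unit_sphere" if "g \<in> W" for g
    unfolding b_def by (rule someI_ex) (use unit_sphere_exists[OF WA[OF that]] in blast)
  define v where "v g = lscale L (cnj (c (g, b g))) (b g)" for g
  have v: "v g = lscale L (cnj (c (g, a))) a" if g: "g \<in> W" and a: "(g, a) \<in> unit_sphere" for g a
  proof -
    obtain z where z: "cmod z = 1" "a = lscale L z (b g)" by (rule unit_sphere_multiple[OF b[OF g] a]) blast
    have "cnj z * z = 1" using z(1) by (metis complex_norm_square mult.commute of_real_1 one_power2)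
    then have "cnj (z * w) * z = cnj w" for w by (simp add: mult.commute mult.left_commute)
    then show ?thesis unfolding z(2) v_def Wc(4)[OF g b[OF g] z(1)] by simp
  qed
  \<comment> \<open>The chosen \<open>b g\<close> need not vary continuously. Over the nonzero
    vectors the normalised vector itself can take its place.\<close>
  have "continuous_map (subtopology (gtop G) W) (ltop L) (\<lambda>g. (g, v g))"
  proof (rule continuous_map_from_nonzero[OF Wc(1)])
    let ?Y = "subtopology (ltop L) {p \<in> topspace (ltop L). snd p \<noteq> 0 \<and> fst p \<in> W}"
    have "continuous_map ?Y euclideanreal (\<lambda>p. inverse (lnorm L (fst p) (snd p)))"
      by (intro continuous_map_real_inverse Lcont_norm Lcont_id) (auto simp: topspace_total norm_eq_0)
    then have "continuous_map ?Y euclidean (\<lambda>p. complex_of_real (inverse (lnorm L (fst p) (snd p))))"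
      by (rule continuous_map_compose_on) (intro continuous_intros)
    then have 1: "continuous_map ?Y (ltop L) (\<lambda>p. (fst p, lscale L (complex_of_real (inverse (lnorm L (fst p) (snd p)))) (snd p)))"
      by (intro Lcont_scale Lcont_id)
    have us: "(g, lscale L (complex_of_real (inverse (lnorm L g a))) a) \<in> unit_sphere"
      if "g \<in> arrows G" "a \<in> fib L g" "a \<noteq> 0" for g a
      using that norm_pos[OF that] by (simp add: unit_sphere_iff fib_scale norm_scale norm_inverse)
    then have "continuous_map ?Y (subtopology (ltop L) {p \<in> unit_sphere. fst p \<in> W})
        (\<lambda>p. (fst p, lscale L (complex_of_real (inverse (lnorm L (fst p) (snd p)))) (snd p)))"
      by (intro continuous_map_into_subtopology 1) (auto simp: topspace_total)
    from continuous_map_compose[OF this Wc(3)]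
    have "continuous_map ?Y euclidean (\<lambda>p. c (fst p, lscale L (complex_of_real (inverse (lnorm L (fst p) (snd p)))) (snd p)))"
      by (simp add: o_def)
    then have "continuous_map ?Y euclidean (\<lambda>p. cnj (c (fst p, lscale L (complex_of_real (inverse (lnorm L (fst p) (snd p)))) (snd p))))"
      by (rule continuous_map_compose_on) (intro continuous_intros)
    from Lcont_scale[OF this 1] show "continuous_map ?Y (ltop L) (\<lambda>p. (fst p, v (fst p)))"
    proof (rule continuous_map_eq)
      fix p assume "p \<in> topspace ?Y"
      then obtain g a where p: "p = (g, a)" "g \<in> W" "g \<in> arrows G" "a \<in> fib L g" "a \<noteq> 0"
        by (cases p) (auto simp: topspace_total)
      show "(fst p, lscale L (cnj (c (fst p, lscale L (complex_of_real (inverse (lnorm L (fst p) (snd p)))) (snd p))))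
          (lscale L (complex_of_real (inverse (lnorm L (fst p) (snd p)))) (snd p))) = (fst p, v (fst p))"
        unfolding p(1) fst_conv snd_conv v[OF p(2) us[OF p(3-5)]] ..
    qed
  qed
  then have cv: "continuous_map (subtopology (gtop G) W) (ltop L) (\<lambda>g. (g, v g))" .
  have vf: "v g \<in> fib L g" if "g \<in> W" for g
    unfolding v_def using b[OF that] by (intro fib_scale WA that) (simp add: unit_sphere_iff)
  let ?V = "{g \<in> W. 0 < lnorm L g (v g)}"
  have tW: "topspace (subtopology (gtop G) W) = W" using openin_subset[OF Wc(1)] by auto
  have "openin (subtopology (gtop G) W) {g \<in> topspace (subtopology (gtop G) W). lnorm L g (v g) \<in> {0<..}}"
    by (rule openin_continuous_map_preimage[OF Lcont_norm[OF cv]]) simp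
  then have V: "openin (gtop G) ?V" using openin_trans_full[OF _ Wc(1)] unfolding tW by simp
  have "v g0 \<noteq> 0"
    using Wc(5)[OF b[OF Wc(2)]] b[OF Wc(2)] norm_0[OF g0] unfolding v_def by (auto simp: unit_sphere_iff)
  then have gV: "g0 \<in> ?V" using Wc(2) norm_pos[OF g0 vf[OF Wc(2)]] by simp
  have cV: "continuous_map (subtopology (gtop G) ?V) (ltop L) (\<lambda>g. (g, v g))"
    by (rule continuous_map_from_subtopology_mono[OF cv]) auto
  have "continuous_map (subtopology (gtop G) ?V) euclideanreal (\<lambda>g. inverse (lnorm L g (v g)))"
    by (intro continuous_map_real_inverse Lcont_norm cV) auto
  then have cn: "continuous_map (subtopology (gtop G) ?V) euclidean (\<lambda>g. complex_of_real (inverse (lnorm L g (v g))))"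
    by (rule continuous_map_compose_on) (intro continuous_intros)
  show ?thesis
  proof (rule that[OF V gV])
    show "continuous_map (subtopology (gtop G) ?V) (ltop L) (\<lambda>g. (g, lscale L (complex_of_real (inverse (lnorm L g (v g)))) (v g)))"
      by (rule Lcont_scale[OF cn cV])
    show "lscale L (complex_of_real (inverse (lnorm L g (v g)))) (v g) \<in> fib L g" if "g \<in> ?V" for g
      using that by (intro fib_scale WA vf) auto
    show "lnorm L g (lscale L (complex_of_real (inverse (lnorm L g (v g)))) (v g)) = 1" if "g \<in> ?V" for g
      using that by (simp add: norm_scale WA vf norm_inverse)
  qed
qed

end


section \<open>Sections and convolution\<close>

context hausdorff_twist
begin

sublocale VF: vector_space "\<lambda>z (f :: 'g \<Rightarrow> 'v) g. lscale L z (f g)"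
  by unfold_locales
    (auto simp: fun_eq_iff VL.scale_right_distrib VL.scale_left_distrib)

text \<open>No continuity is asked, since the vectors of \<open>l2 G L\<close> are sections of this
  general kind.\<close>

definition fsec :: "('g \<Rightarrow> 'v) \<Rightarrow> bool"
  where "fsec f \<longleftrightarrow> (\<forall>g\<in>arrows G. f g \<in> fib L g)"

definition csec :: "('g \<Rightarrow> 'v) \<Rightarrow> bool"
  where "csec f \<longleftrightarrow> fsec f \<and> continuous_map (gtop G) (ltop L) (\<lambda>g. (g, f g))"

lemma fsecD: "fsec f \<Longrightarrow> g \<in> arrows G \<Longrightarrow> f g \<in> fib L g"
  unfolding fsec_def by blast

lemma csec_fsec: "csec f \<Longrightarrow> fsec f"
  unfolding csec_def by blast

text \<open>In a Hausdorff groupoid the compact \<open>K\<close> is closed, so the extension by zero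
  is continuous on all arrows and the open set \<open>U\<close> only restricts the support.\<close>

lemma sections_c_iff:
  assumes U: "openin (gtop G) U"
  shows "f \<in> sections_c G L U \<longleftrightarrow> csec f \<and> (\<exists>K. compactin (gtop G) K \<and> K \<subseteq> U \<and> (\<forall>g. g \<notin> K \<longrightarrow> f g = 0))"
proof
  assume "f \<in> sections_c G L U"
  then obtain K where f: "\<And>g. g \<in> U \<Longrightarrow> f g \<in> fib L g" "continuous_map (subtopology (gtop G) U) (ltop L) (\<lambda>g. (g, f g))"
    and K: "compactin (gtop G) K" "K \<subseteq> U" "\<And>g. g \<notin> K \<Longrightarrow> f g = 0"
    unfolding sections_c_def by blast
  have fs: "fsec f"
    unfolding fsec_def
  proof
    fix g assume "g \<in> arrows G"
    then show "f g \<in> fib L g" using f(1)[of g] K(3)[of g] fib_0[of g] subsetD[OF K(2), of g] by fastforce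
  qed
  have "continuous_map (gtop G) (ltop L) (\<lambda>g. (g, f g))"
  proof (rule continuous_map_open_glue[OF U _ _ f(2)])
    show "openin (gtop G) (arrows G - K)"
      using compactin_imp_closedin[OF Hausdorff K(1)] by blast
    show "continuous_map (subtopology (gtop G) (arrows G - K)) (ltop L) (\<lambda>g. (g, f g))"
      by (rule continuous_map_eq[OF continuous_map_from_subtopology[OF continuous_zero_section]])
        (use K(3) in auto)
  qed (use K in blast)
  then show "csec f \<and> (\<exists>K. compactin (gtop G) K \<and> K \<subseteq> U \<and> (\<forall>g. g \<notin> K \<longrightarrow> f g = 0))"
    using fs K unfolding csec_def by blast
next
  assume "csec f \<and> (\<exists>K. compactin (gtop G) K \<and> K \<subseteq> U \<and> (\<forall>g. g \<notin> K \<longrightarrow> f g = 0))"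
  then show "f \<in> sections_c G L U"
    unfolding sections_c_def csec_def using openin_subset[OF U]
    by (auto intro: continuous_map_from_subtopology fsecD)
qed

lemma sections_cE:
  assumes "open_bisection G U" "f \<in> sections_c G L U"
  obtains K where "csec f" "compactin (gtop G) K" "K \<subseteq> U" "\<And>g. g \<notin> K \<Longrightarrow> f g = 0"
  using assms(2) unfolding sections_c_iff[OF bisection_openin[OF assms(1)]] by blast

lemma csec_add: "csec f \<Longrightarrow> csec h \<Longrightarrow> csec (f + h)"
  unfolding csec_def fsec_def plus_fun_def using Lcont_add[of "gtop G" "\<lambda>g. g" f h] by (auto intro: fib_add)

lemma csec_scale: "csec f \<Longrightarrow> csec (\<lambda>g. lscale L z (f g))"
  unfolding csec_def fsec_def using Lcont_scale[of "gtop G" "\<lambda>_. z" "\<lambda>g. g" f] by (auto intro: fib_scale)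

lemma csec_mult:
  "continuous_map (gtop G) euclidean \<phi> \<Longrightarrow> csec f \<Longrightarrow> csec (\<lambda>g. lscale L (\<phi> g) (f g))"
  unfolding csec_def fsec_def using Lcont_scale[of "gtop G" \<phi> "\<lambda>g. g" f] by (auto intro: fib_scale)

lemma sections_c_scale:
  assumes U: "open_bisection G U" and f: "f \<in> sections_c G L U"
  shows "(\<lambda>g. lscale L z (f g)) \<in> sections_c G L U"
proof -
  obtain K where "csec f" "compactin (gtop G) K" "K \<subseteq> U" "\<And>g. g \<notin> K \<Longrightarrow> f g = 0"
    by (rule sections_cE[OF U f]) blast
  then show ?thesis unfolding sections_c_iff[OF bisection_openin[OF U]]
    by (auto intro!: csec_scale exI[of _ K])
qed

lemma sections_c_mult:
  assumes U: "open_bisection G U" and f: "f \<in> sections_c G L U" and \<phi>: "continuous_map (gtop G) euclidean \<phi>"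
  shows "(\<lambda>g. lscale L (\<phi> g) (f g)) \<in> sections_c G L U"
proof -
  obtain K where "csec f" "compactin (gtop G) K" "K \<subseteq> U" "\<And>g. g \<notin> K \<Longrightarrow> f g = 0"
    by (rule sections_cE[OF U f]) blast
  then show ?thesis unfolding sections_c_iff[OF bisection_openin[OF U]]
    by (auto intro!: csec_mult \<phi> exI[of _ K])
qed

lemma csec_zero: "csec 0"
  unfolding csec_def fsec_def zero_fun_def using continuous_zero_section fib_0 by auto

lemma sections_c_zero: "open_bisection G U \<Longrightarrow> 0 \<in> sections_c G L U"
  unfolding sections_c_iff[OF bisection_openin] using csec_zero by (auto intro: exI[of _ "{}"])

lemma sections_c_Gamma: "open_bisection G U \<Longrightarrow> f \<in> sections_c G L U \<Longrightarrow> f \<in> Gamma_c G L"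
  unfolding Gamma_c_def by (rule VF.span_base) blast

lemma Gamma_subspace: "VF.subspace (Gamma_c G L)"
  unfolding Gamma_c_def by (rule VF.subspace_span)

lemma Gamma_add: "f \<in> Gamma_c G L \<Longrightarrow> h \<in> Gamma_c G L \<Longrightarrow> f + h \<in> Gamma_c G L"
  by (rule VF.subspace_add[OF Gamma_subspace])

text \<open>No scalar case arises, because multiples of an elementary section are elementary on the
  same bisection.\<close>

lemma Gamma_induct [consumes 1, case_names elementary add]:
  assumes f: "f \<in> Gamma_c G L"
    and elem: "\<And>U f. open_bisection G U \<Longrightarrow> f \<in> sections_c G L U \<Longrightarrow> P f"
    and add: "\<And>f h. f \<in> Gamma_c G L \<Longrightarrow> h \<in> Gamma_c G L \<Longrightarrow> P f \<Longrightarrow> P h \<Longrightarrow> P (f + h)"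
  shows "P f"
proof -
  from f have "f \<in> Gamma_c G L \<and> P f"
    unfolding Gamma_c_def
  proof (induction rule: VF.span_induct_alt)
    case base
    then show ?case using elem[OF bisection_units sections_c_zero[OF bisection_units]] VF.span_zero by blast
  next
    case (step c x y)
    then obtain U where U: "open_bisection G U" "x \<in> sections_c G L U" by blast
    note s = sections_c_scale[OF U, of c]
    show ?case
      using add[OF sections_c_Gamma[OF U(1) s] _ elem[OF U(1) s]] Gamma_add[OF sections_c_Gamma[OF U(1) s]] step
      unfolding Gamma_c_def by blast
  qed
  then show ?thesis by blast
qed

lemma Gamma_csec: "f \<in> Gamma_c G L \<Longrightarrow> csec f"
proof (induction rule: Gamma_induct)
  case (elementary U f)
  then show ?case using sections_cE by blast
qed (rule csec_add)

lemma Gamma_fsec: "f \<in> Gamma_c G L \<Longrightarrow> fsec f"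
  by (intro csec_fsec Gamma_csec)

lemma Gamma_compact:
  assumes "f \<in> Gamma_c G L"
  shows "\<exists>K. compactin (gtop G) K \<and> (\<forall>g. g \<notin> K \<longrightarrow> f g = 0)"
  using assms
proof (induction rule: Gamma_induct)
  case (elementary U f)
  obtain K where "csec f" "compactin (gtop G) K" "K \<subseteq> U" "\<And>g. g \<notin> K \<Longrightarrow> f g = 0"
    by (rule sections_cE[OF elementary]) blast
  then show ?case by blast
next
  case (add f h)
  then obtain K K' where "compactin (gtop G) K" "\<forall>g. g \<notin> K \<longrightarrow> f g = 0" "compactin (gtop G) K'" "\<forall>g. g \<notin> K' \<longrightarrow> h g = 0"
    by blast
  then show ?case by (intro exI[of _ "K \<union> K'"]) (simp add: compactin_Un)
qed

lemma Gamma_outside: "f \<in> Gamma_c G L \<Longrightarrow> g \<notin> arrows G \<Longrightarrow> f g = 0"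
  using Gamma_compact compactin_subset_topspace by blast

section \<open>Convolution of sections\<close>

definition rsupp :: "('g \<Rightarrow> 'v) \<Rightarrow> 'g \<Rightarrow> 'g set"
  where "rsupp f g = {a \<in> arrows G. rng G a = rng G g \<and> f a \<noteq> 0}"

text \<open>A section over a bisection has at most one nonzero value in each range fibre, and
  finitely many such sections are added.\<close>

lemma finite_rsupp: "f \<in> Gamma_c G L \<Longrightarrow> finite (rsupp f g)"
proof (induction rule: Gamma_induct)
  case (elementary U f)
  obtain K where K: "csec f" "compactin (gtop G) K" "K \<subseteq> U" "\<And>g. g \<notin> K \<Longrightarrow> f g = 0"
    by (rule sections_cE[OF elementary]) blast
  have "rsupp f g \<subseteq> {lpart U g}"
  proof
    fix a assume "a \<in> rsupp f g"
    then have "a \<in> U" "rng G g = rng G a" using K unfolding rsupp_def by auto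
    then show "a \<in> {lpart U g}" using lpart_eq[OF elementary(1)] by simp
  qed
  then show ?case by (rule finite_subset) simp
next
  case (add f h)
  have "rsupp (f + h) g \<subseteq> rsupp f g \<union> rsupp h g" unfolding rsupp_def by auto
  then show ?case using add by (meson finite_UnI finite_subset)
qed

lemma conv_rsupp:
  assumes g: "g \<in> arrows G"
  shows "conv G L f \<xi> g = (\<Sum>a\<in>rsupp f g. lmul L a (gmul G (ginv G a) g) (f a) (\<xi> (gmul G (ginv G a) g)))"
proof -
  have eq: "{(g1, g2). g1 \<in> arrows G \<and> g2 \<in> arrows G \<and> src G g1 = rng G g2 \<and> gmul G g1 g2 = g \<and> f g1 \<noteq> 0}
      = (\<lambda>a. (a, gmul G (ginv G a) g)) ` rsupp f g" (is "?A = ?B")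
  proof (intro equalityI subsetI)
    fix p assume "p \<in> ?A"
    then obtain a b where p: "p = (a, b)" "a \<in> arrows G" "b \<in> arrows G" "src G a = rng G b" "gmul G a b = g" "f a \<noteq> 0"
      by (cases p) auto
    then have "rng G g = rng G a \<and> b = gmul G (ginv G a) g" using mul_eq_iff[OF p(2,3) g p(4)] by simp
    then show "p \<in> ?B" using p unfolding rsupp_def by auto
  next
    fix p assume "p \<in> ?B"
    then obtain a where "p = (a, gmul G (ginv G a) g)" "a \<in> arrows G" "rng G a = rng G g" "f a \<noteq> 0"
      unfolding rsupp_def by auto
    then show "p \<in> ?A"
      using g by (simp add: inv_mul_arrow rng_inv_mul mul_inv_left)
  qed
  show ?thesis
    unfolding conv_def eq by (subst sum.reindex) (auto intro: inj_onI)
qed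

text \<open>The index set of \<open>conv\<close> depends on \<open>f\<close>. Adding zero terms
  gives different sections a common index set, without which additivity in \<open>f\<close> could
  not be read off.\<close>

lemma conv_superset:
  assumes g: "g \<in> arrows G" and S: "finite S" "rsupp f g \<subseteq> S" "S \<subseteq> {a \<in> arrows G. rng G a = rng G g}"
    and \<xi>: "fsec \<xi>"
  shows "conv G L f \<xi> g = (\<Sum>a\<in>S. lmul L a (gmul G (ginv G a) g) (f a) (\<xi> (gmul G (ginv G a) g)))"
  unfolding conv_rsupp[OF g]
proof (rule sum.mono_neutral_left[OF S(1,2)], intro ballI)
  fix a assume a: "a \<in> S - rsupp f g"
  then have "a \<in> arrows G" "rng G a = rng G g" "f a = 0" using S(3) unfolding rsupp_def by auto
  then show "lmul L a (gmul G (ginv G a) g) (f a) (\<xi> (gmul G (ginv G a) g)) = 0"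
    using g fsecD[OF \<xi>] by (simp add: lmul_0_left inv_mul_arrow rng_inv_mul)
qed

lemma conv_outside: "g \<notin> arrows G \<Longrightarrow> conv G L f \<xi> g = 0"
proof -
  assume g: "g \<notin> arrows G"
  then have *: "{(g1, g2). g1 \<in> arrows G \<and> g2 \<in> arrows G \<and> src G g1 = rng G g2 \<and> gmul G g1 g2 = g \<and> f g1 \<noteq> 0} = {}"
    using mul_closed by blast
  show ?thesis unfolding conv_def * by simp
qed

lemma conv_add_left:
  assumes "f \<in> Gamma_c G L" "h \<in> Gamma_c G L" "fsec \<xi>"
  shows "conv G L (f + h) \<xi> = conv G L f \<xi> + conv G L h \<xi>"
proof
  fix g
  show "conv G L (f + h) \<xi> g = (conv G L f \<xi> + conv G L h \<xi>) g"
  proof (cases "g \<in> arrows G")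
    case g: True
    let ?S = "rsupp f g \<union> rsupp h g"
    have S: "finite ?S" "rsupp (f + h) g \<subseteq> ?S" "?S \<subseteq> {a \<in> arrows G. rng G a = rng G g}"
      using finite_rsupp assms by (auto simp: rsupp_def)
    have "conv G L (f + h) \<xi> g = (\<Sum>a\<in>?S. lmul L a (gmul G (ginv G a) g) ((f + h) a) (\<xi> (gmul G (ginv G a) g)))"
      by (rule conv_superset[OF g S assms(3)])
    also have "\<dots> = (\<Sum>a\<in>?S. lmul L a (gmul G (ginv G a) g) (f a) (\<xi> (gmul G (ginv G a) g))
        + lmul L a (gmul G (ginv G a) g) (h a) (\<xi> (gmul G (ginv G a) g)))"
      using S(3) fsecD[OF Gamma_fsec[OF assms(1)]] fsecD[OF Gamma_fsec[OF assms(2)]] fsecD[OF assms(3)] g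
      by (intro sum.cong) (auto simp: lmul_add_left inv_mul_arrow rng_inv_mul)
    also have "\<dots> = conv G L f \<xi> g + conv G L h \<xi> g"
      unfolding sum.distrib
      using conv_superset[OF g S(1) _ S(3) assms(3), of f] conv_superset[OF g S(1) _ S(3) assms(3), of h] by simp
    finally show ?thesis by simp
  qed (simp add: conv_outside)
qed

lemma conv_scale_left:
  assumes "f \<in> Gamma_c G L" "fsec \<xi>"
  shows "conv G L (\<lambda>g. lscale L z (f g)) \<xi> = (\<lambda>g. lscale L z (conv G L f \<xi> g))"
proof
  fix g
  show "conv G L (\<lambda>g. lscale L z (f g)) \<xi> g = lscale L z (conv G L f \<xi> g)"
  proof (cases "g \<in> arrows G")
    case g: True
    let ?S = "rsupp f g"
    have S: "finite ?S" "rsupp (\<lambda>g. lscale L z (f g)) g \<subseteq> ?S" "?S \<subseteq> {a \<in> arrows G. rng G a = rng G g}"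
      using finite_rsupp assms by (auto simp: rsupp_def)
    have "conv G L (\<lambda>g. lscale L z (f g)) \<xi> g
        = (\<Sum>a\<in>?S. lmul L a (gmul G (ginv G a) g) (lscale L z (f a)) (\<xi> (gmul G (ginv G a) g)))"
      by (rule conv_superset[OF g S assms(2)])
    also have "\<dots> = (\<Sum>a\<in>?S. lscale L z (lmul L a (gmul G (ginv G a) g) (f a) (\<xi> (gmul G (ginv G a) g))))"
      using S(3) fsecD[OF Gamma_fsec[OF assms(1)]] fsecD[OF assms(2)] g
      by (intro sum.cong) (auto simp: lmul_scale_left inv_mul_arrow rng_inv_mul)
    finally show ?thesis unfolding conv_rsupp[OF g] VL.scale_sum_right .
  qed (simp add: conv_outside)
qed

lemma conv_add_right:
  assumes "fsec f" "fsec \<xi>" "fsec \<eta>"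
  shows "conv G L f (\<xi> + \<eta>) = conv G L f \<xi> + conv G L f \<eta>"
proof
  fix g
  show "conv G L f (\<xi> + \<eta>) g = (conv G L f \<xi> + conv G L f \<eta>) g"
  proof (cases "g \<in> arrows G")
    case g: True
    show ?thesis unfolding plus_fun_apply conv_rsupp[OF g] sum.distrib[symmetric]
      using g fsecD[OF assms(1)] fsecD[OF assms(2)] fsecD[OF assms(3)]
      by (intro sum.cong) (auto simp: rsupp_def lmul_add_right inv_mul_arrow rng_inv_mul)
  qed (simp add: conv_outside)
qed

lemma conv_scale_right:
  assumes "fsec f" "fsec \<xi>"
  shows "conv G L f (\<lambda>g. lscale L z (\<xi> g)) = (\<lambda>g. lscale L z (conv G L f \<xi> g))"
proof
  fix g
  show "conv G L f (\<lambda>g. lscale L z (\<xi> g)) g = lscale L z (conv G L f \<xi> g)"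
  proof (cases "g \<in> arrows G")
    case g: True
    show ?thesis unfolding conv_rsupp[OF g] VL.scale_sum_right
      using g fsecD[OF assms(1)] fsecD[OF assms(2)]
      by (intro sum.cong) (auto simp: rsupp_def lmul_scale_right inv_mul_arrow rng_inv_mul)
  qed (simp add: conv_outside)
qed

lemma conv_fsec:
  assumes "fsec f" "fsec \<xi>"
  shows "fsec (conv G L f \<xi>)"
  unfolding fsec_def
proof
  fix g assume g: "g \<in> arrows G"
  have "lmul L a (gmul G (ginv G a) g) (f a) (\<xi> (gmul G (ginv G a) g)) \<in> fib L g" if "a \<in> rsupp f g" for a
    using that g fsecD[OF assms(1)] fsecD[OF assms(2)] unfolding rsupp_def
    by (intro lmul_closed') (auto simp: inv_mul_arrow rng_inv_mul mul_inv_left)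
  then show "conv G L f \<xi> g \<in> fib L g"
    unfolding conv_rsupp[OF g] by (intro VL.subspace_sum fib_subspace g)
qed

text \<open>Over a bisection the sum has a single term, given by the factorisation through
  \<open>U\<close>. All later computations with convolutions start from this formula.\<close>

lemma conv_elementary:
  assumes U: "open_bisection G U" and f: "f \<in> sections_c G L U" and \<xi>: "fsec \<xi>" and g: "g \<in> arrows G"
  shows "conv G L f \<xi> g =
    (if g \<in> ldom U then lmul L (lpart U g) (rpart U g) (f (lpart U g)) (\<xi> (rpart U g)) else 0)"
proof -
  obtain K where K: "csec f" "compactin (gtop G) K" "K \<subseteq> U" "\<And>g. g \<notin> K \<Longrightarrow> f g = 0"
    by (rule sections_cE[OF U f]) blast
  have sub: "a \<in> U \<and> rng G g = rng G a" if "a \<in> rsupp f g" for a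
    using that K(3,4) unfolding rsupp_def by auto
  show ?thesis
  proof (cases "g \<in> ldom U")
    case True
    note l = lpart_in[OF U True]
    have "conv G L f \<xi> g = (\<Sum>a\<in>{lpart U g}. lmul L a (gmul G (ginv G a) g) (f a) (\<xi> (gmul G (ginv G a) g)))"
    proof (rule conv_superset[OF g _ _ _ \<xi>])
      show "rsupp f g \<subseteq> {lpart U g}"
      proof
        fix a assume "a \<in> rsupp f g"
        then have "a \<in> U" "rng G g = rng G a" using sub by auto
        then show "a \<in> {lpart U g}" using lpart_eq[OF U] by simp
      qed
    qed (use l in auto)
    then show ?thesis using True by (simp add: rpart_def)
  next
    case False
    then have "rsupp f g = {}" using sub g unfolding ldom_def by blast
    then show ?thesis using False unfolding conv_rsupp[OF g] by simp
  qed
qed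

text \<open>Continuity comes from the continuous dependence of the two factors on \<open>g\<close>,
  and compactness of the support from the product of the two compact supports.\<close>

lemma conv_sections_c:
  assumes U: "open_bisection G U" and f: "f \<in> sections_c G L U"
    and V: "open_bisection G V" and h: "h \<in> sections_c G L V"
  shows "conv G L f h \<in> sections_c G L (bmul U V)"
proof -
  obtain K where K: "csec f" "compactin (gtop G) K" "K \<subseteq> U" "\<And>g. g \<notin> K \<Longrightarrow> f g = 0"
    by (rule sections_cE[OF U f]) blast
  obtain K' where K': "csec h" "compactin (gtop G) K'" "K' \<subseteq> V" "\<And>g. g \<notin> K' \<Longrightarrow> h g = 0"
    by (rule sections_cE[OF V h]) blast
  note fs = csec_fsec[OF K(1)] and hs = csec_fsec[OF K'(1)]
  have eq: "conv G L f h g = lmul L (lpart U g) (rpart U g) (f (lpart U g)) (h (rpart U g))" if "g \<in> ldom U" for g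
    using conv_elementary[OF U f hs, of g] that unfolding ldom_def by simp
  have sub: "bmul U V \<subseteq> ldom U" unfolding bmul_def by blast
  let ?Y = "subtopology (gtop G) (bmul U V)"
  let ?KK = "{gmul G g h | g h. g \<in> K \<and> h \<in> K' \<and> src G g = rng G h}"
  show ?thesis
    unfolding sections_c_def
  proof (intro CollectI conjI exI)
    show "\<forall>g\<in>bmul U V. conv G L f h g \<in> fib L g"
      using fsecD[OF conv_fsec[OF fs hs]] bisection_arrow[OF bisection_bmul[OF U V]] by blast
    have 1: "continuous_map ?Y (gtop G) (lpart U)" "continuous_map ?Y (gtop G) (rpart U)"
      by (rule continuous_map_from_subtopology_mono[OF continuous_lpart[OF U] sub],
          rule continuous_map_from_subtopology_mono[OF continuous_rpart[OF U] sub])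
    have "continuous_map ?Y (ltop L) (\<lambda>g. (lpart U g, f (lpart U g)))" "continuous_map ?Y (ltop L) (\<lambda>g. (rpart U g, h (rpart U g)))"
      using continuous_map_compose[OF 1(1), of "ltop L" "\<lambda>g. (g, f g)"] continuous_map_compose[OF 1(2), of "ltop L" "\<lambda>g. (g, h g)"]
        K(1) K'(1) unfolding csec_def o_def by auto
    then have "continuous_map ?Y (ltop L) (\<lambda>g. (gmul G (lpart U g) (rpart U g),
        lmul L (lpart U g) (rpart U g) (f (lpart U g)) (h (rpart U g))))"
      by (rule Lcont_mul) (use rpart_props(2)[OF U] sub in auto)
    then show "continuous_map ?Y (ltop L) (\<lambda>g. (g, conv G L f h g))"
      by (rule continuous_map_eq) (use rpart_props(4)[OF U] eq sub in auto)
    show "compactin (gtop G) ?KK" by (rule compact_mul[OF K(2) K'(2)])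
    show "?KK \<subseteq> bmul U V"
    proof
      fix g assume "g \<in> ?KK"
      then obtain a b where ab: "g = gmul G a b" "a \<in> K" "b \<in> K'" "src G a = rng G b" by blast
      then have "a \<in> U" "b \<in> V" using K(3) K'(3) by auto
      then show "g \<in> bmul U V"
        unfolding ab(1) using bmul_iff[OF U _ bisection_arrow[OF V] ab(4)] by simp
    qed
    show "\<forall>g. g \<notin> ?KK \<longrightarrow> conv G L f h g = 0"
    proof (intro allI impI)
      fix g assume g: "g \<notin> ?KK"
      show "conv G L f h g = 0"
      proof (cases "g \<in> ldom U")
        case True
        note l = lpart_in[OF U True] and r = rpart_props[OF U True]
        have "lpart U g \<notin> K \<or> rpart U g \<notin> K'"
        proof (rule ccontr)
          assume "\<not> ?thesis"
          then have "gmul G (lpart U g) (rpart U g) \<in> ?KK" using r(2) by (intro CollectI exI conjI) auto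
          then show False using g unfolding r(4) by blast
        qed
        then have "f (lpart U g) = 0 \<or> h (rpart U g) = 0" using K(4) K'(4) by blast
        then show ?thesis
          unfolding eq[OF True] using fsecD[OF fs l(3)] fsecD[OF hs r(1)] l(3) r(1,2)
          by (auto simp: lmul_0_left lmul_0_right)
      next
        case False
        then show ?thesis using conv_elementary[OF U f hs, of g] conv_outside[of g] by (cases "g \<in> arrows G") auto
      qed
    qed
  qed
qed

lemma conv_Gamma:
  assumes f: "f \<in> Gamma_c G L" and h: "h \<in> Gamma_c G L"
  shows "conv G L f h \<in> Gamma_c G L"
  using f
proof (induction rule: Gamma_induct)
  case (elementary U f)
  show ?case
    using h
  proof (induction rule: Gamma_induct)
    case (elementary V h)
    then show ?case
      using conv_sections_c[OF \<open>open_bisection G U\<close> \<open>f \<in> sections_c G L U\<close>]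
        sections_c_Gamma[OF bisection_bmul[OF \<open>open_bisection G U\<close>]] by blast
  next
    case (add h k)
    then show ?case
      unfolding conv_add_right[OF Gamma_fsec[OF sections_c_Gamma[OF elementary]] Gamma_fsec[OF add(1)] Gamma_fsec[OF add(2)]]
      by (intro Gamma_add)
  qed
next
  case (add f k)
  then show ?case unfolding conv_add_left[OF add(1,2) Gamma_fsec[OF h]] by (intro Gamma_add)
qed

text \<open>If \<open>g = a b d\<close> with \<open>a\<close> in \<open>U\<close> and
  \<open>b\<close> in \<open>V\<close>, both sides are the product of the three values, bracketed
  differently. If there is no such factorisation, both sides vanish.\<close>

lemma conv_assoc_elementary:
  assumes U: "open_bisection G U" and f: "f \<in> sections_c G L U"
    and V: "open_bisection G V" and h: "h \<in> sections_c G L V" and \<xi>: "fsec \<xi>" and g: "g \<in> arrows G"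
  shows "conv G L (conv G L f h) \<xi> g = conv G L f (conv G L h \<xi>) g"
proof -
  note B = bisection_bmul[OF U V] and fh = conv_sections_c[OF U f V h]
  have fs: "fsec f" and hs: "fsec h" using sections_c_Gamma U f V h Gamma_fsec by blast+
  note h\<xi> = conv_fsec[OF hs \<xi>]
  show ?thesis
  proof (cases "g \<in> ldom U \<and> rpart U g \<in> ldom V")
    case True
    define a where "a = lpart U g"
    define k where "k = rpart U g"
    define b where "b = lpart V k"
    define d where "d = rpart V k"
    note a = lpart_in[OF U conjunct1[OF True], folded a_def] and k = rpart_props[OF U conjunct1[OF True], folded a_def k_def]
    have kV: "k \<in> ldom V" using True by (simp add: k_def)
    note b = lpart_in[OF V kV, folded b_def] and d = rpart_props[OF V kV, folded b_def d_def]
    have ab: "src G a = rng G b" using k(2) b(2) by simp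
    have bd: "src G b = rng G d" using d(2) by simp
    have abU: "gmul G a b \<in> ldom U" "lpart U (gmul G a b) = a" "rpart U (gmul G a b) = b"
      using rpart_mul[OF U a(1) b(3) ab] by auto
    have c: "gmul G a b \<in> bmul U V" using bmul_iff[OF U a(1) b(3) ab] b(1) by simp
    have gabd: "g = gmul G (gmul G a b) d"
      using mul_assoc[OF a(3) b(3) d(1) ab bd] k(4) d(4) by simp
    have cd: "src G (gmul G a b) = rng G d" using src_mul[OF a(3) b(3) ab] bd by simp
    note g' = rpart_mul[OF B c d(1) cd, folded gabd]
    have "conv G L (conv G L f h) \<xi> g = lmul L (gmul G a b) d (conv G L f h (gmul G a b)) (\<xi> d)"
      using conv_elementary[OF B fh \<xi> g] g' by simp
    also have "conv G L f h (gmul G a b) = lmul L a b (f a) (h b)"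
      using conv_elementary[OF U f hs mul_closed[OF a(3) b(3) ab]] abU by simp
    also have "lmul L (gmul G a b) d (lmul L a b (f a) (h b)) (\<xi> d) = lmul L a (gmul G b d) (f a) (lmul L b d (h b) (\<xi> d))"
      by (rule lmul_assoc[OF a(3) b(3) d(1) ab bd]) (use fs hs \<xi> a b d in \<open>auto intro: fsecD\<close>)
    also have "gmul G b d = k" using d(4) .
    also have "lmul L b d (h b) (\<xi> d) = conv G L h \<xi> k"
      using conv_elementary[OF V h \<xi> k(1)] kV by (simp add: b_def d_def)
    also have "lmul L a k (f a) (conv G L h \<xi> k) = conv G L f (conv G L h \<xi>) g"
      using conv_elementary[OF U f h\<xi> g] True by (simp add: a_def k_def)
    finally show ?thesis .
  next
    case False
    have "g \<notin> ldom (bmul U V)"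
    proof
      assume "g \<in> ldom (bmul U V)"
      then obtain c where "c \<in> bmul U V" "rng G g = rng G c" unfolding ldom_def by blast
      then have c: "c \<in> ldom U" "rpart U c \<in> V" "rng G g = rng G c" unfolding bmul_def by auto
      then have gU: "g \<in> ldom U" using g unfolding ldom_def by auto
      have "lpart U g = lpart U c" using c(3) by (simp add: lpart_def)
      then have "rng G (rpart U g) = rng G (rpart U c)"
        using rpart_props(2)[OF U gU] rpart_props(2)[OF U c(1)] by simp
      then have "rpart U g \<in> ldom V"
        using c(2) rpart_props(1)[OF U gU] unfolding ldom_def by auto
      then show False using False gU by blast
    qed
    then have 0: "conv G L (conv G L f h) \<xi> g = 0" using conv_elementary[OF B fh \<xi> g] by simp
    show ?thesis
    proof (cases "g \<in> ldom U")
      case True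
      note l = lpart_in[OF U True] and r = rpart_props[OF U True]
      have "conv G L h \<xi> (rpart U g) = 0" using conv_elementary[OF V h \<xi> r(1)] False True by simp
      then show ?thesis
        using 0 conv_elementary[OF U f h\<xi> g] True l(3) r(1,2) fsecD[OF fs] by (simp add: lmul_0_right)
    next
      case False
      then show ?thesis using 0 conv_elementary[OF U f h\<xi> g] by simp
    qed
  qed
qed

lemma conv_assoc:
  assumes f: "f \<in> Gamma_c G L" and h: "h \<in> Gamma_c G L" and \<xi>: "fsec \<xi>"
  shows "conv G L (conv G L f h) \<xi> = conv G L f (conv G L h \<xi>)"
  using f
proof (induction rule: Gamma_induct)
  case f: (elementary U f)
  note fG = sections_c_Gamma[OF f]
  show ?case
    using h
  proof (induction rule: Gamma_induct)
    case h: (elementary V h)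
    show ?case
    proof
      fix g
      show "conv G L (conv G L f h) \<xi> g = conv G L f (conv G L h \<xi>) g"
        using conv_assoc_elementary[OF f h \<xi>] conv_outside by (cases "g \<in> arrows G") auto
    qed
  next
    case (add h k)
    note s = Gamma_fsec[OF fG] Gamma_fsec[OF add(1)] Gamma_fsec[OF add(2)]
    show ?case
      unfolding conv_add_left[OF add(1,2) \<xi>] conv_add_right[OF s]
        conv_add_right[OF s(1) conv_fsec[OF s(2) \<xi>] conv_fsec[OF s(3) \<xi>]]
        conv_add_left[OF conv_Gamma[OF fG add(1)] conv_Gamma[OF fG add(2)] \<xi>] add(3,4) ..
  qed
next
  case (add f k)
  note s = Gamma_fsec[OF h]
  show ?case
    unfolding conv_add_left[OF add(1,2) s] conv_add_left[OF add(1,2) conv_fsec[OF s \<xi>]]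
      conv_add_left[OF conv_Gamma[OF add(1) h] conv_Gamma[OF add(2) h] \<xi>] add(3,4) ..
qed

section \<open>Functions on the unit space as sections\<close>

definition iota :: "('g \<Rightarrow> complex) \<Rightarrow> 'g \<Rightarrow> 'v"
  where "iota e g = (if g \<in> units G then lscale L (e g) (fib_one L g) else 0)"

lemma iota_sections_c:
  assumes e: "e \<in> C_c (unit_top G)"
  shows "iota e \<in> sections_c G L (units G)"
proof -
  obtain K where K: "compactin (unit_top G) K" "\<And>x. x \<notin> K \<Longrightarrow> e x = 0" by (rule C_cE[OF e]) blast
  show ?thesis
    unfolding sections_c_def
  proof (intro CollectI conjI exI)
    show "\<forall>g\<in>units G. iota e g \<in> fib L g"
      by (simp add: iota_def fib_scale unit_arrow fib_one)
    have "continuous_map (unit_top G) (ltop L) (\<lambda>x. (x, lscale L (e x) (fib_one L x)))"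
      by (rule Lcont_scale[OF C_cD_continuous[OF e] continuous_unit_section])
    then show "continuous_map (subtopology (gtop G) (units G)) (ltop L) (\<lambda>g. (g, iota e g))"
      unfolding unit_top_def by (rule continuous_map_eq) (simp add: iota_def)
    show "compactin (gtop G) K" "K \<subseteq> units G"
      using K(1) unfolding unit_top_def by (auto simp: compactin_subtopology)
    show "\<forall>g. g \<notin> K \<longrightarrow> iota e g = 0" using K(2) by (simp add: iota_def)
  qed
qed

lemma iota_Gamma: "e \<in> C_c (unit_top G) \<Longrightarrow> iota e \<in> Gamma_c G L"
  by (rule sections_c_Gamma[OF bisection_units iota_sections_c])

text \<open>The only factorisation of \<open>g\<close> that starts with a unit is the one through
  its range, and the unit of the fibre over the range acts trivially.\<close>

lemma conv_iota_left:
  assumes e: "e \<in> C_c (unit_top G)" and \<xi>: "fsec \<xi>" and g: "g \<in> arrows G"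
  shows "conv G L (iota e) \<xi> g = lscale L (e (rng G g)) (\<xi> g)"
proof -
  note U = bisection_units and r = rng_in_units[OF g]
  have "g \<in> ldom (units G)"
    using g imageI[OF r, of "rng G"] rng_rng[OF g] unfolding ldom_def by simp
  moreover have l: "lpart (units G) g = rng G g" by (rule lpart_eq[OF U r]) (simp add: rng_rng g)
  moreover have "rpart (units G) g = g"
    unfolding rpart_def l inv_unit[OF r] by (rule rng_mul_left[OF g])
  ultimately have "conv G L (iota e) \<xi> g = lmul L (rng G g) g (lscale L (e (rng G g)) (fib_one L (rng G g))) (\<xi> g)"
    using conv_elementary[OF U iota_sections_c[OF e] \<xi> g] r by (simp add: iota_def)
  then show ?thesis
    using fib_one_lmul(1)[OF g fsecD[OF \<xi> g]] fib_one(1)[OF r] fsecD[OF \<xi> g] g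
    by (simp add: lmul_scale_left rng_closed src_rng)
qed

text \<open>The second factor \<open>gmul G (ginv G a) g\<close> is a unit only if
  \<open>a = g\<close>, so one term survives. Nothing is asked of the continuity of
  \<open>\<zeta>\<close>, and the formula covers both \<open>iota e\<close> and point
  masses.\<close>

lemma conv_unit_supported:
  assumes f: "f \<in> Gamma_c G L" and \<zeta>: "fsec \<zeta>" "\<And>g. g \<notin> units G \<Longrightarrow> \<zeta> g = 0" and g: "g \<in> arrows G"
  shows "conv G L f \<zeta> g = lmul L g (src G g) (f g) (\<zeta> (src G g))"
proof -
  note fs = Gamma_fsec[OF f]
  let ?t = "\<lambda>a. lmul L a (gmul G (ginv G a) g) (f a) (\<zeta> (gmul G (ginv G a) g))"
  let ?S = "insert g (rsupp f g)"
  have S: "finite ?S" "?S \<subseteq> {a \<in> arrows G. rng G a = rng G g}"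
    using finite_rsupp[OF f] g by (auto simp: rsupp_def)
  have z: "?t a = 0" if "a \<in> ?S - {g}" for a
  proof -
    have a: "a \<in> arrows G" "rng G a = rng G g" "a \<noteq> g" using that S(2) by auto
    have "gmul G (ginv G a) g \<notin> units G"
    proof
      assume u: "gmul G (ginv G a) g \<in> units G"
      then have "gmul G (ginv G a) g = src G a" using rng_inv_mul[OF a(1) g a(2)] rng_unit by simp
      then have "gmul G a (gmul G (ginv G a) g) = a" using mul_src_right[OF a(1)] by simp
      then show False using mul_inv_left[OF a(1) g a(2)] a(3) by simp
    qed
    then show ?thesis
      using a g fsecD[OF fs a(1)] \<zeta>(2) by (simp add: lmul_0_right inv_mul_arrow rng_inv_mul)
  qed
  have "conv G L f \<zeta> g = sum ?t ?S"
    by (rule conv_superset[OF g S(1) _ S(2) \<zeta>(1)]) blast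
  also have "\<dots> = ?t g" using sum.mono_neutral_right[of ?S "{g}" ?t] S(1) z by auto
  finally show ?thesis by (simp add: inv_mul g)
qed

lemma conv_iota_right:
  assumes e: "e \<in> C_c (unit_top G)" and f: "f \<in> Gamma_c G L" and g: "g \<in> arrows G"
  shows "conv G L f (iota e) g = lscale L (e (src G g)) (f g)"
proof -
  note fs = fsecD[OF Gamma_fsec[OF f] g] and s = src_in_units[OF g]
  have "conv G L f (iota e) g = lmul L g (src G g) (f g) (iota e (src G g))"
    by (rule conv_unit_supported[OF f Gamma_fsec[OF iota_Gamma[OF e]] _ g]) (simp add: iota_def)
  also have "\<dots> = lscale L (e (src G g)) (f g)"
    using fib_one_lmul(2)[OF g fs] fib_one(1)[OF s] fs g s
    by (simp add: iota_def lmul_scale_right src_closed rng_src)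
  finally show ?thesis .
qed

section \<open>Involution and restriction to the units\<close>

definition fstar :: "('g \<Rightarrow> 'v) \<Rightarrow> 'g \<Rightarrow> 'v"
  where "fstar f g = (if g \<in> arrows G then lstar L (ginv G g) (f (ginv G g)) else 0)"

lemma fstar_sections_c:
  assumes U: "open_bisection G U" and f: "f \<in> sections_c G L U"
  shows "fstar f \<in> sections_c G L (ginv G ` U)"
proof -
  obtain K where K: "csec f" "compactin (gtop G) K" "K \<subseteq> U" "\<And>g. g \<notin> K \<Longrightarrow> f g = 0"
    by (rule sections_cE[OF U f]) blast
  have fs: "fsec (fstar f)"
    unfolding fsec_def fstar_def using fsecD[OF csec_fsec[OF K(1)]] lstar_closed[OF inv_closed] inv_inv
    by (auto simp: inv_closed)
  have "continuous_map (gtop G) (ltop L) (\<lambda>g. (ginv G g, f (ginv G g)))"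
    using continuous_map_compose[OF continuous_inv, of "ltop L" "\<lambda>g. (g, f g)"] K(1) unfolding csec_def o_def by blast
  from Lcont_star[OF this] have "continuous_map (gtop G) (ltop L) (\<lambda>g. (g, fstar f g))"
    by (rule continuous_map_eq) (simp add: fstar_def inv_inv)
  then have "csec (fstar f)" using fs unfolding csec_def by blast
  moreover have "compactin (gtop G) (ginv G ` K)" by (rule image_compactin[OF K(2) continuous_inv])
  moreover have "fstar f g = 0" if "g \<notin> ginv G ` K" for g
  proof (cases "g \<in> arrows G")
    case True
    then have "ginv G g \<notin> K" using that inv_inv[OF True] by (metis imageI)
    then show ?thesis using K(4) lstar_0 inv_closed[OF True] by (simp add: fstar_def)
  qed (simp add: fstar_def)
  ultimately show ?thesis
    unfolding sections_c_iff[OF bisection_openin[OF bisection_inv[OF U]]] using K(3) by blast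
qed

lemma restrict_units_add:
  "f \<in> Gamma_c G L \<Longrightarrow> h \<in> Gamma_c G L \<Longrightarrow> restrict_units G L (f + h) = (\<lambda>x. restrict_units G L f x + restrict_units G L h x)"
  unfolding restrict_units_def
  by (auto simp: fun_eq_iff unit_coord_add fsecD[OF Gamma_fsec] unit_arrow)

text \<open>The support stays compact under restriction because the unit space is closed.\<close>

lemma restrict_units_C_c:
  assumes "f \<in> Gamma_c G L"
  shows "restrict_units G L f \<in> C_c (unit_top G)"
proof -
  obtain K where K: "compactin (gtop G) K" "\<And>g. g \<notin> K \<Longrightarrow> f g = 0" using Gamma_compact[OF assms] by blast
  show ?thesis
  proof (rule C_cI)
    have "continuous_map (unit_top G) (ltop L) (\<lambda>x. (x, f x))"
      using Gamma_csec[OF assms] unfolding csec_def unit_top_def by (intro continuous_map_from_subtopology) blast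
    from continuous_unit_coord[OF this]
    have "continuous_map (unit_top G) euclidean (\<lambda>x. unit_coord L x (f x))" by (simp add: topspace_unit_top)
    then show "continuous_map (unit_top G) euclidean (restrict_units G L f)"
      by (rule continuous_map_eq) (simp add: topspace_unit_top restrict_units_def)
    show "compactin (unit_top G) (units G \<inter> K)"
      unfolding unit_top_def using closed_Int_compactin[OF closedin_units K(1)] by (simp add: compactin_subtopology)
    show "restrict_units G L f x = 0" if "x \<notin> units G \<inter> K" for x
      using that K(2) by (auto simp: restrict_units_def unit_coord_0)
  qed
qed

end


section \<open>Square-summable sections and bounded operators\<close>

context hausdorff_twist
begin

abbreviation "H2 \<equiv> l2 G L"
abbreviation "nrm \<equiv> l2_norm G L"

lemma l2_fsec: "\<xi> \<in> H2 \<Longrightarrow> fsec \<xi>"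
  unfolding l2_def fsec_def by blast

lemma l2_outside: "\<xi> \<in> H2 \<Longrightarrow> g \<notin> arrows G \<Longrightarrow> \<xi> g = 0"
  unfolding l2_def by blast

lemma l2_summable: "\<xi> \<in> H2 \<Longrightarrow> (\<lambda>g. (lnorm L g (\<xi> g))\<^sup>2) summable_on arrows G"
  unfolding l2_def by blast

lemma nrm_sq: "(nrm \<xi>)\<^sup>2 = (\<Sum>\<^sub>\<infinity>g\<in>arrows G. (lnorm L g (\<xi> g))\<^sup>2)"
  unfolding l2_norm_def by (intro real_sqrt_pow2 infsum_nonneg) simp

lemma nrm_nonneg: "0 \<le> nrm \<xi>"
  unfolding l2_norm_def by (intro real_sqrt_ge_zero infsum_nonneg) simp

lemma l2_sum_le:
  assumes "\<xi> \<in> H2" "finite F" "F \<subseteq> arrows G"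
  shows "(\<Sum>g\<in>F. (lnorm L g (\<xi> g))\<^sup>2) \<le> (nrm \<xi>)\<^sup>2"
  unfolding nrm_sq by (rule finite_sum_le_infsum[OF l2_summable[OF assms(1)] assms(2,3)]) simp

text \<open>Bounds on finite partial sums yield membership and the norm estimate together, so the
  later estimates involve finite sums only.\<close>

lemma l2I:
  assumes "fsec \<xi>" "\<And>g. g \<notin> arrows G \<Longrightarrow> \<xi> g = 0" "0 \<le> B"
    and B: "\<And>F. finite F \<Longrightarrow> F \<subseteq> arrows G \<Longrightarrow> (\<Sum>g\<in>F. (lnorm L g (\<xi> g))\<^sup>2) \<le> B\<^sup>2"
  shows "\<xi> \<in> H2" "nrm \<xi> \<le> B"
proof -
  have s: "(\<lambda>g. (lnorm L g (\<xi> g))\<^sup>2) summable_on arrows G"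
    by (rule nonneg_bdd_above_summable_on) (auto intro!: bdd_aboveI B)
  then show "\<xi> \<in> H2" using assms(1,2) unfolding l2_def fsec_def by blast
  have "(nrm \<xi>)\<^sup>2 \<le> B\<^sup>2" unfolding nrm_sq by (rule infsum_le_finite_sums[OF s B])
  then show "nrm \<xi> \<le> B" using assms(3) by (rule power2_le_imp_le)
qed

lemma L2_set_le_nrm:
  assumes "\<xi> \<in> H2" "finite F" "F \<subseteq> arrows G"
  shows "L2_set (\<lambda>g. lnorm L g (\<xi> g)) F \<le> nrm \<xi>"
  unfolding L2_set_def using l2_sum_le[OF assms] nrm_nonneg by (intro real_le_lsqrt sum_nonneg) auto

lemma lnorm_le_nrm:
  assumes "\<xi> \<in> H2" "g \<in> arrows G"
  shows "lnorm L g (\<xi> g) \<le> nrm \<xi>"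
  using l2_sum_le[OF assms(1), of "{g}"] assms(2) nrm_nonneg by (auto intro: power2_le_imp_le)

lemma fsec_add: "fsec \<xi> \<Longrightarrow> fsec \<eta> \<Longrightarrow> fsec (\<xi> + \<eta>)"
  unfolding fsec_def by (auto intro: fib_add)

lemma fsec_scale: "fsec \<xi> \<Longrightarrow> fsec (\<lambda>g. lscale L z (\<xi> g))"
  unfolding fsec_def by (auto intro: fib_scale)

lemma l2_add:
  assumes "\<xi> \<in> H2" "\<eta> \<in> H2"
  shows "\<xi> + \<eta> \<in> H2" "nrm (\<xi> + \<eta>) \<le> nrm \<xi> + nrm \<eta>"
proof -
  have "(\<Sum>g\<in>F. (lnorm L g ((\<xi> + \<eta>) g))\<^sup>2) \<le> (nrm \<xi> + nrm \<eta>)\<^sup>2" if F: "finite F" "F \<subseteq> arrows G" for F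
  proof -
    have f: "g \<in> arrows G" "\<xi> g \<in> fib L g" "\<eta> g \<in> fib L g" if "g \<in> F" for g
      using that F(2) fsecD[OF l2_fsec[OF assms(1)]] fsecD[OF l2_fsec[OF assms(2)]] by auto
    have "L2_set (\<lambda>g. lnorm L g ((\<xi> + \<eta>) g)) F \<le> L2_set (\<lambda>g. lnorm L g (\<xi> g) + lnorm L g (\<eta> g)) F"
    proof (rule L2_set_mono)
      show "lnorm L g ((\<xi> + \<eta>) g) \<le> lnorm L g (\<xi> g) + lnorm L g (\<eta> g)" "0 \<le> lnorm L g ((\<xi> + \<eta>) g)" if "g \<in> F" for g
        unfolding plus_fun_apply
        by (rule norm_triangle[OF f[OF that]], rule norm_nonneg[OF f(1)[OF that] fib_add[OF f[OF that]]])
    qed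
    also have "\<dots> \<le> L2_set (\<lambda>g. lnorm L g (\<xi> g)) F + L2_set (\<lambda>g. lnorm L g (\<eta> g)) F"
      by (rule L2_set_triangle_ineq)
    also have "\<dots> \<le> nrm \<xi> + nrm \<eta>" by (intro add_mono L2_set_le_nrm assms F)
    finally have "sqrt (\<Sum>g\<in>F. (lnorm L g ((\<xi> + \<eta>) g))\<^sup>2) \<le> nrm \<xi> + nrm \<eta>" unfolding L2_set_def .
    then show ?thesis by (rule sqrt_le_D)
  qed
  note B = this
  have 0: "(\<xi> + \<eta>) g = 0" if "g \<notin> arrows G" for g
    using l2_outside[OF assms(1) that] l2_outside[OF assms(2) that] by simp
  note fs = fsec_add[OF l2_fsec[OF assms(1)] l2_fsec[OF assms(2)]]
  show "\<xi> + \<eta> \<in> H2" by (rule l2I(1)[OF fs 0 add_nonneg_nonneg[OF nrm_nonneg nrm_nonneg] B])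
  show "nrm (\<xi> + \<eta>) \<le> nrm \<xi> + nrm \<eta>" by (rule l2I(2)[OF fs 0 add_nonneg_nonneg[OF nrm_nonneg nrm_nonneg] B])
qed

lemma l2_scale:
  assumes "\<xi> \<in> H2"
  shows "(\<lambda>g. lscale L z (\<xi> g)) \<in> H2" "nrm (\<lambda>g. lscale L z (\<xi> g)) = cmod z * nrm \<xi>"
proof -
  have eq: "(lnorm L g (lscale L z (\<xi> g)))\<^sup>2 = (cmod z)\<^sup>2 * (lnorm L g (\<xi> g))\<^sup>2" if "g \<in> arrows G" for g
    using norm_scale[OF that fsecD[OF l2_fsec[OF assms] that]] by (simp add: power_mult_distrib)
  have "(\<lambda>g. (cmod z)\<^sup>2 * (lnorm L g (\<xi> g))\<^sup>2) summable_on arrows G"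
    by (rule summable_on_cmult_right[OF l2_summable[OF assms]])
  moreover have "(\<lambda>g. (lnorm L g (lscale L z (\<xi> g)))\<^sup>2) summable_on arrows G
      \<longleftrightarrow> (\<lambda>g. (cmod z)\<^sup>2 * (lnorm L g (\<xi> g))\<^sup>2) summable_on arrows G"
    by (rule summable_on_cong) (rule eq)
  ultimately have "(\<lambda>g. (lnorm L g (lscale L z (\<xi> g)))\<^sup>2) summable_on arrows G" by simp
  then show "(\<lambda>g. lscale L z (\<xi> g)) \<in> H2"
    using fsec_scale[OF l2_fsec[OF assms], of z] l2_outside[OF assms] unfolding l2_def fsec_def by auto
  have "(nrm (\<lambda>g. lscale L z (\<xi> g)))\<^sup>2 = (\<Sum>\<^sub>\<infinity>g\<in>arrows G. (cmod z)\<^sup>2 * (lnorm L g (\<xi> g))\<^sup>2)"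
    unfolding nrm_sq by (rule infsum_cong) (rule eq)
  also have "\<dots> = (cmod z * nrm \<xi>)\<^sup>2"
    unfolding power_mult_distrib nrm_sq by (rule infsum_cmult_right')
  finally show "nrm (\<lambda>g. lscale L z (\<xi> g)) = cmod z * nrm \<xi>"
    using nrm_nonneg by (simp add: power2_eq_iff_nonneg)
qed

lemma l2_zero: "0 \<in> H2"
  unfolding l2_def using norm_0 fib_0 by (auto intro: summable_on_0)

lemma nrm_zero: "nrm 0 = 0"
  using l2_scale(2)[OF l2_zero, of 0] by (simp add: zero_fun_def)

lemma minus_as_scale: "- \<xi> = (\<lambda>g. lscale L (-1) (\<xi> g))"
  by (simp add: fun_eq_iff)

lemma l2_minus: "\<xi> \<in> H2 \<Longrightarrow> - \<xi> \<in> H2" "\<xi> \<in> H2 \<Longrightarrow> nrm (- \<xi>) = nrm \<xi>"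
  unfolding minus_as_scale using l2_scale[of \<xi> "-1"] by auto

lemma l2_diff: "\<xi> \<in> H2 \<Longrightarrow> \<eta> \<in> H2 \<Longrightarrow> \<xi> - \<eta> \<in> H2"
  using l2_add(1)[OF _ l2_minus(1), of \<xi> \<eta>] by simp

lemma nrm_minus_commute: "\<xi> \<in> H2 \<Longrightarrow> \<eta> \<in> H2 \<Longrightarrow> nrm (\<xi> - \<eta>) = nrm (\<eta> - \<xi>)"
  using l2_minus(2)[OF l2_diff, of \<xi> \<eta>] by simp

lemma nrm_triangle_diff: "\<xi> \<in> H2 \<Longrightarrow> \<eta> \<in> H2 \<Longrightarrow> \<zeta> \<in> H2 \<Longrightarrow> nrm (\<xi> - \<zeta>) \<le> nrm (\<xi> - \<eta>) + nrm (\<eta> - \<zeta>)"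
  using l2_add(2)[OF l2_diff l2_diff, of \<xi> \<eta> \<eta> \<zeta>] by simp

lemma nrm_eq_0D:
  assumes "\<xi> \<in> H2" "nrm \<xi> = 0"
  shows "\<xi> = 0"
proof
  fix g
  show "\<xi> g = 0 g"
  proof (cases "g \<in> arrows G")
    case True
    then have "lnorm L g (\<xi> g) = 0"
      using lnorm_le_nrm[OF assms(1) True] assms(2) norm_nonneg[OF True fsecD[OF l2_fsec[OF assms(1)] True]] by simp
    then show ?thesis using norm_eq_0[OF True fsecD[OF l2_fsec[OF assms(1)] True]] by simp
  qed (simp add: l2_outside[OF assms(1)])
qed

text \<open>Coordinates with respect to a unit vector in each fibre reduce pointwise convergence to
  that of complex numbers; convergence in norm then follows from estimates on finite sets of
  arrows.\<close>

lemma l2_complete: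
  assumes s: "\<And>n. s n \<in> H2" and c: "\<And>\<epsilon>. 0 < \<epsilon> \<Longrightarrow> \<exists>N. \<forall>m\<ge>N. \<forall>n\<ge>N. nrm (s m - s n) < \<epsilon>"
  shows "\<exists>\<xi>\<in>H2. (\<lambda>n. nrm (s n - \<xi>)) \<longlonglongrightarrow> 0"
proof -
  have "\<exists>x\<in>fib L g. (\<lambda>n. lnorm L g (s n g - x)) \<longlonglongrightarrow> 0" if g: "g \<in> arrows G" for g
  proof -
    obtain u where u: "u \<in> fib L g" "lnorm L g u = 1"
      using unit_sphere_exists[OF g] by (auto simp: unit_sphere_iff)
    have u0: "u \<noteq> 0" using u norm_0[OF g] by auto
    have "\<exists>z. s n g = lscale L z u" for n
      using fib_multiple[OF g fsecD[OF l2_fsec[OF s] g] u(1) u0] by blast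
    then obtain z where z: "\<And>n. s n g = lscale L (z n) u" by metis
    have d: "lnorm L g (lscale L a u - lscale L b u) = cmod (a - b)" for a b
      using norm_scale[OF g u(1), of "a - b"] u(2) by (simp add: VL.scale_left_diff_distrib)
    have "Cauchy z"
    proof (rule CauchyI)
      fix \<epsilon> :: real assume "0 < \<epsilon>"
      then obtain N where N: "\<And>m n. m \<ge> N \<Longrightarrow> n \<ge> N \<Longrightarrow> nrm (s m - s n) < \<epsilon>" using c by blast
      have "cmod (z m - z n) < \<epsilon>" if "m \<ge> N" "n \<ge> N" for m n
        using lnorm_le_nrm[OF l2_diff[OF s s] g, of m n] N[OF that] by (simp add: z d)
      then show "\<exists>M. \<forall>m\<ge>M. \<forall>n\<ge>M. cmod (z m - z n) < \<epsilon>" by blast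
    qed
    then obtain l where "z \<longlonglongrightarrow> l" using Cauchy_convergent_iff convergent_def by blast
    then have "(\<lambda>n. cmod (z n - l)) \<longlonglongrightarrow> 0" by (simp add: LIM_zero tendsto_norm_zero)
    then show ?thesis using fib_scale[OF g u(1), of l] by (intro bexI[of _ "lscale L l u"]) (simp_all add: z d)
  qed
  then obtain x where x: "\<And>g. g \<in> arrows G \<Longrightarrow> x g \<in> fib L g" "\<And>g. g \<in> arrows G \<Longrightarrow> (\<lambda>n. lnorm L g (s n g - x g)) \<longlonglongrightarrow> 0"
    by metis
  define \<xi> where "\<xi> g = (if g \<in> arrows G then x g else 0)" for g
  have f\<xi>: "fsec \<xi>" unfolding fsec_def \<xi>_def using x(1) by simp
  \<comment> \<open>On a finite set \<open>F\<close> the pointwise limits already control the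
    distance from \<open>s m\<close> to \<open>\<xi>\<close>, so letting \<open>m\<close> grow
    leaves only the Cauchy bound, which is independent of \<open>F\<close>.\<close>
  have tail: "s n - \<xi> \<in> H2 \<and> nrm (s n - \<xi>) \<le> \<epsilon>"
    if N: "\<And>m n. m \<ge> N \<Longrightarrow> n \<ge> N \<Longrightarrow> nrm (s m - s n) < \<epsilon>" and \<epsilon>: "0 < \<epsilon>" and n: "n \<ge> N" for N n \<epsilon>
  proof -
    have fs: "fsec (s n - \<xi>)" using f\<xi> l2_fsec[OF s] unfolding fsec_def by (auto intro: fib_diff)
    have "(\<Sum>g\<in>F. (lnorm L g ((s n - \<xi>) g))\<^sup>2) \<le> \<epsilon>\<^sup>2" if F: "finite F" "F \<subseteq> arrows G" for F
    proof -
      have lim: "(\<lambda>m. \<epsilon> + L2_set (\<lambda>g. lnorm L g (s m g - \<xi> g)) F) \<longlonglongrightarrow> \<epsilon> + L2_set (\<lambda>g. 0) F"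
        unfolding L2_set_def using x(2) F(2) \<xi>_def
        by (intro tendsto_intros) (auto simp: subset_iff)
      have "L2_set (\<lambda>g. lnorm L g ((s n - \<xi>) g)) F \<le> \<epsilon> + L2_set (\<lambda>g. lnorm L g (s m g - \<xi> g)) F" if m: "m \<ge> N" for m
      proof -
        have f: "g \<in> arrows G" "s n g - s m g \<in> fib L g" "s m g - \<xi> g \<in> fib L g" if "g \<in> F" for g
        proof -
          show gA: "g \<in> arrows G" using that F(2) by blast
          show "s n g - s m g \<in> fib L g" "s m g - \<xi> g \<in> fib L g"
            by (intro fib_diff gA fsecD[OF l2_fsec[OF s] gA] fsecD[OF f\<xi> gA])+
        qed
        have "lnorm L g ((s n - \<xi>) g) \<le> lnorm L g (s n g - s m g) + lnorm L g (s m g - \<xi> g)" if "g \<in> F" for g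
          using norm_triangle[OF f[OF that]] by simp
        then have "L2_set (\<lambda>g. lnorm L g ((s n - \<xi>) g)) F \<le> L2_set (\<lambda>g. lnorm L g (s n g - s m g) + lnorm L g (s m g - \<xi> g)) F"
          using F(2) by (intro L2_set_mono norm_nonneg fsecD[OF fs]) auto
        also have "\<dots> \<le> L2_set (\<lambda>g. lnorm L g ((s n - s m) g)) F + L2_set (\<lambda>g. lnorm L g (s m g - \<xi> g)) F"
          using L2_set_triangle_ineq by simp
        also have "L2_set (\<lambda>g. lnorm L g ((s n - s m) g)) F \<le> nrm (s n - s m)"
          by (intro L2_set_le_nrm l2_diff s F)
        also have "\<dots> \<le> \<epsilon>" using N[OF n m] by simp
        finally show ?thesis by simp
      qed
      then have "L2_set (\<lambda>g. lnorm L g ((s n - \<xi>) g)) F \<le> \<epsilon> + L2_set (\<lambda>g. 0) F"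
        by (intro LIMSEQ_le_const[OF lim]) blast
      then have "sqrt (\<Sum>g\<in>F. (lnorm L g ((s n - \<xi>) g))\<^sup>2) \<le> \<epsilon>" unfolding L2_set_def by simp
      then show ?thesis by (rule sqrt_le_D)
    qed
    then show ?thesis using l2I[OF fs _ less_imp_le[OF \<epsilon>]] l2_outside[OF s] by (simp add: \<xi>_def)
  qed
  obtain N where "\<And>m n. m \<ge> N \<Longrightarrow> n \<ge> N \<Longrightarrow> nrm (s m - s n) < 1" using c[of 1] by auto
  then have "s N - \<xi> \<in> H2" using tail[of N 1 N] by simp
  then have "\<xi> \<in> H2" using l2_diff[OF s[of N]] by force
  moreover have "(\<lambda>n. nrm (s n - \<xi>)) \<longlonglongrightarrow> 0"
  proof (rule LIMSEQ_I)
    fix \<epsilon> :: real assume \<epsilon>: "0 < \<epsilon>"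
    then obtain N where "\<And>m n. m \<ge> N \<Longrightarrow> n \<ge> N \<Longrightarrow> nrm (s m - s n) < \<epsilon> / 2" using c[of "\<epsilon> / 2"] by auto
    then have "nrm (s n - \<xi>) \<le> \<epsilon> / 2" if "n \<ge> N" for n using tail[of N "\<epsilon> / 2" n] \<epsilon> that by simp
    then show "\<exists>N. \<forall>n\<ge>N. norm (nrm (s n - \<xi>) - 0) < \<epsilon>"
      using \<epsilon> nrm_nonneg by (intro exI[of _ N]) (force simp: field_simps)
  qed
  ultimately show ?thesis by blast
qed

definition l2lim :: "(nat \<Rightarrow> 'g \<Rightarrow> 'v) \<Rightarrow> ('g \<Rightarrow> 'v) \<Rightarrow> bool"
  where "l2lim s \<xi> \<longleftrightarrow> (\<forall>n. s n \<in> H2) \<and> \<xi> \<in> H2 \<and> (\<lambda>n. nrm (s n - \<xi>)) \<longlonglongrightarrow> 0"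

lemma l2lim_unique:
  assumes "l2lim s \<xi>" "l2lim s \<eta>"
  shows "\<xi> = \<eta>"
proof -
  have H: "\<xi> \<in> H2" "\<eta> \<in> H2" "\<And>n. s n \<in> H2" using assms unfolding l2lim_def by auto
  have "nrm (\<xi> - \<eta>) \<le> nrm (s n - \<xi>) + nrm (s n - \<eta>)" for n
    using nrm_triangle_diff[OF H(1) H(3)[of n] H(2)] nrm_minus_commute[OF H(1) H(3)[of n]] by simp
  moreover have "(\<lambda>n. nrm (s n - \<xi>) + nrm (s n - \<eta>)) \<longlonglongrightarrow> 0 + 0"
    using assms unfolding l2lim_def by (intro tendsto_add) auto
  ultimately have "nrm (\<xi> - \<eta>) \<le> 0 + 0" by (intro LIMSEQ_le_const) auto
  then have "\<xi> - \<eta> = 0" using nrm_nonneg[of "\<xi> - \<eta>"] by (intro nrm_eq_0D l2_diff H) simp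
  then show ?thesis by simp
qed

lemma l2lim_add:
  assumes "l2lim s \<xi>" "l2lim t \<eta>"
  shows "l2lim (\<lambda>n. s n + t n) (\<xi> + \<eta>)"
proof -
  have H: "\<xi> \<in> H2" "\<eta> \<in> H2" "\<And>n. s n \<in> H2" "\<And>n. t n \<in> H2" using assms unfolding l2lim_def by auto
  have "nrm (s n + t n - (\<xi> + \<eta>)) \<le> nrm (s n - \<xi>) + nrm (t n - \<eta>)" for n
    using l2_add(2)[OF l2_diff[OF H(3,1)] l2_diff[OF H(4,2)], of n n] by (simp add: algebra_simps)
  then have "\<forall>\<^sub>F n in sequentially. norm (nrm (s n + t n - (\<xi> + \<eta>))) \<le> nrm (s n - \<xi>) + nrm (t n - \<eta>)"
    by (simp add: nrm_nonneg)
  moreover have "(\<lambda>n. nrm (s n - \<xi>) + nrm (t n - \<eta>)) \<longlonglongrightarrow> 0"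
    using assms tendsto_add[of "\<lambda>n. nrm (s n - \<xi>)" 0 sequentially "\<lambda>n. nrm (t n - \<eta>)" 0] unfolding l2lim_def by simp
  ultimately have "(\<lambda>n. nrm (s n + t n - (\<xi> + \<eta>))) \<longlonglongrightarrow> 0"
    by (rule Lim_null_comparison)
  then show ?thesis using H l2_add(1) unfolding l2lim_def by auto
qed

lemma l2lim_scale:
  assumes "l2lim s \<xi>"
  shows "l2lim (\<lambda>n g. lscale L z (s n g)) (\<lambda>g. lscale L z (\<xi> g))"
proof -
  have H: "\<xi> \<in> H2" "\<And>n. s n \<in> H2" using assms unfolding l2lim_def by auto
  have "(\<lambda>g. lscale L z (s n g)) - (\<lambda>g. lscale L z (\<xi> g)) = (\<lambda>g. lscale L z ((s n - \<xi>) g))" for n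
    by (simp add: fun_eq_iff VL.scale_right_diff_distrib)
  then have "nrm ((\<lambda>g. lscale L z (s n g)) - (\<lambda>g. lscale L z (\<xi> g))) = cmod z * nrm (s n - \<xi>)" for n
    using l2_scale(2)[OF l2_diff[OF H(2,1)]] by simp
  then show ?thesis
    using H l2_scale(1) assms tendsto_mult_right_zero[of "\<lambda>n. nrm (s n - \<xi>)" sequentially "cmod z"] unfolding l2lim_def by simp
qed

subsection \<open>The inner product\<close>

abbreviation "inn \<equiv> l2_inner G L"

lemma inn_eq: "inn \<xi> \<eta> = (\<Sum>\<^sub>\<infinity>g\<in>arrows G. ip g (\<xi> g) (\<eta> g))"
  unfolding l2_inner_def ip_def ..

text \<open>Cauchy-Schwarz on finite sets of arrows, with a bound that passes to the infinite
  sum.\<close>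

lemma ip_abs_summable:
  assumes "\<xi> \<in> H2" "\<eta> \<in> H2"
  shows "(\<lambda>g. lnorm L g (\<xi> g) * lnorm L g (\<eta> g)) summable_on arrows G"
    "(\<lambda>g. ip g (\<xi> g) (\<eta> g)) summable_on arrows G"
    "(\<Sum>\<^sub>\<infinity>g\<in>arrows G. lnorm L g (\<xi> g) * lnorm L g (\<eta> g)) \<le> nrm \<xi> * nrm \<eta>"
    "cmod (inn \<xi> \<eta>) \<le> nrm \<xi> * nrm \<eta>"
proof -
  have nn: "0 \<le> lnorm L g (\<xi> g)" "0 \<le> lnorm L g (\<eta> g)" if "g \<in> arrows G" for g
    using that norm_nonneg fsecD l2_fsec assms by auto
  have B: "(\<Sum>g\<in>F. lnorm L g (\<xi> g) * lnorm L g (\<eta> g)) \<le> nrm \<xi> * nrm \<eta>" if F: "finite F" "F \<subseteq> arrows G" for F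
  proof -
    have "(\<Sum>g\<in>F. lnorm L g (\<xi> g) * lnorm L g (\<eta> g)) = (\<Sum>g\<in>F. \<bar>lnorm L g (\<xi> g)\<bar> * \<bar>lnorm L g (\<eta> g)\<bar>)"
      using nn F(2) by (intro sum.cong) auto
    also have "\<dots> \<le> L2_set (\<lambda>g. lnorm L g (\<xi> g)) F * L2_set (\<lambda>g. lnorm L g (\<eta> g)) F"
      by (rule L2_set_mult_ineq)
    also have "\<dots> \<le> nrm \<xi> * nrm \<eta>"
      by (intro mult_mono L2_set_le_nrm assms F nrm_nonneg L2_set_nonneg)
    finally show ?thesis .
  qed
  show s: "(\<lambda>g. lnorm L g (\<xi> g) * lnorm L g (\<eta> g)) summable_on arrows G"
    by (rule nonneg_bdd_above_summable_on) (auto intro!: bdd_aboveI B mult_nonneg_nonneg nn)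
  show le: "(\<Sum>\<^sub>\<infinity>g\<in>arrows G. lnorm L g (\<xi> g) * lnorm L g (\<eta> g)) \<le> nrm \<xi> * nrm \<eta>"
    by (rule infsum_le_finite_sums[OF s B])
  have ab: "(\<lambda>g. cmod (ip g (\<xi> g) (\<eta> g))) summable_on arrows G"
  proof (rule summable_on_comparison_test[OF s])
    show "cmod (ip g (\<xi> g) (\<eta> g)) \<le> lnorm L g (\<xi> g) * lnorm L g (\<eta> g)" if "g \<in> arrows G" for g
      by (rule cmod_ip[OF that fsecD[OF l2_fsec[OF assms(1)] that] fsecD[OF l2_fsec[OF assms(2)] that]])
  qed simp
  then show "(\<lambda>g. ip g (\<xi> g) (\<eta> g)) summable_on arrows G" by (rule Infinite_Sum.abs_summable_summable)
  have "cmod (inn \<xi> \<eta>) \<le> (\<Sum>\<^sub>\<infinity>g\<in>arrows G. cmod (ip g (\<xi> g) (\<eta> g)))"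
    unfolding inn_eq by (rule norm_infsum_bound[OF ab])
  also have "\<dots> \<le> (\<Sum>\<^sub>\<infinity>g\<in>arrows G. lnorm L g (\<xi> g) * lnorm L g (\<eta> g))"
    by (rule infsum_mono[OF ab s]) (use fsecD l2_fsec assms in \<open>auto intro!: cmod_ip\<close>)
  finally show "cmod (inn \<xi> \<eta>) \<le> nrm \<xi> * nrm \<eta>" using le by linarith
qed

lemma inn_self: "\<xi> \<in> H2 \<Longrightarrow> inn \<xi> \<xi> = complex_of_real ((nrm \<xi>)\<^sup>2)"
proof -
  assume \<xi>: "\<xi> \<in> H2"
  have "inn \<xi> \<xi> = (\<Sum>\<^sub>\<infinity>g\<in>arrows G. complex_of_real ((lnorm L g (\<xi> g))\<^sup>2))"
    unfolding inn_eq by (rule infsum_cong) (use ip_self fsecD[OF l2_fsec[OF \<xi>]] in auto)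
  also have "\<dots> = complex_of_real ((nrm \<xi>)\<^sup>2)"
    unfolding nrm_sq
    by (intro infsumI iffD2[OF has_sum_of_real_iff] has_sum_infsum l2_summable \<xi>)
  finally show ?thesis .
qed

lemma inn_cnj: "\<xi> \<in> H2 \<Longrightarrow> \<eta> \<in> H2 \<Longrightarrow> inn \<eta> \<xi> = cnj (inn \<xi> \<eta>)"
proof -
  assume H: "\<xi> \<in> H2" "\<eta> \<in> H2"
  have "inn \<eta> \<xi> = (\<Sum>\<^sub>\<infinity>g\<in>arrows G. cnj (ip g (\<xi> g) (\<eta> g)))"
    unfolding inn_eq by (rule infsum_cong) (rule ip_cnj[OF _ fsecD[OF l2_fsec[OF H(1)]] fsecD[OF l2_fsec[OF H(2)]]])
  then show ?thesis unfolding inn_eq by (simp add: infsum_cnj)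
qed

lemma inn_add_right: "\<xi> \<in> H2 \<Longrightarrow> \<eta> \<in> H2 \<Longrightarrow> \<zeta> \<in> H2 \<Longrightarrow> inn \<xi> (\<eta> + \<zeta>) = inn \<xi> \<eta> + inn \<xi> \<zeta>"
proof -
  assume H: "\<xi> \<in> H2" "\<eta> \<in> H2" "\<zeta> \<in> H2"
  have "inn \<xi> (\<eta> + \<zeta>) = (\<Sum>\<^sub>\<infinity>g\<in>arrows G. ip g (\<xi> g) (\<eta> g) + ip g (\<xi> g) (\<zeta> g))"
    unfolding inn_eq
    by (rule infsum_cong) (use ip_add_right fsecD[OF l2_fsec[OF H(1)]] fsecD[OF l2_fsec[OF H(2)]] fsecD[OF l2_fsec[OF H(3)]] in auto)
  then show ?thesis unfolding inn_eq by (simp add: infsum_add ip_abs_summable(2) H)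
qed

lemma inn_scale_right: "\<xi> \<in> H2 \<Longrightarrow> \<eta> \<in> H2 \<Longrightarrow> inn \<xi> (\<lambda>g. lscale L z (\<eta> g)) = z * inn \<xi> \<eta>"
proof -
  assume H: "\<xi> \<in> H2" "\<eta> \<in> H2"
  have "inn \<xi> (\<lambda>g. lscale L z (\<eta> g)) = (\<Sum>\<^sub>\<infinity>g\<in>arrows G. z * ip g (\<xi> g) (\<eta> g))"
    unfolding inn_eq
    by (rule infsum_cong) (use ip_scale_right fsecD[OF l2_fsec[OF H(1)]] fsecD[OF l2_fsec[OF H(2)]] in auto)
  then show ?thesis unfolding inn_eq by (simp add: infsum_cmult_right')
qed

lemma inn_diff_right: "\<xi> \<in> H2 \<Longrightarrow> \<eta> \<in> H2 \<Longrightarrow> \<zeta> \<in> H2 \<Longrightarrow> inn \<xi> (\<eta> - \<zeta>) = inn \<xi> \<eta> - inn \<xi> \<zeta>"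
  using inn_add_right[of \<xi> "\<eta> - \<zeta>" \<zeta>] by (simp add: l2_diff)

lemma inn_diff_left: "\<xi> \<in> H2 \<Longrightarrow> \<eta> \<in> H2 \<Longrightarrow> \<zeta> \<in> H2 \<Longrightarrow> inn (\<eta> - \<zeta>) \<xi> = inn \<eta> \<xi> - inn \<zeta> \<xi>"
  using inn_diff_right[of \<xi> \<eta> \<zeta>] inn_cnj[of \<xi> "\<eta> - \<zeta>"] inn_cnj[of \<xi> \<eta>] inn_cnj[of \<xi> \<zeta>] by (simp add: l2_diff)

lemma inn_add_left: "\<xi> \<in> H2 \<Longrightarrow> \<eta> \<in> H2 \<Longrightarrow> \<zeta> \<in> H2 \<Longrightarrow> inn (\<eta> + \<zeta>) \<xi> = inn \<eta> \<xi> + inn \<zeta> \<xi>"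
  using inn_diff_left[of \<xi> "\<eta> + \<zeta>" \<zeta>] by (simp add: l2_add)

lemma inn_scale_left: "\<xi> \<in> H2 \<Longrightarrow> \<eta> \<in> H2 \<Longrightarrow> inn (\<lambda>g. lscale L z (\<xi> g)) \<eta> = cnj z * inn \<xi> \<eta>"
  using inn_scale_right[of \<eta> \<xi> z] inn_cnj[of \<eta> "\<lambda>g. lscale L z (\<xi> g)"] inn_cnj[of \<eta> \<xi>] by (simp add: l2_scale)

subsection \<open>Bounded operators\<close>

abbreviation "BO \<equiv> bounded_operators G L"
abbreviation "opn \<equiv> operator_norm G L"

lemma BO_D:
  assumes "T \<in> BO"
  shows "\<And>\<xi>. \<xi> \<in> H2 \<Longrightarrow> T \<xi> \<in> H2" "\<And>\<xi>. \<xi> \<notin> H2 \<Longrightarrow> T \<xi> = 0"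
    "\<And>\<xi> \<eta>. \<xi> \<in> H2 \<Longrightarrow> \<eta> \<in> H2 \<Longrightarrow> T (\<xi> + \<eta>) = T \<xi> + T \<eta>"
    "\<And>z \<xi>. \<xi> \<in> H2 \<Longrightarrow> T (\<lambda>g. lscale L z (\<xi> g)) = (\<lambda>g. lscale L z (T \<xi> g))"
  using assms unfolding bounded_operators_def by blast+

lemma BO_I:
  assumes "\<And>\<xi>. \<xi> \<in> H2 \<Longrightarrow> T \<xi> \<in> H2" "\<And>\<xi>. \<xi> \<notin> H2 \<Longrightarrow> T \<xi> = 0"
    "\<And>\<xi> \<eta>. \<xi> \<in> H2 \<Longrightarrow> \<eta> \<in> H2 \<Longrightarrow> T (\<xi> + \<eta>) = T \<xi> + T \<eta>"
    "\<And>z \<xi>. \<xi> \<in> H2 \<Longrightarrow> T (\<lambda>g. lscale L z (\<xi> g)) = (\<lambda>g. lscale L z (T \<xi> g))"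
    "\<And>\<xi>. \<xi> \<in> H2 \<Longrightarrow> nrm (T \<xi>) \<le> C * nrm \<xi>"
  shows "T \<in> BO"
  using assms unfolding bounded_operators_def by blast

lemma BO_zero_arg: "T \<in> BO \<Longrightarrow> T 0 = 0"
  using BO_D(3)[OF _ l2_zero l2_zero, of T] by simp


text \<open>\<open>operator_norm\<close> is a supremum of real numbers and bounds its members only
  after this has been established.\<close>

lemma opn_set_bdd:
  assumes "T \<in> BO"
  shows "bdd_above {nrm (T \<xi>) | \<xi>. \<xi> \<in> H2 \<and> nrm \<xi> \<le> 1}"
proof -
  obtain C where C: "\<And>\<xi>. \<xi> \<in> H2 \<Longrightarrow> nrm (T \<xi>) \<le> C * nrm \<xi>"
    using assms unfolding bounded_operators_def by blast
  have "nrm (T \<xi>) \<le> \<bar>C\<bar>" if "\<xi> \<in> H2" "nrm \<xi> \<le> 1" for \<xi>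
  proof -
    have "C * nrm \<xi> \<le> \<bar>C\<bar> * 1" using that nrm_nonneg by (intro mult_mono) auto
    then show ?thesis using C[OF that(1)] by simp
  qed
  then show ?thesis by (intro bdd_aboveI) auto
qed

lemma opn_nonneg: "T \<in> BO \<Longrightarrow> 0 \<le> opn T"
  unfolding operator_norm_def using l2_zero
  by (intro cSup_upper2[OF _ nrm_nonneg[of "T 0"] opn_set_bdd]) (auto simp: nrm_zero intro!: exI[of _ 0])

lemma opn_bound:
  assumes T: "T \<in> BO" and \<xi>: "\<xi> \<in> H2"
  shows "nrm (T \<xi>) \<le> opn T * nrm \<xi>"
proof (cases "nrm \<xi> = 0")
  case True
  then show ?thesis using nrm_eq_0D[OF \<xi>] BO_zero_arg[OF T] nrm_zero by simp
next
  case False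
  then have p: "0 < nrm \<xi>" using nrm_nonneg[of \<xi>] by simp
  let ?z = "complex_of_real (inverse (nrm \<xi>))"
  have z: "cmod ?z = inverse (nrm \<xi>)" using p by (simp add: norm_inverse)
  have n: "nrm (\<lambda>g. lscale L ?z (\<xi> g)) \<le> 1" using l2_scale(2)[OF \<xi>, of ?z] p z by simp
  have "nrm (T (\<lambda>g. lscale L ?z (\<xi> g))) \<le> opn T"
    unfolding operator_norm_def by (rule cSup_upper[OF _ opn_set_bdd[OF T]]) (use l2_scale(1)[OF \<xi>] n in blast)
  then have "inverse (nrm \<xi>) * nrm (T \<xi>) \<le> opn T"
    unfolding BO_D(4)[OF T \<xi>] l2_scale(2)[OF BO_D(1)[OF T \<xi>]] z .
  then show ?thesis using p by (simp add: field_simps)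
qed

lemma opn_le:
  assumes "0 \<le> C" "\<And>\<xi>. \<xi> \<in> H2 \<Longrightarrow> nrm (T \<xi>) \<le> C * nrm \<xi>"
  shows "opn T \<le> C"
  unfolding operator_norm_def
proof (rule cSup_least)
  show "{nrm (T \<xi>) | \<xi>. \<xi> \<in> H2 \<and> nrm \<xi> \<le> 1} \<noteq> {}" using l2_zero nrm_zero by force
  fix x assume "x \<in> {nrm (T \<xi>) | \<xi>. \<xi> \<in> H2 \<and> nrm \<xi> \<le> 1}"
  then obtain \<xi> where \<xi>: "x = nrm (T \<xi>)" "\<xi> \<in> H2" "nrm \<xi> \<le> 1" by blast
  have "C * nrm \<xi> \<le> C * 1" using \<xi>(3) assms(1) by (rule mult_left_mono)
  then show "x \<le> C" using assms(2)[OF \<xi>(2)] \<xi>(1) by simp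
qed

definition oscale :: "complex \<Rightarrow> ('g, 'v) operator \<Rightarrow> ('g, 'v) operator"
  where "oscale z T = (\<lambda>\<xi> g. lscale L z (T \<xi> g))"

sublocale VO: vector_space oscale
  by unfold_locales
    (auto simp: oscale_def fun_eq_iff VL.scale_right_distrib VL.scale_left_distrib)

lemma BO_add:
  assumes "S \<in> BO" "T \<in> BO"
  shows "S + T \<in> BO" "opn (S + T) \<le> opn S + opn T"
proof -
  have b: "nrm ((S + T) \<xi>) \<le> (opn S + opn T) * nrm \<xi>" if "\<xi> \<in> H2" for \<xi>
    using l2_add(2)[OF BO_D(1)[OF assms(1) that] BO_D(1)[OF assms(2) that]] opn_bound[OF assms(1) that] opn_bound[OF assms(2) that]
    by (simp add: distrib_right)
  show "S + T \<in> BO"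
    by (rule BO_I[OF _ _ _ _ b])
      (use BO_D[OF assms(1)] BO_D[OF assms(2)] in \<open>auto simp: l2_add fun_eq_iff VL.scale_right_distrib\<close>)
  show "opn (S + T) \<le> opn S + opn T"
    by (rule opn_le[OF _ b]) (use opn_nonneg assms in auto)
qed

lemma BO_scale:
  assumes "T \<in> BO"
  shows "oscale z T \<in> BO" "opn (oscale z T) = cmod z * opn T"
proof -
  have n: "nrm (oscale w S \<xi>) = cmod w * nrm (S \<xi>)" if "S \<in> BO" "\<xi> \<in> H2" for w S \<xi>
    using l2_scale(2)[OF BO_D(1)[OF that]] by (simp add: oscale_def)
  have b: "nrm (oscale w S \<xi>) \<le> (cmod w * opn S) * nrm \<xi>" if "S \<in> BO" "\<xi> \<in> H2" for w S \<xi>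
    using mult_left_mono[OF opn_bound[OF that], of "cmod w"] n[OF that] by simp
  have m: "oscale w S \<in> BO" if "S \<in> BO" for w S
    by (rule BO_I[OF _ _ _ _ b[OF that]])
      (use BO_D[OF that] in \<open>auto simp: oscale_def l2_scale fun_eq_iff VL.scale_right_distrib mult.commute\<close>)
  show zT: "oscale z T \<in> BO" by (rule m[OF assms])
  have le: "opn (oscale w S) \<le> cmod w * opn S" if "S \<in> BO" for w S
    by (rule opn_le[OF _ b[OF that]]) (simp_all add: opn_nonneg that)
  show "opn (oscale z T) = cmod z * opn T"
  proof (cases "z = 0")
    case True
    then show ?thesis using le[OF assms, of z] opn_nonneg[OF zT] by simp
  next
    case False
    \<comment> \<open>The reverse inequality is the one just shown, applied to the inverse
      scalar.\<close>
    have "oscale (inverse z) (oscale z T) = T" using False by (simp add: oscale_def)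
    then have "opn T \<le> inverse (cmod z) * opn (oscale z T)"
      using le[OF zT, of "inverse z"] by (simp add: norm_inverse)
    then have "cmod z * opn T \<le> opn (oscale z T)" using False by (simp add: field_simps)
    then show ?thesis using le[OF assms, of z] by simp
  qed
qed

lemma BO_subspace: "VO.subspace BO"
proof (rule VO.subspaceI)
  show "0 \<in> BO" by (rule BO_I[where C = 0]) (auto simp: l2_zero nrm_zero)
qed (auto simp: BO_add BO_scale)

lemma BO_diff: "S \<in> BO \<Longrightarrow> T \<in> BO \<Longrightarrow> S - T \<in> BO"
  by (rule VO.subspace_diff[OF BO_subspace])

lemma BO_comp:
  assumes "S \<in> BO" "T \<in> BO"
  shows "S \<circ> T \<in> BO" "opn (S \<circ> T) \<le> opn S * opn T"
proof -
  have b: "nrm ((S \<circ> T) \<xi>) \<le> (opn S * opn T) * nrm \<xi>" if "\<xi> \<in> H2" for \<xi>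
    using opn_bound[OF assms(1) BO_D(1)[OF assms(2) that]] mult_left_mono[OF opn_bound[OF assms(2) that] opn_nonneg[OF assms(1)]]
    by simp
  show "S \<circ> T \<in> BO"
    by (rule BO_I[OF _ _ _ _ b])
      (use BO_D[OF assms(1)] BO_D[OF assms(2)] BO_zero_arg[OF assms(1)] in auto)
  show "opn (S \<circ> T) \<le> opn S * opn T"
    by (rule opn_le[OF _ b]) (use opn_nonneg assms in auto)
qed

lemma BO_comp_add_right: "S \<in> BO \<Longrightarrow> T \<in> BO \<Longrightarrow> U \<in> BO \<Longrightarrow> S \<circ> (T + U) = (S \<circ> T) + (S \<circ> U)"
proof
  fix \<xi> assume B: "S \<in> BO" "T \<in> BO" "U \<in> BO"
  show "(S \<circ> (T + U)) \<xi> = ((S \<circ> T) + (S \<circ> U)) \<xi>"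
    unfolding o_apply plus_fun_apply[of T U \<xi>] plus_fun_apply[of "S \<circ> T" "S \<circ> U" \<xi>]
  proof (cases "\<xi> \<in> H2")
    case True
    show "S (T \<xi> + U \<xi>) = S (T \<xi>) + S (U \<xi>)"
      by (rule BO_D(3)[OF B(1) BO_D(1)[OF B(2) True] BO_D(1)[OF B(3) True]])
  next
    case False
    show "S (T \<xi> + U \<xi>) = S (T \<xi>) + S (U \<xi>)"
      by (simp only: BO_D(2)[OF B(2) False] BO_D(2)[OF B(3) False] BO_zero_arg[OF B(1)] add_0_left)
  qed
qed

lemma BO_comp_scale_right: "S \<in> BO \<Longrightarrow> T \<in> BO \<Longrightarrow> S \<circ> oscale z T = oscale z (S \<circ> T)"
  by (rule ext, rename_tac \<xi>, case_tac "\<xi> \<in> H2") (auto simp: oscale_def BO_D BO_zero_arg zero_fun_def[symmetric])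

lemma opn_eq_0D:
  assumes "T \<in> BO" "opn T = 0"
  shows "T = 0"
proof
  fix \<xi>
  show "T \<xi> = 0 \<xi>"
  proof (cases "\<xi> \<in> H2")
    case True
    then have "nrm (T \<xi>) = 0" using opn_bound[OF assms(1) True] assms(2) nrm_nonneg[of "T \<xi>"] by simp
    then show ?thesis using nrm_eq_0D[OF BO_D(1)[OF assms(1) True]] by simp
  qed (simp add: BO_D(2)[OF assms(1)])
qed

lemma opn_minus_commute: "S \<in> BO \<Longrightarrow> T \<in> BO \<Longrightarrow> opn (S - T) = opn (T - S)"
  using BO_scale(2)[OF BO_diff, of T S "-1"] by simp

lemma opn_triangle_diff: "S \<in> BO \<Longrightarrow> T \<in> BO \<Longrightarrow> U \<in> BO \<Longrightarrow> opn (S - U) \<le> opn (S - T) + opn (T - U)"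
  using BO_add(2)[OF BO_diff BO_diff, of S T T U] by simp

text \<open>Pointwise limits exist by completeness of the Hilbert space. The Cauchy bound is uniform
  on the unit ball, which gives both boundedness of the limit and convergence in norm.\<close>

lemma BO_complete:
  assumes s: "\<And>n. s n \<in> BO" and c: "\<And>\<epsilon>. 0 < \<epsilon> \<Longrightarrow> \<exists>N. \<forall>m\<ge>N. \<forall>n\<ge>N. opn (s m - s n) < \<epsilon>"
  shows "\<exists>T\<in>BO. (\<lambda>n. opn (s n - T)) \<longlonglongrightarrow> 0"
proof -
  have "\<exists>\<eta>. l2lim (\<lambda>n. s n \<xi>) \<eta>" if \<xi>: "\<xi> \<in> H2" for \<xi>
  proof -
    have "\<exists>N. \<forall>m\<ge>N. \<forall>n\<ge>N. nrm (s m \<xi> - s n \<xi>) < \<epsilon>" if \<epsilon>: "0 < \<epsilon>" for \<epsilon>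
    proof -
      have "0 < \<epsilon> / (nrm \<xi> + 1)" using \<epsilon> nrm_nonneg[of \<xi>] by simp
      then obtain N where N: "\<And>m n. m \<ge> N \<Longrightarrow> n \<ge> N \<Longrightarrow> opn (s m - s n) < \<epsilon> / (nrm \<xi> + 1)" using c by blast
      have "nrm (s m \<xi> - s n \<xi>) < \<epsilon>" if "m \<ge> N" "n \<ge> N" for m n
      proof -
        have "nrm (s m \<xi> - s n \<xi>) \<le> opn (s m - s n) * nrm \<xi>" using opn_bound[OF BO_diff[OF s s] \<xi>] by simp
        also have "\<dots> \<le> opn (s m - s n) * (nrm \<xi> + 1)" by (intro mult_left_mono opn_nonneg BO_diff s) simp
        also have "\<dots> < \<epsilon> / (nrm \<xi> + 1) * (nrm \<xi> + 1)"
          using N[OF that] nrm_nonneg[of \<xi>] by (intro mult_strict_right_mono) auto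
        also have "\<dots> = \<epsilon>" using nrm_nonneg[of \<xi>] by simp
        finally show ?thesis .
      qed
      then show ?thesis by blast
    qed
    then show ?thesis using l2_complete[of "\<lambda>n. s n \<xi>"] BO_D(1)[OF s \<xi>] unfolding l2lim_def by blast
  qed
  then obtain T0 where T0: "\<And>\<xi>. \<xi> \<in> H2 \<Longrightarrow> l2lim (\<lambda>n. s n \<xi>) (T0 \<xi>)" by metis
  define T where "T \<xi> = (if \<xi> \<in> H2 then T0 \<xi> else 0)" for \<xi>
  have T: "l2lim (\<lambda>n. s n \<xi>) (T \<xi>)" if "\<xi> \<in> H2" for \<xi> using T0[OF that] that by (simp add: T_def)
  have T1: "T \<xi> \<in> H2" if "\<xi> \<in> H2" for \<xi> using T[OF that] unfolding l2lim_def by blast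
  have T2: "T (\<xi> + \<eta>) = T \<xi> + T \<eta>" if "\<xi> \<in> H2" "\<eta> \<in> H2" for \<xi> \<eta>
    using l2lim_unique[OF T[OF l2_add(1)[OF that]]] l2lim_add[OF T[OF that(1)] T[OF that(2)]]
    by (simp add: BO_D(3)[OF s that])
  have T3: "T (\<lambda>g. lscale L z (\<xi> g)) = (\<lambda>g. lscale L z (T \<xi> g))" if "\<xi> \<in> H2" for z \<xi>
    using l2lim_unique[OF T[OF l2_scale(1)[OF that]]] l2lim_scale[OF T[OF that]]
    by (simp add: BO_D(4)[OF s that])
  have tail: "nrm (s n \<xi> - T \<xi>) \<le> \<epsilon> * nrm \<xi>"
    if N: "\<And>m n. m \<ge> N \<Longrightarrow> n \<ge> N \<Longrightarrow> opn (s m - s n) < \<epsilon>" and n: "n \<ge> N" and \<xi>: "\<xi> \<in> H2" for N n \<epsilon> \<xi>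
  proof -
    have "nrm (s n \<xi> - T \<xi>) \<le> \<epsilon> * nrm \<xi> + nrm (s m \<xi> - T \<xi>)" if "m \<ge> N" for m
    proof -
      have "nrm (s n \<xi> - s m \<xi>) \<le> opn (s n - s m) * nrm \<xi>" using opn_bound[OF BO_diff[OF s s] \<xi>] by simp
      also have "\<dots> \<le> \<epsilon> * nrm \<xi>" using N[OF n that] nrm_nonneg by (intro mult_right_mono) auto
      finally show ?thesis
        using nrm_triangle_diff[OF BO_D(1)[OF s \<xi>] BO_D(1)[OF s \<xi>] T1[OF \<xi>], of n m] by simp
    qed
    moreover have "(\<lambda>m. \<epsilon> * nrm \<xi> + nrm (s m \<xi> - T \<xi>)) \<longlonglongrightarrow> \<epsilon> * nrm \<xi> + 0"
      using T[OF \<xi>] unfolding l2lim_def by (intro tendsto_intros) auto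
    ultimately show ?thesis using LIMSEQ_le_const[of _ "\<epsilon> * nrm \<xi> + 0"] by auto
  qed
  obtain N where N: "\<And>m n. m \<ge> N \<Longrightarrow> n \<ge> N \<Longrightarrow> opn (s m - s n) < 1" using c[of 1] by auto
  have "T \<in> BO"
  proof (rule BO_I[OF T1 _ T2 T3])
    show "nrm (T \<xi>) \<le> (opn (s N) + 1) * nrm \<xi>" if \<xi>: "\<xi> \<in> H2" for \<xi>
      using nrm_triangle_diff[OF T1[OF \<xi>] BO_D(1)[OF s \<xi>] l2_zero, of N] tail[of N 1 N, OF N _ \<xi>] opn_bound[OF s \<xi>, of N]
        nrm_minus_commute[OF T1[OF \<xi>] BO_D(1)[OF s \<xi>, of N]] by (simp add: distrib_right)
    show "T \<xi> = 0" if "\<xi> \<notin> H2" for \<xi>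
      unfolding T_def using that by (rule if_not_P)
  qed
  moreover have "(\<lambda>n. opn (s n - T)) \<longlonglongrightarrow> 0"
  proof (rule LIMSEQ_I)
    fix \<epsilon> :: real assume \<epsilon>: "0 < \<epsilon>"
    then obtain N where N: "\<And>m n. m \<ge> N \<Longrightarrow> n \<ge> N \<Longrightarrow> opn (s m - s n) < \<epsilon> / 2" using c[of "\<epsilon> / 2"] by auto
    have "opn (s n - T) \<le> \<epsilon> / 2" if "n \<ge> N" for n
      using tail[OF N that] \<epsilon> by (intro opn_le) auto
    then show "\<exists>N. \<forall>n\<ge>N. norm (opn (s n - T) - 0) < \<epsilon>"
      using \<epsilon> opn_nonneg[OF BO_diff[OF s \<open>T \<in> BO\<close>]] by (intro exI[of _ N]) (force simp: field_simps)
  qed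
  ultimately show ?thesis by blast
qed

subsection \<open>Adjoints\<close>

text \<open>A relation instead of \<open>adjoint_operator\<close>, whose definite description has no
  content until an adjoint is exhibited. Adjoints are found explicitly for sections and then by
  passing to limits.\<close>

definition adj :: "('g, 'v) operator \<Rightarrow> ('g, 'v) operator \<Rightarrow> bool"
  where "adj T S \<longleftrightarrow> (\<forall>\<xi>\<in>H2. \<forall>\<eta>\<in>H2. inn (T \<xi>) \<eta> = inn \<xi> (S \<eta>))"


lemma adj_unique:
  assumes "S \<in> BO" "S' \<in> BO" "adj T S" "adj T S'"
  shows "S = S'"
proof
  fix \<eta>
  show "S \<eta> = S' \<eta>"
  proof (cases "\<eta> \<in> H2")
    case True
    note H = BO_D(1)[OF assms(1) True] BO_D(1)[OF assms(2) True]
    note d = l2_diff[OF H]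
    have "inn (S \<eta> - S' \<eta>) (S \<eta>) = inn (S \<eta> - S' \<eta>) (S' \<eta>)"
      using assms(3,4) d True unfolding adj_def by metis
    then have "inn (S \<eta> - S' \<eta>) (S \<eta> - S' \<eta>) = 0" by (simp add: inn_diff_right d H)
    then have "nrm (S \<eta> - S' \<eta>) = 0" unfolding inn_self[OF d] by simp
    then have "S \<eta> - S' \<eta> = 0" by (rule nrm_eq_0D[OF d])
    then show ?thesis by simp
  qed (simp add: BO_D(2)[OF assms(1)] BO_D(2)[OF assms(2)])
qed

lemma adjoint_operator_eq:
  assumes "S \<in> BO" "adj T S"
  shows "adjoint_operator G L T = S"
  unfolding adjoint_operator_def
proof (rule the_equality)
  show "S \<in> BO \<and> (\<forall>\<xi>\<in>H2. \<forall>\<eta>\<in>H2. inn (T \<xi>) \<eta> = inn \<xi> (S \<eta>))" using assms unfolding adj_def by blast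
  show "R = S" if "R \<in> BO \<and> (\<forall>\<xi>\<in>H2. \<forall>\<eta>\<in>H2. inn (T \<xi>) \<eta> = inn \<xi> (R \<eta>))" for R
    using that adj_unique[OF _ assms(1) _ assms(2)] unfolding adj_def by blast
qed

text \<open>The squared norm of \<open>S \<eta>\<close> is the inner product of
  \<open>T (S \<eta>)\<close> with \<open>\<eta>\<close>; Cauchy-Schwarz and division by the norm of
  \<open>S \<eta>\<close> finish.\<close>

lemma opn_adj_le:
  assumes T: "T \<in> BO" and S: "S \<in> BO" and a: "adj T S"
  shows "opn S \<le> opn T"
proof (rule opn_le[OF opn_nonneg[OF T]])
  fix \<eta> assume \<eta>: "\<eta> \<in> H2"
  note S\<eta> = BO_D(1)[OF S \<eta>]
  have "inn (T (S \<eta>)) \<eta> = inn (S \<eta>) (S \<eta>)" using a S\<eta> \<eta> unfolding adj_def by blast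
  then have "(nrm (S \<eta>))\<^sup>2 = cmod (inn (T (S \<eta>)) \<eta>)" unfolding inn_self[OF S\<eta>] by (simp add: norm_power)
  also have "cmod (inn (T (S \<eta>)) \<eta>) \<le> nrm (T (S \<eta>)) * nrm \<eta>" by (intro ip_abs_summable(4) BO_D(1)[OF T] S\<eta> \<eta>)
  also have "\<dots> \<le> (opn T * nrm (S \<eta>)) * nrm \<eta>" by (intro mult_right_mono opn_bound T S\<eta> nrm_nonneg)
  finally have le: "nrm (S \<eta>) * nrm (S \<eta>) \<le> (opn T * nrm \<eta>) * nrm (S \<eta>)" by (simp add: power2_eq_square mult_ac)
  show "nrm (S \<eta>) \<le> opn T * nrm \<eta>"
  proof (cases "nrm (S \<eta>) = 0")
    case True
    then show ?thesis using opn_nonneg[OF T] nrm_nonneg by simp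
  next
    case False
    then have "0 < nrm (S \<eta>)" using nrm_nonneg[of "S \<eta>"] by simp
    then show ?thesis using le by simp
  qed
qed

lemma adj_add:
  "\<lbrakk>T \<in> BO; S \<in> BO; T' \<in> BO; S' \<in> BO; adj T S; adj T' S'\<rbrakk> \<Longrightarrow> adj (T + T') (S + S')"
  unfolding adj_def by (auto simp: inn_add_left inn_add_right BO_D)

lemma adj_diff:
  "\<lbrakk>T \<in> BO; S \<in> BO; T' \<in> BO; S' \<in> BO; adj T S; adj T' S'\<rbrakk> \<Longrightarrow> adj (T - T') (S - S')"
  unfolding adj_def by (auto simp: inn_diff_left inn_diff_right BO_D)

lemma adj_scale:
  "\<lbrakk>T \<in> BO; S \<in> BO; adj T S\<rbrakk> \<Longrightarrow> adj (oscale z T) (oscale (cnj z) S)"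
  unfolding adj_def oscale_def by (auto simp: inn_scale_left inn_scale_right BO_D)

lemma adj_comp:
  "\<lbrakk>T \<in> BO; S \<in> BO; T' \<in> BO; S' \<in> BO; adj T S; adj T' S'\<rbrakk> \<Longrightarrow> adj (T \<circ> T') (S' \<circ> S)"
  unfolding adj_def by (auto simp: BO_D)

lemma adj_limit:
  assumes s: "\<And>n. s n \<in> BO" "\<And>n. t n \<in> BO" "\<And>n. adj (s n) (t n)"
    and T: "T \<in> BO" "(\<lambda>n. opn (s n - T)) \<longlonglongrightarrow> 0" and S: "S \<in> BO" "(\<lambda>n. opn (t n - S)) \<longlonglongrightarrow> 0"
  shows "adj T S"
  unfolding adj_def
proof (intro ballI)
  fix \<xi> \<eta> assume H: "\<xi> \<in> H2" "\<eta> \<in> H2"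
  have 1: "cmod (inn (T \<xi>) \<eta> - inn \<xi> (S \<eta>)) \<le> (opn (s n - T) + opn (t n - S)) * (nrm \<xi> * nrm \<eta>)" for n
  proof -
    have eq: "inn (T \<xi>) \<eta> - inn \<xi> (S \<eta>) = inn \<xi> ((t n - S) \<eta>) - inn ((s n - T) \<xi>) \<eta>"
      using s(3)[of n] H by (simp add: adj_def inn_diff_left inn_diff_right BO_D s T S)
    have "cmod (inn (T \<xi>) \<eta> - inn \<xi> (S \<eta>)) \<le> cmod (inn \<xi> ((t n - S) \<eta>)) + cmod (inn ((s n - T) \<xi>) \<eta>)"
      unfolding eq by (rule norm_triangle_ineq4)
    also have "\<dots> \<le> nrm \<xi> * nrm ((t n - S) \<eta>) + nrm ((s n - T) \<xi>) * nrm \<eta>"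
      by (rule add_mono[OF ip_abs_summable(4)[OF H(1) BO_D(1)[OF BO_diff[OF s(2) S(1)] H(2)]]
            ip_abs_summable(4)[OF BO_D(1)[OF BO_diff[OF s(1) T(1)] H(1)] H(2)]])
    also have "\<dots> \<le> nrm \<xi> * (opn (t n - S) * nrm \<eta>) + (opn (s n - T) * nrm \<xi>) * nrm \<eta>"
      by (rule add_mono[OF mult_left_mono[OF opn_bound[OF BO_diff[OF s(2) S(1)] H(2)] nrm_nonneg]
            mult_right_mono[OF opn_bound[OF BO_diff[OF s(1) T(1)] H(1)] nrm_nonneg]])
    finally show ?thesis by (simp add: algebra_simps)
  qed
  have "(\<lambda>n. (opn (s n - T) + opn (t n - S)) * (nrm \<xi> * nrm \<eta>)) \<longlonglongrightarrow> (0 + 0) * (nrm \<xi> * nrm \<eta>)"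
    by (intro tendsto_intros T S)
  then have "cmod (inn (T \<xi>) \<eta> - inn \<xi> (S \<eta>)) \<le> (0 + 0) * (nrm \<xi> * nrm \<eta>)"
    by (rule LIMSEQ_le_const) (use 1 in blast)
  then show "inn (T \<xi>) \<eta> = inn \<xi> (S \<eta>)" by simp
qed

end


section \<open>The reduced C*-algebra\<close>

context hausdorff_twist
begin

abbreviation "R \<equiv> regular_rep G L"
abbreviation "A \<equiv> reduced_cstar G L"
abbreviation "Gam \<equiv> Gamma_c G L"

lemma R_apply: "\<xi> \<in> H2 \<Longrightarrow> R f \<xi> = conv G L f \<xi>"
  unfolding regular_rep_def by simp

lemma R_outside: "\<xi> \<notin> H2 \<Longrightarrow> R f \<xi> = 0"
  unfolding regular_rep_def by (rule if_not_P)

text \<open>Convolution by a section over a bisection moves values from \<open>rpart U g\<close> to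
  \<open>g\<close>, a partial bijection of arrows, and multiplies them by vectors of norm at most
  \<open>B\<close>. Hence \<open>B\<close> bounds the operator.\<close>

lemma conv_elementary_bound:
  assumes U: "open_bisection G U" and f: "f \<in> sections_c G L U"
    and B: "0 \<le> B" "\<And>g. g \<in> arrows G \<Longrightarrow> lnorm L g (f g) \<le> B" and \<xi>: "\<xi> \<in> H2"
  shows "conv G L f \<xi> \<in> H2" "nrm (conv G L f \<xi>) \<le> B * nrm \<xi>"
proof -
  note \<xi>s = l2_fsec[OF \<xi>] and fs = Gamma_fsec[OF sections_c_Gamma[OF U f]]
  have c: "conv G L f \<xi> g = (if g \<in> ldom U then lmul L (lpart U g) (rpart U g) (f (lpart U g)) (\<xi> (rpart U g)) else 0)"
    if "g \<in> arrows G" for g by (rule conv_elementary[OF U f \<xi>s that])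
  have inj: "inj_on (rpart U) (ldom U)"
  proof (rule inj_onI)
    fix g h assume gh: "g \<in> ldom U" "h \<in> ldom U" "rpart U g = rpart U h"
    have "src G (lpart U g) = src G (lpart U h)"
      using rpart_props(2)[OF U gh(1)] rpart_props(2)[OF U gh(2)] gh(3) by simp
    then have "lpart U g = lpart U h"
      by (rule inj_onD[OF bisection_src_inj[OF U]]) (intro lpart_in(1)[OF U] gh)+
    then have "gmul G (lpart U g) (rpart U g) = gmul G (lpart U h) (rpart U h)" using gh(3) by (rule arg_cong2)
    then show "g = h" unfolding rpart_props(4)[OF U gh(1)] rpart_props(4)[OF U gh(2)] .
  qed
  have bd: "(\<Sum>g\<in>F. (lnorm L g (conv G L f \<xi> g))\<^sup>2) \<le> (B * nrm \<xi>)\<^sup>2" if F: "finite F" "F \<subseteq> arrows G" for F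
  proof -
    have "(\<Sum>g\<in>F. (lnorm L g (conv G L f \<xi> g))\<^sup>2) = (\<Sum>g\<in>F \<inter> ldom U. (lnorm L g (conv G L f \<xi> g))\<^sup>2)"
    proof (rule sum.mono_neutral_right[OF F(1)], blast, intro ballI)
      fix g assume "g \<in> F - F \<inter> ldom U"
      then have "g \<in> arrows G" "g \<notin> ldom U" using F by auto
      then show "(lnorm L g (conv G L f \<xi> g))\<^sup>2 = 0" using c[of g] norm_0 by simp
    qed
    also have "\<dots> \<le> (\<Sum>g\<in>F \<inter> ldom U. B\<^sup>2 * (lnorm L (rpart U g) (\<xi> (rpart U g)))\<^sup>2)"
    proof (rule sum_mono)
      fix g assume g: "g \<in> F \<inter> ldom U"
      then have gA: "g \<in> arrows G" and gU: "g \<in> ldom U" using F by auto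
      note l = lpart_in[OF U gU] and r = rpart_props[OF U gU]
      have "lnorm L (gmul G (lpart U g) (rpart U g)) (lmul L (lpart U g) (rpart U g) (f (lpart U g)) (\<xi> (rpart U g)))
          \<le> lnorm L (lpart U g) (f (lpart U g)) * lnorm L (rpart U g) (\<xi> (rpart U g))"
        by (rule norm_lmul) (use l r fsecD[OF fs] fsecD[OF \<xi>s] in auto)
      also have "\<dots> \<le> B * lnorm L (rpart U g) (\<xi> (rpart U g))"
        by (intro mult_right_mono B(2) l norm_nonneg r fsecD[OF \<xi>s])
      finally have le: "lnorm L g (conv G L f \<xi> g) \<le> B * lnorm L (rpart U g) (\<xi> (rpart U g))"
        using c[OF gA] gU unfolding r(4) by simp
      show "(lnorm L g (conv G L f \<xi> g))\<^sup>2 \<le> B\<^sup>2 * (lnorm L (rpart U g) (\<xi> (rpart U g)))\<^sup>2"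
        unfolding power_mult_distrib[symmetric]
        by (rule power_mono[OF le norm_nonneg[OF gA fsecD[OF conv_fsec[OF fs \<xi>s] gA]]])
    qed
    also have "\<dots> = B\<^sup>2 * (\<Sum>g\<in>rpart U ` (F \<inter> ldom U). (lnorm L g (\<xi> g))\<^sup>2)"
      using inj_on_subset[OF inj, of "F \<inter> ldom U"] by (simp add: sum_distrib_left sum.reindex)
    also have "\<dots> \<le> B\<^sup>2 * (nrm \<xi>)\<^sup>2"
      by (intro mult_left_mono l2_sum_le \<xi>) (use F rpart_props(1)[OF U] in auto)
    finally show ?thesis by (simp add: power_mult_distrib)
  qed
  note I = l2I[OF conv_fsec[OF fs \<xi>s] conv_outside mult_nonneg_nonneg[OF B(1) nrm_nonneg] bd]
  show "conv G L f \<xi> \<in> H2" by (rule I(1))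
  show "nrm (conv G L f \<xi>) \<le> B * nrm \<xi>" by (rule I(2))
qed

lemma csec_bounded:
  assumes "csec f" "compactin (gtop G) K" "\<And>g. g \<notin> K \<Longrightarrow> f g = 0"
  shows "\<exists>B\<ge>0. \<forall>g\<in>arrows G. lnorm L g (f g) \<le> B"
proof -
  have "continuous_map (gtop G) euclideanreal (\<lambda>g. lnorm L g (f g))"
    using assms(1) unfolding csec_def by (intro Lcont_norm) blast
  then have "compactin euclideanreal ((\<lambda>g. lnorm L g (f g)) ` K)" by (rule image_compactin[OF assms(2)])
  then have "bounded ((\<lambda>g. lnorm L g (f g)) ` K)" by (simp add: compact_imp_bounded)
  then obtain B where B: "\<And>g. g \<in> K \<Longrightarrow> \<bar>lnorm L g (f g)\<bar> \<le> B" unfolding bounded_iff by auto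
  have "lnorm L g (f g) \<le> max B 0" if "g \<in> arrows G" for g
    using B[of g] assms(3)[of g] norm_0[OF that] by (cases "g \<in> K") auto
  then show ?thesis by (intro exI[of _ "max B 0"]) simp
qed

lemma R_add: "f \<in> Gam \<Longrightarrow> h \<in> Gam \<Longrightarrow> R (f + h) = R f + R h"
proof
  fix \<xi> assume fh: "f \<in> Gam" "h \<in> Gam"
  show "R (f + h) \<xi> = (R f + R h) \<xi>"
  proof (cases "\<xi> \<in> H2")
    case True
    then show ?thesis
      unfolding plus_fun_apply[of "R f" "R h" \<xi>] R_apply[OF True] by (intro conv_add_left fh l2_fsec)
  next
    case False
    show ?thesis unfolding plus_fun_apply[of "R f" "R h" \<xi>] R_outside[OF False] by (rule add_0_left[symmetric])
  qed
qed

lemma R_scale: "f \<in> Gam \<Longrightarrow> R (\<lambda>g. lscale L z (f g)) = oscale z (R f)"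
proof
  fix \<xi> assume f: "f \<in> Gam"
  show "R (\<lambda>g. lscale L z (f g)) \<xi> = oscale z (R f) \<xi>"
    unfolding oscale_def using conv_scale_left[OF f l2_fsec, of \<xi> z] R_outside
    by (cases "\<xi> \<in> H2") (simp_all add: R_apply zero_fun_def)
qed

lemma R_elementary_BO:
  assumes U: "open_bisection G U" and f: "f \<in> sections_c G L U"
  shows "R f \<in> BO"
proof -
  obtain K where K: "csec f" "compactin (gtop G) K" "K \<subseteq> U" "\<And>g. g \<notin> K \<Longrightarrow> f g = 0"
    by (rule sections_cE[OF U f]) blast
  have "\<exists>B\<ge>0. \<forall>g\<in>arrows G. lnorm L g (f g) \<le> B"
    by (rule csec_bounded[OF K(1,2)]) (rule K(4))
  then obtain B where "0 \<le> B" "\<forall>g\<in>arrows G. lnorm L g (f g) \<le> B"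
    by (elim exE conjE)
  then have B: "0 \<le> B" "\<And>g. g \<in> arrows G \<Longrightarrow> lnorm L g (f g) \<le> B" by simp_all
  note fs = csec_fsec[OF K(1)]
  show ?thesis
  proof (rule BO_I)
    show "R f \<xi> \<in> H2" "nrm (R f \<xi>) \<le> B * nrm \<xi>" if "\<xi> \<in> H2" for \<xi>
      using conv_elementary_bound[OF U f B that] by (simp_all add: R_apply that)
    show "R f \<xi> = 0" if "\<xi> \<notin> H2" for \<xi> by (rule R_outside[OF that])
    show "R f (\<xi> + \<eta>) = R f \<xi> + R f \<eta>" if "\<xi> \<in> H2" "\<eta> \<in> H2" for \<xi> \<eta>
      unfolding R_apply[OF that(1)] R_apply[OF that(2)] R_apply[OF l2_add(1)[OF that]]
      by (intro conv_add_right fs l2_fsec that)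
    show "R f (\<lambda>g. lscale L z (\<xi> g)) = (\<lambda>g. lscale L z (R f \<xi> g))" if "\<xi> \<in> H2" for z \<xi>
      unfolding R_apply[OF that] R_apply[OF l2_scale(1)[OF that]]
      by (intro conv_scale_right fs l2_fsec that)
  qed
qed

lemma R_BO: "f \<in> Gam \<Longrightarrow> R f \<in> BO"
proof (induction rule: Gamma_induct)
  case (elementary U f)
  then show ?case by (rule R_elementary_BO)
next
  case (add f h)
  then show ?case unfolding R_add[OF add(1,2)] by (intro BO_add)
qed

lemma R_mult:
  assumes "f \<in> Gam" "h \<in> Gam"
  shows "R (conv G L f h) = R f \<circ> R h"
proof
  fix \<xi>
  show "R (conv G L f h) \<xi> = (R f \<circ> R h) \<xi>"
  proof (cases "\<xi> \<in> H2")
    case True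
    have "R h \<xi> \<in> H2" by (rule BO_D(1)[OF R_BO[OF assms(2)] True])
    then show ?thesis
      using conv_assoc[OF assms l2_fsec[OF True]] by (simp add: R_apply True)
  next
    case False
    show ?thesis unfolding o_apply R_outside[OF False] BO_zero_arg[OF R_BO[OF assms(1)]] ..
  qed
qed

text \<open>The map \<open>rpart U\<close> is a bijection from \<open>ldom U\<close> onto the
  corresponding domain of the inverse bisection, with the \<open>rpart\<close> of the latter as
  inverse. Reindexing along it matches the two sums term by term through
  \<open>ip_adjoint\<close>.\<close>

lemma R_adj_elementary:
  assumes U: "open_bisection G U" and f: "f \<in> sections_c G L U"
  shows "adj (R f) (R (fstar f))"
  unfolding adj_def
proof (intro ballI)
  fix \<xi> \<eta> assume H: "\<xi> \<in> H2" "\<eta> \<in> H2"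
  note V = bisection_inv[OF U] and f' = fstar_sections_c[OF U f] and \<xi>s = l2_fsec[OF H(1)] and \<eta>s = l2_fsec[OF H(2)]
  note fs = Gamma_fsec[OF sections_c_Gamma[OF U f]]
  let ?V = "ginv G ` U"
  define t where "t k = ip k (\<xi> k) (conv G L (fstar f) \<eta> k)" for k
  have ip0: "ip g 0 b = 0" "ip g b 0 = 0" if "g \<in> arrows G" "b \<in> fib L g" for g b
    unfolding ip_def using that lstar_closed[OF that]
    by (simp_all add: lstar_0 lmul_0_left lmul_0_right inv_closed src_inv unit_coord_0 src_in_units)
  have dom: "ldom W \<subseteq> arrows G" for W unfolding ldom_def by blast
  have map: "rpart U g \<in> ldom ?V \<and> rpart ?V (rpart U g) = g \<and> ip g (conv G L f \<xi> g) (\<eta> g) = t (rpart U g)"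
    if g: "g \<in> ldom U" for g
  proof -
    define a where "a = lpart U g"
    define k where "k = rpart U g"
    note a = lpart_in[OF U g, folded a_def] and k = rpart_props[OF U g, folded a_def k_def]
    have gA: "g \<in> arrows G" using g dom by blast
    have aV: "ginv G a \<in> ?V" using a(1) by blast
    have rk: "rng G k = rng G (ginv G a)" using k(2) by (simp add: rng_inv a)
    have kV: "k \<in> ldom ?V" unfolding ldom_def using k(1) rk aV by blast
    have lk: "lpart ?V k = ginv G a" by (rule lpart_eq[OF V aV rk])
    have rg: "rpart ?V k = g" unfolding rpart_def lk inv_inv[OF a(3)] by (rule k(4))
    have "t k = ip k (\<xi> k) (lmul L (ginv G a) g (lstar L a (f a)) (\<eta> g))"
      unfolding t_def using conv_elementary[OF V f' \<eta>s k(1)] kV a(3)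
      by (simp add: lk rg fstar_def inv_closed inv_inv)
    also have "\<dots> = ip g (lmul L a k (f a) (\<xi> k)) (\<eta> g)"
      using ip_adjoint[OF a(3) k(1) k(2)[symmetric] fsecD[OF fs a(3)] fsecD[OF \<xi>s k(1)], of "\<eta> g"] fsecD[OF \<eta>s gA]
      unfolding k(4) by simp
    also have "\<dots> = ip g (conv G L f \<xi> g) (\<eta> g)"
      using conv_elementary[OF U f \<xi>s gA] g by (simp add: a_def k_def)
    finally show ?thesis using kV rg unfolding k_def by simp
  qed
  have bwd: "rpart ?V k \<in> ldom U \<and> rpart U (rpart ?V k) = k" if k: "k \<in> ldom ?V" for k
  proof -
    obtain a where a: "a \<in> U" "lpart ?V k = ginv G a" using lpart_in(1)[OF V k] by blast
    have aA: "a \<in> arrows G" by (rule bisection_arrow[OF U a(1)])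
    have kA: "k \<in> arrows G" using k dom by blast
    have "rng G k = src G a" using lpart_in(2)[OF V k] unfolding a(2) by (simp add: rng_inv aA)
    then show ?thesis
      unfolding rpart_def[of ?V] a(2) inv_inv[OF aA] using rpart_mul(1,3)[OF U a(1) kA] by simp
  qed
  have "inn (R f \<xi>) \<eta> = (\<Sum>\<^sub>\<infinity>g\<in>ldom U. ip g (conv G L f \<xi> g) (\<eta> g))"
    unfolding inn_eq R_apply[OF H(1)]
    by (rule infsum_cong_neutral)
      (use dom conv_elementary[OF U f \<xi>s] ip0 fsecD[OF \<eta>s] in auto)
  also have "\<dots> = (\<Sum>\<^sub>\<infinity>g\<in>ldom U. t (rpart U g))"
    by (rule infsum_cong) (use map in blast)
  also have "\<dots> = infsum t (ldom ?V)"
    by (rule infsum_reindex_bij_betw, rule bij_betw_byWitness[where f' = "rpart ?V"]) (use map bwd in auto)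
  also have "\<dots> = inn \<xi> (R (fstar f) \<eta>)"
    unfolding inn_eq R_apply[OF H(2)] t_def
    by (rule infsum_cong_neutral)
      (use dom conv_elementary[OF V f' \<eta>s] ip0 fsecD[OF \<xi>s] in auto)
  finally show "inn (R f \<xi>) \<eta> = inn \<xi> (R (fstar f) \<eta>)" .
qed

text \<open>The existence of an adjoint among the sections is all that the passage to limits uses,
  and it is inherited by sums.\<close>

lemma R_adj: "f \<in> Gam \<Longrightarrow> \<exists>h\<in>Gam. adj (R f) (R h)"
proof (induction rule: Gamma_induct)
  case (elementary U f)
  then show ?case
    using R_adj_elementary sections_c_Gamma[OF bisection_inv fstar_sections_c] by blast
next
  case (add f h)
  then obtain f' h' where fh: "f' \<in> Gam" "adj (R f) (R f')" "h' \<in> Gam" "adj (R h) (R h')" by blast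
  have "adj (R f + R h) (R f' + R h')"
    by (rule adj_add[OF R_BO[OF add(1)] R_BO[OF fh(1)] R_BO[OF add(2)] R_BO[OF fh(3)] fh(2,4)])
  then have "adj (R (f + h)) (R (f' + h'))"
    unfolding R_add[OF add(1,2)] R_add[OF fh(1,3)] .
  then show ?case using Gamma_add[OF fh(1,3)] by blast
qed

lemma carr_A: "T \<in> carr A \<longleftrightarrow> T \<in> BO \<and> (\<forall>\<epsilon>>0. \<exists>f\<in>Gam. opn (T - R f) < \<epsilon>)"
  unfolding reduced_cstar_def by simp

lemma A_ops: "cscale A = oscale" "cmul A S T = S \<circ> T" "cstar A = adjoint_operator G L" "cnorm A = opn"
  unfolding reduced_cstar_def oscale_def by (simp_all add: fun_eq_iff)

lemma carr_BO: "T \<in> carr A \<Longrightarrow> T \<in> BO"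
  unfolding carr_A by blast

lemma carr_approx: "T \<in> carr A \<Longrightarrow> 0 < \<epsilon> \<Longrightarrow> \<exists>f\<in>Gam. opn (T - R f) < \<epsilon>"
  unfolding carr_A by blast

lemma opn_zero: "opn 0 = 0"
  using BO_scale(2)[OF VO.subspace_0[OF BO_subspace], of 0] by simp

lemma R_carr: "f \<in> Gam \<Longrightarrow> R f \<in> carr A"
  unfolding carr_A using R_BO by (auto intro!: bexI[of _ f] simp: opn_zero)

lemma carr_closure:
  assumes "T \<in> BO" "\<And>\<epsilon>. 0 < \<epsilon> \<Longrightarrow> \<exists>S\<in>carr A. opn (T - S) < \<epsilon>"
  shows "T \<in> carr A"
  unfolding carr_A
proof (intro conjI allI impI assms(1))
  fix \<epsilon> :: real assume "0 < \<epsilon>"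
  then obtain S where S: "S \<in> carr A" "opn (T - S) < \<epsilon> / 2" using assms(2)[of "\<epsilon> / 2"] by auto
  obtain f where f: "f \<in> Gam" "opn (S - R f) < \<epsilon> / 2" using carr_approx[OF S(1), of "\<epsilon> / 2"] \<open>0 < \<epsilon>\<close> by auto
  have "opn (T - R f) \<le> opn (T - S) + opn (S - R f)"
    by (intro opn_triangle_diff assms(1) carr_BO S R_BO f)
  then show "\<exists>f\<in>Gam. opn (T - R f) < \<epsilon>" using S f by (intro bexI[of _ f]) auto
qed

lemma carr_add: 
  assumes "S \<in> carr A" "T \<in> carr A"
  shows "S + T \<in> carr A"
  unfolding carr_A
proof (intro conjI allI impI)
  show "S + T \<in> BO" by (intro BO_add carr_BO assms)
  fix \<epsilon> :: real assume "0 < \<epsilon>"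
  then obtain f h where f: "f \<in> Gam" "opn (S - R f) < \<epsilon> / 2" and h: "h \<in> Gam" "opn (T - R h) < \<epsilon> / 2"
    using carr_approx[OF assms(1), of "\<epsilon> / 2"] carr_approx[OF assms(2), of "\<epsilon> / 2"] by auto
  have "opn ((S - R f) + (T - R h)) \<le> opn (S - R f) + opn (T - R h)"
    by (intro BO_add(2) BO_diff carr_BO assms R_BO f h)
  also have "(S - R f) + (T - R h) = (S + T) - R (f + h)" unfolding R_add[OF f(1) h(1)] by (rule add_diff_add[symmetric])
  finally have "opn (S + T - R (f + h)) < \<epsilon>" using f(2) h(2) by linarith
  then show "\<exists>k\<in>Gam. opn (S + T - R k) < \<epsilon>" using Gamma_add[OF f(1) h(1)] by (rule bexI)
qed

lemma carr_scale:
  assumes "T \<in> carr A"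
  shows "oscale z T \<in> carr A"
  unfolding carr_A
proof (intro conjI allI impI)
  show "oscale z T \<in> BO" by (intro BO_scale carr_BO assms)
  fix \<epsilon> :: real assume "0 < \<epsilon>"
  then have p: "0 < \<epsilon> / (cmod z + 1)" by (simp add: add_nonneg_pos)
  obtain f where f: "f \<in> Gam" "opn (T - R f) < \<epsilon> / (cmod z + 1)" using carr_approx[OF assms p] by blast
  have zf: "(\<lambda>g. lscale L z (f g)) \<in> Gam" by (rule VF.subspace_scale[OF Gamma_subspace f(1)])
  have d: "T - R f \<in> BO" by (intro BO_diff carr_BO assms R_BO f)
  have "opn (oscale z T - R (\<lambda>g. lscale L z (f g))) = cmod z * opn (T - R f)"
    unfolding R_scale[OF f(1)] VO.scale_right_diff_distrib[symmetric] by (rule BO_scale(2)[OF d])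
  also have "\<dots> \<le> (cmod z + 1) * opn (T - R f)" by (intro mult_right_mono opn_nonneg d) simp
  also have "\<dots> < (cmod z + 1) * (\<epsilon> / (cmod z + 1))"
    using f(2) by (intro mult_strict_left_mono) (auto simp: add_nonneg_pos)
  also have "\<dots> = \<epsilon>" using norm_ge_zero[of z] by (simp add: add_nonneg_eq_0_iff)
  finally show "\<exists>f\<in>Gam. opn (oscale z T - R f) < \<epsilon>" using zf by blast
qed

lemma BO_comp_diff_right: "S \<in> BO \<Longrightarrow> T \<in> BO \<Longrightarrow> U \<in> BO \<Longrightarrow> S \<circ> (T - U) = (S \<circ> T) - (S \<circ> U)"
  using BO_comp_add_right[of S "T - U" U] by (simp add: BO_diff algebra_simps)

lemma comp_diff_left: "(S - T) \<circ> U = (S \<circ> U) - (T \<circ> (U :: ('g, 'v) operator))"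
  by (simp add: fun_eq_iff)

lemma carr_comp:
  assumes S: "S \<in> carr A" and T: "T \<in> carr A"
  shows "S \<circ> T \<in> carr A"
proof (rule carr_closure)
  note SB = carr_BO[OF S] and TB = carr_BO[OF T]
  show "S \<circ> T \<in> BO" by (intro BO_comp SB TB)
  fix \<epsilon> :: real assume \<epsilon>: "0 < \<epsilon>"
  \<comment> \<open>One bound for both outer factors: \<open>h\<close> is chosen within 1 of
    \<open>T\<close>, so the norm of \<open>R h\<close> is at most \<open>opn T + 1\<close>.\<close>
  define q where "q = opn S + opn T + 2"
  have q: "0 < q" "opn S \<le> q" "opn T + 1 \<le> q" using opn_nonneg[OF SB] opn_nonneg[OF TB] by (auto simp: q_def)
  have p: "0 < \<epsilon> / (2 * q)" using \<epsilon> q by simp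
  obtain f where f: "f \<in> Gam" "opn (S - R f) < \<epsilon> / (2 * q)" using carr_approx[OF S p] by blast
  obtain h where h: "h \<in> Gam" "opn (T - R h) < min 1 (\<epsilon> / (2 * q))" using carr_approx[OF T, of "min 1 (\<epsilon> / (2 * q))"] p by auto
  note fB = R_BO[OF f(1)] and hB = R_BO[OF h(1)]
  have "opn (R h) \<le> opn (R h - T) + opn T"
    using BO_add(2)[OF BO_diff[OF hB TB] TB] by simp
  then have hq: "opn (R h) \<le> q" using h(2) opn_minus_commute[OF hB TB] q(3) by simp
  have "(S \<circ> T) - (R f \<circ> R h) = (S \<circ> (T - R h)) + ((S - R f) \<circ> R h)"
    unfolding BO_comp_diff_right[OF SB TB hB] comp_diff_left by (simp add: algebra_simps)
  then have "opn ((S \<circ> T) - (R f \<circ> R h)) \<le> opn (S \<circ> (T - R h)) + opn ((S - R f) \<circ> R h)"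
    using BO_add(2)[OF BO_comp(1)[OF SB BO_diff[OF TB hB]] BO_comp(1)[OF BO_diff[OF SB fB] hB]] by simp
  also have "\<dots> \<le> opn S * opn (T - R h) + opn (S - R f) * opn (R h)"
    by (intro add_mono BO_comp(2) BO_diff SB TB fB hB)
  also have "\<dots> \<le> q * opn (T - R h) + opn (S - R f) * q"
    by (intro add_mono mult_right_mono mult_left_mono q hq opn_nonneg BO_diff SB TB fB hB)
  also have "\<dots> < q * (\<epsilon> / (2 * q)) + \<epsilon> / (2 * q) * q"
    using f(2) h(2) q(1) by (intro add_strict_mono mult_strict_left_mono mult_strict_right_mono) auto
  also have "\<dots> = \<epsilon>" using q(1) by simp
  finally show "\<exists>U\<in>carr A. opn ((S \<circ> T) - U) < \<epsilon>"
    using R_carr[OF conv_Gamma[OF f(1) h(1)]] unfolding R_mult[OF f(1) h(1)] by blast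
qed

text \<open>Sections approximating \<open>T\<close> have adjoints that are sections. Passing to
  adjoints does not increase norms, so the adjoints form a Cauchy sequence, and its limit is the
  adjoint of \<open>T\<close> and again lies in the algebra.\<close>

lemma carr_adjoint:
  assumes T: "T \<in> carr A"
  obtains S where "S \<in> carr A" "adj T S" "cstar A T = S"
proof -
  note TB = carr_BO[OF T]
  have "\<exists>f\<in>Gam. opn (T - R f) < inverse (real (Suc n))" for n by (rule carr_approx[OF T]) simp
  then obtain f where f: "\<And>n. f n \<in> Gam" "\<And>n. opn (T - R (f n)) < inverse (real (Suc n))" by metis
  obtain h where h: "\<And>n. h n \<in> Gam" "\<And>n. adj (R (f n)) (R (h n))" using R_adj[OF f(1)] by metis
  note fB = R_BO[OF f(1)] and hB = R_BO[OF h(1)]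
  have c: "\<exists>N. \<forall>m\<ge>N. \<forall>n\<ge>N. opn (R (h m) - R (h n)) < \<epsilon>" if \<epsilon>: "0 < \<epsilon>" for \<epsilon>
  proof -
    obtain N where N: "inverse (real (Suc N)) < \<epsilon> / 2" using reals_Archimedean[of "\<epsilon> / 2"] \<epsilon> by auto
    have "opn (R (h m) - R (h n)) < \<epsilon>" if mn: "m \<ge> N" "n \<ge> N" for m n
    proof -
      have "opn (R (h m) - R (h n)) \<le> opn (R (f m) - R (f n))"
        by (rule opn_adj_le[OF BO_diff[OF fB fB] BO_diff[OF hB hB] adj_diff[OF fB hB fB hB h(2) h(2)]])
      also have "\<dots> \<le> opn (R (f m) - T) + opn (T - R (f n))" by (rule opn_triangle_diff[OF fB TB fB])
      also have "\<dots> < inverse (real (Suc m)) + inverse (real (Suc n))"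
        using f(2)[of m] f(2)[of n] opn_minus_commute[OF fB TB, of m] by simp
      also have "\<dots> \<le> inverse (real (Suc N)) + inverse (real (Suc N))"
        using mn by (intro add_mono le_imp_inverse_le) auto
      finally show ?thesis using N by simp
    qed
    then show ?thesis by blast
  qed
  obtain S where S: "S \<in> BO" "(\<lambda>n. opn (R (h n) - S)) \<longlonglongrightarrow> 0" using BO_complete[OF hB c] by blast
  have "(\<lambda>n. opn (R (f n) - T)) \<longlonglongrightarrow> 0"
  proof (rule Lim_null_comparison)
    show "\<forall>\<^sub>F n in sequentially. norm (opn (R (f n) - T)) \<le> inverse (real (Suc n))"
      using f(2) opn_minus_commute[OF fB TB] opn_nonneg[OF BO_diff[OF fB TB]] by (simp add: less_imp_le)
    show "(\<lambda>n. inverse (real (Suc n))) \<longlonglongrightarrow> 0" by (rule LIMSEQ_inverse_real_of_nat)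
  qed
  then have a: "adj T S" by (rule adj_limit[OF fB hB h(2) TB _ S])
  have "S \<in> carr A"
  proof (rule carr_closure[OF S(1)])
    fix \<epsilon> :: real assume "0 < \<epsilon>"
    then obtain n where "norm (opn (R (h n) - S) - 0) < \<epsilon>" using LIMSEQ_D[OF S(2)] by blast
    then show "\<exists>U\<in>carr A. opn (S - U) < \<epsilon>"
      using R_carr[OF h(1)] opn_minus_commute[OF hB S(1), of n] by (intro bexI[of _ "R (h n)"]) auto
  qed
  then show ?thesis using that a adjoint_operator_eq[OF S(1) a] by (simp add: A_ops)
qed

lemma cstar_eq: "T \<in> carr A \<Longrightarrow> S \<in> BO \<Longrightarrow> adj T S \<Longrightarrow> cstar A T = S"
  unfolding A_ops by (rule adjoint_operator_eq)

lemma banach_star_algebra_A: "banach_star_algebra A"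
proof (rule banach_star_algebra.intro, unfold A_ops)
  show "vector_space oscale" by (rule VO.vector_space_axioms)
  have zero: "0 \<in> carr A"
    using R_carr[OF VF.subspace_0[OF Gamma_subspace]] carr_scale[of "R 0" 0] by simp
  show "module.subspace oscale (carr A)"
    by (rule VO.subspaceI) (auto intro: zero carr_add carr_scale)
  note B = carr_BO
  fix a b c :: "('g, 'v) operator" and z
  assume a: "a \<in> carr A"
  obtain a' where a': "a' \<in> carr A" "adj a a'" "cstar A a = a'" by (rule carr_adjoint[OF a]) blast
  show "adjoint_operator G L a \<in> carr A" using a' by (simp add: A_ops)
  show "adjoint_operator G L (oscale z a) = oscale (cnj z) (adjoint_operator G L a)"
    using cstar_eq[OF carr_scale[OF a] BO_scale(1)[OF B[OF a'(1)]] adj_scale[OF B[OF a] B[OF a'(1)] a'(2)]] a'(3)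
    by (simp add: A_ops)
  show "opn (oscale z a) = cmod z * opn a" by (rule BO_scale(2)[OF B[OF a]])
  show "opn a = 0 \<Longrightarrow> a = 0" by (rule opn_eq_0D[OF B[OF a]])
  assume b: "b \<in> carr A"
  obtain b' where b': "b' \<in> carr A" "adj b b'" "cstar A b = b'" by (rule carr_adjoint[OF b]) blast
  show "a \<circ> b \<in> carr A" by (rule carr_comp[OF a b])
  show "oscale z a \<circ> b = oscale z (a \<circ> b)" by (simp add: oscale_def fun_eq_iff)
  show "a \<circ> oscale z b = oscale z (a \<circ> b)" by (rule BO_comp_scale_right[OF B[OF a] B[OF b]])
  show "opn (a + b) \<le> opn a + opn b" by (rule BO_add(2)[OF B[OF a] B[OF b]])
  show "opn (a \<circ> b) \<le> opn a * opn b" by (rule BO_comp(2)[OF B[OF a] B[OF b]])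
  show "adjoint_operator G L (a + b) = adjoint_operator G L a + adjoint_operator G L b"
    using cstar_eq[OF carr_add[OF a b] BO_add(1)[OF B[OF a'(1)] B[OF b'(1)]]
        adj_add[OF B[OF a] B[OF a'(1)] B[OF b] B[OF b'(1)] a'(2) b'(2)]] a'(3) b'(3) by (simp add: A_ops)
  show "adjoint_operator G L (a \<circ> b) = adjoint_operator G L b \<circ> adjoint_operator G L a"
    using cstar_eq[OF carr_comp[OF a b] BO_comp(1)[OF B[OF b'(1)] B[OF a'(1)]]
        adj_comp[OF B[OF a] B[OF a'(1)] B[OF b] B[OF b'(1)] a'(2) b'(2)]] a'(3) b'(3) by (simp add: A_ops)
  assume c: "c \<in> carr A"
  show "a \<circ> b \<circ> c = a \<circ> (b \<circ> c)" by (rule comp_assoc)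
  show "(a + b) \<circ> c = (a \<circ> c) + (b \<circ> c)" by (simp add: fun_eq_iff)
  show "a \<circ> (b + c) = (a \<circ> b) + (a \<circ> c)" by (rule BO_comp_add_right[OF B[OF a] B[OF b] B[OF c]])
next
  fix s :: "nat \<Rightarrow> ('g, 'v) operator"
  assume s: "\<And>n. s n \<in> carr A" and c: "\<And>\<epsilon>. 0 < \<epsilon> \<Longrightarrow> \<exists>N. \<forall>m\<ge>N. \<forall>n\<ge>N. opn (s m - s n) < \<epsilon>"
  note sB = carr_BO[OF s]
  obtain T where T: "T \<in> BO" "(\<lambda>n. opn (s n - T)) \<longlonglongrightarrow> 0" using BO_complete[OF sB c] by blast
  have "T \<in> carr A"
  proof (rule carr_closure[OF T(1)])
    fix \<epsilon> :: real assume "0 < \<epsilon>"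
    then obtain n where "norm (opn (s n - T) - 0) < \<epsilon>" using LIMSEQ_D[OF T(2)] by blast
    then show "\<exists>U\<in>carr A. opn (T - U) < \<epsilon>"
      using s opn_minus_commute[OF sB T(1), of n] by (intro bexI[of _ "s n"]) auto
  qed
  then show "\<exists>l\<in>carr A. (\<lambda>n. opn (s n - l)) \<longlonglongrightarrow> 0" using T(2) by blast
qed

subsection \<open>The conditional expectation\<close>

definition delta :: "'g \<Rightarrow> 'g \<Rightarrow> 'v"
  where "delta x = (\<lambda>g. if g = x then fib_one L x else 0)"

text \<open>The diagonal matrix coefficient at \<open>x\<close>, read off as a coordinate;
  \<open>cexp_inn\<close> rewrites it as an inner product. The value 0 off the units lets the
  expectation of a section lie in \<open>C_c\<close> of the unit space.\<close>

definition cexp :: "('g, 'v) operator \<Rightarrow> 'g \<Rightarrow> complex"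
  where "cexp T x = (if x \<in> units G then unit_coord L x (T (delta x) x) else 0)"

lemma delta_l2:
  assumes x: "x \<in> units G"
  shows "delta x \<in> H2" "nrm (delta x) \<le> 1"
proof -
  have fs: "fsec (delta x)" unfolding fsec_def delta_def using fib_one(1)[OF x] fib_0 by simp
  have bd: "(\<Sum>g\<in>F. (lnorm L g (delta x g))\<^sup>2) \<le> 1\<^sup>2" if F: "finite F" "F \<subseteq> arrows G" for F
  proof -
    have "(\<Sum>g\<in>F. (lnorm L g (delta x g))\<^sup>2) = (\<Sum>g\<in>F. if g = x then 1 else 0)"
      using F norm_fib_one[OF x] by (intro sum.cong) (auto simp: delta_def norm_0)
    also have "\<dots> \<le> 1" using F(1) by (simp add: sum.delta)
    finally show ?thesis by simp
  qed
  note I = l2I[OF fs _ zero_le_one bd]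
  show "delta x \<in> H2" "nrm (delta x) \<le> 1"
    by (rule I(1); use unit_arrow[OF x] in \<open>auto simp: delta_def\<close>)
      (rule I(2); use unit_arrow[OF x] in \<open>auto simp: delta_def\<close>)
qed

lemma inn_delta:
  assumes x: "x \<in> units G" and \<xi>: "\<xi> \<in> H2"
  shows "inn (delta x) \<xi> = unit_coord L x (\<xi> x)"
proof -
  note xA = unit_arrow[OF x]
  have "inn (delta x) \<xi> = (\<Sum>\<^sub>\<infinity>g\<in>{x}. ip g (delta x g) (\<xi> g))"
    unfolding inn_eq
  proof (rule infsum_cong_neutral)
    fix g assume g: "g \<in> arrows G - {x}"
    then show "ip g (delta x g) (\<xi> g) = 0"
      using fsecD[OF l2_fsec[OF \<xi>], of g] unfolding ip_def delta_def
      by (simp add: lstar_0 lmul_0_left inv_closed src_inv unit_coord_0 src_in_units)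
  qed (use xA in auto)
  also have "\<dots> = unit_coord L x (\<xi> x)"
    using x fib_one[OF x] fsecD[OF l2_fsec[OF \<xi>] xA] by (simp add: ip_def delta_def inv_unit src_unit lstar_fib_one)
  finally show ?thesis .
qed

lemma cexp_inn: "T \<in> BO \<Longrightarrow> x \<in> units G \<Longrightarrow> cexp T x = inn (delta x) (T (delta x))"
  by (simp add: cexp_def inn_delta BO_D delta_l2)

lemma cexp_add: "S \<in> BO \<Longrightarrow> T \<in> BO \<Longrightarrow> cexp (S + T) x = cexp S x + cexp T x"
proof (cases "x \<in> units G")
  case True
  assume B: "S \<in> BO" "T \<in> BO"
  note d = delta_l2(1)[OF True]
  show ?thesis
    unfolding cexp_inn[OF B(1) True] cexp_inn[OF B(2) True] cexp_inn[OF BO_add(1)[OF B] True] plus_fun_apply[of S T "delta x"]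
    by (rule inn_add_right[OF d BO_D(1)[OF B(1) d] BO_D(1)[OF B(2) d]])
qed (simp add: cexp_def)

lemma cexp_scale: "T \<in> BO \<Longrightarrow> cexp (oscale z T) x = z * cexp T x"
  using fsecD[OF l2_fsec[OF BO_D(1)[OF _ delta_l2(1)]], of T x x]
  by (simp add: cexp_def oscale_def unit_coord_scale unit_arrow)

lemma cexp_bound: assumes T: "T \<in> BO" shows "cmod (cexp T x) \<le> opn T"
proof (cases "x \<in> units G")
  case True
  note d = delta_l2[OF True]
  have "cmod (cexp T x) \<le> nrm (delta x) * nrm (T (delta x))"
    unfolding cexp_inn[OF T True] by (rule ip_abs_summable(4)[OF d(1) BO_D(1)[OF T d(1)]])
  also have "\<dots> \<le> 1 * nrm (T (delta x))" by (intro mult_right_mono d nrm_nonneg)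
  also have "\<dots> \<le> opn T * nrm (delta x)" using opn_bound[OF T d(1)] by simp
  also have "\<dots> \<le> opn T * 1" by (intro mult_left_mono d opn_nonneg T)
  finally show ?thesis by simp
qed (simp add: cexp_def opn_nonneg[OF T])

lemma cexp_R: "f \<in> Gam \<Longrightarrow> cexp (R f) = restrict_units G L f"
proof
  fix x assume f: "f \<in> Gam"
  show "cexp (R f) x = restrict_units G L f x"
  proof (cases "x \<in> units G")
    case True
    note fx = fsecD[OF Gamma_fsec[OF f] unit_arrow[OF True]]
    have "conv G L f (delta x) x = lmul L x (src G x) (f x) (delta x (src G x))"
      by (rule conv_unit_supported[OF f l2_fsec[OF delta_l2(1)[OF True]] _ unit_arrow[OF True]])
        (use True in \<open>auto simp: delta_def\<close>)
    also have "\<dots> = f x"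
      using True fib_one(3)[OF True fx] by (simp add: delta_def src_unit)
    finally show ?thesis
      using True by (simp add: cexp_def restrict_units_def R_apply delta_l2)
  qed (simp add: cexp_def restrict_units_def)
qed

lemma cexp_left:
  assumes e: "e \<in> C_c (unit_top G)" and T: "T \<in> BO"
  shows "cexp (R (iota e) \<circ> T) x = e x * cexp T x"
proof (cases "x \<in> units G")
  case True
  note Td = BO_D(1)[OF T delta_l2(1)[OF True]] and xA = unit_arrow[OF True]
  show ?thesis
    using conv_iota_left[OF e l2_fsec[OF Td] xA] fsecD[OF l2_fsec[OF Td] xA] True
    by (simp add: cexp_def R_apply Td rng_unit unit_coord_scale)
qed (simp add: cexp_def)

text \<open>The point mass at \<open>x\<close> is an eigenvector of \<open>R (iota e)\<close> with
  eigenvalue \<open>e x\<close>.\<close>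

lemma cexp_right:
  assumes e: "e \<in> C_c (unit_top G)" and T: "T \<in> BO"
  shows "cexp (T \<circ> R (iota e)) x = e x * cexp T x"
proof (cases "x \<in> units G")
  case True
  note d = delta_l2(1)[OF True]
  have "R (iota e) (delta x) = (\<lambda>g. lscale L (e x) (delta x g))"
  proof
    fix g
    show "R (iota e) (delta x) g = lscale L (e x) (delta x g)"
    proof (cases "g \<in> arrows G")
      case g: True
      then show ?thesis
        unfolding R_apply[OF d] conv_iota_left[OF e l2_fsec[OF d] g] using True by (simp add: delta_def rng_unit)
    next
      case False
      then show ?thesis
        unfolding R_apply[OF d] conv_outside[OF False] using unit_arrow[OF True] by (auto simp: delta_def)
    qed
  qed
  then show ?thesis
    using True fsecD[OF l2_fsec[OF BO_D(1)[OF T d]] unit_arrow[OF True]]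
    by (simp add: cexp_def BO_D(4)[OF T d] unit_coord_scale)
qed (simp add: cexp_def)

lemma restrict_iota:
  assumes e: "e \<in> C_c (unit_top G)"
  shows "restrict_units G L (iota e) = e"
proof
  fix x
  show "restrict_units G L (iota e) x = e x"
    using C_c_outside[OF e, of x] fib_one(1)
    by (cases "x \<in> units G") (simp_all add: restrict_units_def iota_def unit_coord_scale unit_coord_one topspace_unit_top)
qed

lemma cexp_star:
  assumes T: "T \<in> carr A"
  shows "cexp (cstar A T) x = cnj (cexp T x)"
proof (cases "x \<in> units G")
  case True
  note d = delta_l2(1)[OF True]
  obtain S where S: "S \<in> carr A" "adj T S" "cstar A T = S" by (rule carr_adjoint[OF T]) blast
  note B = carr_BO[OF T] carr_BO[OF S(1)]
  have "inn (delta x) (S (delta x)) = inn (T (delta x)) (delta x)" using S(2) d unfolding adj_def by simp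
  also have "\<dots> = cnj (inn (delta x) (T (delta x)))" by (rule inn_cnj[OF d BO_D(1)[OF B(1) d]])
  finally show ?thesis unfolding S(3) cexp_inn[OF B(1) True] cexp_inn[OF B(2) True] .
qed (simp add: cexp_def)

text \<open>The coefficient of \<open>T* T\<close> at \<open>x\<close> is the squared norm of
  \<open>T (delta x)\<close>.\<close>

lemma cexp_positive:
  assumes T: "T \<in> carr A"
  shows "cexp (cstar A T \<circ> T) x \<in> \<real>\<^sub>\<ge>\<^sub>0"
proof (cases "x \<in> units G")
  case True
  note d = delta_l2(1)[OF True]
  obtain S where S: "S \<in> carr A" "adj T S" "cstar A T = S" by (rule carr_adjoint[OF T]) blast
  note B = carr_BO[OF T] carr_BO[OF S(1)]
  note Td = BO_D(1)[OF B(1) d]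
  have "inn (T (delta x)) (T (delta x)) = inn (delta x) (S (T (delta x)))" using S(2) d Td unfolding adj_def by blast
  then have "cexp (S \<circ> T) x = complex_of_real ((nrm (T (delta x)))\<^sup>2)"
    unfolding cexp_inn[OF BO_comp(1)[OF B(2,1)] True] inn_self[OF Td] by simp
  then show ?thesis unfolding S(3) by (simp add: complex_nonneg_Reals_iff)
qed (simp add: cexp_def)

end


section \<open>Invariant measures and traces of a principal twist\<close>

context hausdorff_twist
begin

abbreviation "X \<equiv> unit_top G"
abbreviation "rs \<equiv> restrict_units G L"

lemma R_zero: "R 0 = 0"
  using R_scale[OF VF.subspace_0[OF Gamma_subspace], of 0] by (simp add: zero_fun_def oscale_def)

lemma iota_add: "iota (\<lambda>x. e x + f x) = iota e + iota f"
  by (auto simp: fun_eq_iff iota_def VL.scale_left_distrib)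

lemma iota_scale: "iota (\<lambda>x. z * e x) = (\<lambda>g. lscale L z (iota e g))"
  by (auto simp: fun_eq_iff iota_def)

lemma conv_iota_iota:
  assumes e: "e \<in> C_c X" and f: "f \<in> C_c X"
  shows "conv G L (iota e) (iota f) = iota (\<lambda>x. e x * f x)"
proof
  fix g
  show "conv G L (iota e) (iota f) g = iota (\<lambda>x. e x * f x) g"
  proof (cases "g \<in> arrows G")
    case True
    then show ?thesis
      using conv_iota_left[OF e Gamma_fsec[OF iota_Gamma[OF f]] True] by (simp add: iota_def rng_unit)
  next
    case False
    then show ?thesis using unit_arrow by (auto simp: conv_outside iota_def)
  qed
qed

lemma fstar_iota: "fstar (iota e) = iota (\<lambda>x. cnj (e x))"
proof
  fix g
  show "fstar (iota e) g = iota (\<lambda>x. cnj (e x)) g"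
  proof (cases "g \<in> units G")
    case True
    then show ?thesis
      by (simp add: fstar_def iota_def unit_arrow inv_unit lstar_scale fib_one lstar_fib_one)
  next
    case False
    then have "ginv G g \<notin> units G" if "g \<in> arrows G" using inv_unit inv_inv[OF that] by metis
    then show ?thesis using False by (simp add: fstar_def iota_def lstar_0 inv_closed)
  qed
qed

lemma iota_norm:
  assumes e: "e \<in> C_c X" and B: "\<And>x. cmod (e x) \<le> B"
  shows "opn (R (iota e)) \<le> B"
proof -
  have B0: "0 \<le> B" using B norm_ge_zero order_trans by blast
  have le: "lnorm L g (iota e g) \<le> B" if "g \<in> arrows G" for g
    using B B0 by (cases "g \<in> units G") (simp_all add: iota_def norm_scale unit_arrow fib_one norm_fib_one norm_0 that)
  show ?thesis
    by (rule opn_le[OF B0])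
      (simp add: R_apply conv_elementary_bound(2)[OF bisection_units iota_sections_c[OF e] B0 le])
qed

text \<open>On the right, \<open>iota e\<close> multiplies by the value of \<open>e\<close> at the
  source, so a bump equal to 1 on the sources of the support suffices.\<close>

lemma right_unit_exists:
  assumes f: "f \<in> Gam"
  shows "\<exists>e\<in>C_c X. conv G L f (iota e) = f"
proof -
  obtain K where K: "compactin (gtop G) K" "\<And>g. g \<notin> K \<Longrightarrow> f g = 0" using Gamma_compact[OF f] by blast
  have sK: "compactin X (src G ` K)" by (rule image_compactin[OF K(1) continuous_src])
  obtain u M where u: "(\<lambda>x. complex_of_real (u x)) \<in> C_c X" "\<And>x. 0 \<le> u x" "\<And>x. u x \<le> 1"
    "\<And>x. x \<in> src G ` K \<Longrightarrow> u x = 1" "compactin X M" "M \<subseteq> topspace X" "\<And>x. x \<notin> M \<Longrightarrow> u x = 0"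
    by (rule C_c_bump[OF units_locally_compact units_Hausdorff sK openin_topspace compactin_subset_topspace[OF sK]]) blast
  have "conv G L f (iota (\<lambda>x. complex_of_real (u x))) g = f g" for g
  proof (cases "g \<in> arrows G")
    case True
    then show ?thesis
      unfolding conv_iota_right[OF u(1) f True] using u(4)[of "src G g"] K(2)[of g] by (cases "g \<in> K") auto
  next
    case False
    then show ?thesis using conv_outside Gamma_outside[OF f] by simp
  qed
  then show ?thesis using u(1) by blast
qed

text \<open>A unit that is the range of \<open>a\<close> in \<open>U\<close> factors through
  \<open>U\<close> only as \<open>a\<close> times its inverse, and the remaining units do not factor
  through \<open>U\<close>.\<close>

lemma rs_conv:
  assumes U: "open_bisection G U" and f: "f \<in> sections_c G L U" and h: "fsec h"
  shows "a \<in> U \<Longrightarrow> rs (conv G L f h) (rng G a) = unit_coord L (rng G a) (lmul L a (ginv G a) (f a) (h (ginv G a)))"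
    and "x \<notin> rng G ` U \<Longrightarrow> rs (conv G L f h) x = 0"
proof -
  assume a: "a \<in> U"
  note aA = bisection_arrow[OF U a]
  note r = rng_in_units[OF aA]
  have "gmul G a (ginv G a) = rng G a" by (rule mul_inv[OF aA])
  then have d: "rng G a \<in> ldom U" "lpart U (rng G a) = a" "rpart U (rng G a) = ginv G a"
    using rpart_mul[OF U a inv_closed[OF aA]] by (simp_all add: rng_inv aA)
  show "rs (conv G L f h) (rng G a) = unit_coord L (rng G a) (lmul L a (ginv G a) (f a) (h (ginv G a)))"
    using conv_elementary[OF U f h rng_closed[OF aA]] d r by (simp add: restrict_units_def)
next
  assume x: "x \<notin> rng G ` U"
  show "rs (conv G L f h) x = 0"
  proof (cases "x \<in> units G")
    case True
    then have "x \<notin> ldom U" using x by (simp add: ldom_def rng_unit)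
    then show ?thesis
      using conv_elementary[OF U f h unit_arrow[OF True]] True by (simp add: restrict_units_def unit_coord_0)
  qed (simp add: restrict_units_def)
qed

section \<open>Traciality on sections is equivalent to invariance\<close>

definition pull :: "'g set \<Rightarrow> ('g \<Rightarrow> complex) \<Rightarrow> 'g \<Rightarrow> complex"
  where "pull U F = (\<lambda>x. if x \<in> src G ` U then F (bisection_map G U x) else 0)"

lemma pull_src: "open_bisection G U \<Longrightarrow> a \<in> U \<Longrightarrow> pull U F (src G a) = F (rng G a)"
  unfolding pull_def bisection_map_def by (simp add: the_inv_into_f_f bisection_src_inj)

lemma pull_outside: "x \<notin> src G ` U \<Longrightarrow> pull U F x = 0"
  unfolding pull_def by simp

text \<open>
  Exchanging the factors of a product of sections over \<open>U\<close> and \<open>V\<close> transports its restriction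
  to the units along the bisection \<open>U \<inter> V\<^sup>-\<^sup>1\<close>.
\<close>

lemma rs_conv_swap:
  assumes U: "open_bisection G U" and f: "f \<in> sections_c G L U"
    and V: "open_bisection G V" and h: "h \<in> sections_c G L V"
  defines "W \<equiv> U \<inter> ginv G ` V"
  shows "open_bisection G W" "rs (conv G L f h) \<in> C_c (subtopology X (rng G ` W))"
    "rs (conv G L h f) = pull W (rs (conv G L f h))"
proof -
  note fG = sections_c_Gamma[OF U f] and hG = sections_c_Gamma[OF V h]
  note fs = Gamma_fsec[OF fG] and hs = Gamma_fsec[OF hG]
  obtain K where K: "csec f" "compactin (gtop G) K" "K \<subseteq> U" "\<And>g. g \<notin> K \<Longrightarrow> f g = 0"
    by (rule sections_cE[OF U f]) blast
  obtain K' where K': "csec h" "compactin (gtop G) K'" "K' \<subseteq> V" "\<And>g. g \<notin> K' \<Longrightarrow> h g = 0"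
    by (rule sections_cE[OF V h]) blast
  show W: "open_bisection G W"
    by (rule bisection_subset[OF U]) (use bisection_openin[OF U] bisection_openin[OF bisection_inv[OF V]] in \<open>auto simp: W_def\<close>)
  have inW: "a \<in> W" if "a \<in> U" "ginv G a \<in> V" for a
  proof -
    have "a = ginv G (ginv G a)" using inv_inv[OF bisection_arrow[OF U that(1)]] by simp
    then show ?thesis unfolding W_def using that by blast
  qed
  have Winv: "a \<in> U" "ginv G a \<in> V" "a \<in> arrows G" if a: "a \<in> W" for a
  proof -
    show "a \<in> U" "a \<in> arrows G" using a bisection_arrow[OF U] unfolding W_def by auto
    obtain b where "b \<in> V" "a = ginv G b" using a unfolding W_def by blast
    then show "ginv G a \<in> V" using inv_inv[OF bisection_arrow[OF V]] by simp
  qed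
  have zero: "lmul L a (ginv G a) (f a) (h (ginv G a)) = 0" if "a \<in> arrows G" "f a = 0 \<or> h (ginv G a) = 0" for a
    using that fsecD[OF fs] fsecD[OF hs] by (auto simp: lmul_0_left lmul_0_right inv_closed rng_inv)
  let ?C = "rng G ` (K \<inter> ginv G ` K')"
  have KK: "compactin (gtop G) (K \<inter> ginv G ` K')"
    by (rule closed_Int_compactin[OF compactin_imp_closedin[OF Hausdorff K(2)] image_compactin[OF K'(2) continuous_inv]])
  then have C: "compactin X ?C" by (rule image_compactin[OF _ continuous_rng])
  have CW: "?C \<subseteq> rng G ` W" using K(3) K'(3) unfolding W_def by blast
  have off: "rs (conv G L f h) x = 0" if x: "x \<notin> ?C" for x
  proof (cases "x \<in> rng G ` U")
    case True
    then obtain a where a: "a \<in> U" "x = rng G a" by blast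
    note aA = bisection_arrow[OF U a(1)]
    have "a \<notin> K \<or> ginv G a \<notin> K'"
    proof (rule ccontr)
      assume "\<not> ?thesis"
      then have "a \<in> K" "ginv G (ginv G a) \<in> ginv G ` K'" by auto
      then show False using x a(2) inv_inv[OF aA] by auto
    qed
    then have "f a = 0 \<or> h (ginv G a) = 0" using K(4) K'(4) by blast
    then show ?thesis
      unfolding a(2) rs_conv(1)[OF U f hs a(1)] using zero[OF aA] unit_coord_0[OF rng_in_units[OF aA]] by simp
  next
    case False
    then show ?thesis by (rule rs_conv(2)[OF U f hs])
  qed
  show "rs (conv G L f h) \<in> C_c (subtopology X (rng G ` W))"
  proof (rule C_cI[OF _ _ off])
    show "continuous_map (subtopology X (rng G ` W)) euclidean (rs (conv G L f h))"
      by (intro continuous_map_from_subtopology C_cD_continuous restrict_units_C_c conv_Gamma fG hG)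
    show "compactin (subtopology X (rng G ` W)) ?C" using C CW by (simp add: compactin_subtopology)
  qed
  show "rs (conv G L h f) = pull W (rs (conv G L f h))"
  proof
    fix y
    show "rs (conv G L h f) y = pull W (rs (conv G L f h)) y"
    proof (cases "y \<in> src G ` W")
      case True
      then obtain a where a: "a \<in> W" "y = src G a" by blast
      note a' = Winv[OF a(1)]
      have r: "rng G (ginv G a) = src G a" "ginv G (ginv G a) = a" by (simp_all add: rng_inv inv_inv a')
      have "rs (conv G L h f) y = unit_coord L (src G a) (lmul L (ginv G a) a (h (ginv G a)) (f a))"
        using rs_conv(1)[OF V h fs a'(2)] unfolding r a(2) .
      also have "\<dots> = unit_coord L (rng G a) (lmul L a (ginv G a) (f a) (h (ginv G a)))"
        by (rule unit_coord_commute[symmetric]) (use a' fsecD[OF fs] fsecD[OF hs] inv_closed in auto)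
      also have "\<dots> = rs (conv G L f h) (rng G a)" by (rule rs_conv(1)[OF U f hs a'(1), symmetric])
      also have "\<dots> = pull W (rs (conv G L f h)) y" unfolding a(2) by (rule pull_src[OF W a(1), symmetric])
      finally show ?thesis .
    next
      case False
      have "rs (conv G L h f) y = 0"
      proof (cases "y \<in> rng G ` V")
        case True
        then obtain b where b: "b \<in> V" "y = rng G b" by blast
        note bA = bisection_arrow[OF V b(1)]
        have "ginv G b \<notin> U"
        proof
          assume "ginv G b \<in> U"
          then have "ginv G b \<in> W" using inW[of "ginv G b"] b(1) inv_inv[OF bA] by simp
          then have "src G (ginv G b) \<in> src G ` W" by blast
          then show False using False b(2) by (simp add: src_inv bA)
        qed
        then have "f (ginv G b) = 0" using K(3,4) by blast
        then show ?thesis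
          unfolding b(2) rs_conv(1)[OF V h fs b(1)] using fsecD[OF hs bA] bA
          by (simp add: lmul_0_right inv_closed rng_inv unit_coord_0 rng_in_units)
      next
        case False
        then show ?thesis by (rule rs_conv(2)[OF V h fs])
      qed
      then show ?thesis using pull_outside[OF False] by simp
    qed
  qed
qed

lemma rs_conv_add:
  assumes "f \<in> Gam" "f' \<in> Gam" "h \<in> Gam"
  shows "rs (conv G L (f + f') h) = (\<lambda>x. rs (conv G L f h) x + rs (conv G L f' h) x)"
    "rs (conv G L h (f + f')) = (\<lambda>x. rs (conv G L h f) x + rs (conv G L h f') x)"
  unfolding conv_add_left[OF assms(1,2) Gamma_fsec[OF assms(3)]]
    conv_add_right[OF Gamma_fsec[OF assms(3)] Gamma_fsec[OF assms(1)] Gamma_fsec[OF assms(2)]]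
  by (intro restrict_units_add conv_Gamma assms)+

text \<open>Both sides are additive in each factor, so two elementary sections suffice; for those
  the exchange is transport along one bisection, which is what invariance is about.\<close>

lemma invariant_imp_tracial:
  assumes \<mu>: "\<mu> \<in> invariant_Rad G" and f: "f \<in> Gam" and h: "h \<in> Gam"
  shows "\<mu> (rs (conv G L f h)) = \<mu> (rs (conv G L h f))"
proof -
  have R: "\<mu> \<in> Rad X" using \<mu> unfolding invariant_Rad_def by blast
  note C = restrict_units_C_c[OF conv_Gamma]
  show ?thesis
    using f
  proof (induction rule: Gamma_induct)
    case f: (elementary U f)
    note fG = sections_c_Gamma[OF f]
    show ?case
      using h
    proof (induction rule: Gamma_induct)
      case h: (elementary V h)
      note s = rs_conv_swap[OF f h]
      show ?case
        using \<mu> s(1,2) unfolding s(3) invariant_Rad_def pull_def by blast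
    next
      case (add h k)
      show ?case
        unfolding rs_conv_add[OF add(1,2) fG] Rad_add[OF R C[OF fG add(1)] C[OF fG add(2)]]
          Rad_add[OF R C[OF add(1) fG] C[OF add(2) fG]] add(3,4) ..
    qed
  next
    case (add f k)
    show ?case
      unfolding rs_conv_add[OF add(1,2) h] Rad_add[OF R C[OF h add(1)] C[OF h add(2)]]
        Rad_add[OF R C[OF add(1) h] C[OF add(2) h]] add(3,4) ..
  qed
qed

text \<open>The compact support is the lift of \<open>M\<close> to \<open>W\<close> under the
  inverse of the range map.\<close>

lemma section_of_function:
  assumes W: "open_bisection G W" and u: "\<And>g. g \<in> W \<Longrightarrow> u g \<in> fib L g"
      "continuous_map (subtopology (gtop G) W) (ltop L) (\<lambda>g. (g, u g))"
    and h: "h \<in> C_c X" "compactin X M" "M \<subseteq> rng G ` W" "\<And>x. x \<notin> M \<Longrightarrow> h x = 0"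
  shows "(\<lambda>g. if g \<in> W then lscale L (h (rng G g)) (u g) else 0) \<in> sections_c G L W"
  unfolding sections_c_def
proof (intro CollectI conjI exI)
  let ?i = "the_inv_into W (rng G)"
  show "\<forall>g\<in>W. (if g \<in> W then lscale L (h (rng G g)) (u g) else 0) \<in> fib L g"
    using u(1) bisection_arrow[OF W] by (auto intro: fib_scale)
  have "continuous_map (gtop G) euclidean (\<lambda>g. h (rng G g))"
    using continuous_map_compose[OF continuous_rng C_cD_continuous[OF h(1)]] by (simp add: o_def)
  then have "continuous_map (subtopology (gtop G) W) (ltop L) (\<lambda>g. (g, lscale L (h (rng G g)) (u g)))"
    by (intro Lcont_scale u continuous_map_from_subtopology)
  then show "continuous_map (subtopology (gtop G) W) (ltop L) (\<lambda>g. (g, if g \<in> W then lscale L (h (rng G g)) (u g) else 0))"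
    by (rule continuous_map_eq) auto
  have inv: "?i (rng G g) = g" if "g \<in> W" for g
    using that by (simp add: the_inv_into_f_f bisection_rng_inj[OF W])
  have "continuous_map (subtopology X (rng G ` W)) (gtop G) ?i"
    by (rule continuous_map_the_inv_into[OF bisection_openin[OF W] bisection_rng_inj[OF W] open_rng])
  then show "compactin (gtop G) (?i ` M)"
    by (rule image_compactin[rotated]) (use h(2,3) in \<open>simp add: compactin_subtopology\<close>)
  show "?i ` M \<subseteq> W" using h(3) inv by force
  show "\<forall>g. g \<notin> ?i ` M \<longrightarrow> (if g \<in> W then lscale L (h (rng G g)) (u g) else 0) = 0"
  proof (intro allI impI)
    fix g assume g: "g \<notin> ?i ` M"
    have "rng G g \<notin> M" if "g \<in> W" using g inv[OF that] by (metis imageI)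
    then show "(if g \<in> W then lscale L (h (rng G g)) (u g) else 0) = 0" using h(4) by simp
  qed
qed

text \<open>Let \<open>u\<close> be a unit section over a small bisection \<open>W\<close>, let
  \<open>h\<close> be supported in its range and let \<open>v\<close> be 1 on the support of
  \<open>h\<close>. With \<open>p = h u\<close> and \<open>q = v u\<close>, the product of
  \<open>p\<close> and the adjoint of \<open>q\<close> restricts to \<open>h\<close> on the units,
  since \<open>u u* = 1\<close> and \<open>h v = h\<close>. The product in the other order restricts
  to the transported function. A partition of unity reduces the general case to such
  \<open>h\<close>.\<close>

lemma tracial_imp_invariant:
  assumes R: "\<mu> \<in> Rad X" and tr: "\<And>f h. f \<in> Gam \<Longrightarrow> h \<in> Gam \<Longrightarrow> \<mu> (rs (conv G L f h)) = \<mu> (rs (conv G L h f))"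
  shows "\<mu> \<in> invariant_Rad G"
proof -
  have "\<mu> f = \<mu> (pull U f)" if U: "open_bisection G U" and f: "f \<in> C_c (subtopology X (rng G ` U))" for U f
  proof -
    have oU: "openin X (rng G ` U)" by (rule open_rng[OF bisection_openin[OF U]])
    obtain K where K: "compactin (subtopology X (rng G ` U)) K" "\<And>x. x \<notin> K \<Longrightarrow> f x = 0" by (rule C_cE[OF f]) blast
    then have K': "compactin X K" "K \<subseteq> rng G ` U" by (auto simp: compactin_subtopology)
    have "continuous_map X euclidean f"
      by (rule continuous_map_zero_off[OF oU compactin_imp_closedin[OF units_Hausdorff K'(1)] K'(2) C_cD_continuous[OF f] K(2)])
    then have fX: "f \<in> C_c X" using C_cI K'(1) K(2) by blast
    \<comment> \<open>Membership of the transported function is carried along because additivity of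
      \<open>\<mu>\<close> requires it for each summand.\<close>
    have "pull U f \<in> C_c X \<and> \<mu> f = \<mu> (pull U f)"
    proof (rule C_c_local_induct[OF units_locally_compact units_Hausdorff fX K'(1) K(2)])
      have "pull U (\<lambda>_. 0) = (\<lambda>_. 0)" by (simp add: pull_def fun_eq_iff)
      then show "pull U (\<lambda>_. 0) \<in> C_c X \<and> \<mu> (\<lambda>_. 0) = \<mu> (pull U (\<lambda>_. 0))" using C_c_zero by simp
    next
      fix g h assume gh: "g \<in> C_c X" "h \<in> C_c X" "pull U g \<in> C_c X \<and> \<mu> g = \<mu> (pull U g)" "pull U h \<in> C_c X \<and> \<mu> h = \<mu> (pull U h)"
      have "pull U (\<lambda>x. g x + h x) = (\<lambda>x. pull U g x + pull U h x)" by (simp add: pull_def fun_eq_iff)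
      then show "pull U (\<lambda>x. g x + h x) \<in> C_c X \<and> \<mu> (\<lambda>x. g x + h x) = \<mu> (pull U (\<lambda>x. g x + h x))"
        using gh C_c_add[of "pull U g" X "pull U h"] Rad_add[OF R gh(1,2)] Rad_add[OF R, of "pull U g" "pull U h"] by simp
    next
      fix x assume "x \<in> K"
      then obtain a where a: "a \<in> U" "x = rng G a" using K'(2) by blast
      obtain W0 u where u: "openin (gtop G) W0" "a \<in> W0" "\<And>g. g \<in> W0 \<Longrightarrow> u g \<in> fib L g" "\<And>g. g \<in> W0 \<Longrightarrow> lnorm L g (u g) = 1"
        "continuous_map (subtopology (gtop G) W0) (ltop L) (\<lambda>g. (g, u g))"
        by (rule local_unit_section[OF bisection_arrow[OF U a(1)]]) blast
      define W where "W = U \<inter> W0"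
      have W: "open_bisection G W"
        by (rule bisection_subset[OF U]) (use bisection_openin[OF U] u(1) in \<open>auto simp: W_def\<close>)
      have uW: "\<And>g. g \<in> W \<Longrightarrow> u g \<in> fib L g" "continuous_map (subtopology (gtop G) W) (ltop L) (\<lambda>g. (g, u g))"
        using u(3) continuous_map_from_subtopology_mono[OF u(5), of W] by (auto simp: W_def)
      have oW: "openin X (rng G ` W)" by (rule open_rng[OF bisection_openin[OF W]])
      have "pull U h \<in> C_c X \<and> \<mu> h = \<mu> (pull U h)"
        if h: "h \<in> C_c X" "compactin X M" "M \<subseteq> rng G ` W" "\<And>y. y \<notin> M \<Longrightarrow> h y = 0" for h M
      proof -
        obtain v M' where v: "(\<lambda>x. complex_of_real (v x)) \<in> C_c X" "\<And>x. 0 \<le> v x" "\<And>x. v x \<le> 1"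
          "\<And>x. x \<in> M \<Longrightarrow> v x = 1" "compactin X M'" "M' \<subseteq> rng G ` W" "\<And>x. x \<notin> M' \<Longrightarrow> v x = 0"
          by (rule C_c_bump[OF units_locally_compact units_Hausdorff h(2) oW h(3)]) blast
        define p where "p = (\<lambda>g. if g \<in> W then lscale L (h (rng G g)) (u g) else 0)"
        define q where "q = (\<lambda>g. if g \<in> W then lscale L (complex_of_real (v (rng G g))) (u g) else 0)"
        have p: "p \<in> sections_c G L W" unfolding p_def by (rule section_of_function[OF W uW h])
        have q: "q \<in> sections_c G L W" unfolding q_def
          by (rule section_of_function[OF W uW v(1,5,6)]) (use v(7) in auto)
        note V = bisection_inv[OF W] and q' = fstar_sections_c[OF W q]
        have WW: "W \<inter> ginv G ` ginv G ` W = W"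
        proof -
          have "b = ginv G (ginv G b)" if "b \<in> W" for b using inv_inv[OF bisection_arrow[OF W that]] by simp
          then show ?thesis by blast
        qed
        note s = rs_conv_swap[OF W p V q', unfolded WW]
        note pG = sections_c_Gamma[OF W p] and qG = sections_c_Gamma[OF V q']
        have eq: "rs (conv G L p (fstar q)) = h"
        proof
          fix y
          show "rs (conv G L p (fstar q)) y = h y"
          proof (cases "y \<in> rng G ` W")
            case True
            then obtain b where b: "b \<in> W" "y = rng G b" by blast
            note bA = bisection_arrow[OF W b(1)] and ub = uW(1)[OF b(1)]
            note sb = lstar_closed[OF bA ub]
            have bW0: "b \<in> W0" using b(1) unfolding W_def by blast
            have one: "unit_coord L (rng G b) (lmul L b (ginv G b) (u b) (lstar L b (u b))) = 1"
              using unit_coord_commute[OF bA ub sb] ip_self[OF bA ub] u(4)[OF bW0] unfolding ip_def by simp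
            have "fstar q (ginv G b) = lscale L (complex_of_real (v y)) (lstar L b (u b))"
              using b bA ub by (simp add: fstar_def q_def inv_closed inv_inv lstar_scale)
            then have "rs (conv G L p (fstar q)) y
                = unit_coord L (rng G b) (lmul L b (ginv G b) (lscale L (h y) (u b)) (lscale L (complex_of_real (v y)) (lstar L b (u b))))"
              using rs_conv(1)[OF W p Gamma_fsec[OF qG] b(1)] b by (simp add: p_def)
            also have "lmul L b (ginv G b) (lscale L (h y) (u b)) (lscale L (complex_of_real (v y)) (lstar L b (u b)))
                = lscale L (h y * complex_of_real (v y)) (lmul L b (ginv G b) (u b) (lstar L b (u b)))"
              using bA ub sb by (simp add: lmul_scale_left lmul_scale_right fib_scale inv_closed rng_inv)
            also have "unit_coord L (rng G b) \<dots> = h y * complex_of_real (v y)"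
              using unit_coord_scale[OF rng_in_units[OF bA] lmul_inv_fib[OF bA ub sb]] one by simp
            also have "\<dots> = h y" using v(4)[of y] h(4)[of y] by (cases "y \<in> M") auto
            finally show ?thesis .
          next
            case False
            then have "h y = 0" using h(3,4) by blast
            then show ?thesis using rs_conv(2)[OF W p Gamma_fsec[OF qG] False] by simp
          qed
        qed
        \<comment> \<open>The two bisections transport \<open>h\<close> alike: arrows of
          \<open>U\<close> outside \<open>W\<close> have their range outside the support of
          \<open>h\<close>.\<close>
        have "pull W h = pull U h"
        proof
          fix y
          show "pull W h y = pull U h y"
          proof (cases "y \<in> src G ` U")
            case True
            then obtain b where b: "b \<in> U" "y = src G b" by blast
            show ?thesis
            proof (cases "b \<in> W")
              case True
              then show ?thesis unfolding b(2) pull_src[OF U b(1)] by (rule pull_src[OF W])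
            next
              case False
              have "rng G b \<notin> rng G ` W"
              proof
                assume "rng G b \<in> rng G ` W"
                then obtain c where c: "c \<in> W" "rng G b = rng G c" by blast
                then have "b = c" using inj_onD[OF bisection_rng_inj[OF U] c(2) b(1)] by (simp add: W_def)
                then show False using False c(1) by simp
              qed
              then have "h (rng G b) = 0" using h(3,4) by blast
              moreover have "src G b \<notin> src G ` W"
              proof
                assume "src G b \<in> src G ` W"
                then obtain c where c: "c \<in> W" "src G b = src G c" by blast
                then have "b = c" using inj_onD[OF bisection_src_inj[OF U] c(2) b(1)] by (simp add: W_def)
                then show False using False c(1) by simp
              qed
              ultimately show ?thesis unfolding b(2) pull_src[OF U b(1)] by (simp add: pull_outside)
            qed
          next
            case False
            then have "y \<notin> src G ` W" unfolding W_def by blast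
            then show ?thesis using False by (simp add: pull_outside)
          qed
        qed
        then have "rs (conv G L (fstar q) p) = pull U h" using s(3) eq by simp
        then show ?thesis
          using tr[OF pG qG] restrict_units_C_c[OF conv_Gamma[OF qG pG]] eq by simp
      qed
      then show "\<exists>W. openin X W \<and> x \<in> W \<and> (\<forall>h\<in>C_c X. \<forall>L. compactin X L \<and> L \<subseteq> W \<and> (\<forall>y. y \<notin> L \<longrightarrow> h y = 0) \<longrightarrow>
          pull U h \<in> C_c X \<and> \<mu> h = \<mu> (pull U h))"
        using oW a u(2) by (intro exI[of _ "rng G ` W"]) (auto simp: W_def)
    qed
    then show ?thesis by blast
  qed
  then show ?thesis unfolding invariant_Rad_def pull_def using R by blast
qed

end

section \<open>Principal groupoids: traces live on the units\<close>

locale principal_twist = hausdorff_twist G L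
  for G :: "'g groupoid" and L :: "('g, 'v::ab_group_add) fell_bundle" +
  assumes principal: "principal_groupoid G"
begin

text \<open>The unit \<open>rng G g\<close> has the same range and the same source as
  \<open>g\<close>, so principality identifies the two.\<close>

lemma rng_eq_src_unit:
  assumes g: "g \<in> arrows G" and "rng G g = src G g"
  shows "g \<in> units G"
proof -
  have "(rng G g, src G g) = (rng G (rng G g), src G (rng G g))"
    using assms by (simp add: rng_rng src_rng rng_src src_src)
  then have "g = rng G g"
    using inj_onD[OF principal[unfolded principal_groupoid_def] _ g rng_closed[OF g]] by simp
  then show ?thesis using rng_in_units[OF g] by simp
qed

text \<open>
  Locally the range and the source lie in disjoint open sets, and multiplying on the left by a
  function equal to 1 on the range is the same, for a trace, as multiplying by it on the right,
  which gives 0.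
\<close>

lemma trace_off_units:
  fixes \<tau> :: "('g, 'v) operator \<Rightarrow> complex"
  assumes add: "\<And>p q. p \<in> R ` Gam \<Longrightarrow> q \<in> R ` Gam \<Longrightarrow> \<tau> (p + q) = \<tau> p + \<tau> q"
    and com: "\<And>e p. e \<in> C_c X \<Longrightarrow> p \<in> R ` Gam \<Longrightarrow> \<tau> (R (iota e) \<circ> p) = \<tau> (p \<circ> R (iota e))"
    and U: "open_bisection G U" and f: "f \<in> sections_c G L U" and off: "\<And>x. x \<in> units G \<Longrightarrow> f x = 0"
  shows "\<tau> (R f) = 0"
proof -
  have G0: "0 \<in> Gam" by (rule VF.subspace_0[OF Gamma_subspace])
  have \<tau>0: "\<tau> 0 = 0" using add[of "R 0" "R 0"] G0 unfolding R_zero by (metis add_cancel_right_left imageI R_zero add_0_left)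
  obtain K0 where K0: "csec f" "compactin (gtop G) K0" "K0 \<subseteq> U" "\<And>g. g \<notin> K0 \<Longrightarrow> f g = 0"
    by (rule sections_cE[OF U f]) blast
  \<comment> \<open>The units are open, so removing them leaves a compact set; \<open>f\<close>
    still vanishes off it by \<open>off\<close>.\<close>
  define K where "K = (arrows G - units G) \<inter> K0"
  have "closedin (gtop G) (arrows G - units G)" using openin_units by blast
  then have K: "compactin (gtop G) K" unfolding K_def by (rule closed_Int_compactin[OF _ K0(2)])
  have KU: "K \<subseteq> U" "K \<inter> units G = {}" using K0(3) by (auto simp: K_def)
  have Koff: "f g = 0" if "g \<notin> K" for g
    using that off[of g] K0(4)[of g] compactin_subset_topspace[OF K0(2)] unfolding K_def by blast
  have rK: "compactin X (rng G ` K)" by (rule image_compactin[OF K continuous_rng])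
  \<comment> \<open>The sections \<open>s h\<close> depend additively on \<open>h\<close>, which
    moves the partition of unity from the arrows to functions on the unit space.\<close>
  define s where "s h = (\<lambda>g. lscale L (h (rng G g)) (f g))" for h :: "'g \<Rightarrow> complex"
  have sS: "s h \<in> sections_c G L U" if h: "h \<in> C_c X" for h
    unfolding s_def
    by (rule sections_c_mult[OF U f])
      (use continuous_map_compose[OF continuous_rng C_cD_continuous[OF h]] in \<open>simp add: o_def\<close>)
  note sG = sections_c_Gamma[OF U sS]
  obtain e M where e: "(\<lambda>x. complex_of_real (e x)) \<in> C_c X" "\<And>x. 0 \<le> e x" "\<And>x. e x \<le> 1"
    "\<And>x. x \<in> rng G ` K \<Longrightarrow> e x = 1" "compactin X M" "M \<subseteq> topspace X" "\<And>x. x \<notin> M \<Longrightarrow> e x = 0"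
    by (rule C_c_bump[OF units_locally_compact units_Hausdorff rK openin_topspace compactin_subset_topspace[OF rK]]) blast
  have "\<tau> (R (s (\<lambda>x. complex_of_real (e x)))) = 0"
  proof (rule C_c_local_induct[OF units_locally_compact units_Hausdorff e(1,5), where Q = "\<lambda>h. \<tau> (R (s h)) = 0"])
    show "complex_of_real (e x) = 0" if "x \<notin> M" for x using e(7)[OF that] by simp
    have "s (\<lambda>_. 0) = 0" by (simp add: s_def zero_fun_def)
    then show "\<tau> (R (s (\<lambda>_. 0))) = 0" using \<tau>0 by (simp add: R_zero)
    show "\<tau> (R (s (\<lambda>x. g x + h x))) = 0" if "g \<in> C_c X" "h \<in> C_c X" "\<tau> (R (s g)) = 0" "\<tau> (R (s h)) = 0" for g h
    proof -
      have "s (\<lambda>x. g x + h x) = s g + s h" by (simp add: s_def fun_eq_iff VL.scale_left_distrib)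
      then have "\<tau> (R (s (\<lambda>x. g x + h x))) = \<tau> (R (s g) + R (s h))" using R_add[OF sG[OF that(1)] sG[OF that(2)]] by simp
      also have "\<dots> = 0" using add[OF imageI[OF sG[OF that(1)]] imageI[OF sG[OF that(2)]]] that(3,4) by simp
      finally show ?thesis .
    qed
    fix x assume "x \<in> M"
    then have xX: "x \<in> topspace X" using e(6) by blast
    show "\<exists>W. openin X W \<and> x \<in> W \<and> (\<forall>h\<in>C_c X. \<forall>L. compactin X L \<and> L \<subseteq> W \<and> (\<forall>y. y \<notin> L \<longrightarrow> h y = 0) \<longrightarrow> \<tau> (R (s h)) = 0)"
    proof (cases "x \<in> rng G ` K")
      \<comment> \<open>Near such an \<open>x\<close> the section \<open>s h\<close> is zero:
        \<open>h\<close> is supported off the range of \<open>K\<close>, and \<open>f\<close> on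
        \<open>K\<close>.\<close>
      case False
      have "openin X (topspace X - rng G ` K)" using compactin_imp_closedin[OF units_Hausdorff rK] by blast
      moreover have "\<tau> (R (s h)) = 0" if "L' \<subseteq> topspace X - rng G ` K" "\<And>y. y \<notin> L' \<Longrightarrow> h y = 0" for h L'
      proof -
        have "s h g = 0" for g
          using that Koff[of g] by (cases "g \<in> K") (auto simp: s_def)
        then have "s h = 0" by (simp add: fun_eq_iff)
        then show ?thesis using \<tau>0 by (simp add: R_zero)
      qed
      ultimately show ?thesis using False xX by (intro exI[of _ "topspace X - rng G ` K"]) blast
    next
      case True
      then obtain k where k: "k \<in> K" "x = rng G k" by blast
      have kU: "k \<in> U" "k \<notin> units G" using k(1) KU by auto
      note kA = bisection_arrow[OF U kU(1)]
      have "rng G k \<noteq> src G k" using rng_eq_src_unit[OF kA] kU(2) by blast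
      then have "rng G k \<in> topspace X \<and> src G k \<in> topspace X \<and> rng G k \<noteq> src G k"
        using rng_in_units[OF kA] src_in_units[OF kA] by (simp add: topspace_unit_top)
      then have "\<exists>U V. openin X U \<and> openin X V \<and> rng G k \<in> U \<and> src G k \<in> V \<and> disjnt U V"
        by (rule units_Hausdorff[unfolded Hausdorff_space_def, rule_format])
      then obtain O1 O2 where O: "openin X O1" "openin X O2" "rng G k \<in> O1" "src G k \<in> O2" "disjnt O1 O2"
        by (elim exE conjE)
      \<comment> \<open>The arrows of the bisection near \<open>k\<close> whose ranges and sources
        stay in the two disjoint open sets.\<close>
      define B where "B = U \<inter> {g \<in> arrows G. rng G g \<in> O1} \<inter> {g \<in> arrows G. src G g \<in> O2}"
      have oB: "openin (gtop G) B"
        unfolding B_def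
        by (intro openin_Int bisection_openin[OF U] openin_continuous_map_preimage[OF continuous_rng O(1)]
            openin_continuous_map_preimage[OF continuous_src O(2)])
      have kB: "k \<in> B" unfolding B_def using kU kA O by blast
      have oW: "openin X (rng G ` B)" by (rule open_rng[OF oB])
      have "\<tau> (R (s h)) = 0"
        if h: "h \<in> C_c X" "compactin X L'" "L' \<subseteq> rng G ` B" "\<And>y. y \<notin> L' \<Longrightarrow> h y = 0" for h L'
      proof -
        obtain v M' where v: "(\<lambda>x. complex_of_real (v x)) \<in> C_c X" "\<And>x. 0 \<le> v x" "\<And>x. v x \<le> 1"
          "\<And>x. x \<in> L' \<Longrightarrow> v x = 1" "compactin X M'" "M' \<subseteq> rng G ` B" "\<And>x. x \<notin> M' \<Longrightarrow> v x = 0"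
          by (rule C_c_bump[OF units_locally_compact units_Hausdorff h(2) oW h(3)]) blast
        let ?v = "\<lambda>x. complex_of_real (v x)"
        note sh = sG[OF h(1)] and iv = iota_Gamma[OF v(1)]
        have "conv G L (iota ?v) (s h) g = s h g" for g
        proof (cases "g \<in> arrows G")
          case True
          show ?thesis
            unfolding conv_iota_left[OF v(1) Gamma_fsec[OF sh] True]
            using v(4)[of "rng G g"] h(4)[of "rng G g"] by (cases "rng G g \<in> L'") (auto simp: s_def)
        next
          case False
          then show ?thesis using conv_outside Gamma_outside[OF sh] by simp
        qed
        then have "conv G L (iota ?v) (s h) = s h" by (rule ext)
        then have l: "R (iota ?v) \<circ> R (s h) = R (s h)" using R_mult[OF iv sh] by simp
        have "conv G L (s h) (iota ?v) g = 0" for g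
        proof (cases "g \<in> arrows G")
          case True
          \<comment> \<open>An arrow with a nonzero value has its range in \<open>L'\<close> and so
            belongs to \<open>B\<close>. Its source then lies in \<open>O2\<close>, while
            \<open>v\<close> is supported in \<open>O1\<close>.\<close>
          have "lscale L (?v (src G g)) (s h g) = 0"
          proof (cases "s h g = 0")
            case False
            then have gU: "g \<in> U" and gL: "rng G g \<in> L'" using K0(3) K0(4)[of g] h(4)[of "rng G g"] by (auto simp: s_def)
            then obtain b where b: "b \<in> B" "rng G g = rng G b" using h(3) by blast
            have "b \<in> U" using b(1) by (simp add: B_def)
            then have "g = b" by (rule inj_onD[OF bisection_rng_inj[OF U] b(2) gU])
            then have "src G g \<in> O2" using b(1) by (simp add: B_def)
            moreover have "M' \<subseteq> O1" using v(6) by (auto simp: B_def)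
            ultimately have "src G g \<notin> M'" using O(5) by (auto simp: disjnt_def)
            then show ?thesis using v(7) by simp
          qed simp
          then show ?thesis unfolding conv_iota_right[OF v(1) sh True] .
        next
          case False
          then show ?thesis by (rule conv_outside)
        qed
        then have "conv G L (s h) (iota ?v) = 0" by (simp add: fun_eq_iff)
        then have r: "R (s h) \<circ> R (iota ?v) = 0" using R_mult[OF sh iv] by (simp add: R_zero)
        show ?thesis using com[OF v(1) imageI[OF sh]] unfolding l r \<tau>0 .
      qed
      then show ?thesis using oW kB k(2) by (intro exI[of _ "rng G ` B"]) blast
    qed
  qed
  moreover have "s (\<lambda>x. complex_of_real (e x)) = f"
  proof
    fix g
    show "s (\<lambda>x. complex_of_real (e x)) g = f g"
      using e(4) Koff[of g] by (cases "g \<in> K") (auto simp: s_def)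
  qed
  ultimately show ?thesis by simp
qed

text \<open>The unit space is clopen, so \<open>chi\<close> is continuous and splits an elementary
  section into its restriction to the units and a section vanishing there; the latter has trace
  0.\<close>

lemma trace_on_units:
  fixes \<tau> :: "('g, 'v) operator \<Rightarrow> complex"
  assumes add: "\<And>p q. p \<in> R ` Gam \<Longrightarrow> q \<in> R ` Gam \<Longrightarrow> \<tau> (p + q) = \<tau> p + \<tau> q"
    and com: "\<And>e p. e \<in> C_c X \<Longrightarrow> p \<in> R ` Gam \<Longrightarrow> \<tau> (R (iota e) \<circ> p) = \<tau> (p \<circ> R (iota e))"
    and f: "f \<in> Gam"
  shows "\<tau> (R f) = \<tau> (R (iota (rs f)))"
  using f
proof (induction rule: Gamma_induct)
  case (elementary U f)
  note fG = sections_c_Gamma[OF elementary] and U = elementary(1) and fS = elementary(2)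
  define chi where "chi g = (if g \<in> units G then 0 else (1 :: complex))" for g
  have "continuous_map (gtop G) euclidean chi"
  proof (rule continuous_map_open_glue[OF openin_units])
    show "openin (gtop G) (arrows G - units G)" using closedin_units by blast
    show "continuous_map (subtopology (gtop G) (units G)) euclidean chi"
      by (rule continuous_map_eq[of _ _ "\<lambda>_. 0"]) (auto simp: chi_def)
    show "continuous_map (subtopology (gtop G) (arrows G - units G)) euclidean chi"
      by (rule continuous_map_eq[of _ _ "\<lambda>_. 1"]) (auto simp: chi_def)
  qed blast
  then have S: "(\<lambda>g. lscale L (chi g) (f g)) \<in> sections_c G L U" by (rule sections_c_mult[OF U fS])
  have 0: "\<tau> (R (\<lambda>g. lscale L (chi g) (f g))) = 0"
    by (rule trace_off_units[OF add com U S]) (auto simp: chi_def)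
  have iG: "iota (rs f) \<in> Gam" by (intro iota_Gamma restrict_units_C_c fG)
  have "f = iota (rs f) + (\<lambda>g. lscale L (chi g) (f g))"
  proof
    fix g
    show "f g = (iota (rs f) + (\<lambda>g. lscale L (chi g) (f g))) g"
      using unit_coord[of g "f g"] fsecD[OF Gamma_fsec[OF fG], of g] unit_arrow[of g]
      by (simp add: iota_def chi_def restrict_units_def)
  qed
  then have "R f = R (iota (rs f) + (\<lambda>g. lscale L (chi g) (f g)))" by (rule arg_cong)
  also have "\<dots> = R (iota (rs f)) + R (\<lambda>g. lscale L (chi g) (f g))"
    by (rule R_add[OF iG sections_c_Gamma[OF U S]])
  finally have "\<tau> (R f) = \<tau> (R (iota (rs f))) + \<tau> (R (\<lambda>g. lscale L (chi g) (f g)))"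
    by (rule trans[OF arg_cong[of _ _ \<tau>] add[OF imageI[OF iG] imageI[OF sections_c_Gamma[OF U S]]]])
  then show ?case unfolding 0 add_0_right .
next
  case (add f h)
  have i: "iota (rs f) \<in> Gam" "iota (rs h) \<in> Gam" by (intro iota_Gamma restrict_units_C_c add)+
  show ?case
    unfolding restrict_units_add[OF add(1,2)] iota_add R_add[OF add(1,2)] R_add[OF i]
      assms(1)[OF imageI[OF add(1)] imageI[OF add(2)]] assms(1)[OF imageI[OF i(1)] imageI[OF i(2)]] add(3,4) ..
qed

text \<open>Groupoid-specific input enters in three places: sections act boundedly with adjoints
  that are sections, invariance is the tracial condition on sections, and by principality a trace
  sees only the units.\<close>

lemma trace_data_A: "trace_data A X (\<lambda>f. R (iota f)) cexp (R ` Gam) (invariant_Rad G)"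
proof (rule trace_data.intro[OF banach_star_algebra_A], rule trace_data_axioms.intro, unfold A_ops)
  show "locally_compact_space X" by (rule units_locally_compact)
  show "Hausdorff_space X" by (rule units_Hausdorff)
  show "R (iota (\<lambda>x. f x + g x)) = R (iota f) + R (iota g)" if "f \<in> C_c X" "g \<in> C_c X" for f g
    unfolding iota_add by (intro R_add iota_Gamma that)
  show "R (iota (\<lambda>x. z * f x)) = oscale z (R (iota f))" if "f \<in> C_c X" for f z
    unfolding iota_scale by (intro R_scale iota_Gamma that)
  show "R (iota (\<lambda>x. f x * g x)) = R (iota f) \<circ> R (iota g)" if "f \<in> C_c X" "g \<in> C_c X" for f g
    unfolding conv_iota_iota[OF that, symmetric] by (intro R_mult iota_Gamma that)
  show "R (iota (\<lambda>x. cnj (f x))) = adjoint_operator G L (R (iota f))" if f: "f \<in> C_c X" for f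
    using adjoint_operator_eq[OF R_BO R_adj_elementary[OF bisection_units iota_sections_c[OF f]]] iota_Gamma[OF C_c_cnj[OF f]]
    unfolding fstar_iota by simp
  show "opn (R (iota f)) \<le> B" if "f \<in> C_c X" "\<And>x. cmod (f x) \<le> B" for f B
    by (rule iota_norm[OF that])
  show "module.subspace oscale (R ` Gam)"
  proof (rule VO.subspaceI)
    show "0 \<in> R ` Gam" using imageI[OF VF.subspace_0[OF Gamma_subspace], of R] by (simp add: R_zero)
    show "p + q \<in> R ` Gam" if pq: "p \<in> R ` Gam" "q \<in> R ` Gam" for p q
    proof -
      obtain f h where fh: "f \<in> Gam" "p = R f" "h \<in> Gam" "q = R h" using pq by blast
      show ?thesis unfolding fh(2,4) R_add[OF fh(1,3), symmetric] by (rule imageI[OF Gamma_add[OF fh(1,3)]])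
    qed
    show "oscale z p \<in> R ` Gam" if p: "p \<in> R ` Gam" for z p
    proof -
      obtain f where f: "f \<in> Gam" "p = R f" using p by blast
      show ?thesis unfolding f(2) R_scale[OF f(1), symmetric]
        by (rule imageI[OF VF.subspace_scale[OF Gamma_subspace f(1)]])
    qed
  qed
  show "R ` Gam \<subseteq> carr A" using R_carr by blast
  show "R (iota f) \<in> R ` Gam" if "f \<in> C_c X" for f by (intro imageI iota_Gamma that)
  show "p \<circ> q \<in> R ` Gam" if pq: "p \<in> R ` Gam" "q \<in> R ` Gam" for p q
  proof -
    obtain f h where "f \<in> Gam" "p = R f" "h \<in> Gam" "q = R h" using pq by blast
    then show ?thesis using imageI[OF conv_Gamma[of f h], of R] R_mult[of f h] by simp
  qed
  show "\<exists>p\<in>R ` Gam. opn (a - p) < \<epsilon>" if "a \<in> carr A" "0 < \<epsilon>" for a \<epsilon>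
    using carr_approx[OF that] by blast
  show "\<exists>e\<in>C_c X. p \<circ> R (iota e) = p" if p: "p \<in> R ` Gam" for p
  proof -
    obtain f where f: "f \<in> Gam" "p = R f" using p by blast
    obtain e where e: "e \<in> C_c X" "conv G L f (iota e) = f" using right_unit_exists[OF f(1)] by blast
    show ?thesis
      unfolding f(2) by (rule bexI[OF _ e(1)]) (use R_mult[OF f(1) iota_Gamma[OF e(1)]] e(2) in simp)
  qed
  show "cexp (a + b) x = cexp a x + cexp b x" if "a \<in> carr A" "b \<in> carr A" for a b x
    by (intro cexp_add carr_BO that)
  show "cexp (oscale z a) x = z * cexp a x" if "a \<in> carr A" for a x z
    by (intro cexp_scale carr_BO that)
  show "cmod (cexp a x) \<le> opn a" if "a \<in> carr A" for a x by (intro cexp_bound carr_BO that)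
  show "cexp (R (iota f) \<circ> a) x = f x * cexp a x" if "f \<in> C_c X" "a \<in> carr A" for f a x
    by (intro cexp_left carr_BO that)
  show "cexp (a \<circ> R (iota f)) x = f x * cexp a x" if "f \<in> C_c X" "a \<in> carr A" for f a x
    by (intro cexp_right carr_BO that)
  show "cexp (R (iota f)) = f" if "f \<in> C_c X" for f
    unfolding cexp_R[OF iota_Gamma[OF that]] by (rule restrict_iota[OF that])
  show "cexp p \<in> C_c X" if "p \<in> R ` Gam" for p
    using that cexp_R restrict_units_C_c by auto
  show "cexp (adjoint_operator G L a) x = cnj (cexp a x)" if "a \<in> carr A" for a x
    using cexp_star[OF that] unfolding A_ops .
  show "cexp (adjoint_operator G L a \<circ> a) x \<in> \<real>\<^sub>\<ge>\<^sub>0" if "a \<in> carr A" for a x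
    using cexp_positive[OF that] unfolding A_ops .
  have RR: "cexp (R f \<circ> R h) = rs (conv G L f h)" if "f \<in> Gam" "h \<in> Gam" for f h
    using cexp_R[OF conv_Gamma[OF that]] R_mult[OF that] by simp
  show "(\<mu> \<in> invariant_Rad G) = (\<mu> \<in> Rad X \<and> (\<forall>p\<in>R ` Gam. \<forall>q\<in>R ` Gam. \<mu> (cexp (p \<circ> q)) = \<mu> (cexp (q \<circ> p))))" for \<mu>
  proof
    assume \<mu>: "\<mu> \<in> invariant_Rad G"
    then have "\<mu> \<in> Rad X" unfolding invariant_Rad_def by blast
    then show "\<mu> \<in> Rad X \<and> (\<forall>p\<in>R ` Gam. \<forall>q\<in>R ` Gam. \<mu> (cexp (p \<circ> q)) = \<mu> (cexp (q \<circ> p)))"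
      using invariant_imp_tracial[OF \<mu>] by (auto simp: RR)
  next
    assume \<mu>: "\<mu> \<in> Rad X \<and> (\<forall>p\<in>R ` Gam. \<forall>q\<in>R ` Gam. \<mu> (cexp (p \<circ> q)) = \<mu> (cexp (q \<circ> p)))"
    show "\<mu> \<in> invariant_Rad G"
      by (rule tracial_imp_invariant) (use \<mu> RR in auto)
  qed
  show "\<tau> p = \<tau> (R (iota (cexp p)))"
    if add: "\<And>p q. p \<in> R ` Gam \<Longrightarrow> q \<in> R ` Gam \<Longrightarrow> \<tau> (p + q) = \<tau> p + \<tau> q"
      and com: "\<And>f p. f \<in> C_c X \<Longrightarrow> p \<in> R ` Gam \<Longrightarrow> \<tau> (R (iota f) \<circ> p) = \<tau> (p \<circ> R (iota f))"
      and p: "p \<in> R ` Gam" for \<tau> :: "('g, 'v) operator \<Rightarrow> complex" and p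
  proof -
    obtain f where f: "f \<in> Gam" "p = R f" using p by blast
    show ?thesis unfolding f(2) cexp_R[OF f(1)] by (rule trace_on_units[OF add com f(1)])
  qed
qed

lemma extends_measure_iff: "extends_measure G L \<mu> \<tau> \<longleftrightarrow> (\<forall>p\<in>R ` Gam. \<tau> p = \<mu> (cexp p))"
  unfolding extends_measure_def by (simp add: cexp_R)

end

theorem theorem5:
  fixes G :: "'g groupoid" and L :: "('g, 'v::ab_group_add) fell_bundle"
  assumes "twisted_etale_groupoid G L"
    and "principal_groupoid G"
  shows "(\<forall>\<mu>\<in>invariant_Rad G.
            \<exists>!\<tau>. \<tau> \<in> traces (reduced_cstar G L) \<and> extends_measure G L \<mu> \<tau>) \<and>
         ordered_tvs_iso
           (C_c (unit_top G)) (invariant_Rad G) (positive_invariant_Rad G)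
           (Ped (reduced_cstar G L)) (traces (reduced_cstar G L)) (positive_traces (reduced_cstar G L))
           (trace_of G L)"
proof -
  interpret twisted_etale_groupoid G L by (rule assms(1))
  have Hausdorff: "Hausdorff_space (gtop G)" by (rule principal_Hausdorff[OF assms(2)])
  interpret principal_twist G L
    by unfold_locales (rule Hausdorff, rule assms(2))
  interpret T: trace_data "reduced_cstar G L" "unit_top G" "\<lambda>f. regular_rep G L (iota f)" cexp
      "regular_rep G L ` Gamma_c G L" "invariant_Rad G"
    by (rule trace_data_A)
  \<comment> \<open>The operators of sections play the part of \<open>\<Gamma>\<close>, and
    \<open>extends_measure\<close> becomes the condition that singles out the trace in the abstract
    theorem.\<close>
  show ?thesis
    using T.ordered_tvs_iso_trace
    unfolding extends_measure_iff trace_of_def[abs_def] positive_invariant_Rad_def .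
qed


end
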